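(* Let $K$ be a field. There is an equivalence of categories between the category of cofree bialgebras over $K$ and the category of bialgebras of the form $U2(R)$ for some $B_\infty$-algebra $R$ over $K$ (where $U2(R)$ is viewed as a bialgebra through its product $*$ and its coproduct $\Delta$; morphisms in both categories are bialgebra morphisms).
   Context: All vector spaces are over a field $K$ of arbitrary characteristic. Bialgebras are unital, counital, associative and coassociative. Cofree bialgebra. Put $\overline\Delta(x)=\Delta(x)-x\otimes1-1\otimes x$ and $\mathrm{Prim}\,\mathcal H=\{x:\overline\Delta(x)=0\}$. The tensor coalgebra $T^c(V)=\bigoplus_{n\ge0}V^{\otimes n}$ has the deconcatenation coproduct $\Delta(v_1\cdots v_n)=\sum_{i=0}^n v_1\cdots v_i\otimes v_{i+1}\cdots v_n$. A bialgebra $\mathcal H$ is cofree if it is isomorphic as a coalgebra to $T^c(\mathrm{Prim}\,\mathcal H)$. 2-associative algebra. A vector space with two associative products $*$ and $\cdot$ having a common unit $1$. $2as(V)$ denotes the free (unital) 2-associative algebra on the vector space $V$. 2-associative bialgebra. $(\mathcal H,*,\cdot,\Delta)$ such that $(\mathcal H,*,\Delta)$ is a bialgebra and $(\mathcal H,\cdot,\Delta)$ is a unital infinitesimal bialgebra: $\cdot$ is unital associative, $\Delta$ is counital coassociative, and $\Delta(x\cdot y)=(x\otimes1)\cdot\Delta(y)+\Delta(x)\cdot(1\otimes y)-x\otimes y$, where $(a\otimes b)\cdot(a'\otimes b')=a\cdot a'\otimes b\cdot b'$. $B_\infty$-algebra. A vector space $R$ with linear maps $M_{pq}:R^{\otimes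 p}\otimes R^{\otimes q}\to R$ ($p,q\ge0$) with $M_{00}=0$, $M_{10}=M_{01}=\mathrm{Id}$, $M_{n0}=M_{0n}=0$ for $n\ge2$, satisfying for all $i,j,k\ge1$ the relation $$\sum_{l=1}^{i+j}\sum_{(\underline a,\underline b)}M_{lk}\circ(M^l_{(\underline a,\underline b)}\otimes\mathrm{Id}^{\otimes k})=\sum_{m=1}^{j+k}\sum_{(\underline b,\underline c)}M_{im}\circ(\mathrm{Id}^{\otimes i}\otimes M^m_{(\underline b,\underline c)}),$$ where the inner sum on the left runs over pairs of $l$-tuples of non-negative integers $\underline a,\underline b$ with $\sum a_s=i$, $\sum b_s=j$, the inner sum on the right over pairs of $m$-tuples of non-negative integers with $\sum b_s=j$, $\sum c_s=k$, and $M^l_{(\underline a,\underline b)}=M_{a_1b_1}\cdots M_{a_lb_l}:R^{\otimes p}\otimes R^{\otimes q}\to R^{\otimes l}$ (with $p=\sum a_s$, $q=\sum b_s$) sends $(u_1\cdots u_p,v_1\cdots v_q)$ to $M_{a_1b_1}(u_1\cdots u_{a_1},v_1\cdots v_{b_1})\otimes M_{a_2b_2}(u_{a_1+1}\cdots u_{a_1+a_2},v_{b_1+1}\cdots v_{b_1+b_2})\otimes\cdots\otimes M_{a_lb_l}(\cdots u_p,\cdots v_q)$. From 2-associative algebras to $B_\infty$-algebras. Any 2-associative algebra $(A,*,\cdot)$ becomes a $B_\infty$-algebra $A_{B_\infty}$ with operations defined inductively by $M_{00}=0$, $M_{10}=M_{01}=\mathrm{Id}$, $M_{n0}=M_{0n}=0$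 for $n\geq 2$, and for $p,q\ge1$ $$M_{pq}(u_1\cdots u_p,v_1\cdots v_q)=(u_1\cdot\ldots\cdot u_p)*(v_1\cdot\ldots\cdot v_q)-\sum_{k\ge2}\sum_{(\underline i,\underline j)}\nu^{k-1}\big(M_{i_1j_1}\cdots M_{i_kj_k}(u_1\cdots u_p,v_1\cdots v_q)\big),$$ where $\sum i_s=p$, $\sum j_s=q$ and $\nu^{k-1}$ multiplies the $k$ tensor factors with $\cdot$. Universal enveloping 2-associative algebra. For a $B_\infty$-algebra $R$, $U2(R)$ is the quotient of $2as(R)$ by the 2-associative ideal generated by the elements $M_{pq}(r_1\cdots r_p,s_1\cdots s_q)-\widetilde M_{pq}(r_1\cdots r_p,s_1\cdots s_q)$, $r_i,s_j\in R$, where $M_{pq}$ is the operation of $R$ and $\widetilde M_{pq}$ that of $2as(R)_{B_\infty}$. $2as(R)$ has a unique coproduct making it a 2-associative bialgebra in which $R$ is primitive; it induces the 2-associative bialgebra structure on $U2(R)$. *)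

theory Defs
  imports HOL.Hull "HOL-Algebra.QuotRing" "HOL-Algebra.Module"
begin

section \<open>Vector spaces\<close>

text \<open>
  Vector spaces over a field \<open>K\<close> are structures \<open>V\<close> with \<open>module K V\<close>.  The record type of modules
  also has the fields \<open>mult\<close> and \<open>one\<close>; they carry the product of an algebra and are
  irrelevant for a structure that is only used as a vector space or as a coalgebra.
\<close>

definition linear_map ::
  "('k, 'm) ring_scheme \<Rightarrow> ('k, 'a, 'x) module_scheme \<Rightarrow> ('k, 'b, 'y) module_scheme \<Rightarrow> ('a \<Rightarrow> 'b) \<Rightarrow> bool"
  where "linear_map K V W f \<longleftrightarrow>
    f \<in> carrier V \<rightarrow> carrier W \<and>
    (\<forall>x \<in> carrier V. \<forall>y \<in> carrier V. f (x \<oplus>\<^bsub>V\<^esub> y) = f x \<oplus>\<^bsub>W\<^esub> f y) \<and>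
    (\<forall>c \<in> carrier K. \<forall>x \<in> carrier V. f (c \<odot>\<^bsub>V\<^esub> x) = c \<odot>\<^bsub>W\<^esub> f x)"

definition scalar_module :: "('k, 'm) ring_scheme \<Rightarrow> ('k, 'k) module"
  where "scalar_module K =
    \<lparr>carrier = carrier K, mult = mult K, one = one K, zero = zero K, add = add K, smult = mult K\<rparr>"

definition free_module :: "('k, 'm) ring_scheme \<Rightarrow> 'x set \<Rightarrow> ('k, 'x \<Rightarrow> 'k) module"
  where "free_module K X =
    \<lparr>carrier = {f. (\<forall>x \<in> X. f x \<in> carrier K) \<and> (\<forall>x. x \<notin> X \<longrightarrow> f x = \<zero>\<^bsub>K\<^esub>) \<and> finite {x. f x \<noteq> \<zero>\<^bsub>K\<^esub>}},
     mult = (\<lambda>f g x. \<zero>\<^bsub>K\<^esub>), one = (\<lambda>x. \<zero>\<^bsub>K\<^esub>),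
     zero = (\<lambda>x. \<zero>\<^bsub>K\<^esub>), add = (\<lambda>f g x. f x \<oplus>\<^bsub>K\<^esub> g x), smult = (\<lambda>c f x. c \<otimes>\<^bsub>K\<^esub> f x)\<rparr>"

definition basis_elt :: "('k, 'm) ring_scheme \<Rightarrow> 'x \<Rightarrow> 'x \<Rightarrow> 'k"
  where "basis_elt K x = (\<lambda>y. if y = x then \<one>\<^bsub>K\<^esub> else \<zero>\<^bsub>K\<^esub>)"

definition submodule_span :: "('k, 'm) ring_scheme \<Rightarrow> ('k, 'a, 'x) module_scheme \<Rightarrow> 'a set \<Rightarrow> 'a set"
  where "submodule_span K V S = (\<lambda>N. submodule N K V) hull S"

text \<open>The first five fields are those of the library's quotient ring \<open>V Quot N\<close>.\<close>

definition quot_module :: "('k, 'a, 'x) module_scheme \<Rightarrow> 'a set \<Rightarrow> ('k, 'a set) module"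
  where "quot_module V N =
    \<lparr>carrier = a_rcosets\<^bsub>V\<^esub> N, mult = rcoset_mult V N, one = N +>\<^bsub>V\<^esub> \<one>\<^bsub>V\<^esub>, zero = N, add = set_add V,
     smult = (\<lambda>c X. \<Union>x \<in> X. N +>\<^bsub>V\<^esub> (c \<odot>\<^bsub>V\<^esub> x))\<rparr>"

text \<open>
  \<open>lift_quot K U \<beta>\<close> is the linear map from a quotient of a free module on a set to \<open>U\<close> that is
  induced by the map \<open>\<beta>\<close> from this set to \<open>U\<close>.  It is only meaningful if the linear extension
  of \<open>\<beta>\<close> vanishes on the submodule that is divided out, so that the choice of the
  representative does not matter; this is the case in all uses below.
\<close>

definition lift_quot ::
  "('k, 'm) ring_scheme \<Rightarrow> ('k, 'b, 'y) module_scheme \<Rightarrow> ('x \<Rightarrow> 'b) \<Rightarrow> ('x \<Rightarrow> 'k) set \<Rightarrow> 'b"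
  where "lift_quot K U \<beta> X =
    (let f = (SOME f. f \<in> X) in \<Oplus>\<^bsub>U\<^esub>x \<in> {x. f x \<noteq> \<zero>\<^bsub>K\<^esub>}. f x \<odot>\<^bsub>U\<^esub> \<beta> x)"


section \<open>Tensor products\<close>

definition tensor_rels ::
  "('k, 'm) ring_scheme \<Rightarrow> ('k, 'a, 'x) module_scheme \<Rightarrow> ('k, 'b, 'y) module_scheme \<Rightarrow> ('a \<times> 'b \<Rightarrow> 'k) set"
  where "tensor_rels K V W =
    (let F = free_module K (carrier V \<times> carrier W); e = (\<lambda>v w. basis_elt K (v, w)) in
      {e (v \<oplus>\<^bsub>V\<^esub> v') w \<ominus>\<^bsub>F\<^esub> (e v w \<oplus>\<^bsub>F\<^esub> e v' w) |v v' w.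
         v \<in> carrier V \<and> v' \<in> carrier V \<and> w \<in> carrier W} \<union>
      {e v (w \<oplus>\<^bsub>W\<^esub> w') \<ominus>\<^bsub>F\<^esub> (e v w \<oplus>\<^bsub>F\<^esub> e v w') |v w w'.
         v \<in> carrier V \<and> w \<in> carrier W \<and> w' \<in> carrier W} \<union>
      {e (c \<odot>\<^bsub>V\<^esub> v) w \<ominus>\<^bsub>F\<^esub> c \<odot>\<^bsub>F\<^esub> e v w |c v w.
         c \<in> carrier K \<and> v \<in> carrier V \<and> w \<in> carrier W} \<union>
      {e v (c \<odot>\<^bsub>W\<^esub> w) \<ominus>\<^bsub>F\<^esub> c \<odot>\<^bsub>F\<^esub> e v w |c v w.
         c \<in> carrier K \<and> v \<in> carrier V \<and> w \<in> carrier W})"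

definition tensor_ideal ::
  "('k, 'm) ring_scheme \<Rightarrow> ('k, 'a, 'x) module_scheme \<Rightarrow> ('k, 'b, 'y) module_scheme \<Rightarrow> ('a \<times> 'b \<Rightarrow> 'k) set"
  where "tensor_ideal K V W =
    submodule_span K (free_module K (carrier V \<times> carrier W)) (tensor_rels K V W)"

definition pure_tensor ::
  "('k, 'm) ring_scheme \<Rightarrow> ('k, 'a, 'x) module_scheme \<Rightarrow> ('k, 'b, 'y) module_scheme \<Rightarrow>
    'a \<Rightarrow> 'b \<Rightarrow> ('a \<times> 'b \<Rightarrow> 'k) set"
  where "pure_tensor K V W v w =
    tensor_ideal K V W +>\<^bsub>free_module K (carrier V \<times> carrier W)\<^esub> basis_elt K (v, w)"

definition tensor_space ::
  "('k, 'm) ring_scheme \<Rightarrow> ('k, 'a, 'x) module_scheme \<Rightarrow> ('k, 'b, 'y) module_scheme \<Rightarrow>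
    ('k, ('a \<times> 'b \<Rightarrow> 'k) set) module"
  where "tensor_space K V W =
    quot_module (free_module K (carrier V \<times> carrier W)) (tensor_ideal K V W)"

text \<open>The product is \<open>(a \<otimes> b) (a' \<otimes> b') = a a' \<otimes> b b'\<close>; it is irrelevant unless \<open>V\<close> and \<open>W\<close> are algebras.\<close>

definition tensor ::
  "('k, 'm) ring_scheme \<Rightarrow> ('k, 'a, 'x) module_scheme \<Rightarrow> ('k, 'b, 'y) module_scheme \<Rightarrow>
    ('k, ('a \<times> 'b \<Rightarrow> 'k) set) module"
  where "tensor K V W =
    (tensor_space K V W)
      \<lparr>mult := (\<lambda>X Y.
          lift_quot K (tensor_space K V W) (\<lambda>(a, b).
            lift_quot K (tensor_space K V W) (\<lambda>(a', b').
              pure_tensor K V W (a \<otimes>\<^bsub>V\<^esub> a') (b \<otimes>\<^bsub>W\<^esub> b')) Y) X),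
       one := pure_tensor K V W \<one>\<^bsub>V\<^esub> \<one>\<^bsub>W\<^esub>\<rparr>"

text \<open>\<open>f \<otimes> g\<close>, where \<open>V'\<close> and \<open>W'\<close> are the codomains; the domains do not enter the formula.\<close>

definition tensor_map ::
  "('k, 'm) ring_scheme \<Rightarrow> ('k, 'c, 'x) module_scheme \<Rightarrow> ('k, 'd, 'y) module_scheme \<Rightarrow>
    ('a \<Rightarrow> 'c) \<Rightarrow> ('b \<Rightarrow> 'd) \<Rightarrow> ('a \<times> 'b \<Rightarrow> 'k) set \<Rightarrow> ('c \<times> 'd \<Rightarrow> 'k) set"
  where "tensor_map K V' W' f g =
    lift_quot K (tensor K V' W') (\<lambda>(v, w). pure_tensor K V' W' (f v) (g w))"

definition tensor_assoc ::
  "('k, 'm) ring_scheme \<Rightarrow> ('k, 'a, 'x) module_scheme \<Rightarrow>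
    (('a \<times> 'a \<Rightarrow> 'k) set \<times> 'a \<Rightarrow> 'k) set \<Rightarrow> ('a \<times> ('a \<times> 'a \<Rightarrow> 'k) set \<Rightarrow> 'k) set"
  where "tensor_assoc K C =
    (let CC = tensor K C C; T = tensor K C CC in
      lift_quot K T (\<lambda>(X, c).
        lift_quot K T (\<lambda>(a, b). pure_tensor K C CC a (pure_tensor K C C b c)) X))"


section \<open>Algebras, coalgebras, bialgebras\<close>

definition assoc_algebra :: "('k, 'm) ring_scheme \<Rightarrow> ('k, 'a, 'x) module_scheme \<Rightarrow> bool"
  where "assoc_algebra K A \<longleftrightarrow>
    module K A \<and> ring A \<and>
    (\<forall>c \<in> carrier K. \<forall>x \<in> carrier A. \<forall>y \<in> carrier A.
      (c \<odot>\<^bsub>A\<^esub> x) \<otimes>\<^bsub>A\<^esub> y = c \<odot>\<^bsub>A\<^esub> (x \<otimes>\<^bsub>A\<^esub> y) \<and> x \<otimes>\<^bsub>A\<^esub> (c \<odot>\<^bsub>A\<^esub> y) = c \<odot>\<^bsub>A\<^esub> (x \<otimes>\<^bsub>A\<^esub> y))"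

record ('k, 'a) bialg = "('k, 'a) module" +
  comult :: "'a \<Rightarrow> ('a \<times> 'a \<Rightarrow> 'k) set"
  counit :: "'a \<Rightarrow> 'k"

definition coalgebra :: "('k, 'm) ring_scheme \<Rightarrow> ('k, 'a, 'x) bialg_scheme \<Rightarrow> bool"
  where "coalgebra K C \<longleftrightarrow>
    (let CC = tensor K C C; \<Delta> = comult C; \<epsilon> = counit C in
      module K C \<and>
      linear_map K C CC \<Delta> \<and>
      linear_map K C (scalar_module K) \<epsilon> \<and>
      (\<forall>x \<in> carrier C.
        tensor_assoc K C (tensor_map K CC C \<Delta> (\<lambda>y. y) (\<Delta> x)) = tensor_map K C CC (\<lambda>y. y) \<Delta> (\<Delta> x)) \<and>
      (\<forall>x \<in> carrier C.
        lift_quot K C (\<lambda>(a, b). \<epsilon> a \<odot>\<^bsub>C\<^esub> b) (\<Delta> x) = x \<and>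
        lift_quot K C (\<lambda>(a, b). \<epsilon> b \<odot>\<^bsub>C\<^esub> a) (\<Delta> x) = x))"

definition coalgebra_map ::
  "('k, 'm) ring_scheme \<Rightarrow> ('k, 'a, 'x) bialg_scheme \<Rightarrow> ('k, 'b, 'y) bialg_scheme \<Rightarrow> ('a \<Rightarrow> 'b) \<Rightarrow> bool"
  where "coalgebra_map K C D f \<longleftrightarrow>
    linear_map K C D f \<and>
    (\<forall>x \<in> carrier C. comult D (f x) = tensor_map K D D f f (comult C x)) \<and>
    (\<forall>x \<in> carrier C. counit D (f x) = counit C x)"

definition coalgebra_iso ::
  "('k, 'm) ring_scheme \<Rightarrow> ('k, 'a, 'x) bialg_scheme \<Rightarrow> ('k, 'b, 'y) bialg_scheme \<Rightarrow> ('a \<Rightarrow> 'b) \<Rightarrow> bool"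
  where "coalgebra_iso K C D f \<longleftrightarrow> coalgebra_map K C D f \<and> bij_betw f (carrier C) (carrier D)"

definition bialgebra :: "('k, 'm) ring_scheme \<Rightarrow> ('k, 'a, 'x) bialg_scheme \<Rightarrow> bool"
  where "bialgebra K H \<longleftrightarrow>
    assoc_algebra K H \<and> coalgebra K H \<and>
    comult H \<in> ring_hom H (tensor K H H) \<and> counit H \<in> ring_hom H K"

text \<open>Maps are normalised to be \<open>undefined\<close> outside the carrier, so that equality of morphisms is equality of functions.\<close>

definition bialgebra_hom ::
  "('k, 'm) ring_scheme \<Rightarrow> ('k, 'a, 'x) bialg_scheme \<Rightarrow> ('k, 'b, 'y) bialg_scheme \<Rightarrow> ('a \<Rightarrow> 'b) set"
  where "bialgebra_hom K G H =
    {f \<in> extensional (carrier G). f \<in> ring_hom G H \<and> coalgebra_map K G H f}"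

definition Prim :: "('k, 'm) ring_scheme \<Rightarrow> ('k, 'a, 'x) bialg_scheme \<Rightarrow> 'a set"
  where "Prim K H =
    {x \<in> carrier H.
      (comult H x \<ominus>\<^bsub>tensor K H H\<^esub> pure_tensor K H H x \<one>\<^bsub>H\<^esub>) \<ominus>\<^bsub>tensor K H H\<^esub> pure_tensor K H H \<one>\<^bsub>H\<^esub> x
        = \<zero>\<^bsub>tensor K H H\<^esub>}"


section \<open>The tensor coalgebra and cofree bialgebras\<close>

text \<open>
  The direct sum of all tensor powers of \<open>V\<close> is the free module on the words over \<open>V\<close> modulo
  multilinearity; the word \<open>[v\<^sub>1, \<dots>, v\<^sub>n]\<close> stands for the tensor of its letters.  The relations
  are homogeneous in the length and leave the empty word alone.
\<close>

definition word_rels :: "('k, 'm) ring_scheme \<Rightarrow> ('k, 'a, 'x) module_scheme \<Rightarrow> ('a list \<Rightarrow> 'k) set"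
  where "word_rels K V =
    (let F = free_module K (lists (carrier V)); e = basis_elt K in
      {e (xs @ [u \<oplus>\<^bsub>V\<^esub> v] @ ys) \<ominus>\<^bsub>F\<^esub> (e (xs @ [u] @ ys) \<oplus>\<^bsub>F\<^esub> e (xs @ [v] @ ys)) |xs u v ys.
         xs \<in> lists (carrier V) \<and> u \<in> carrier V \<and> v \<in> carrier V \<and> ys \<in> lists (carrier V)} \<union>
      {e (xs @ [c \<odot>\<^bsub>V\<^esub> v] @ ys) \<ominus>\<^bsub>F\<^esub> c \<odot>\<^bsub>F\<^esub> e (xs @ [v] @ ys) |xs c v ys.
         xs \<in> lists (carrier V) \<and> c \<in> carrier K \<and> v \<in> carrier V \<and> ys \<in> lists (carrier V)})"

definition words_module :: "('k, 'm) ring_scheme \<Rightarrow> ('k, 'a, 'x) module_scheme \<Rightarrow> ('k, ('a list \<Rightarrow> 'k) set) module"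
  where "words_module K V =
    (let F = free_module K (lists (carrier V)) in quot_module F (submodule_span K F (word_rels K V)))"

definition word :: "('k, 'm) ring_scheme \<Rightarrow> ('k, 'a, 'x) module_scheme \<Rightarrow> 'a list \<Rightarrow> ('a list \<Rightarrow> 'k) set"
  where "word K V xs =
    (let F = free_module K (lists (carrier V)) in submodule_span K F (word_rels K V) +>\<^bsub>F\<^esub> basis_elt K xs)"

definition with_coalgebra ::
  "('k, 'a, 'x) module_scheme \<Rightarrow> ('a \<Rightarrow> ('a \<times> 'a \<Rightarrow> 'k) set) \<Rightarrow> ('a \<Rightarrow> 'k) \<Rightarrow> ('k, 'a) bialg"
  where "with_coalgebra A \<Delta> \<epsilon> =
    \<lparr>carrier = carrier A, mult = mult A, one = one A, zero = zero A, add = add A, smult = smult A,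
     comult = \<Delta>, counit = \<epsilon>\<rparr>"

definition tensor_coalgebra ::
  "('k, 'm) ring_scheme \<Rightarrow> ('k, 'a, 'x) module_scheme \<Rightarrow> ('k, ('a list \<Rightarrow> 'k) set) bialg"
  where "tensor_coalgebra K V =
    (let T = words_module K V; TT = tensor K T T in
      with_coalgebra T
        (lift_quot K TT (\<lambda>xs.
          \<Oplus>\<^bsub>TT\<^esub>i \<in> {0..length xs}. pure_tensor K T T (word K V (take i xs)) (word K V (drop i xs))))
        (lift_quot K (scalar_module K) (\<lambda>xs. if xs = [] then \<one>\<^bsub>K\<^esub> else \<zero>\<^bsub>K\<^esub>)))"

definition cofree_bialgebra :: "('k, 'm) ring_scheme \<Rightarrow> ('k, 'a, 'x) bialg_scheme \<Rightarrow> bool"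
  where "cofree_bialgebra K H \<longleftrightarrow>
    bialgebra K H \<and> (\<exists>\<phi>. coalgebra_iso K H (tensor_coalgebra K (H\<lparr>carrier := Prim K H\<rparr>)) \<phi>)"


section \<open>2-associative algebras and bialgebras\<close>

text \<open>The product \<open>*\<close> is the field \<open>mult\<close>, the product \<open>\<cdot>\<close> is the field \<open>dot\<close>.\<close>

record ('k, 'a) two_alg = "('k, 'a) module" +
  dot :: "'a \<Rightarrow> 'a \<Rightarrow> 'a"

definition dot_alg :: "('k, 'a, 'x) two_alg_scheme \<Rightarrow> ('k, 'a, 'x) two_alg_scheme"
  where "dot_alg A = A\<lparr>mult := dot A\<rparr>"

definition two_as_algebra :: "('k, 'm) ring_scheme \<Rightarrow> ('k, 'a, 'x) two_alg_scheme \<Rightarrow> bool"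
  where "two_as_algebra K A \<longleftrightarrow> assoc_algebra K A \<and> assoc_algebra K (dot_alg A)"

definition two_as_bialgebra ::
  "('k, 'm) ring_scheme \<Rightarrow> ('k, 'a, 'x) two_alg_scheme \<Rightarrow>
    ('a \<Rightarrow> ('a \<times> 'a \<Rightarrow> 'k) set) \<Rightarrow> ('a \<Rightarrow> 'k) \<Rightarrow> bool"
  where "two_as_bialgebra K A \<Delta> \<epsilon> \<longleftrightarrow>
    two_as_algebra K A \<and>
    bialgebra K (with_coalgebra A \<Delta> \<epsilon>) \<and>
    (let D = tensor K (dot_alg A) (dot_alg A); p = pure_tensor K A A in
      \<forall>x \<in> carrier A. \<forall>y \<in> carrier A.
        \<Delta> (dot A x y) = (p x \<one>\<^bsub>A\<^esub> \<otimes>\<^bsub>D\<^esub> \<Delta> y \<oplus>\<^bsub>D\<^esub> \<Delta> x \<otimes>\<^bsub>D\<^esub> p \<one>\<^bsub>A\<^esub> y) \<ominus>\<^bsub>D\<^esub> p x y)"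

definition two_ideal :: "('k, 'm) ring_scheme \<Rightarrow> ('k, 'a, 'x) two_alg_scheme \<Rightarrow> 'a set \<Rightarrow> bool"
  where "two_ideal K A I \<longleftrightarrow>
    submodule I K A \<and>
    (\<forall>a \<in> carrier A. \<forall>x \<in> I. a \<otimes>\<^bsub>A\<^esub> x \<in> I \<and> x \<otimes>\<^bsub>A\<^esub> a \<in> I \<and> dot A a x \<in> I \<and> dot A x a \<in> I)"

definition two_ideal_gen :: "('k, 'm) ring_scheme \<Rightarrow> ('k, 'a, 'x) two_alg_scheme \<Rightarrow> 'a set \<Rightarrow> 'a set"
  where "two_ideal_gen K A S = two_ideal K A hull S"

definition two_quot :: "('k, 'a, 'x) two_alg_scheme \<Rightarrow> 'a set \<Rightarrow> ('k, 'a set) two_alg"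
  where "two_quot A I =
    \<lparr>carrier = carrier (quot_module A I), mult = mult (quot_module A I), one = one (quot_module A I),
     zero = zero (quot_module A I), add = add (quot_module A I), smult = smult (quot_module A I),
     dot = rcoset_mult (dot_alg A) I\<rparr>"


section \<open>The free 2-associative algebra\<close>

datatype 'a two_term = Var 'a | Unit | Star "'a two_term" "'a two_term" | Dot "'a two_term" "'a two_term"

text \<open>
  The free vector space on all terms in \<open>*\<close>, \<open>\<cdot>\<close>, \<open>1\<close> and variables from \<open>X\<close>; both products are the bilinear
  extensions of the term constructors.
\<close>

definition free_two_magma :: "('k, 'm) ring_scheme \<Rightarrow> 'a set \<Rightarrow> ('k, 'a two_term \<Rightarrow> 'k) two_alg"
  where "free_two_magma K X =
    (let F = free_module K {t. set_two_term t \<subseteq> X} in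
      \<lparr>carrier = carrier F,
       mult = (\<lambda>f g t. case t of Star r s \<Rightarrow> f r \<otimes>\<^bsub>K\<^esub> g s | _ \<Rightarrow> \<zero>\<^bsub>K\<^esub>),
       one = basis_elt K Unit,
       zero = zero F, add = add F, smult = smult F,
       dot = (\<lambda>f g t. case t of Dot r s \<Rightarrow> f r \<otimes>\<^bsub>K\<^esub> g s | _ \<Rightarrow> \<zero>\<^bsub>K\<^esub>)\<rparr>)"

definition two_as_rels :: "('k, 'm) ring_scheme \<Rightarrow> ('k, 'a, 'x) module_scheme \<Rightarrow> ('a two_term \<Rightarrow> 'k) set"
  where "two_as_rels K V =
    (let F = free_two_magma K (carrier V); e = (\<lambda>v. basis_elt K (Var v)) in
      (\<Union>\<mu> \<in> {mult F, dot F}.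
        {\<mu> (\<mu> x y) z \<ominus>\<^bsub>F\<^esub> \<mu> x (\<mu> y z) |x y z. x \<in> carrier F \<and> y \<in> carrier F \<and> z \<in> carrier F} \<union>
        {\<mu> \<one>\<^bsub>F\<^esub> x \<ominus>\<^bsub>F\<^esub> x |x. x \<in> carrier F} \<union>
        {\<mu> x \<one>\<^bsub>F\<^esub> \<ominus>\<^bsub>F\<^esub> x |x. x \<in> carrier F}) \<union>
      {e (u \<oplus>\<^bsub>V\<^esub> v) \<ominus>\<^bsub>F\<^esub> (e u \<oplus>\<^bsub>F\<^esub> e v) |u v. u \<in> carrier V \<and> v \<in> carrier V} \<union>
      {e (c \<odot>\<^bsub>V\<^esub> v) \<ominus>\<^bsub>F\<^esub> c \<odot>\<^bsub>F\<^esub> e v |c v. c \<in> carrier K \<and> v \<in> carrier V})"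

definition two_as_ideal :: "('k, 'm) ring_scheme \<Rightarrow> ('k, 'a, 'x) module_scheme \<Rightarrow> ('a two_term \<Rightarrow> 'k) set"
  where "two_as_ideal K V = two_ideal_gen K (free_two_magma K (carrier V)) (two_as_rels K V)"

definition two_as ::
  "('k, 'm) ring_scheme \<Rightarrow> ('k, 'a, 'x) module_scheme \<Rightarrow> ('k, ('a two_term \<Rightarrow> 'k) set) two_alg"
  where "two_as K V = two_quot (free_two_magma K (carrier V)) (two_as_ideal K V)"

definition two_as_gen ::
  "('k, 'm) ring_scheme \<Rightarrow> ('k, 'a, 'x) module_scheme \<Rightarrow> 'a \<Rightarrow> ('a two_term \<Rightarrow> 'k) set"
  where "two_as_gen K V v =
    two_as_ideal K V +>\<^bsub>free_two_magma K (carrier V)\<^esub> basis_elt K (Var v)"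

text \<open>
  The coproduct (with its counit) of \<open>2as(V)\<close> is the unique one for which \<open>2as(V)\<close> is a 2-associative
  bialgebra with primitive generators.
\<close>

definition two_as_coalg ::
  "('k, 'm) ring_scheme \<Rightarrow> ('k, 'a, 'x) module_scheme \<Rightarrow>
    (('a two_term \<Rightarrow> 'k) set \<Rightarrow> (('a two_term \<Rightarrow> 'k) set \<times> ('a two_term \<Rightarrow> 'k) set \<Rightarrow> 'k) set) \<times>
    (('a two_term \<Rightarrow> 'k) set \<Rightarrow> 'k)"
  where "two_as_coalg K V =
    (THE p. let A = two_as K V; \<Delta> = fst p; \<epsilon> = snd p in
      \<Delta> \<in> extensional (carrier A) \<and> \<epsilon> \<in> extensional (carrier A) \<and>
      two_as_bialgebra K A \<Delta> \<epsilon> \<and>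
      (\<forall>v \<in> carrier V. two_as_gen K V v \<in> Prim K (with_coalgebra A \<Delta> \<epsilon>)))"


section \<open>\<open>B\<^sub>\<infinity>\<close>-algebras\<close>

text \<open>
  The field \<open>ops\<close> collects all \<open>M\<^sub>p\<^sub>q\<close>: the value \<open>M\<^sub>p\<^sub>q(u\<^sub>1\<cdots>u\<^sub>p, v\<^sub>1\<cdots>v\<^sub>q)\<close> is
  \<open>ops R [u\<^sub>1, \<dots>, u\<^sub>p] [v\<^sub>1, \<dots>, v\<^sub>q]\<close>.  Linear maps on tensor powers are given as multilinear maps.
\<close>

record ('k, 'a) binf_alg = "('k, 'a) module" +
  ops :: "'a list \<Rightarrow> 'a list \<Rightarrow> 'a"

text \<open>
  A pair of \<open>l\<close>-tuples \<open>(a, b)\<close> of non-negative integers with sums \<open>p\<close> and \<open>q\<close> is the same as a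
  way of cutting the words \<open>us\<close> and \<open>vs\<close> of lengths \<open>p\<close> and \<open>q\<close> simultaneously into \<open>l\<close>
  consecutive, possibly empty, blocks of lengths \<open>a\<^sub>s\<close> and \<open>b\<^sub>s\<close>.  The sums over such tuples are
  written as sums over the lists of pairs of blocks.
\<close>

definition cuts :: "nat \<Rightarrow> 'a list \<Rightarrow> 'a list \<Rightarrow> ('a list \<times> 'a list) list set"
  where "cuts l us vs = {ps. length ps = l \<and> concat (map fst ps) = us \<and> concat (map snd ps) = vs}"

definition binf_algebra :: "('k, 'm) ring_scheme \<Rightarrow> ('k, 'a, 'x) binf_alg_scheme \<Rightarrow> bool"
  where "binf_algebra K R \<longleftrightarrow>
    (let M = ops R; L = lists (carrier R) in
      module K R \<and>
      (\<forall>us \<in> L. \<forall>vs \<in> L. M us vs \<in> carrier R) \<and>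
      (\<forall>us \<in> L. \<forall>us' \<in> L. \<forall>vs \<in> L. \<forall>x \<in> carrier R. \<forall>y \<in> carrier R. \<forall>c \<in> carrier K.
        M (us @ [x \<oplus>\<^bsub>R\<^esub> y] @ us') vs = M (us @ [x] @ us') vs \<oplus>\<^bsub>R\<^esub> M (us @ [y] @ us') vs \<and>
        M (us @ [c \<odot>\<^bsub>R\<^esub> x] @ us') vs = c \<odot>\<^bsub>R\<^esub> M (us @ [x] @ us') vs) \<and>
      (\<forall>us \<in> L. \<forall>vs \<in> L. \<forall>vs' \<in> L. \<forall>x \<in> carrier R. \<forall>y \<in> carrier R. \<forall>c \<in> carrier K.
        M us (vs @ [x \<oplus>\<^bsub>R\<^esub> y] @ vs') = M us (vs @ [x] @ vs') \<oplus>\<^bsub>R\<^esub> M us (vs @ [y] @ vs') \<and>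
        M us (vs @ [c \<odot>\<^bsub>R\<^esub> x] @ vs') = c \<odot>\<^bsub>R\<^esub> M us (vs @ [x] @ vs')) \<and>
      M [] [] = \<zero>\<^bsub>R\<^esub> \<and>
      (\<forall>x \<in> carrier R. M [x] [] = x \<and> M [] [x] = x) \<and>
      (\<forall>us \<in> L. length us \<ge> 2 \<longrightarrow> M us [] = \<zero>\<^bsub>R\<^esub> \<and> M [] us = \<zero>\<^bsub>R\<^esub>) \<and>
      (\<forall>us \<in> L. \<forall>vs \<in> L. \<forall>ws \<in> L. us \<noteq> [] \<and> vs \<noteq> [] \<and> ws \<noteq> [] \<longrightarrow>
        (\<Oplus>\<^bsub>R\<^esub>l \<in> {1..length us + length vs}. \<Oplus>\<^bsub>R\<^esub>ps \<in> cuts l us vs. M (map (\<lambda>(a, b). M a b) ps) ws) =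
        (\<Oplus>\<^bsub>R\<^esub>m \<in> {1..length vs + length ws}. \<Oplus>\<^bsub>R\<^esub>ps \<in> cuts m vs ws. M us (map (\<lambda>(b, c). M b c) ps))))"

text \<open>The iterated product \<open>u\<^sub>1 \<cdot> \<dots> \<cdot> u\<^sub>n\<close>.\<close>

definition dot_prod :: "('k, 'a, 'x) two_alg_scheme \<Rightarrow> 'a list \<Rightarrow> 'a"
  where "dot_prod A us = foldr (dot A) us \<one>\<^bsub>A\<^esub>"

text \<open>No closure conditions are needed here, in contrast to the library's congruence rules.\<close>

lemma finsum_fundef_cong [fundef_cong]:
  assumes "A = B" and "\<And>x. x \<in> B \<Longrightarrow> f x = g x"
  shows "finsum G f A = finsum G g B"
proof -
  have *: "(S, y) \<in> foldSetD (carrier G) (add G \<circ> f') \<zero>\<^bsub>G\<^esub>"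
    if "(S, y) \<in> foldSetD (carrier G) (add G \<circ> g') \<zero>\<^bsub>G\<^esub>" "\<And>x. x \<in> S \<Longrightarrow> f' x = g' x" for S y f' g'
    using that
  proof (induction rule: foldSetD.induct)
    case (insertI x S y)
    then have "(add G \<circ> f') x = (add G \<circ> g') x" by simp
    with insertI show ?case by (metis foldSetD.insertI insertCI)
  qed (rule foldSetD.emptyI)
  have "(B, y) \<in> foldSetD (carrier G) (add G \<circ> f) \<zero>\<^bsub>G\<^esub> \<longleftrightarrow> (B, y) \<in> foldSetD (carrier G) (add G \<circ> g) \<zero>\<^bsub>G\<^esub>" for y
    using *[of B y g f] *[of B y f g] assms(2) by auto
  then show ?thesis
    using assms(1) by (simp add: finsum_def finprod_def foldD_def)
qed

text \<open>
  The operations of \<open>A\<close> as a \<open>B\<^sub>\<infinity>\<close>-algebra.  Tuples with some \<open>(i\<^sub>s, j\<^sub>s) = (0, 0)\<close> contribute \<open>0\<close>,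
  because \<open>M\<^sub>0\<^sub>0 = 0\<close>; leaving them out makes the sum finite and the recursion well-founded.
\<close>

function binf_of :: "('k, 'a, 'x) two_alg_scheme \<Rightarrow> 'a list \<Rightarrow> 'a list \<Rightarrow> 'a"
  where "binf_of A us vs =
    (if us = [] then (if length vs = 1 then hd vs else \<zero>\<^bsub>A\<^esub>)
     else if vs = [] then (if length us = 1 then hd us else \<zero>\<^bsub>A\<^esub>)
     else (dot_prod A us \<otimes>\<^bsub>A\<^esub> dot_prod A vs) \<ominus>\<^bsub>A\<^esub>
       (\<Oplus>\<^bsub>A\<^esub>ps \<in> {ps \<in> (\<Union>k \<in> {2..}. cuts k us vs). ([], []) \<notin> set ps}.
         dot_prod A (map (\<lambda>(p, q). binf_of A p q) ps)))"
  by pat_completeness auto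
termination
proof (relation "measure (\<lambda>(A, us, vs). length us + length vs)", goal_cases)
  case 1
  then show ?case by simp
next
  case (2 A us vs ps z p q)
  then have z: "(p, q) \<in> set ps" and c: "ps \<in> (\<Union>k \<in> {2..}. cuts k us vs)" and ne: "([], []) \<notin> set ps"
    by auto
  from z obtain xs ys where ps: "ps = xs @ (p, q) # ys" by (meson split_list)
  from c have len: "length ps \<ge> 2" and us: "us = concat (map fst ps)" and vs: "vs = concat (map snd ps)"
    by (auto simp: cuts_def)
  from len ps have "xs @ ys \<noteq> []" by auto
  then obtain r where r: "r \<in> set (xs @ ys)" by (meson last_in_set)
  with ne ps have "r \<noteq> ([], [])" by auto
  then have "0 < length (fst r) + length (snd r)" by (cases r) auto
  also have "\<dots> \<le> (\<Sum>s\<leftarrow>xs @ ys. length (fst s) + length (snd s))"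
    using r by (intro member_le_sum_list) auto
  also have "\<dots> = length (concat (map fst (xs @ ys))) + length (concat (map snd (xs @ ys)))"
    by (induction "xs @ ys" arbitrary: xs ys) (simp_all add: sum_list_addf length_concat comp_def)
  finally show ?case
    by (simp add: us vs ps)
qed

declare binf_of.simps [simp del]


section \<open>The universal enveloping 2-associative bialgebra\<close>

definition U2_ideal :: "('k, 'm) ring_scheme \<Rightarrow> ('k, 'a, 'x) binf_alg_scheme \<Rightarrow> ('a two_term \<Rightarrow> 'k) set set"
  where "U2_ideal K R =
    two_ideal_gen K (two_as K R)
      {two_as_gen K R (ops R rs ss) \<ominus>\<^bsub>two_as K R\<^esub>
         binf_of (two_as K R) (map (two_as_gen K R) rs) (map (two_as_gen K R) ss) |rs ss.
       rs \<in> lists (carrier R) \<and> ss \<in> lists (carrier R)}"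

definition U2_alg ::
  "('k, 'm) ring_scheme \<Rightarrow> ('k, 'a, 'x) binf_alg_scheme \<Rightarrow> ('k, ('a two_term \<Rightarrow> 'k) set set) two_alg"
  where "U2_alg K R = two_quot (two_as K R) (U2_ideal K R)"

text \<open>
  \<open>U2(R)\<close> as a bialgebra with the product \<open>*\<close>; coproduct and counit are induced by those of
  \<open>2as(R)\<close> along the projection \<open>\<pi>\<close>.
\<close>

definition U2 ::
  "('k, 'm) ring_scheme \<Rightarrow> ('k, 'a, 'x) binf_alg_scheme \<Rightarrow> ('k, ('a two_term \<Rightarrow> 'k) set set) bialg"
  where "U2 K R =
    (let A = two_as K R; U = U2_alg K R; \<pi> = (\<lambda>x. U2_ideal K R +>\<^bsub>A\<^esub> x) in
      with_coalgebra U
        (\<lambda>X. tensor_map K U U \<pi> \<pi> (fst (two_as_coalg K R) (SOME x. x \<in> X)))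
        (\<lambda>X. snd (two_as_coalg K R) (SOME x. x \<in> X)))"


section \<open>Categories and equivalences\<close>

record ('o, 'f) cat =
  Ob :: "'o set"
  Hom :: "'o \<Rightarrow> 'o \<Rightarrow> 'f set"
  Id :: "'o \<Rightarrow> 'f"
  Comp :: "'o \<Rightarrow> 'o \<Rightarrow> 'o \<Rightarrow> 'f \<Rightarrow> 'f \<Rightarrow> 'f"  \<comment> \<open>\<open>Comp A B C g f\<close> for \<open>f : A \<rightarrow> B\<close> and \<open>g : B \<rightarrow> C\<close>\<close>

definition category :: "('o, 'f) cat \<Rightarrow> bool"
  where "category \<C> \<longleftrightarrow>
    (\<forall>A \<in> Ob \<C>. Id \<C> A \<in> Hom \<C> A A) \<and>
    (\<forall>A \<in> Ob \<C>. \<forall>B \<in> Ob \<C>. \<forall>C \<in> Ob \<C>. \<forall>f \<in> Hom \<C> A B. \<forall>g \<in> Hom \<C> B C. Comp \<C> A B C g f \<in> Hom \<C> A C) \<and>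
    (\<forall>A \<in> Ob \<C>. \<forall>B \<in> Ob \<C>. \<forall>f \<in> Hom \<C> A B. Comp \<C> A A B f (Id \<C> A) = f \<and> Comp \<C> A B B (Id \<C> B) f = f) \<and>
    (\<forall>A \<in> Ob \<C>. \<forall>B \<in> Ob \<C>. \<forall>C \<in> Ob \<C>. \<forall>D \<in> Ob \<C>.
      \<forall>f \<in> Hom \<C> A B. \<forall>g \<in> Hom \<C> B C. \<forall>h \<in> Hom \<C> C D.
        Comp \<C> A C D h (Comp \<C> A B C g f) = Comp \<C> A B D (Comp \<C> B C D h g) f)"

definition cat_functor ::
  "('o, 'f) cat \<Rightarrow> ('p, 'g) cat \<Rightarrow> ('o \<Rightarrow> 'p) \<Rightarrow> ('o \<Rightarrow> 'o \<Rightarrow> 'f \<Rightarrow> 'g) \<Rightarrow> bool"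
  where "cat_functor \<C> \<D> F \<Phi> \<longleftrightarrow>
    (\<forall>A \<in> Ob \<C>. F A \<in> Ob \<D>) \<and>
    (\<forall>A \<in> Ob \<C>. \<forall>B \<in> Ob \<C>. \<forall>f \<in> Hom \<C> A B. \<Phi> A B f \<in> Hom \<D> (F A) (F B)) \<and>
    (\<forall>A \<in> Ob \<C>. \<Phi> A A (Id \<C> A) = Id \<D> (F A)) \<and>
    (\<forall>A \<in> Ob \<C>. \<forall>B \<in> Ob \<C>. \<forall>C \<in> Ob \<C>. \<forall>f \<in> Hom \<C> A B. \<forall>g \<in> Hom \<C> B C.
      \<Phi> A C (Comp \<C> A B C g f) = Comp \<D> (F A) (F B) (F C) (\<Phi> B C g) (\<Phi> A B f))"

definition cat_iso :: "('o, 'f) cat \<Rightarrow> 'o \<Rightarrow> 'o \<Rightarrow> 'f \<Rightarrow> bool"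
  where "cat_iso \<C> A B f \<longleftrightarrow>
    f \<in> Hom \<C> A B \<and> (\<exists>g \<in> Hom \<C> B A. Comp \<C> A B A g f = Id \<C> A \<and> Comp \<C> B A B f g = Id \<C> B)"

definition natural_iso ::
  "('o, 'f) cat \<Rightarrow> ('p, 'g) cat \<Rightarrow> ('o \<Rightarrow> 'p) \<Rightarrow> ('o \<Rightarrow> 'o \<Rightarrow> 'f \<Rightarrow> 'g) \<Rightarrow>
    ('o \<Rightarrow> 'p) \<Rightarrow> ('o \<Rightarrow> 'o \<Rightarrow> 'f \<Rightarrow> 'g) \<Rightarrow> ('o \<Rightarrow> 'g) \<Rightarrow> bool"
  where "natural_iso \<C> \<D> F \<Phi> G \<Gamma> \<eta> \<longleftrightarrow>
    (\<forall>A \<in> Ob \<C>. cat_iso \<D> (F A) (G A) (\<eta> A)) \<and>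
    (\<forall>A \<in> Ob \<C>. \<forall>B \<in> Ob \<C>. \<forall>f \<in> Hom \<C> A B.
      Comp \<D> (F A) (F B) (G B) (\<eta> B) (\<Phi> A B f) = Comp \<D> (F A) (G A) (G B) (\<Gamma> A B f) (\<eta> A))"

definition equivalent_categories :: "('o, 'f) cat \<Rightarrow> ('p, 'g) cat \<Rightarrow> bool"
  where "equivalent_categories \<C> \<D> \<longleftrightarrow>
    category \<C> \<and> category \<D> \<and>
    (\<exists>F \<Phi> G \<Gamma> \<eta> \<epsilon>.
      cat_functor \<C> \<D> F \<Phi> \<and> cat_functor \<D> \<C> G \<Gamma> \<and>
      natural_iso \<C> \<C> (\<lambda>A. A) (\<lambda>A B f. f) (\<lambda>A. G (F A)) (\<lambda>A B f. \<Gamma> (F A) (F B) (\<Phi> A B f)) \<eta> \<and>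
      natural_iso \<D> \<D> (\<lambda>X. F (G X)) (\<lambda>X Y g. \<Phi> (G X) (G Y) (\<Gamma> X Y g)) (\<lambda>X. X) (\<lambda>X Y g. g) \<epsilon>)"

definition bialgebra_category ::
  "('k, 'm) ring_scheme \<Rightarrow> ('k, 'a) bialg set \<Rightarrow> (('k, 'a) bialg, 'a \<Rightarrow> 'a) cat"
  where "bialgebra_category K Hs =
    \<lparr>Ob = Hs, Hom = bialgebra_hom K, Id = (\<lambda>A. \<lambda>x \<in> carrier A. x),
     Comp = (\<lambda>A B C g f. compose (carrier A) g f)\<rparr>"

text \<open>
  The type \<open>'u\<close> serves as a universe: the cofree bialgebras \<open>H\<close> and the \<open>B\<^sub>\<infinity>\<close>-algebras \<open>R\<close> range over
  the structures whose carrier is a set of elements of \<open>'u\<close>.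
\<close>

definition cofree_category :: "('k, 'm) ring_scheme \<Rightarrow> (('k, 'u) bialg, 'u \<Rightarrow> 'u) cat"
  where "cofree_category K = bialgebra_category K {H. cofree_bialgebra K H}"

definition U2_category ::
  "('k, 'm) ring_scheme \<Rightarrow> 'u itself \<Rightarrow>
    (('k, ('u two_term \<Rightarrow> 'k) set set) bialg,
     ('u two_term \<Rightarrow> 'k) set set \<Rightarrow> ('u two_term \<Rightarrow> 'k) set set) cat"
  where "U2_category K _ = bialgebra_category K {U2 K R |R :: ('k, 'u) binf_alg. binf_algebra K R}"

end

theory Submission
  imports Defs
begin

text \<open>
  Write \<open>T(R)\<close> for the tensor coalgebra of \<open>R\<close>. A tensor is recovered from its counit and its coproduct by cutting the
  first tensor factor of the coproduct down to letters; hence a product on \<open>T(R)\<close> that is compatible with the coproduct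
  is determined by the letter components \<open>M\<^sub>p\<^sub>q\<close> of the products of words, and unitality and associativity need
  only be tested on letter components, where they are the axioms of a \<open>B\<^sub>\<infinity>\<close>-algebra. So bialgebra structures on
  \<open>T(R)\<close> with unit the empty word are the same as \<open>B\<^sub>\<infinity>\<close>-structures on \<open>R\<close>. Over a field the empty word is the only
  group-like element of \<open>T(R)\<close>, so every cofree bialgebra is of this form.

  For a \<open>B\<^sub>\<infinity>\<close>-algebra \<open>R\<close>, concatenation and the product above make \<open>T(R)\<close> a 2-associative bialgebra. The map
  \<open>2as(R) \<rightarrow> T(R)\<close> extending the identity of \<open>R\<close> kills the relations of \<open>U2(R)\<close>, and \<open>T(R) \<rightarrow> U2(R)\<close> sending words to
  iterated products \<open>\<cdot>\<close> is inverse to the induced map. Thus \<open>T(R)\<close> and \<open>U2(R)\<close> are isomorphic bialgebras, and both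
  categories have, up to isomorphism, the same objects; a transport to the universe \<open>'u\<close> is possible because \<open>T(R)\<close>
  is spanned by words over \<open>K\<close> and therefore embeds into \<open>'u\<close>.
\<close>

section \<open>Linear maps\<close>

text \<open>The coproduct of \<open>2as(V)\<close> is a definite description, so its existence and
  uniqueness have to be proved. Existence does not come from a formula on terms: a coproduct with
  the unital infinitesimal relation amounts to a multiplicative section of an algebra on pairs, and
  freeness provides that section. No normal form in \<open>2as(R)\<close> is computed, since
  \<open>T(R)\<close> serves as its model, and the independence of the coproduct of
  \<open>U2(R)\<close> from representatives falls out of the comparison with \<open>T(R)\<close>.
  The field enters through group-like elements: a functional with value 1 at a given nonzero vector
  is required. Both functors are conjugation by chosen isomorphisms, so all the work lies in
  matching objects. Sizes matter in one direction only: the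
  \<open>B\<^sub>\<infinity>\<close>-algebra of a cofree \<open>H\<close> sits on the primitive
  elements of \<open>H\<close>, hence already in \<open>'u\<close>, whereas \<open>U2(R)\<close>
  lives over a larger type and must be brought back to \<open>'u\<close>.\<close>

lemma finsum_struct_cong:
  assumes "carrier W = carrier V" "add W = add V" "zero W = zero V"
  shows "finsum W f A = finsum V f A"
  using assms by (simp add: finsum_def finprod_def)

lemma a_minus_struct_cong:
  assumes "carrier W = carrier V" "add W = add V" "zero W = zero V"
  shows "x \<ominus>\<^bsub>W\<^esub> y = x \<ominus>\<^bsub>V\<^esub> y"
  using assms by (simp add: a_minus_def a_inv_def m_inv_def)

lemma module_cring: "module K V \<Longrightarrow> cring K"
  by (simp add: module_def)

lemma module_abelian_group: "module K V \<Longrightarrow> abelian_group V"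
  by (simp add: module_def)

lemma linear_mapI:
  assumes "\<And>x. x \<in> carrier V \<Longrightarrow> f x \<in> carrier W"
    and "\<And>x y. x \<in> carrier V \<Longrightarrow> y \<in> carrier V \<Longrightarrow> f (x \<oplus>\<^bsub>V\<^esub> y) = f x \<oplus>\<^bsub>W\<^esub> f y"
    and "\<And>c x. c \<in> carrier K \<Longrightarrow> x \<in> carrier V \<Longrightarrow> f (c \<odot>\<^bsub>V\<^esub> x) = c \<odot>\<^bsub>W\<^esub> f x"
  shows "linear_map K V W f"
  using assms by (auto simp: linear_map_def)

lemma lin_closed: "linear_map K V W f \<Longrightarrow> x \<in> carrier V \<Longrightarrow> f x \<in> carrier W"
  by (auto simp: linear_map_def)

lemma lin_add:
  "linear_map K V W f \<Longrightarrow> x \<in> carrier V \<Longrightarrow> y \<in> carrier V \<Longrightarrow> f (x \<oplus>\<^bsub>V\<^esub> y) = f x \<oplus>\<^bsub>W\<^esub> f y"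
  by (auto simp: linear_map_def)

lemma lin_smult:
  "linear_map K V W f \<Longrightarrow> c \<in> carrier K \<Longrightarrow> x \<in> carrier V \<Longrightarrow> f (c \<odot>\<^bsub>V\<^esub> x) = c \<odot>\<^bsub>W\<^esub> f x"
  by (auto simp: linear_map_def)

text \<open>Quotients and transported copies inherit their axioms along a surjection. The zero of
  \<open>W\<close> is a record field of its own, which addition and scalars do not tie to the image
  of the zero of \<open>V\<close> before \<open>W\<close> is known to be a group; hence the
  assumption on it.\<close>

lemma module_surj:
  assumes V: "module K V" and f: "linear_map K V W f" and s: "f ` carrier V = carrier W" and z: "f \<zero>\<^bsub>V\<^esub> = \<zero>\<^bsub>W\<^esub>"
  shows "module K W"
proof -
  interpret V: module K V by fact
  note a = lin_add[OF f, symmetric] and m = lin_smult[OF f, symmetric]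
  show ?thesis
  proof (rule moduleI)
    show "abelian_group W"
    proof (rule abelian_groupI)
      fix x assume "x \<in> carrier W"
      then obtain u where "u \<in> carrier V" "x = f u" unfolding s[symmetric] by blast
      then show "\<exists>y\<in>carrier W. y \<oplus>\<^bsub>W\<^esub> x = \<zero>\<^bsub>W\<^esub>"
        unfolding s[symmetric] by (intro bexI[of _ "f (\<ominus>\<^bsub>V\<^esub> u)"]) (simp_all add: a V.l_neg z)
    qed (auto simp: s[symmetric] a V.a_assoc simp flip: z intro: arg_cong[OF V.a_comm])
  qed (auto simp: s[symmetric] a m V.R.is_cring V.smult_l_distr V.smult_r_distr V.smult_assoc1)
qed

text \<open>One vector space occurs under many records that differ in products, unit or coproduct;
  this lemma and those named \<open>struct_cong\<close> move facts between them.\<close>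

lemma module_cong:
  assumes "module K V" "carrier W = carrier V" "add W = add V" "zero W = zero V" "smult W = smult V"
  shows "module K W"
  by (rule module_surj[OF assms(1), of _ "\<lambda>x. x"]) (use assms in \<open>simp_all add: linear_map_def\<close>)

lemma lin_from_surj:
  assumes V: "module K V" and f: "linear_map K V W f" and s: "f ` carrier V = carrier W"
    and h: "linear_map K V U h" and e: "\<And>x. x \<in> carrier V \<Longrightarrow> h' (f x) = h x"
  shows "linear_map K W U h'"
proof -
  interpret V: module K V by fact
  show ?thesis
    by (rule linear_mapI)
      (auto simp: s[symmetric] e lin_closed[OF h] lin_add[OF f, symmetric] lin_add[OF h] lin_smult[OF f, symmetric] lin_smult[OF h])
qed

lemma lin_struct_cong:
  assumes "carrier V' = carrier V" "add V' = add V" "smult V' = smult V"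
    and "carrier W' = carrier W" "add W' = add W" "smult W' = smult W"
  shows "linear_map K V' W' f \<longleftrightarrow> linear_map K V W f"
  using assms by (simp add: linear_map_def)

lemma lin_cong:
  assumes "module K V" "\<And>x. x \<in> carrier V \<Longrightarrow> f x = g x"
  shows "linear_map K V W f \<longleftrightarrow> linear_map K V W g"
proof -
  interpret V: module K V by fact
  show ?thesis using assms(2) by (auto simp: linear_map_def Pi_def)
qed

lemma lin_zero:
  assumes "linear_map K V W f" "module K V" "module K W"
  shows "f \<zero>\<^bsub>V\<^esub> = \<zero>\<^bsub>W\<^esub>"
proof -
  interpret V: module K V by fact
  interpret W: module K W by fact
  have "f (\<zero>\<^bsub>K\<^esub> \<odot>\<^bsub>V\<^esub> \<zero>\<^bsub>V\<^esub>) = \<zero>\<^bsub>K\<^esub> \<odot>\<^bsub>W\<^esub> f \<zero>\<^bsub>V\<^esub>"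
    by (rule lin_smult[OF assms(1)]) auto
  then show ?thesis using lin_closed[OF assms(1)] by simp
qed

lemma module_neg_eq_smult:
  assumes "module K V" "x \<in> carrier V"
  shows "\<ominus>\<^bsub>V\<^esub> x = (\<ominus>\<^bsub>K\<^esub> \<one>\<^bsub>K\<^esub>) \<odot>\<^bsub>V\<^esub> x"
proof -
  interpret V: module K V by fact
  show ?thesis using assms(2) by (simp add: V.smult_l_minus)
qed

lemma lin_neg:
  assumes "linear_map K V W f" "module K V" "module K W" "x \<in> carrier V"
  shows "f (\<ominus>\<^bsub>V\<^esub> x) = \<ominus>\<^bsub>W\<^esub> f x"
proof -
  interpret V: module K V by fact
  show ?thesis
    using assms by (simp add: module_neg_eq_smult[of K] lin_smult[OF assms(1)] lin_closed[OF assms(1)])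
qed

lemma lin_minus:
  assumes "linear_map K V W f" "module K V" "module K W" "x \<in> carrier V" "y \<in> carrier V"
  shows "f (x \<ominus>\<^bsub>V\<^esub> y) = f x \<ominus>\<^bsub>W\<^esub> f y"
proof -
  interpret V: module K V by fact
  show ?thesis
    using assms by (simp add: a_minus_def lin_add[OF assms(1)] lin_neg[OF assms(1-3)])
qed

lemma lin_finsum:
  assumes "linear_map K V W f" "module K V" "module K W" "\<And>i. i \<in> A \<Longrightarrow> g i \<in> carrier V"
  shows "f (finsum V g A) = finsum W (\<lambda>i. f (g i)) A"
proof -
  interpret V: module K V by fact
  interpret W: module K W by fact
  show ?thesis
  proof (cases "finite A")
    case True
    then show ?thesis using assms(4)
    proof (induction A)
      case empty
      then show ?case by (simp add: lin_zero[OF assms(1-3)])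
    next
      case (insert a A)
      then have "f (finsum V g (insert a A)) = f (g a \<oplus>\<^bsub>V\<^esub> finsum V g A)" by simp
      also have "\<dots> = f (g a) \<oplus>\<^bsub>W\<^esub> f (finsum V g A)"
        using insert by (intro lin_add[OF assms(1)]) auto
      finally show ?case
        using insert lin_closed[OF assms(1)] by (simp add: Pi_def)
    qed
  next
    case False
    then show ?thesis
      by (simp add: lin_zero[OF assms(1-3)] V.finsum_infinite W.finsum_infinite)
  qed
qed

lemma lin_comp:
  "linear_map K U V f \<Longrightarrow> linear_map K V W g \<Longrightarrow> linear_map K U W (\<lambda>x. g (f x))"
  by (auto simp: linear_map_def Pi_iff)

lemma lin_id: "linear_map K V V (\<lambda>x. x)"
  by (auto simp: linear_map_def)

lemma lin_add_fun:
  assumes "linear_map K V W f" "linear_map K V W g" "module K W"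
  shows "linear_map K V W (\<lambda>x. f x \<oplus>\<^bsub>W\<^esub> g x)"
proof -
  interpret W: module K W by fact
  show ?thesis
    using assms by (intro linear_mapI)
      (auto simp: lin_add[of K] lin_smult[of K] lin_closed[of K] W.smult_r_distr W.a_ac)
qed

lemma lin_smult_fun:
  assumes "linear_map K V W f" "module K W" "c \<in> carrier K"
  shows "linear_map K V W (\<lambda>x. c \<odot>\<^bsub>W\<^esub> f x)"
proof -
  interpret W: module K W by fact
  show ?thesis
    using assms by (intro linear_mapI)
      (auto simp: lin_add[of K] lin_smult[of K] lin_closed[of K] W.smult_r_distr
        W.smult_assoc1[symmetric] W.R.m_comm)
qed

lemma lin_minus_fun:
  assumes "linear_map K V W f" "linear_map K V W g" "module K W"
  shows "linear_map K V W (\<lambda>x. f x \<ominus>\<^bsub>W\<^esub> g x)"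
proof -
  interpret W: module K W by fact
  show ?thesis
    using assms by (intro linear_mapI)
      (simp_all add: lin_add[of K] lin_smult[of K] lin_closed[of K] W.smult_r_distr W.a_ac
       a_minus_def W.minus_add W.smult_r_minus)
qed

lemma lin_zero_fun:
  assumes "module K W" shows "linear_map K V W (\<lambda>x. \<zero>\<^bsub>W\<^esub>)"
proof -
  interpret W: module K W by fact
  show ?thesis by (intro linear_mapI) auto
qed

lemma lin_scale:
  assumes "module K W" "linear_map K V (scalar_module K) f" "w \<in> carrier W"
  shows "linear_map K V W (\<lambda>x. f x \<odot>\<^bsub>W\<^esub> w)"
proof -
  interpret W: module K W by fact
  show ?thesis using assms(2,3)
    by (intro linear_mapI) (auto simp: linear_map_def scalar_module_def Pi_def W.smult_l_distr W.smult_assoc1)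
qed

lemma scalar_module_module:
  assumes "cring K" shows "module K (scalar_module K)"
proof -
  interpret cring K by fact
  show ?thesis
    by (rule moduleI) (auto simp: scalar_module_def m_assoc l_distr r_distr assms
       intro!: abelian_groupI a_assoc a_comm intro: l_neg bexI[where x="a_inv K _"])
qed

lemma scalar_module_simps [simp]:
  "carrier (scalar_module K) = carrier K" "add (scalar_module K) = add K" "zero (scalar_module K) = zero K"
  "smult (scalar_module K) = mult K" "mult (scalar_module K) = mult K" "one (scalar_module K) = one K"
  by (simp_all add: scalar_module_def)

section \<open>Bilinear maps and spanning sets\<close>

definition bilinear where
  "bilinear K V W U b \<longleftrightarrow>
    (\<forall>v \<in> carrier V. linear_map K W U (b v)) \<and> (\<forall>w \<in> carrier W. linear_map K V U (\<lambda>v. b v w))"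

lemma bilinearI:
  assumes "\<And>v. v \<in> carrier V \<Longrightarrow> linear_map K W U (b v)"
    and "\<And>w. w \<in> carrier W \<Longrightarrow> linear_map K V U (\<lambda>v. b v w)"
  shows "bilinear K V W U b"
  using assms by (simp add: bilinear_def)

lemma bilin_right: "bilinear K V W U b \<Longrightarrow> v \<in> carrier V \<Longrightarrow> linear_map K W U (b v)"
  by (simp add: bilinear_def)

lemma bilin_left: "bilinear K V W U b \<Longrightarrow> w \<in> carrier W \<Longrightarrow> linear_map K V U (\<lambda>v. b v w)"
  by (simp add: bilinear_def)

lemma bilin_closed: "bilinear K V W U b \<Longrightarrow> v \<in> carrier V \<Longrightarrow> w \<in> carrier W \<Longrightarrow> b v w \<in> carrier U"
  by (meson bilinear_def lin_closed)

lemma bilin_comp: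
  "bilinear K V W U b \<Longrightarrow> linear_map K V' V f \<Longrightarrow> linear_map K W' W g \<Longrightarrow> linear_map K U U' h \<Longrightarrow>
    bilinear K V' W' U' (\<lambda>v w. h (b (f v) (g w)))"
  by (auto simp: bilinear_def linear_map_def Pi_def)

lemma bilin_struct_cong:
  assumes "carrier V' = carrier V" "add V' = add V" "smult V' = smult V"
    and "carrier W' = carrier W" "add W' = add W" "smult W' = smult W"
    and "carrier U' = carrier U" "add U' = add U" "smult U' = smult U"
  shows "bilinear K V' W' U' f \<longleftrightarrow> bilinear K V W U f"
  using assms by (simp add: bilinear_def linear_map_def)

text \<open>Stated through submodules instead of linear combinations: applied to the submodule of
  all vectors with a given property, it is the induction rule \<open>spans_induct\<close>.\<close>

definition spans where
  "spans K V S \<longleftrightarrow> S \<subseteq> carrier V \<and> (\<forall>N. submodule N K V \<and> S \<subseteq> N \<longrightarrow> carrier V \<subseteq> N)"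

lemma submoduleI':
  assumes "module K V" "N \<subseteq> carrier V" "\<zero>\<^bsub>V\<^esub> \<in> N" "\<And>x y. x \<in> N \<Longrightarrow> y \<in> N \<Longrightarrow> x \<oplus>\<^bsub>V\<^esub> y \<in> N"
    "\<And>c x. c \<in> carrier K \<Longrightarrow> x \<in> N \<Longrightarrow> c \<odot>\<^bsub>V\<^esub> x \<in> N"
  shows "submodule N K V"
proof -
  interpret V: module K V by fact
  show ?thesis
  proof (rule V.submoduleI)
    fix a assume "a \<in> N"
    then show "\<ominus>\<^bsub>V\<^esub> a \<in> N" using assms(2,5) by (auto simp: module_neg_eq_smult[OF assms(1)])
  qed (use assms in auto)
qed

lemma spans_induct [consumes 3, case_names zero gen add smult]:
  assumes "spans K V S" "module K V" "x \<in> carrier V"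
    and "P \<zero>\<^bsub>V\<^esub>" "\<And>x. x \<in> S \<Longrightarrow> P x"
    and "\<And>x y. x \<in> carrier V \<Longrightarrow> y \<in> carrier V \<Longrightarrow> P x \<Longrightarrow> P y \<Longrightarrow> P (x \<oplus>\<^bsub>V\<^esub> y)"
    and "\<And>c x. c \<in> carrier K \<Longrightarrow> x \<in> carrier V \<Longrightarrow> P x \<Longrightarrow> P (c \<odot>\<^bsub>V\<^esub> x)"
  shows "P x"
proof -
  interpret V: module K V by fact
  have "submodule {x \<in> carrier V. P x} K V"
    by (rule submoduleI'[OF assms(2)]) (use assms in auto)
  moreover have "S \<subseteq> {x \<in> carrier V. P x}" using assms(1,5) by (auto simp: spans_def)
  ultimately show ?thesis using assms(1,3) by (auto simp: spans_def)
qed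

lemma lin_eqI:
  assumes "spans K V S" "module K V" "module K W" "linear_map K V W f" "linear_map K V W g"
    and "\<And>x. x \<in> S \<Longrightarrow> f x = g x" and "x \<in> carrier V"
  shows "f x = g x"
  using assms(1,2,7)
proof (induction rule: spans_induct)
  case zero
  then show ?case using assms by (simp add: lin_zero[of K V W])
qed (use assms in \<open>simp_all add: lin_add[of K] lin_smult[of K]\<close>)

lemma bilin_eqI:
  assumes "spans K V S" "spans K W T" "module K V" "module K W" "module K U"
    and "bilinear K V W U f" "bilinear K V W U g"
    and "\<And>x y. x \<in> S \<Longrightarrow> y \<in> T \<Longrightarrow> f x y = g x y" and "x \<in> carrier V" "y \<in> carrier W"
  shows "f x y = g x y"
proof -
  have *: "f x y = g x y" if "x \<in> S" for x
  proof -
    have x: "x \<in> carrier V" using assms(1) that by (auto simp: spans_def)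
    show ?thesis
      by (rule lin_eqI[OF assms(2,4,5) bilin_right[OF assms(6) x] bilin_right[OF assms(7) x]])
        (simp_all add: assms(8)[OF that] assms(10))
  qed
  show ?thesis
    by (rule lin_eqI[where f="\<lambda>x. f x y" and g="\<lambda>x. g x y",
          OF assms(1,3,5) bilin_left[OF assms(6,10)] bilin_left[OF assms(7,10)] * assms(9)])
qed

lemma submodule_kernel:
  assumes "linear_map K V W f" "module K V" "module K W"
  shows "submodule {x \<in> carrier V. f x = \<zero>\<^bsub>W\<^esub>} K V"
proof -
  interpret V: module K V by fact
  interpret W: module K W by fact
  show ?thesis
    by (rule submoduleI'[OF assms(2)])
      (auto simp: lin_zero[OF assms] lin_add[OF assms(1)] lin_smult[OF assms(1)])
qed

lemma spans_image:
  assumes "spans K V S" "module K V" "module K W" "linear_map K V W f" "f ` carrier V = carrier W"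
  shows "spans K W (f ` S)"
  unfolding spans_def
proof (intro conjI allI impI)
  interpret V: module K V by fact
  interpret W: module K W by fact
  show "f ` S \<subseteq> carrier W" using assms(1,5) by (auto simp: spans_def)
  fix N assume N: "submodule N K W \<and> f ` S \<subseteq> N"
  then interpret N: submodule N K W by simp
  note NE = W.submoduleE[OF conjunct1[OF N]]
  have "f x \<in> N" if "x \<in> carrier V" for x
    using assms(1,2) that
  proof (induction rule: spans_induct)
    case zero
    then show ?case using lin_zero[OF assms(4,2,3)] N.one_closed by simp
  next
    case (gen x)
    then show ?case using N by auto
  qed (simp_all add: lin_add[OF assms(4)] lin_smult[OF assms(4)] NE)
  then show "carrier W \<subseteq> N" unfolding assms(5)[symmetric] by (simp add: image_subset_iff)
qed

section \<open>Finite sums\<close>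

lemma (in abelian_group) minus_eq_zero_iff:
  assumes "a \<in> carrier G" "b \<in> carrier G"
  shows "a \<ominus> b = \<zero> \<longleftrightarrow> a = b"
proof
  assume "a \<ominus> b = \<zero>"
  then show "a = b" using assms minus_equality[of a "\<ominus> b"] by (simp add: a_minus_def)
qed (use assms in \<open>simp add: a_minus_def r_neg\<close>)

context abelian_monoid begin

lemma finsum_eqI:
  "A = B \<Longrightarrow> (\<And>x. x \<in> B \<Longrightarrow> g x \<in> carrier G) \<Longrightarrow> (\<And>x. x \<in> B \<Longrightarrow> f x = g x) \<Longrightarrow> finsum G f A = finsum G g B"
  by (rule finsum_cong') auto

lemma finsum_Sigma:
  assumes "finite A" "\<And>x. x \<in> A \<Longrightarrow> finite (B x)" "\<And>x y. x \<in> A \<Longrightarrow> y \<in> B x \<Longrightarrow> f x y \<in> carrier G"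
  shows "(\<Oplus>x\<in>A. \<Oplus>y\<in>B x. f x y) = (\<Oplus>z\<in>Sigma A B. f (fst z) (snd z))"
proof -
  have "(\<Oplus>z\<in>Sigma A B. f (fst z) (snd z)) = (\<Oplus>z\<in>(\<Union>x\<in>A. Pair x ` B x). f (fst z) (snd z))"
    by (rule finsum_eqI) (use assms in auto)
  also have "\<dots> = (\<Oplus>x\<in>A. \<Oplus>z\<in>Pair x ` B x. f (fst z) (snd z))"
    by (rule add.finprod_UN_disjoint) (use assms in \<open>auto simp: pairwise_def disjnt_def\<close>)
  also have "\<dots> = (\<Oplus>x\<in>A. \<Oplus>y\<in>B x. f x y)"
  proof (rule finsum_eqI[OF refl])
    fix x assume x: "x \<in> A"
    show "(\<Oplus>y\<in>B x. f x y) \<in> carrier G" using assms x by auto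
    show "(\<Oplus>z\<in>Pair x ` B x. f (fst z) (snd z)) = (\<Oplus>y\<in>B x. f x y)"
      by (subst finsum_reindex) (use assms x in \<open>auto simp: inj_on_def\<close>)
  qed
  finally show ?thesis by simp
qed

lemma finsum_bij:
  assumes "bij_betw h A B" "\<And>y. y \<in> B \<Longrightarrow> g y \<in> carrier G" "\<And>x. x \<in> A \<Longrightarrow> f x = g (h x)"
  shows "finsum G f A = finsum G g B"
proof -
  have "finsum G g B = finsum G g (h ` A)" using assms(1) by (simp add: bij_betw_def)
  also have "\<dots> = (\<Oplus>x\<in>A. g (h x))"
    by (rule finsum_reindex) (use assms in \<open>auto simp: bij_betw_def\<close>)
  also have "\<dots> = finsum G f A"
    by (rule finsum_eqI) (use assms in \<open>auto simp: bij_betw_def\<close>)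
  finally show ?thesis by simp
qed

lemma finsum_mono_neutral:
  assumes "finite B" "A \<subseteq> B" "\<And>x. x \<in> A \<Longrightarrow> f x \<in> carrier G" "\<And>x. x \<in> B - A \<Longrightarrow> f x = \<zero>"
  shows "finsum G f A = finsum G f B"
proof -
  have B: "B = A \<union> (B - A)" and fin: "finite A" using assms(1,2) finite_subset by blast+
  have z: "finsum G f (B - A) = \<zero>" using assms(4) by (intro add.finprod_one_eqI) auto
  have "finsum G f B = finsum G f A \<oplus> finsum G f (B - A)"
    by (subst B, rule finsum_Un_disjoint) (use assms fin in auto)
  then show ?thesis using z assms(3) by simp
qed

end

section \<open>Free modules and their quotients\<close>

lemma free_module_simps:
  "carrier (free_module K X) = {f. (\<forall>x \<in> X. f x \<in> carrier K) \<and> (\<forall>x. x \<notin> X \<longrightarrow> f x = \<zero>\<^bsub>K\<^esub>) \<and> finite {x. f x \<noteq> \<zero>\<^bsub>K\<^esub>}}"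
  "zero (free_module K X) = (\<lambda>x. \<zero>\<^bsub>K\<^esub>)"
  "add (free_module K X) = (\<lambda>f g x. f x \<oplus>\<^bsub>K\<^esub> g x)"
  "smult (free_module K X) = (\<lambda>c f x. c \<otimes>\<^bsub>K\<^esub> f x)"
  by (simp_all add: free_module_def)

lemma free_module_closed: "cring K \<Longrightarrow> f \<in> carrier (free_module K X) \<Longrightarrow> f x \<in> carrier K"
  by (cases "x \<in> X") (auto simp: free_module_simps cring.cring_simprules)

lemma free_module_module:
  assumes "cring K" shows "module K (free_module K X)"
proof -
  interpret cring K by fact
  let ?F = "free_module K X"
  have cl: "f \<in> carrier ?F \<Longrightarrow> f x \<in> carrier K" for f x by (rule free_module_closed[OF assms])
  have fin: "f \<in> carrier ?F \<Longrightarrow> finite {x. f x \<noteq> \<zero>\<^bsub>K\<^esub>}" for f by (simp add: free_module_simps)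
  have addc: "(\<lambda>x. f x \<oplus>\<^bsub>K\<^esub> g x) \<in> carrier ?F" if "f \<in> carrier ?F" "g \<in> carrier ?F" for f g
  proof -
    have "finite {x. f x \<oplus>\<^bsub>K\<^esub> g x \<noteq> \<zero>\<^bsub>K\<^esub>}"
      by (rule finite_subset[of _ "{x. f x \<noteq> \<zero>\<^bsub>K\<^esub>} \<union> {x. g x \<noteq> \<zero>\<^bsub>K\<^esub>}"]) (use fin that in auto)
    then show ?thesis using that by (auto simp: free_module_simps)
  qed
  have sm: "(\<lambda>x. c \<otimes>\<^bsub>K\<^esub> f x) \<in> carrier ?F" if "f \<in> carrier ?F" "c \<in> carrier K" for f c
  proof -
    have "finite {x. c \<otimes>\<^bsub>K\<^esub> f x \<noteq> \<zero>\<^bsub>K\<^esub>}"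
      by (rule finite_subset[of _ "{x. f x \<noteq> \<zero>\<^bsub>K\<^esub>}"]) (use fin that in auto)
    then show ?thesis using that by (auto simp: free_module_simps)
  qed
  show ?thesis
  proof (rule moduleI)
    show "abelian_group ?F"
    proof (rule abelian_groupI)
      fix f assume f: "f \<in> carrier ?F"
      then have n: "(\<lambda>x. \<ominus>\<^bsub>K\<^esub> \<one>\<^bsub>K\<^esub> \<otimes>\<^bsub>K\<^esub> f x) \<in> carrier ?F" by (intro sm) auto
      have "(\<lambda>x. \<ominus>\<^bsub>K\<^esub> \<one>\<^bsub>K\<^esub> \<otimes>\<^bsub>K\<^esub> f x) \<oplus>\<^bsub>?F\<^esub> f = \<zero>\<^bsub>?F\<^esub>"
        using cl[OF f] by (auto simp: free_module_simps l_minus l_neg)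
      then show "\<exists>g\<in>carrier ?F. g \<oplus>\<^bsub>?F\<^esub> f = \<zero>\<^bsub>?F\<^esub>" using n by blast
    next
      show "\<zero>\<^bsub>?F\<^esub> \<in> carrier ?F" by (auto simp: free_module_simps)
    next
      fix f g assume "f \<in> carrier ?F" "g \<in> carrier ?F"
      then show "f \<oplus>\<^bsub>?F\<^esub> g \<in> carrier ?F" using addc by (simp add: free_module_simps(3))
    qed (auto simp: free_module_simps(2,3) cl a_ac fun_eq_iff)
  next
    fix c f assume "c \<in> carrier K" "f \<in> carrier ?F"
    then show "c \<odot>\<^bsub>?F\<^esub> f \<in> carrier ?F" using sm by (simp add: free_module_simps(4))
  qed (auto simp: assms free_module_simps(3,4) cl l_distr r_distr m_assoc fun_eq_iff)
qed

lemma basis_elt_closed: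
  assumes "cring K" "x \<in> X" shows "basis_elt K x \<in> carrier (free_module K X)"
proof -
  interpret cring K by fact
  have "finite {y. basis_elt K x y \<noteq> \<zero>\<^bsub>K\<^esub>}"
    by (rule finite_subset[of _ "{x}"]) (auto simp: basis_elt_def)
  then show ?thesis using assms(2) by (auto simp: free_module_simps basis_elt_def)
qed

lemma spans_free_module:
  assumes "cring K"
  shows "spans K (free_module K X) (basis_elt K ` X)"
  unfolding spans_def
proof (intro conjI allI impI subsetI)
  interpret cring K by fact
  let ?F = "free_module K X"
  interpret F: module K ?F by (rule free_module_module[OF assms])
  show "x \<in> carrier ?F" if "x \<in> basis_elt K ` X" for x using that basis_elt_closed[OF assms] by auto
  fix N f assume N: "submodule N K ?F \<and> basis_elt K ` X \<subseteq> N" and f: "f \<in> carrier ?F"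
  note NE = F.submoduleE[OF conjunct1[OF N]]
  have N0: "\<zero>\<^bsub>?F\<^esub> \<in> N" using subgroup.one_closed[OF submodule.axioms(1)[OF conjunct1[OF N]]] by simp
  have "finite A \<Longrightarrow> f \<in> carrier ?F \<Longrightarrow> {x. f x \<noteq> \<zero>\<^bsub>K\<^esub>} \<subseteq> A \<Longrightarrow> f \<in> N" for A f
  proof (induction A arbitrary: f rule: finite_induct)
    case empty
    then have "f = \<zero>\<^bsub>?F\<^esub>" by (auto simp: free_module_simps)
    then show ?case using N0 by simp
  next
    case (insert a A)
    show ?case
    proof (cases "f a = \<zero>\<^bsub>K\<^esub>")
      case True
      then show ?thesis using insert by (intro insert.IH) auto
    next
      case False
      let ?g = "f(a := \<zero>\<^bsub>K\<^esub>)"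
      have a: "a \<in> X" and fa: "f a \<in> carrier K"
        using False insert.prems free_module_closed[OF assms] by (auto simp: free_module_simps)
      have fin: "finite {x. ?g x \<noteq> \<zero>\<^bsub>K\<^esub>}"
        by (rule finite_subset[of _ "{x. f x \<noteq> \<zero>\<^bsub>K\<^esub>}"]) (use insert.prems in \<open>auto simp: free_module_simps\<close>)
      then have "?g \<in> carrier ?F" using insert.prems(1) by (auto simp: free_module_simps)
      moreover have "{x. ?g x \<noteq> \<zero>\<^bsub>K\<^esub>} \<subseteq> A" using insert.prems(2) by auto
      ultimately have "?g \<in> N" by (rule insert.IH)
      moreover have "f a \<odot>\<^bsub>?F\<^esub> basis_elt K a \<in> N"
        using N a fa NE by auto
      ultimately have "f a \<odot>\<^bsub>?F\<^esub> basis_elt K a \<oplus>\<^bsub>?F\<^esub> ?g \<in> N" using NE by auto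
      moreover have "f a \<odot>\<^bsub>?F\<^esub> basis_elt K a \<oplus>\<^bsub>?F\<^esub> ?g = f"
        using free_module_closed[OF assms insert.prems(1)]
        by (auto simp: free_module_simps basis_elt_def fun_eq_iff)
      ultimately show ?thesis by simp
    qed
  qed
  then show "f \<in> N" using f by (auto simp: free_module_simps)
qed

text \<open>The map before passing to a quotient: \<open>lift_quot\<close> is \<open>lin_ext\<close>
  at a chosen representative.\<close>

definition "lin_ext K U \<beta> f = (\<Oplus>\<^bsub>U\<^esub>x \<in> {x. f x \<noteq> \<zero>\<^bsub>K\<^esub>}. f x \<odot>\<^bsub>U\<^esub> \<beta> x)"

lemma lift_quot_lin_ext: "lift_quot K U \<beta> X = lin_ext K U \<beta> (SOME f. f \<in> X)"
  by (simp add: lift_quot_def lin_ext_def Let_def)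

text \<open>The index set of \<open>lin_ext\<close> depends on the support of its argument.
  Enlarging it to any finite superset gives two functions a common index set, which additivity
  requires.\<close>

lemma lin_ext_superset:
  assumes "module K U" "f \<in> carrier (free_module K X)" "\<And>x. x \<in> X \<Longrightarrow> \<beta> x \<in> carrier U"
    and "finite A" "{x. f x \<noteq> \<zero>\<^bsub>K\<^esub>} \<subseteq> A" "A \<subseteq> X"
  shows "lin_ext K U \<beta> f = (\<Oplus>\<^bsub>U\<^esub>x \<in> A. f x \<odot>\<^bsub>U\<^esub> \<beta> x)"
proof -
  interpret U: module K U by fact
  show ?thesis unfolding lin_ext_def
    by (rule U.finsum_mono_neutral)
      (use assms free_module_closed[OF module_cring[OF assms(1)] assms(2)] in auto)
qed

lemma lin_ext_linear:
  assumes "module K U" "\<And>x. x \<in> X \<Longrightarrow> \<beta> x \<in> carrier U"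
  shows "linear_map K (free_module K X) U (lin_ext K U \<beta>)"
proof -
  interpret U: module K U by fact
  let ?F = "free_module K X"
  have cK: "cring K" by (rule module_cring[OF assms(1)])
  interpret F: module K ?F by (rule free_module_module[OF cK])
  note cl = free_module_closed[OF cK]
  define sup where "sup f = {x. f x \<noteq> \<zero>\<^bsub>K\<^esub>}" for f :: "'e \<Rightarrow> 'a"
  have sup: "finite (sup f)" "sup f \<subseteq> X" if "f \<in> carrier ?F" for f
    using that by (auto simp: free_module_simps sup_def)
  have key: "lin_ext K U \<beta> f = (\<Oplus>\<^bsub>U\<^esub>x \<in> A. f x \<odot>\<^bsub>U\<^esub> \<beta> x)"
    if "f \<in> carrier ?F" "finite A" "sup f \<subseteq> A" "A \<subseteq> X" for f A
    by (rule lin_ext_superset) (use that assms in \<open>auto simp: sup_def\<close>)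
  show ?thesis
  proof (rule linear_mapI)
    fix f assume f: "f \<in> carrier ?F"
    show "lin_ext K U \<beta> f \<in> carrier U"
      using key[OF f sup(1)[OF f] subset_refl sup(2)[OF f]] sup[OF f] cl[OF f] assms(2)
      by (auto intro!: U.finsum_closed)
  next
    fix f g assume f: "f \<in> carrier ?F" and g: "g \<in> carrier ?F"
    let ?A = "sup f \<union> sup g"
    have A: "finite ?A" "?A \<subseteq> X" using sup f g by auto
    have "sup (f \<oplus>\<^bsub>?F\<^esub> g) \<subseteq> ?A" by (auto simp: sup_def free_module_simps)
    then show "lin_ext K U \<beta> (f \<oplus>\<^bsub>?F\<^esub> g) = lin_ext K U \<beta> f \<oplus>\<^bsub>U\<^esub> lin_ext K U \<beta> g"
      unfolding key[OF f A(1) Un_upper1 A(2)] key[OF g A(1) Un_upper2 A(2)]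
      apply (subst key[OF F.a_closed[OF f g] A(1) _ A(2)], assumption)
      apply (subst U.finsum_addf[symmetric])
      subgoal using A(2) cl[OF f] assms(2) by blast
      subgoal using A(2) cl[OF g] assms(2) by blast
      subgoal using A(2) cl[OF f] cl[OF g] assms(2)
        by (intro U.finsum_eqI refl) (auto simp: free_module_simps(3) U.smult_l_distr subset_iff)
      done
  next
    fix c f assume c: "c \<in> carrier K" and f: "f \<in> carrier ?F"
    have "sup (c \<odot>\<^bsub>?F\<^esub> f) \<subseteq> sup f" using c by (auto simp: sup_def free_module_simps)
    then show "lin_ext K U \<beta> (c \<odot>\<^bsub>?F\<^esub> f) = c \<odot>\<^bsub>U\<^esub> lin_ext K U \<beta> f"
      unfolding key[OF f sup(1)[OF f] subset_refl sup(2)[OF f]]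
      apply (subst key[OF F.smult_closed[OF c f] sup(1)[OF f] _ sup(2)[OF f]], assumption)
      apply (subst U.finsum_smult_ldistr[OF sup(1)[OF f] c])
      subgoal using sup(2)[OF f] cl[OF f] assms(2) by blast
      subgoal using sup(2)[OF f] cl[OF f] assms(2) c
        by (intro U.finsum_eqI refl) (auto simp: free_module_simps(4) U.smult_assoc1 subset_iff)
      done
  qed
qed

lemma lin_ext_basis_elt:
  assumes "module K U" "x \<in> X" "\<And>x. x \<in> X \<Longrightarrow> \<beta> x \<in> carrier U"
  shows "lin_ext K U \<beta> (basis_elt K x) = \<beta> x"
proof -
  interpret U: module K U by fact
  have "lin_ext K U \<beta> (basis_elt K x) = (\<Oplus>\<^bsub>U\<^esub>y \<in> {x}. basis_elt K x y \<odot>\<^bsub>U\<^esub> \<beta> y)"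
    by (rule lin_ext_superset[OF assms(1) basis_elt_closed])
      (use assms module_cring in \<open>auto simp: basis_elt_def\<close>)
  then show ?thesis using assms by (simp add: basis_elt_def Pi_def)
qed

lemma submodule_submodule_span:
  assumes "module K V" "S \<subseteq> carrier V"
  shows "submodule (submodule_span K V S) K V"
proof -
  interpret V: module K V by fact
  \<comment> \<open>The carrier is one of the submodules intersected in the hull; this keeps the
    hull inside the carrier.\<close>
  have V: "submodule (carrier V) K V" by (rule V.carrier_is_submodule)
  show ?thesis unfolding submodule_span_def hull_def
    apply (rule submoduleI'[OF assms(1)])
    subgoal using V assms(2) by blast
    subgoal using subgroup.one_closed[OF submodule.axioms(1)] by fastforce
    subgoal using V.submoduleE(5) by blast
    subgoal using V.submoduleE(4) by blast
    done
qed

lemma submodule_span_incl: "S \<subseteq> submodule_span K V S"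
  unfolding submodule_span_def by (rule hull_subset)

lemma lin_zero_on_span:
  assumes "linear_map K V W f" "module K V" "module K W" "S \<subseteq> carrier V" "\<And>x. x \<in> S \<Longrightarrow> f x = \<zero>\<^bsub>W\<^esub>"
    and "x \<in> submodule_span K V S"
  shows "f x = \<zero>\<^bsub>W\<^esub>"
proof -
  have "submodule_span K V S \<subseteq> {x \<in> carrier V. f x = \<zero>\<^bsub>W\<^esub>}"
    unfolding submodule_span_def
    by (rule hull_minimal) (use assms submodule_kernel[OF assms(1-3)] in auto)
  then show ?thesis using assms by auto
qed

lemma quot_module_simps:
  "carrier (quot_module V N) = a_rcosets\<^bsub>V\<^esub> N"
  "zero (quot_module V N) = N"
  "add (quot_module V N) = set_add V"
  "one (quot_module V N) = N +>\<^bsub>V\<^esub> \<one>\<^bsub>V\<^esub>"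
  "mult (quot_module V N) = rcoset_mult V N"
  "smult (quot_module V N) = (\<lambda>c X. \<Union>x \<in> X. N +>\<^bsub>V\<^esub> (c \<odot>\<^bsub>V\<^esub> x))"
  by (simp_all add: quot_module_def)

section \<open>Quotients by submodules\<close>

locale submod = module K V + N: submodule N K V for K V N
begin

lemma submod_abelian_subgroup: "abelian_subgroup N V"
  by (rule abelian_subgroupI3) (auto simp: additive_subgroup_def N.subgroup_axioms module_abelian_group[OF module_axioms])

sublocale AS: abelian_subgroup N V by (rule submod_abelian_subgroup)

lemma coset_eq_iff:
  assumes "x \<in> carrier V" "y \<in> carrier V"
  shows "N +>\<^bsub>V\<^esub> x = N +>\<^bsub>V\<^esub> y \<longleftrightarrow> x \<ominus>\<^bsub>V\<^esub> y \<in> N"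
proof -
  have "N +>\<^bsub>V\<^esub> x = N +>\<^bsub>V\<^esub> y \<longleftrightarrow> x \<in> N +>\<^bsub>V\<^esub> y"
    using assms AS.a_repr_independence'[of x y] AS.a_rcos_self[of x] by auto
  also have "\<dots> \<longleftrightarrow> x \<ominus>\<^bsub>V\<^esub> y \<in> N"
    using assms by (simp add: AS.a_rcos_module a_minus_def)
  finally show ?thesis .
qed

lemma mem_coset: "x \<in> carrier V \<Longrightarrow> x \<in> N +>\<^bsub>V\<^esub> x"
  by (rule AS.a_rcos_self)

lemma mem_coset_carrier: "x \<in> carrier V \<Longrightarrow> y \<in> N +>\<^bsub>V\<^esub> x \<Longrightarrow> y \<in> carrier V"
  using AS.a_elemrcos_carrier by blast

lemma mem_coset_eq: "x \<in> carrier V \<Longrightarrow> y \<in> N +>\<^bsub>V\<^esub> x \<Longrightarrow> N +>\<^bsub>V\<^esub> y = N +>\<^bsub>V\<^esub> x"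
  using AS.a_repr_independence' by blast

lemma U_minus_zero: "\<ominus>\<^bsub>V\<^esub> \<zero>\<^bsub>V\<^esub> = \<zero>\<^bsub>V\<^esub>"
  using a_inv_def[of V] M.add.inv_one by simp

lemma coset_mem_iff: "x \<in> carrier V \<Longrightarrow> N +>\<^bsub>V\<^esub> x = N \<longleftrightarrow> x \<in> N"
  using coset_eq_iff[of x "\<zero>\<^bsub>V\<^esub>"] by (simp add: a_minus_def AS.a_subset U_minus_zero)

lemma quot_carrier: "carrier (quot_module V N) = (\<lambda>x. N +>\<^bsub>V\<^esub> x) ` carrier V"
  by (auto simp: quot_module_simps A_RCOSETS_def')

lemma quot_add:
  "x \<in> carrier V \<Longrightarrow> y \<in> carrier V \<Longrightarrow>
    (N +>\<^bsub>V\<^esub> x) \<oplus>\<^bsub>quot_module V N\<^esub> (N +>\<^bsub>V\<^esub> y) = N +>\<^bsub>V\<^esub> (x \<oplus>\<^bsub>V\<^esub> y)"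
  by (simp add: quot_module_simps AS.a_rcos_sum)

text \<open>The scalar multiple is a union over all representatives. It collapses to one coset
  because the multiples of two representatives differ by an element of \<open>N\<close>.\<close>

lemma quot_smult:
  assumes "c \<in> carrier K" "x \<in> carrier V"
  shows "c \<odot>\<^bsub>quot_module V N\<^esub> (N +>\<^bsub>V\<^esub> x) = N +>\<^bsub>V\<^esub> (c \<odot>\<^bsub>V\<^esub> x)"
proof -
  have "N +>\<^bsub>V\<^esub> (c \<odot>\<^bsub>V\<^esub> y) = N +>\<^bsub>V\<^esub> (c \<odot>\<^bsub>V\<^esub> x)" if "y \<in> N +>\<^bsub>V\<^esub> x" for y
  proof -
    have y: "y \<in> carrier V" using that assms by (auto intro: mem_coset_carrier)
    then have "y \<ominus>\<^bsub>V\<^esub> x \<in> N" using that assms mem_coset_eq coset_eq_iff by blast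
    then have "c \<odot>\<^bsub>V\<^esub> (y \<ominus>\<^bsub>V\<^esub> x) \<in> N" by (rule N.smult_closed[OF assms(1)])
    then have "c \<odot>\<^bsub>V\<^esub> y \<ominus>\<^bsub>V\<^esub> c \<odot>\<^bsub>V\<^esub> x \<in> N" using assms y by (simp add: a_minus_def smult_r_distr smult_r_minus)
    then show ?thesis by (intro iffD2[OF coset_eq_iff]) (simp_all add: assms y)
  qed
  then have "(\<Union>y\<in>N +>\<^bsub>V\<^esub> x. N +>\<^bsub>V\<^esub> (c \<odot>\<^bsub>V\<^esub> y)) = (\<Union>y\<in>N +>\<^bsub>V\<^esub> x. N +>\<^bsub>V\<^esub> (c \<odot>\<^bsub>V\<^esub> x))"
    by (intro SUP_cong refl)
  then show ?thesis using mem_coset[OF assms(2)] by (simp only: quot_module_simps) (metis UN_constant empty_iff)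
qed

lemma quot_zero: "\<zero>\<^bsub>quot_module V N\<^esub> = N +>\<^bsub>V\<^esub> \<zero>\<^bsub>V\<^esub>"
  using coset_mem_iff[of "\<zero>\<^bsub>V\<^esub>"] by (simp add: quot_module_simps)

lemma quot_proj_linear: "linear_map K V (quot_module V N) (\<lambda>x. N +>\<^bsub>V\<^esub> x)"
  by (rule linear_mapI) (auto simp: quot_carrier quot_add quot_smult)

lemma quot_module_module: "module K (quot_module V N)"
  by (rule module_surj[OF module_axioms quot_proj_linear]) (simp_all add: quot_carrier quot_zero)

lemma some_coset_rep:
  assumes "X \<in> carrier (quot_module V N)"
  shows "(SOME x. x \<in> X) \<in> carrier V" "N +>\<^bsub>V\<^esub> (SOME x. x \<in> X) = X"
proof -
  obtain x where x: "x \<in> carrier V" "X = N +>\<^bsub>V\<^esub> x" using assms by (auto simp: quot_carrier)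
  have m: "(SOME x. x \<in> X) \<in> N +>\<^bsub>V\<^esub> x"
    using mem_coset[OF x(1)] unfolding x(2) by (rule someI)
  show "(SOME x. x \<in> X) \<in> carrier V" by (rule mem_coset_carrier[OF x(1) m])
  show "N +>\<^bsub>V\<^esub> (SOME x. x \<in> X) = X" using mem_coset_eq[OF x(1) m] x(2) by simp
qed

text \<open>The choice of a representative is harmless for a map that vanishes on \<open>N\<close>,
  as two representatives differ by an element of \<open>N\<close>.\<close>

lemma quot_lift:
  assumes "module K U" "linear_map K V U f" "\<And>x. x \<in> N \<Longrightarrow> f x = \<zero>\<^bsub>U\<^esub>"
  shows "linear_map K (quot_module V N) U (\<lambda>X. f (SOME x. x \<in> X))"
    and "x \<in> carrier V \<Longrightarrow> f (SOME y. y \<in> N +>\<^bsub>V\<^esub> x) = f x"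
proof -
  interpret U: module K U by fact
  have *: "f (SOME y. y \<in> N +>\<^bsub>V\<^esub> x) = f x" if x: "x \<in> carrier V" for x
  proof -
    let ?y = "SOME y. y \<in> N +>\<^bsub>V\<^esub> x"
    have y: "?y \<in> carrier V" "N +>\<^bsub>V\<^esub> ?y = N +>\<^bsub>V\<^esub> x" using some_coset_rep[of "N +>\<^bsub>V\<^esub> x"] x unfolding quot_carrier by blast+
    then have "?y \<ominus>\<^bsub>V\<^esub> x \<in> N" using coset_eq_iff x by blast
    then have "f ?y \<ominus>\<^bsub>U\<^esub> f x = \<zero>\<^bsub>U\<^esub>" using lin_minus[OF assms(2) module_axioms assms(1)] x y assms(3) by metis
    then show ?thesis using lin_closed[OF assms(2)] x y by (simp add: U.minus_eq_zero_iff)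
  qed
  then show "x \<in> carrier V \<Longrightarrow> f (SOME y. y \<in> N +>\<^bsub>V\<^esub> x) = f x" .
  show "linear_map K (quot_module V N) U (\<lambda>X. f (SOME x. x \<in> X))"
    by (rule linear_mapI)
      (auto simp: quot_carrier quot_add quot_smult * lin_closed[OF assms(2)] lin_add[OF assms(2)]
        lin_smult[OF assms(2)])
qed

end

lemma lin_congI:
  "linear_map K V W g \<Longrightarrow> module K V \<Longrightarrow> (\<And>x. x \<in> carrier V \<Longrightarrow> f x = g x) \<Longrightarrow> linear_map K V W f"
  using lin_cong[of K V f g W] by blast

lemma submodule_iff:
  assumes "module K V"
  shows "submodule N K V \<longleftrightarrow> N \<subseteq> carrier V \<and> \<zero>\<^bsub>V\<^esub> \<in> N \<and> (\<forall>x\<in>N. \<forall>y\<in>N. x \<oplus>\<^bsub>V\<^esub> y \<in> N) \<and>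
    (\<forall>c\<in>carrier K. \<forall>x\<in>N. c \<odot>\<^bsub>V\<^esub> x \<in> N)"
proof
  interpret V: module K V by fact
  assume N: "submodule N K V"
  have "\<zero>\<^bsub>V\<^esub> \<in> N" using subgroup.one_closed[OF submodule.axioms(1)[OF N]] by simp
  then show "N \<subseteq> carrier V \<and> \<zero>\<^bsub>V\<^esub> \<in> N \<and> (\<forall>x\<in>N. \<forall>y\<in>N. x \<oplus>\<^bsub>V\<^esub> y \<in> N) \<and>
    (\<forall>c\<in>carrier K. \<forall>x\<in>N. c \<odot>\<^bsub>V\<^esub> x \<in> N)"
    using V.submoduleE[OF N] by simp
qed (use submoduleI'[OF assms] in simp)

lemma spans_struct_cong:
  assumes "module K V" "carrier W = carrier V" "add W = add V" "zero W = zero V" "smult W = smult V"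
  shows "spans K W S \<longleftrightarrow> spans K V S"
  unfolding spans_def submodule_iff[OF assms(1)] submodule_iff[OF module_cong[OF assms]] assms(2-) ..

text \<open>Each \<open>G v\<close> is already linear, so additivity and homogeneity in
  \<open>v\<close> are equations between linear maps on \<open>Q\<close> and can be tested on
  generators. This is how lifts to quotients are shown to depend linearly on a parameter.\<close>

lemma bilin_from_span:
  assumes "module K V" "module K Q" "module K U" "spans K Q S"
    and "\<And>v. v \<in> carrier V \<Longrightarrow> linear_map K Q U (G v)"
    and "\<And>s. s \<in> S \<Longrightarrow> linear_map K V U (\<lambda>v. G v s)"
  shows "bilinear K V Q U G"
proof (rule bilinearI[OF assms(5)])
  interpret V: module K V by fact
  interpret Q: module K Q by fact
  interpret U: module K U by fact
  note G = assms(5)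
  fix w assume w: "w \<in> carrier Q"
  show "linear_map K V U (\<lambda>v. G v w)"
  proof (rule linear_mapI)
    fix x assume "x \<in> carrier V" then show "G x w \<in> carrier U" using lin_closed[OF G] w by blast
  next
    fix x y assume x: "x \<in> carrier V" and y: "y \<in> carrier V"
    show "G (x \<oplus>\<^bsub>V\<^esub> y) w = G x w \<oplus>\<^bsub>U\<^esub> G y w"
      by (rule lin_eqI[OF assms(4,2,3) G lin_add_fun[OF G G assms(3)] _ w])
        (use x y lin_add[OF assms(6) x y] in simp_all)
  next
    fix c x assume c: "c \<in> carrier K" and x: "x \<in> carrier V"
    show "G (c \<odot>\<^bsub>V\<^esub> x) w = c \<odot>\<^bsub>U\<^esub> G x w"
      by (rule lin_eqI[OF assms(4,2,3) G lin_smult_fun[OF G assms(3) c] _ w])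
        (use x c lin_smult[OF assms(6) c x] in simp_all)
  qed
qed

section \<open>Free modules modulo relations\<close>

context
  fixes K :: "('k, 'm) ring_scheme" and X :: "'x set" and S
  assumes cK: "cring K" and S: "S \<subseteq> carrier (free_module K X)"
begin

private abbreviation "F \<equiv> free_module K X"
private abbreviation "N \<equiv> submodule_span K F S"
private abbreviation "Q \<equiv> quot_module F N"

private lemma sm: "submod K F N"
  by (intro submod.intro free_module_module submodule_submodule_span cK S)

lemma free_quot_module: "module K Q"
  by (rule submod.quot_module_module[OF sm])

lemma free_quot_proj: "linear_map K F Q (\<lambda>f. N +>\<^bsub>F\<^esub> f)"
  by (rule submod.quot_proj_linear[OF sm])

lemma free_quot_closed: "x \<in> X \<Longrightarrow> N +>\<^bsub>F\<^esub> basis_elt K x \<in> carrier Q"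
  by (rule lin_closed[OF free_quot_proj basis_elt_closed[OF cK]])

lemma free_quot_spans: "spans K Q ((\<lambda>x. N +>\<^bsub>F\<^esub> basis_elt K x) ` X)"
  using spans_image[OF spans_free_module[OF cK] free_module_module[OF cK] free_quot_module free_quot_proj]
  by (simp add: submod.quot_carrier[OF sm] image_image)

lemma free_quot_rel: "f \<in> S \<Longrightarrow> N +>\<^bsub>F\<^esub> f = \<zero>\<^bsub>Q\<^esub>"
  using submod.coset_mem_iff[OF sm, of f] submodule_span_incl[of S K F] S by (simp add: quot_module_simps(2) subset_iff)

text \<open>The universal property behind both tensor products, where \<open>S\<close> consists of
  the bilinearity relations, and word modules, where \<open>S\<close> consists of the multilinearity
  relations.\<close>

lemma free_quot_lift:
  assumes "module K U" "\<And>x. x \<in> X \<Longrightarrow> \<beta> x \<in> carrier U" "\<And>f. f \<in> S \<Longrightarrow> lin_ext K U \<beta> f = \<zero>\<^bsub>U\<^esub>"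
  shows "linear_map K Q U (lift_quot K U \<beta>)"
    and "x \<in> X \<Longrightarrow> lift_quot K U \<beta> (N +>\<^bsub>F\<^esub> basis_elt K x) = \<beta> x"
proof -
  note L = lin_ext_linear[OF assms(1,2)]
  have z: "lin_ext K U \<beta> f = \<zero>\<^bsub>U\<^esub>" if "f \<in> N" for f
    by (rule lin_zero_on_span[OF L free_module_module[OF cK] assms(1) S assms(3) that])
  show "linear_map K Q U (lift_quot K U \<beta>)"
    unfolding lift_quot_lin_ext by (rule submod.quot_lift(1)[OF sm assms(1) L z])
  assume x: "x \<in> X"
  show "lift_quot K U \<beta> (N +>\<^bsub>F\<^esub> basis_elt K x) = \<beta> x"
    unfolding lift_quot_lin_ext
    using submod.quot_lift(2)[OF sm assms(1) L z basis_elt_closed[OF cK x]] lin_ext_basis_elt[OF assms(1) x assms(2)]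
    by simp
qed

end

section \<open>Tensor products\<close>

text \<open>The space underlying a tensor product is built from carrier, addition and scalars alone,
  so it is literally equal for structures that differ in their products.\<close>

lemma tensor_space_struct_cong:
  assumes "carrier V' = carrier V" "add V' = add V" "smult V' = smult V"
    and "carrier W' = carrier W" "add W' = add W" "smult W' = smult W"
  shows "tensor_space K V' W' = tensor_space K V W"
    and "pure_tensor K V' W' = pure_tensor K V W"
  using assms by (simp_all add: tensor_space_def tensor_ideal_def tensor_rels_def pure_tensor_def fun_eq_iff)

lemma tensor_simps:
  "carrier (tensor K V W) = carrier (tensor_space K V W)"
  "zero (tensor K V W) = zero (tensor_space K V W)"
  "add (tensor K V W) = add (tensor_space K V W)"
  "smult (tensor K V W) = smult (tensor_space K V W)"
  "one (tensor K V W) = pure_tensor K V W \<one>\<^bsub>V\<^esub> \<one>\<^bsub>W\<^esub>"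
  by (simp_all add: tensor_def)

lemma tensor_struct_cong:
  assumes "carrier V' = carrier V" "add V' = add V" "smult V' = smult V"
    and "carrier W' = carrier W" "add W' = add W" "smult W' = smult W"
  shows "carrier (tensor K V' W') = carrier (tensor K V W)"
    "zero (tensor K V' W') = zero (tensor K V W)"
    "add (tensor K V' W') = add (tensor K V W)"
    "smult (tensor K V' W') = smult (tensor K V W)"
  by (simp_all add: tensor_simps tensor_space_struct_cong[OF assms])

lemma lift_quot_struct_cong:
  assumes "carrier V' = carrier V" "add V' = add V" "smult V' = smult V" "zero V' = zero V"
  shows "lift_quot K V' \<beta> = lift_quot K V \<beta>"
  by (rule ext) (simp add: lift_quot_def Let_def assms finsum_struct_cong[OF assms(1,2,4)])

lemma tensor_map_struct_cong:
  assumes "carrier V' = carrier V" "add V' = add V" "smult V' = smult V"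
    and "carrier W' = carrier W" "add W' = add W" "smult W' = smult W"
  shows "tensor_map K V' W' f g = tensor_map K V W f g"
  unfolding tensor_map_def tensor_space_struct_cong(2)[OF assms]
  by (rule lift_quot_struct_cong) (simp_all add: tensor_struct_cong[OF assms])

context
  fixes K :: "('k, 'm) ring_scheme" and V :: "('k, 'a, 'x) module_scheme" and W :: "('k, 'b, 'y) module_scheme"
  assumes V: "module K V" and W: "module K W"
begin

private lemma cK: "cring K" by (rule module_cring[OF V])

private lemma rels: "tensor_rels K V W \<subseteq> carrier (free_module K (carrier V \<times> carrier W))"
proof -
  let ?F = "free_module K (carrier V \<times> carrier W)"
  interpret V: module K V by (rule V)
  interpret W: module K W by (rule W)
  interpret F: module K ?F by (rule free_module_module[OF cK])
  show ?thesis unfolding tensor_rels_def Let_def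
    by (intro Un_least) (auto intro!: basis_elt_closed[OF cK] F.minus_closed)
qed

lemma tensor_module: "module K (tensor K V W)"
proof (rule module_cong)
  show "module K (tensor_space K V W)"
    unfolding tensor_space_def tensor_ideal_def by (rule free_quot_module[OF cK rels])
qed (simp_all add: tensor_simps)

lemma pure_tensor_closed: "v \<in> carrier V \<Longrightarrow> w \<in> carrier W \<Longrightarrow> pure_tensor K V W v w \<in> carrier (tensor K V W)"
  unfolding tensor_simps pure_tensor_def tensor_space_def tensor_ideal_def
  by (rule free_quot_closed[OF cK rels]) auto

lemma tensor_spans: "spans K (tensor K V W) {pure_tensor K V W v w |v w. v \<in> carrier V \<and> w \<in> carrier W}"
proof -
  have *: "(\<lambda>x. tensor_ideal K V W +>\<^bsub>free_module K (carrier V \<times> carrier W)\<^esub> basis_elt K x) ` (carrier V \<times> carrier W)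
    = {pure_tensor K V W v w |v w. v \<in> carrier V \<and> w \<in> carrier W}"
    by (auto simp: pure_tensor_def)
  have "spans K (tensor_space K V W) {pure_tensor K V W v w |v w. v \<in> carrier V \<and> w \<in> carrier W}"
    using free_quot_spans[OF cK rels] unfolding *[symmetric] tensor_space_def tensor_ideal_def .
  then show ?thesis
    using spans_struct_cong[of K "tensor_space K V W" "tensor K V W"] free_quot_module[OF cK rels]
    by (simp add: tensor_simps tensor_space_def tensor_ideal_def)
qed

lemma tensor_eqI:
  assumes "module K U" "linear_map K (tensor K V W) U f" "linear_map K (tensor K V W) U g"
    and "\<And>v w. v \<in> carrier V \<Longrightarrow> w \<in> carrier W \<Longrightarrow> f (pure_tensor K V W v w) = g (pure_tensor K V W v w)"
    and "x \<in> carrier (tensor K V W)"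
  shows "f x = g x"
  by (rule lin_eqI[OF tensor_spans tensor_module assms(1-3) _ assms(5)]) (use assms(4) in auto)

lemma pure_tensor_bilinear: "bilinear K V W (tensor K V W) (pure_tensor K V W)"
proof -
  let ?F = "free_module K (carrier V \<times> carrier W)"
  interpret V: module K V by (rule V)
  interpret W: module K W by (rule W)
  interpret F: module K ?F by (rule free_module_module[OF cK])
  interpret T: module K "tensor_space K V W"
    unfolding tensor_space_def tensor_ideal_def by (rule free_quot_module[OF cK rels])
  let ?p = "\<lambda>f. tensor_ideal K V W +>\<^bsub>?F\<^esub> f"
  have p: "linear_map K ?F (tensor_space K V W) ?p"
    unfolding tensor_space_def tensor_ideal_def by (rule free_quot_proj[OF cK rels])
  have eq: "?p a = ?p b" if "a \<ominus>\<^bsub>?F\<^esub> b \<in> tensor_rels K V W" "a \<in> carrier ?F" "b \<in> carrier ?F" for a b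
  proof -
    have "?p (a \<ominus>\<^bsub>?F\<^esub> b) = \<zero>\<^bsub>tensor_space K V W\<^esub>"
      unfolding tensor_space_def tensor_ideal_def by (rule free_quot_rel[OF cK rels that(1)])
    then show ?thesis
      using lin_minus[OF p F.module_axioms T.module_axioms that(2,3)] lin_closed[OF p] that
      by (simp add: T.minus_eq_zero_iff)
  qed
  note b = basis_elt_closed[OF cK]
  have P: "pure_tensor K V W = (\<lambda>v w. ?p (basis_elt K (v, w)))" by (simp add: pure_tensor_def fun_eq_iff)
  show ?thesis
  proof (rule bilinearI; rule linear_mapI)
    fix v x assume "v \<in> carrier V" "x \<in> carrier W"
    then show "pure_tensor K V W v x \<in> carrier (tensor K V W)" by (rule pure_tensor_closed)
  next
    fix v x y assume *: "v \<in> carrier V" "x \<in> carrier W" "y \<in> carrier W"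
    have "?p (basis_elt K (v, x \<oplus>\<^bsub>W\<^esub> y)) = ?p (basis_elt K (v, x) \<oplus>\<^bsub>?F\<^esub> basis_elt K (v, y))"
      proof (rule eq, goal_cases)
      case 1
      show ?case unfolding tensor_rels_def Let_def by (rule UnI1, rule UnI1, rule UnI2, rule CollectI) (use * in fast)
    qed (use * in \<open>simp_all add: b\<close>)
    then show "pure_tensor K V W v (x \<oplus>\<^bsub>W\<^esub> y) = pure_tensor K V W v x \<oplus>\<^bsub>tensor K V W\<^esub> pure_tensor K V W v y"
      using * by (simp add: P tensor_simps lin_add[OF p] b)
  next
    fix v c x assume *: "v \<in> carrier V" "c \<in> carrier K" "x \<in> carrier W"
    have "?p (basis_elt K (v, c \<odot>\<^bsub>W\<^esub> x)) = ?p (c \<odot>\<^bsub>?F\<^esub> basis_elt K (v, x))"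
      proof (rule eq, goal_cases)
      case 1
      show ?case unfolding tensor_rels_def Let_def by (rule UnI2, rule CollectI) (use * in fast)
    qed (use * in \<open>simp_all add: b\<close>)
    then show "pure_tensor K V W v (c \<odot>\<^bsub>W\<^esub> x) = c \<odot>\<^bsub>tensor K V W\<^esub> pure_tensor K V W v x"
      using * by (simp add: P tensor_simps lin_smult[OF p] b)
  next
    fix w x assume "w \<in> carrier W" "x \<in> carrier V"
    then show "pure_tensor K V W x w \<in> carrier (tensor K V W)" by (intro pure_tensor_closed)
  next
    fix w x y assume *: "w \<in> carrier W" "x \<in> carrier V" "y \<in> carrier V"
    have "?p (basis_elt K (x \<oplus>\<^bsub>V\<^esub> y, w)) = ?p (basis_elt K (x, w) \<oplus>\<^bsub>?F\<^esub> basis_elt K (y, w))"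
      proof (rule eq, goal_cases)
      case 1
      show ?case unfolding tensor_rels_def Let_def by (rule UnI1, rule UnI1, rule UnI1, rule CollectI) (use * in fast)
    qed (use * in \<open>simp_all add: b\<close>)
    then show "pure_tensor K V W (x \<oplus>\<^bsub>V\<^esub> y) w = pure_tensor K V W x w \<oplus>\<^bsub>tensor K V W\<^esub> pure_tensor K V W y w"
      using * by (simp add: P tensor_simps lin_add[OF p] b)
  next
    fix w c x assume *: "w \<in> carrier W" "c \<in> carrier K" "x \<in> carrier V"
    have "?p (basis_elt K (c \<odot>\<^bsub>V\<^esub> x, w)) = ?p (c \<odot>\<^bsub>?F\<^esub> basis_elt K (x, w))"
      proof (rule eq, goal_cases)
      case 1
      show ?case unfolding tensor_rels_def Let_def by (rule UnI1, rule UnI2, rule CollectI) (use * in fast)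
    qed (use * in \<open>simp_all add: b\<close>)
    then show "pure_tensor K V W (c \<odot>\<^bsub>V\<^esub> x) w = c \<odot>\<^bsub>tensor K V W\<^esub> pure_tensor K V W x w"
      using * by (simp add: P tensor_simps lin_smult[OF p] b)
  qed
qed

lemma tensor_lift:
  assumes U: "module K U" and \<beta>: "bilinear K V W U (\<lambda>v w. \<beta> (v, w))"
  shows "linear_map K (tensor K V W) U (lift_quot K U \<beta>)"
    and "v \<in> carrier V \<Longrightarrow> w \<in> carrier W \<Longrightarrow> lift_quot K U \<beta> (pure_tensor K V W v w) = \<beta> (v, w)"
proof -
  let ?F = "free_module K (carrier V \<times> carrier W)"
  interpret V: module K V by (rule V)
  interpret W: module K W by (rule W)
  interpret U: module K U by (rule U)
  interpret F: module K ?F by (rule free_module_module[OF cK])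
  have cl: "\<beta> x \<in> carrier U" if "x \<in> carrier V \<times> carrier W" for x
    using that bilin_closed[OF \<beta>] by (cases x) auto
  have L: "linear_map K ?F U (lin_ext K U \<beta>)" by (rule lin_ext_linear[OF U cl])
  note Lm = lin_minus[OF L F.module_axioms U]
  have Lb: "lin_ext K U \<beta> (basis_elt K (v, w)) = \<beta> (v, w)" if "v \<in> carrier V" "w \<in> carrier W" for v w
    by (rule lin_ext_basis_elt[OF U _ cl]) (use that in auto)
  note b = basis_elt_closed[OF cK]
  have z: "lin_ext K U \<beta> f = \<zero>\<^bsub>U\<^esub>" if f: "f \<in> tensor_rels K V W" for f
    using f unfolding tensor_rels_def Let_def
    apply (elim UnE CollectE exE conjE)
    subgoal for v v' w
      using lin_add[OF bilin_left[OF \<beta>, of w], of v v'] bilin_closed[OF \<beta>]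
      by (simp add: Lm b Lb lin_add[OF L] U.minus_eq_zero_iff)
    subgoal for v w w'
      using lin_add[OF bilin_right[OF \<beta>, of v], of w w'] bilin_closed[OF \<beta>]
      by (simp add: Lm b Lb lin_add[OF L] U.minus_eq_zero_iff)
    subgoal for c v w
      using lin_smult[OF bilin_left[OF \<beta>, of w], of c v] bilin_closed[OF \<beta>]
      by (simp add: Lm b Lb lin_smult[OF L] U.minus_eq_zero_iff)
    subgoal for c v w
      using lin_smult[OF bilin_right[OF \<beta>, of v], of c w] bilin_closed[OF \<beta>]
      by (simp add: Lm b Lb lin_smult[OF L] U.minus_eq_zero_iff)
    done
  note fq = free_quot_lift[OF cK rels U cl z]
  show "linear_map K (tensor K V W) U (lift_quot K U \<beta>)"
    using fq(1) unfolding tensor_space_def[symmetric] tensor_ideal_def[symmetric]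
    by (subst lin_struct_cong[of _ "tensor_space K V W" U U]) (simp_all add: tensor_simps)
  show "v \<in> carrier V \<Longrightarrow> w \<in> carrier W \<Longrightarrow> lift_quot K U \<beta> (pure_tensor K V W v w) = \<beta> (v, w)"
    using fq(2)[of "(v, w)"] by (simp add: pure_tensor_def tensor_ideal_def)
qed

end

lemma tensor_map_linear:
  assumes "module K V" "module K W" "module K V'" "module K W'" "linear_map K V V' f" "linear_map K W W' g"
  shows "linear_map K (tensor K V W) (tensor K V' W') (tensor_map K V' W' f g)"
    and "v \<in> carrier V \<Longrightarrow> w \<in> carrier W \<Longrightarrow>
      tensor_map K V' W' f g (pure_tensor K V W v w) = pure_tensor K V' W' (f v) (g w)"
proof -
  have b: "bilinear K V W (tensor K V' W') (\<lambda>v w. case (v, w) of (v, w) \<Rightarrow> pure_tensor K V' W' (f v) (g w))"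
    using bilin_comp[OF pure_tensor_bilinear[OF assms(3,4)] assms(5,6) lin_id] by simp
  show "linear_map K (tensor K V W) (tensor K V' W') (tensor_map K V' W' f g)"
    unfolding tensor_map_def by (rule tensor_lift(1)[OF assms(1,2) tensor_module[OF assms(3,4)] b])
  show "v \<in> carrier V \<Longrightarrow> w \<in> carrier W \<Longrightarrow>
      tensor_map K V' W' f g (pure_tensor K V W v w) = pure_tensor K V' W' (f v) (g w)"
    unfolding tensor_map_def using tensor_lift(2)[OF assms(1,2) tensor_module[OF assms(3,4)] b] by simp
qed

lemma tensor_map_comp:
  assumes "module K V" "module K W" "module K V'" "module K W'" "module K V''" "module K W''"
    and "linear_map K V V' f" "linear_map K W W' g" "linear_map K V' V'' f'" "linear_map K W' W'' g'"
    and "x \<in> carrier (tensor K V W)"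
  shows "tensor_map K V'' W'' f' g' (tensor_map K V' W' f g x) = tensor_map K V'' W'' (\<lambda>v. f' (f v)) (\<lambda>w. g' (g w)) x"
  by (rule tensor_eqI[OF assms(1,2) tensor_module[OF assms(5,6)]
        lin_comp[OF tensor_map_linear(1)[OF assms(1-4,7,8)] tensor_map_linear(1)[OF assms(3-6,9,10)]]
        tensor_map_linear(1)[OF assms(1,2,5,6) lin_comp[OF assms(7,9)] lin_comp[OF assms(8,10)]] _ assms(11)])
    (simp add: tensor_map_linear(2)[OF assms(1-4,7,8)] tensor_map_linear(2)[OF assms(3-6,9,10)]
      tensor_map_linear(2)[OF assms(1,2,5,6) lin_comp[OF assms(7,9)] lin_comp[OF assms(8,10)]]
      lin_closed[OF assms(7)] lin_closed[OF assms(8)])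

lemma tensor_map_eq_id:
  assumes "module K V" "module K W" "\<And>v. v \<in> carrier V \<Longrightarrow> f v = v" "\<And>w. w \<in> carrier W \<Longrightarrow> g w = w"
    and "x \<in> carrier (tensor K V W)"
  shows "tensor_map K V W f g x = x"
proof -
  have f: "linear_map K V V f" by (rule lin_congI[OF lin_id assms(1,3)])
  have g: "linear_map K W W g" by (rule lin_congI[OF lin_id assms(2,4)])
  show ?thesis
    by (rule tensor_eqI[where g="\<lambda>x. x", OF assms(1,2) tensor_module[OF assms(1,2)]
          tensor_map_linear(1)[OF assms(1,2,1,2) f g] lin_id _ assms(5)])
      (simp add: tensor_map_linear(2)[OF assms(1,2,1,2) f g] assms)
qed

lemma tensor_map_cong:
  assumes "module K V" "module K W" "module K V'" "module K W'" "linear_map K V V' f" "linear_map K W W' g"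
    and "\<And>v. v \<in> carrier V \<Longrightarrow> f v = f' v" "\<And>w. w \<in> carrier W \<Longrightarrow> g w = g' w"
    and "x \<in> carrier (tensor K V W)"
  shows "tensor_map K V' W' f g x = tensor_map K V' W' f' g' x"
proof -
  have f: "linear_map K V V' f'" by (rule lin_congI[OF assms(5,1)]) (simp add: assms(7))
  have g: "linear_map K W W' g'" by (rule lin_congI[OF assms(6,2)]) (simp add: assms(8))
  show ?thesis
    by (rule tensor_eqI[OF assms(1,2) tensor_module[OF assms(3,4)]
          tensor_map_linear(1)[OF assms(1-6)] tensor_map_linear(1)[OF assms(1-4) f g] _ assms(9)])
      (simp add: tensor_map_linear(2)[OF assms(1-6)] tensor_map_linear(2)[OF assms(1-4) f g] assms(7,8))
qed

lemma tensor_assoc_linear: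
  assumes "module K C"
  defines "CC \<equiv> tensor K C C"
  shows "linear_map K (tensor K CC C) (tensor K C CC) (tensor_assoc K C)"
    and "a \<in> carrier C \<Longrightarrow> b \<in> carrier C \<Longrightarrow> c \<in> carrier C \<Longrightarrow>
      tensor_assoc K C (pure_tensor K CC C (pure_tensor K C C a b) c) = pure_tensor K C CC a (pure_tensor K C C b c)"
proof -
  note C = assms(1)
  have CC: "module K CC" unfolding CC_def by (rule tensor_module[OF C C])
  have T: "module K (tensor K C CC)" by (rule tensor_module[OF C CC])
  note p = pure_tensor_bilinear[OF C CC] and q = pure_tensor_bilinear[OF C C, folded CC_def]
  let ?G = "\<lambda>c. lift_quot K (tensor K C CC) (\<lambda>(a, b). pure_tensor K C CC a (pure_tensor K C C b c))"
  have G: "bilinear K C C (tensor K C CC) (\<lambda>a b. case (a, b) of (a, b) \<Rightarrow> pure_tensor K C CC a (pure_tensor K C C b c))"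
    if "c \<in> carrier C" for c
    using bilin_comp[OF p lin_id bilin_left[OF q that] lin_id] by simp
  note GL = tensor_lift(1)[OF C C T G, folded CC_def] and GP = tensor_lift(2)[OF C C T G, folded CC_def]
  \<comment> \<open>The inner lift is a map out of a quotient that depends on the parameter
    \<open>c\<close>; its linearity in \<open>c\<close> is visible on pure tensors.\<close>
  have "bilinear K C CC (tensor K C CC) ?G"
  proof (rule bilin_from_span[OF C CC T tensor_spans[OF C C, folded CC_def] GL])
    fix s assume "s \<in> {pure_tensor K C C v w |v w. v \<in> carrier C \<and> w \<in> carrier C}"
    then obtain a b where s: "s = pure_tensor K C C a b" "a \<in> carrier C" "b \<in> carrier C" by auto
    have "linear_map K C (tensor K C CC) (\<lambda>c. pure_tensor K C CC a (pure_tensor K C C b c))"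
      by (rule lin_comp[OF bilin_right[OF q] bilin_right[OF p]]) (use s in auto)
    then show "linear_map K C (tensor K C CC) (\<lambda>c. ?G c s)"
      using lin_cong[where W="tensor K C CC", OF C, of "\<lambda>c. ?G c s" "\<lambda>c. pure_tensor K C CC a (pure_tensor K C C b c)"] s GP by simp
  qed
  then have G2: "bilinear K CC C (tensor K C CC) (\<lambda>X c. case (X, c) of (X, c) \<Rightarrow> ?G c X)"
    by (simp add: bilinear_def)
  have ta: "tensor_assoc K C = lift_quot K (tensor K C CC) (\<lambda>(X, c). ?G c X)"
    by (simp add: tensor_assoc_def CC_def Let_def)
  show "linear_map K (tensor K CC C) (tensor K C CC) (tensor_assoc K C)"
    unfolding ta by (rule tensor_lift(1)[OF CC C T G2])
  assume abc: "a \<in> carrier C" "b \<in> carrier C" "c \<in> carrier C"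
  have "pure_tensor K C C a b \<in> carrier CC" unfolding CC_def using pure_tensor_closed[OF C C] abc by blast
  then show "tensor_assoc K C (pure_tensor K CC C (pure_tensor K C C a b) c) = pure_tensor K C CC a (pure_tensor K C C b c)"
    unfolding ta using tensor_lift(2)[OF CC C T G2, of "pure_tensor K C C a b" c] abc GP by simp
qed

section \<open>Algebras\<close>

lemma assoc_algebra_bilinear:
  assumes "assoc_algebra K A" shows "bilinear K A A A (mult A)"
proof -
  interpret ring A using assms by (simp add: assoc_algebra_def)
  show ?thesis using assms
    by (auto simp: assoc_algebra_def l_distr r_distr intro!: bilinearI linear_mapI)
qed

lemma assoc_algebraD:
  assumes "assoc_algebra K A" shows "module K A" "ring A" "monoid A" "\<one>\<^bsub>A\<^esub> \<in> carrier A"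
    "\<And>x y. x \<in> carrier A \<Longrightarrow> y \<in> carrier A \<Longrightarrow> x \<otimes>\<^bsub>A\<^esub> y \<in> carrier A"
proof -
  show "module K A" and r: "ring A" using assms unfolding assoc_algebra_def by blast+
  interpret ring A by (rule r)
  show "monoid A" "\<one>\<^bsub>A\<^esub> \<in> carrier A"
    "\<And>x y. x \<in> carrier A \<Longrightarrow> y \<in> carrier A \<Longrightarrow> x \<otimes>\<^bsub>A\<^esub> y \<in> carrier A"
    by (unfold_locales) auto
qed

text \<open>Associativity is trilinear, so it spreads from \<open>S\<close> to the whole carrier one
  argument at a time, beginning with the last one.\<close>

lemma assoc_algebraI:
  assumes A: "module K A" and m: "bilinear K A A A (mult A)" and one: "\<one>\<^bsub>A\<^esub> \<in> carrier A" and sp: "spans K A S"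
    and assoc: "\<And>x y z. x \<in> S \<Longrightarrow> y \<in> S \<Longrightarrow> z \<in> S \<Longrightarrow> (x \<otimes>\<^bsub>A\<^esub> y) \<otimes>\<^bsub>A\<^esub> z = x \<otimes>\<^bsub>A\<^esub> (y \<otimes>\<^bsub>A\<^esub> z)"
    and unit: "\<And>x. x \<in> S \<Longrightarrow> \<one>\<^bsub>A\<^esub> \<otimes>\<^bsub>A\<^esub> x = x" "\<And>x. x \<in> S \<Longrightarrow> x \<otimes>\<^bsub>A\<^esub> \<one>\<^bsub>A\<^esub> = x"
  shows "assoc_algebra K A"
proof -
  interpret A: module K A by (rule A)
  note ml = bilin_left[OF m] and mr = bilin_right[OF m] and cl = bilin_closed[OF m]
  have S: "x \<in> S \<Longrightarrow> x \<in> carrier A" for x using sp by (auto simp: spans_def)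
  have a1: "(x \<otimes>\<^bsub>A\<^esub> y) \<otimes>\<^bsub>A\<^esub> z = x \<otimes>\<^bsub>A\<^esub> (y \<otimes>\<^bsub>A\<^esub> z)" if "x \<in> S" "y \<in> S" "z \<in> carrier A" for x y z
    by (rule lin_eqI[OF sp A A mr lin_comp[OF mr mr] _ that(3)]) (use that S cl assoc in auto)
  have a2: "(x \<otimes>\<^bsub>A\<^esub> y) \<otimes>\<^bsub>A\<^esub> z = x \<otimes>\<^bsub>A\<^esub> (y \<otimes>\<^bsub>A\<^esub> z)" if "x \<in> S" "y \<in> carrier A" "z \<in> carrier A" for x y z
    by (rule lin_eqI[where f="\<lambda>y. (x \<otimes>\<^bsub>A\<^esub> y) \<otimes>\<^bsub>A\<^esub> z", OF sp A A lin_comp[OF mr ml] lin_comp[OF ml mr] _ that(2)]) (use that S cl a1 in auto)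
  have a3: "(x \<otimes>\<^bsub>A\<^esub> y) \<otimes>\<^bsub>A\<^esub> z = x \<otimes>\<^bsub>A\<^esub> (y \<otimes>\<^bsub>A\<^esub> z)" if "x \<in> carrier A" "y \<in> carrier A" "z \<in> carrier A" for x y z
    by (rule lin_eqI[where f="\<lambda>x. (x \<otimes>\<^bsub>A\<^esub> y) \<otimes>\<^bsub>A\<^esub> z", OF sp A A lin_comp[OF ml ml] ml _ that(1)]) (use that S cl a2 in auto)
  have u1: "\<one>\<^bsub>A\<^esub> \<otimes>\<^bsub>A\<^esub> x = x" if "x \<in> carrier A" for x
    by (rule lin_eqI[OF sp A A mr lin_id _ that]) (use one unit in auto)
  have u2: "x \<otimes>\<^bsub>A\<^esub> \<one>\<^bsub>A\<^esub> = x" if "x \<in> carrier A" for x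
    by (rule lin_eqI[where f="\<lambda>x. x \<otimes>\<^bsub>A\<^esub> \<one>\<^bsub>A\<^esub>", OF sp A A ml lin_id _ that]) (use one unit in auto)
  have "ring A"
    by (intro ringI module_abelian_group[OF A] monoidI a3 u1 u2 cl one lin_add[OF ml] lin_add[OF mr])
  then show ?thesis
    using A lin_smult[OF ml] lin_smult[OF mr] by (auto simp: assoc_algebra_def)
qed

lemma spans_carrier: "spans K V (carrier V)"
  by (simp add: spans_def)

section \<open>The product on a tensor product\<close>

context
  fixes K :: "('k, 'm) ring_scheme" and A :: "('k, 'a, 'x) module_scheme" and B :: "('k, 'b, 'y) module_scheme"
  assumes A: "module K A" and B: "module K B"
    and mA: "bilinear K A A A (mult A)" and mB: "bilinear K B B B (mult B)"
begin

private abbreviation (input) "T \<equiv> tensor K A B"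

text \<open>Bilinearity of the two products is all that enters, so the lemma is available for the
  product on \<open>T(V)\<close> before that product is known to be associative. The defining double
  lift is opened from the inside: the inner lift is bilinear in each of the parameters
  \<open>a\<close> and \<open>b\<close>, then the outer one in its tensor argument.\<close>

lemma tensor_mult_bilinear_pure:
  shows "bilinear K T T T (mult T)"
    and "a \<in> carrier A \<Longrightarrow> b \<in> carrier B \<Longrightarrow> a' \<in> carrier A \<Longrightarrow> b' \<in> carrier B \<Longrightarrow>
      pure_tensor K A B a b \<otimes>\<^bsub>T\<^esub> pure_tensor K A B a' b' = pure_tensor K A B (a \<otimes>\<^bsub>A\<^esub> a') (b \<otimes>\<^bsub>B\<^esub> b')"
proof -
  let ?p = "pure_tensor K A B"
  have T: "module K T" by (rule tensor_module[OF A B])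
  note p = pure_tensor_bilinear[OF A B] and sp = tensor_spans[OF A B]
  let ?I = "\<lambda>a b. lift_quot K T (\<lambda>(a', b'). ?p (a \<otimes>\<^bsub>A\<^esub> a') (b \<otimes>\<^bsub>B\<^esub> b'))"
  have I: "bilinear K A B T (\<lambda>a' b'. case (a', b') of (a', b') \<Rightarrow> ?p (a \<otimes>\<^bsub>A\<^esub> a') (b \<otimes>\<^bsub>B\<^esub> b'))"
    if "a \<in> carrier A" "b \<in> carrier B" for a b
    using bilin_comp[OF p bilin_right[OF mA that(1)] bilin_right[OF mB that(2)] lin_id] by simp
  note IL = tensor_lift(1)[OF A B T I] and IP = tensor_lift(2)[OF A B T I]
  have I2: "bilinear K A T T (\<lambda>a. ?I a b)" if b: "b \<in> carrier B" for b
  proof (rule bilin_from_span[OF A T T sp])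
    fix s assume "s \<in> {?p v w |v w. v \<in> carrier A \<and> w \<in> carrier B}"
    then obtain a' b' where s: "s = ?p a' b'" "a' \<in> carrier A" "b' \<in> carrier B" by auto
    have "linear_map K A T (\<lambda>a. ?p (a \<otimes>\<^bsub>A\<^esub> a') (b \<otimes>\<^bsub>B\<^esub> b'))"
      using lin_comp[OF bilin_left[OF mA s(2)] bilin_left[OF p bilin_closed[OF mB b s(3)]]] .
    then show "linear_map K A T (\<lambda>a. ?I a b s)"
      using lin_cong[where W=T, OF A, of "\<lambda>a. ?I a b s" "\<lambda>a. ?p (a \<otimes>\<^bsub>A\<^esub> a') (b \<otimes>\<^bsub>B\<^esub> b')"] s IP b by simp
  qed (use IL b in auto)
  have I3: "bilinear K B T T (\<lambda>b. ?I a b)" if a: "a \<in> carrier A" for a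
  proof (rule bilin_from_span[OF B T T sp])
    fix s assume "s \<in> {?p v w |v w. v \<in> carrier A \<and> w \<in> carrier B}"
    then obtain a' b' where s: "s = ?p a' b'" "a' \<in> carrier A" "b' \<in> carrier B" by auto
    have "linear_map K B T (\<lambda>b. ?p (a \<otimes>\<^bsub>A\<^esub> a') (b \<otimes>\<^bsub>B\<^esub> b'))"
      using lin_comp[OF bilin_left[OF mB s(3)] bilin_right[OF p bilin_closed[OF mA a s(2)]]] .
    then show "linear_map K B T (\<lambda>b. ?I a b s)"
      using lin_cong[where W=T, OF B, of "\<lambda>b. ?I a b s" "\<lambda>b. ?p (a \<otimes>\<^bsub>A\<^esub> a') (b \<otimes>\<^bsub>B\<^esub> b')"] s IP a by simp
  qed (use IL a in auto)
  let ?M = "\<lambda>Y. lift_quot K T (\<lambda>(a, b). ?I a b Y)"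
  have M: "bilinear K A B T (\<lambda>a b. case (a, b) of (a, b) \<Rightarrow> ?I a b Y)" if "Y \<in> carrier T" for Y
    using bilin_left[OF I2 that] bilin_left[OF I3 that] by (simp add: bilinear_def)
  note Mlin = tensor_lift(1)[OF A B T M] and MP = tensor_lift(2)[OF A B T M]
  have "bilinear K T T T (\<lambda>Y X. ?M Y X)"
  proof (rule bilin_from_span[OF T T T sp])
    fix s assume "s \<in> {?p v w |v w. v \<in> carrier A \<and> w \<in> carrier B}"
    then obtain a b where s: "s = ?p a b" "a \<in> carrier A" "b \<in> carrier B" by auto
    show "linear_map K T T (\<lambda>Y. ?M Y s)"
      using lin_cong[where W=T, OF T, of "\<lambda>Y. ?M Y s" "\<lambda>Y. ?I a b Y"] s MP IL by simp
  qed (use Mlin in auto)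
  moreover have mult: "mult T = (\<lambda>X Y. ?M Y X)"
  proof -
    have L: "lift_quot K (tensor_space K A B) b = lift_quot K T b" for b :: "'a \<times> 'b \<Rightarrow> _"
      by (rule lift_quot_struct_cong) (simp_all add: tensor_simps)
    have "mult T = (\<lambda>X Y. lift_quot K (tensor_space K A B) (\<lambda>(a, b).
            lift_quot K (tensor_space K A B) (\<lambda>(a', b'). ?p (a \<otimes>\<^bsub>A\<^esub> a') (b \<otimes>\<^bsub>B\<^esub> b')) Y) X)"
      by (simp add: tensor_def)
    then show ?thesis by (simp only: L)
  qed
  ultimately show "bilinear K T T T (mult T)" by (simp add: bilinear_def)
  assume "a \<in> carrier A" "b \<in> carrier B" "a' \<in> carrier A" "b' \<in> carrier B"
  then show "?p a b \<otimes>\<^bsub>T\<^esub> ?p a' b' = ?p (a \<otimes>\<^bsub>A\<^esub> a') (b \<otimes>\<^bsub>B\<^esub> b')"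
    using MP[of "?p a' b'" a b] IP[of a b a' b'] pure_tensor_closed[OF A B] by (simp add: mult)
qed

end

lemma tensor_assoc_algebra:
  assumes A: "assoc_algebra K A" and B: "assoc_algebra K B"
  shows "assoc_algebra K (tensor K A B)"
proof -
  note mA = assoc_algebraD(1)[OF A] and mB = assoc_algebraD(1)[OF B]
  interpret A: monoid A by (rule assoc_algebraD[OF A])
  interpret B: monoid B by (rule assoc_algebraD[OF B])
  note bl = assoc_algebra_bilinear[OF A] assoc_algebra_bilinear[OF B]
  note pure = tensor_mult_bilinear_pure(2)[OF mA mB bl]
  show ?thesis
  proof (rule assoc_algebraI[OF tensor_module[OF mA mB] tensor_mult_bilinear_pure(1)[OF mA mB bl] _ tensor_spans[OF mA mB]])
    show "\<one>\<^bsub>tensor K A B\<^esub> \<in> carrier (tensor K A B)"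
      unfolding tensor_simps(5) by (rule pure_tensor_closed[OF mA mB]) auto
  qed (auto simp: tensor_simps(5) pure A.m_assoc B.m_assoc)
qed

lemma tensor_map_mult:
  assumes A: "assoc_algebra K A" and B: "assoc_algebra K B" and A': "assoc_algebra K A'" and B': "assoc_algebra K B'"
    and f: "linear_map K A A' f" and g: "linear_map K B B' g"
    and fm: "\<And>x y. x \<in> carrier A \<Longrightarrow> y \<in> carrier A \<Longrightarrow> f (x \<otimes>\<^bsub>A\<^esub> y) = f x \<otimes>\<^bsub>A'\<^esub> f y"
    and gm: "\<And>x y. x \<in> carrier B \<Longrightarrow> y \<in> carrier B \<Longrightarrow> g (x \<otimes>\<^bsub>B\<^esub> y) = g x \<otimes>\<^bsub>B'\<^esub> g y"
    and X: "X \<in> carrier (tensor K A B)" and Y: "Y \<in> carrier (tensor K A B)"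
  shows "tensor_map K A' B' f g (X \<otimes>\<^bsub>tensor K A B\<^esub> Y) =
    tensor_map K A' B' f g X \<otimes>\<^bsub>tensor K A' B'\<^esub> tensor_map K A' B' f g Y"
proof -
  note m = assoc_algebraD(1)[OF A] assoc_algebraD(1)[OF B]
  note m' = assoc_algebraD(1)[OF A'] assoc_algebraD(1)[OF B']
  note bl = assoc_algebra_bilinear[OF A] assoc_algebra_bilinear[OF B]
  note bl' = assoc_algebra_bilinear[OF A'] assoc_algebra_bilinear[OF B']
  note tm = tensor_map_linear[OF m m' f g]
  show ?thesis
    by (rule bilin_eqI[where f="\<lambda>X Y. tensor_map K A' B' f g (X \<otimes>\<^bsub>tensor K A B\<^esub> Y)" and
      g="\<lambda>X Y. tensor_map K A' B' f g X \<otimes>\<^bsub>tensor K A' B'\<^esub> tensor_map K A' B' f g Y",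
      OF tensor_spans[OF m] tensor_spans[OF m] tensor_module[OF m] tensor_module[OF m] tensor_module[OF m']
      bilin_comp[OF tensor_mult_bilinear_pure(1)[OF m bl] lin_id lin_id tm(1)]
      bilin_comp[OF tensor_mult_bilinear_pure(1)[OF m' bl'] tm(1) tm(1) lin_id] _ X Y])
      (auto simp: tensor_mult_bilinear_pure(2)[OF m bl] tensor_mult_bilinear_pure(2)[OF m' bl'] tm(2) fm gm
        assoc_algebraD(5)[OF A] assoc_algebraD(5)[OF B] lin_closed[OF f] lin_closed[OF g])
qed

section \<open>Coassociativity and counitality on products\<close>

text \<open>Pointwise forms of the coalgebra axioms. The elements that satisfy them form a
  submodule, and this submodule is closed under suitable products, so the axioms can be proved by
  induction from generators.\<close>

definition "coassoc_at K A \<Delta> x \<longleftrightarrow>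
    tensor_assoc K A (tensor_map K (tensor K A A) A \<Delta> (\<lambda>y. y) (\<Delta> x)) = tensor_map K A (tensor K A A) (\<lambda>y. y) \<Delta> (\<Delta> x)"

definition "counit_at K A \<Delta> \<epsilon> x \<longleftrightarrow>
    lift_quot K A (\<lambda>(a, b). \<epsilon> a \<odot>\<^bsub>A\<^esub> b) (\<Delta> x) = x \<and> lift_quot K A (\<lambda>(a, b). \<epsilon> b \<odot>\<^bsub>A\<^esub> a) (\<Delta> x) = x"

lemma counit_maps:
  assumes A: "module K A" and e: "linear_map K A (scalar_module K) \<epsilon>"
  shows "linear_map K (tensor K A A) A (lift_quot K A (\<lambda>(a, b). \<epsilon> a \<odot>\<^bsub>A\<^esub> b))"
    and "a \<in> carrier A \<Longrightarrow> b \<in> carrier A \<Longrightarrow> lift_quot K A (\<lambda>(a, b). \<epsilon> a \<odot>\<^bsub>A\<^esub> b) (pure_tensor K A A a b) = \<epsilon> a \<odot>\<^bsub>A\<^esub> b"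
    and "linear_map K (tensor K A A) A (lift_quot K A (\<lambda>(a, b). \<epsilon> b \<odot>\<^bsub>A\<^esub> a))"
    and "a \<in> carrier A \<Longrightarrow> b \<in> carrier A \<Longrightarrow> lift_quot K A (\<lambda>(a, b). \<epsilon> b \<odot>\<^bsub>A\<^esub> a) (pure_tensor K A A a b) = \<epsilon> b \<odot>\<^bsub>A\<^esub> a"
proof -
  have ec: "\<epsilon> a \<in> carrier K" if "a \<in> carrier A" for a using lin_closed[OF e that] by simp
  have 1: "bilinear K A A A (\<lambda>a b. case (a, b) of (a, b) \<Rightarrow> \<epsilon> a \<odot>\<^bsub>A\<^esub> b)"
    using lin_smult_fun[OF lin_id A ec] lin_scale[OF A e] by (simp add: bilinear_def)
  have 2: "bilinear K A A A (\<lambda>a b. case (a, b) of (a, b) \<Rightarrow> \<epsilon> b \<odot>\<^bsub>A\<^esub> a)"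
    using lin_smult_fun[OF lin_id A ec] lin_scale[OF A e] by (simp add: bilinear_def)
  show "linear_map K (tensor K A A) A (lift_quot K A (\<lambda>(a, b). \<epsilon> a \<odot>\<^bsub>A\<^esub> b))" by (rule tensor_lift(1)[OF A A A 1])
  show "a \<in> carrier A \<Longrightarrow> b \<in> carrier A \<Longrightarrow> lift_quot K A (\<lambda>(a, b). \<epsilon> a \<odot>\<^bsub>A\<^esub> b) (pure_tensor K A A a b) = \<epsilon> a \<odot>\<^bsub>A\<^esub> b"
    using tensor_lift(2)[OF A A A 1] by simp
  show "linear_map K (tensor K A A) A (lift_quot K A (\<lambda>(a, b). \<epsilon> b \<odot>\<^bsub>A\<^esub> a))" by (rule tensor_lift(1)[OF A A A 2])
  show "a \<in> carrier A \<Longrightarrow> b \<in> carrier A \<Longrightarrow> lift_quot K A (\<lambda>(a, b). \<epsilon> b \<odot>\<^bsub>A\<^esub> a) (pure_tensor K A A a b) = \<epsilon> b \<odot>\<^bsub>A\<^esub> a"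
    using tensor_lift(2)[OF A A A 2] by simp
qed

section \<open>Coassociativity and counitality under the infinitesimal relation\<close>

locale linear_comult =
  fixes K :: "('k, 'm) ring_scheme" and A :: "('k, 'a, 'x) module_scheme" and \<Delta>
  assumes A: "module K A" and D: "linear_map K A (tensor K A A) \<Delta>"
begin

abbreviation "AA \<equiv> tensor K A A"
abbreviation "A3 \<equiv> tensor K A AA"
abbreviation "p \<equiv> pure_tensor K A A"

sublocale A: module K A by (rule A)
lemma AA: "module K AA" by (rule tensor_module[OF A A])
lemma A3: "module K A3" by (rule tensor_module[OF A AA])
sublocale AA: module K AA by (rule AA)
sublocale A3: module K A3 by (rule A3)

lemmas D_closed = lin_closed[OF D]
lemmas p_closed = pure_tensor_closed[OF A A]
lemmas p3_closed = pure_tensor_closed[OF A AA]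
lemmas p_bilin = pure_tensor_bilinear[OF A A]
lemmas p3_bilin = pure_tensor_bilinear[OF A AA]
lemmas eqI = tensor_eqI[OF A A]

text \<open>The two sides of coassociativity as linear maps from \<open>A \<otimes> A\<close> to
  \<open>A \<otimes> (A \<otimes> A)\<close>; coassociativity at \<open>x\<close> is the equation
  \<open>\<alpha> (\<Delta> x) = \<beta> (\<Delta> x)\<close>.\<close>

definition "\<alpha> X = tensor_assoc K A (tensor_map K AA A \<Delta> (\<lambda>y. y) X)"
definition "\<beta> X = tensor_map K A AA (\<lambda>y. y) \<Delta> X"

text \<open>\<open>\<rho> q\<close> is \<open>X \<mapsto> X \<otimes> q\<close> up to reassociation.\<close>

definition "\<rho> q = tensor_map K A AA (\<lambda>a. a) (\<lambda>b. p b q)"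

lemma \<rho>_lin: "q \<in> carrier A \<Longrightarrow> linear_map K AA A3 (\<rho> q)"
  unfolding \<rho>_def by (rule tensor_map_linear(1)[OF A A A AA lin_id bilin_left[OF p_bilin]])

lemma \<rho>_pure: "q \<in> carrier A \<Longrightarrow> a \<in> carrier A \<Longrightarrow> b \<in> carrier A \<Longrightarrow> \<rho> q (p a b) = pure_tensor K A AA a (p b q)"
  unfolding \<rho>_def by (rule tensor_map_linear(2)[OF A A A AA lin_id bilin_left[OF p_bilin]])

lemma assoc_pure:
  assumes "X \<in> carrier AA" "q \<in> carrier A"
  shows "tensor_assoc K A (pure_tensor K AA A X q) = \<rho> q X"
  by (rule eqI[OF A3 lin_comp[OF bilin_left[OF pure_tensor_bilinear[OF AA A] assms(2)] tensor_assoc_linear(1)[OF A]]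
      \<rho>_lin[OF assms(2)] _ assms(1)]) (simp add: tensor_assoc_linear(2)[OF A] \<rho>_pure assms(2))

lemma \<alpha>_lin: "linear_map K AA A3 \<alpha>"
  unfolding \<alpha>_def by (rule lin_comp[OF tensor_map_linear(1)[OF A A AA A D lin_id] tensor_assoc_linear(1)[OF A]])

lemma \<alpha>_pure: "a \<in> carrier A \<Longrightarrow> b \<in> carrier A \<Longrightarrow> \<alpha> (p a b) = \<rho> b (\<Delta> a)"
  unfolding \<alpha>_def by (simp add: tensor_map_linear(2)[OF A A AA A D lin_id] assoc_pure D_closed)

lemma \<beta>_lin: "linear_map K AA A3 \<beta>"
  unfolding \<beta>_def by (rule tensor_map_linear(1)[OF A A A AA lin_id D])

lemma \<beta>_pure: "a \<in> carrier A \<Longrightarrow> b \<in> carrier A \<Longrightarrow> \<beta> (p a b) = pure_tensor K A AA a (\<Delta> b)"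
  unfolding \<beta>_def by (rule tensor_map_linear(2)[OF A A A AA lin_id D])

lemma coassoc_at_iff: "coassoc_at K A \<Delta> x \<longleftrightarrow> \<alpha> (\<Delta> x) = \<beta> (\<Delta> x)"
  by (simp add: coassoc_at_def \<alpha>_def \<beta>_def)

lemma coassoc_at_submodule: "submodule {x \<in> carrier A. coassoc_at K A \<Delta> x} K A"
  unfolding coassoc_at_iff
  by (rule submoduleI'[OF A])
    (auto simp: lin_zero[OF D A AA] lin_zero[OF \<alpha>_lin AA A3] lin_zero[OF \<beta>_lin AA A3]
      lin_add[OF D] lin_smult[OF D] lin_add[OF \<alpha>_lin] lin_smult[OF \<alpha>_lin]
      lin_add[OF \<beta>_lin] lin_smult[OF \<beta>_lin] D_closed)

lemma counit_at_submodule: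
  assumes e: "linear_map K A (scalar_module K) \<epsilon>"
  shows "submodule {x \<in> carrier A. counit_at K A \<Delta> \<epsilon> x} K A"
proof -
  note c = counit_maps(1,3)[OF A e]
  show ?thesis unfolding counit_at_def
  by (rule submoduleI'[OF A])
    (auto simp: lin_zero[OF D A AA] lin_zero[OF c(1) AA A] lin_zero[OF c(2) AA A]
      lin_add[OF D] lin_smult[OF D] lin_add[OF c(1)] lin_smult[OF c(1)]
      lin_add[OF c(2)] lin_smult[OF c(2)] D_closed)
qed

end

text \<open>The infinitesimal relation in a form with neither a unit nor a subtraction:
  multiplication by \<open>x \<otimes> 1\<close> is written as left multiplication on the first
  tensor factor, multiplication by \<open>1 \<otimes> y\<close> as right multiplication on the
  second, and the correction term stands on the left.\<close>

locale infinitesimal_comult = linear_comult +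
  fixes m
  assumes m: "bilinear K A A A m"
    and m_assoc: "\<And>x y z. x \<in> carrier A \<Longrightarrow> y \<in> carrier A \<Longrightarrow> z \<in> carrier A \<Longrightarrow> m (m x y) z = m x (m y z)"
    and inf: "\<And>x y. x \<in> carrier A \<Longrightarrow> y \<in> carrier A \<Longrightarrow>
      \<Delta> (m x y) \<oplus>\<^bsub>tensor K A A\<^esub> pure_tensor K A A x y =
        tensor_map K A A (m x) (\<lambda>b. b) (\<Delta> y) \<oplus>\<^bsub>tensor K A A\<^esub> tensor_map K A A (\<lambda>a. a) (\<lambda>b. m b y) (\<Delta> x)"
begin

lemmas m_closed = bilin_closed[OF m]
lemmas mr = bilin_right[OF m]
lemmas ml = bilin_left[OF m]

definition "lm x = tensor_map K A A (m x) (\<lambda>b. b)"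
definition "rm y = tensor_map K A A (\<lambda>a. a) (\<lambda>b. m b y)"
definition "lm3 x = tensor_map K A AA (m x) (\<lambda>b. b)"
definition "rm3 y = tensor_map K A AA (\<lambda>a. a) (rm y)"
text \<open>On pure tensors, \<open>a \<otimes> b\<close> and \<open>c \<otimes> d\<close> are sent
  to \<open>a \<otimes> (m b c \<otimes> d)\<close>: the inner factors are multiplied.\<close>

definition "\<Theta> X Y = tensor_map K A AA (\<lambda>a. a) (\<lambda>b. lm b Y) X"

lemma lm_lin: "x \<in> carrier A \<Longrightarrow> linear_map K AA AA (lm x)"
  unfolding lm_def by (rule tensor_map_linear(1)[OF A A A A mr lin_id])
lemma lm_pure: "x \<in> carrier A \<Longrightarrow> a \<in> carrier A \<Longrightarrow> b \<in> carrier A \<Longrightarrow> lm x (p a b) = p (m x a) b"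
  unfolding lm_def by (rule tensor_map_linear(2)[OF A A A A mr lin_id])
lemma rm_lin: "x \<in> carrier A \<Longrightarrow> linear_map K AA AA (rm x)"
  unfolding rm_def by (rule tensor_map_linear(1)[OF A A A A lin_id ml])
lemma rm_pure: "x \<in> carrier A \<Longrightarrow> a \<in> carrier A \<Longrightarrow> b \<in> carrier A \<Longrightarrow> rm x (p a b) = p a (m b x)"
  unfolding rm_def by (rule tensor_map_linear(2)[OF A A A A lin_id ml])
lemma lm3_lin: "x \<in> carrier A \<Longrightarrow> linear_map K A3 A3 (lm3 x)"
  unfolding lm3_def by (rule tensor_map_linear(1)[OF A AA A AA mr lin_id])
lemma lm3_pure: "x \<in> carrier A \<Longrightarrow> a \<in> carrier A \<Longrightarrow> Y \<in> carrier AA \<Longrightarrow>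
    lm3 x (pure_tensor K A AA a Y) = pure_tensor K A AA (m x a) Y"
  unfolding lm3_def by (rule tensor_map_linear(2)[OF A AA A AA mr lin_id])
lemma rm3_lin: "x \<in> carrier A \<Longrightarrow> linear_map K A3 A3 (rm3 x)"
  unfolding rm3_def by (rule tensor_map_linear(1)[OF A AA A AA lin_id rm_lin])
lemma rm3_pure: "x \<in> carrier A \<Longrightarrow> a \<in> carrier A \<Longrightarrow> Y \<in> carrier AA \<Longrightarrow>
    rm3 x (pure_tensor K A AA a Y) = pure_tensor K A AA a (rm x Y)"
  unfolding rm3_def by (rule tensor_map_linear(2)[OF A AA A AA lin_id rm_lin])

lemma lm_bilin: "bilinear K A AA AA lm"
proof (rule bilin_from_span[OF A AA AA tensor_spans[OF A A] lm_lin])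
  fix s assume "s \<in> {p v w |v w. v \<in> carrier A \<and> w \<in> carrier A}"
  then obtain a b where s: "s = p a b" "a \<in> carrier A" "b \<in> carrier A" by auto
  show "linear_map K A AA (\<lambda>v. lm v s)"
    by (rule lin_congI[OF lin_comp[OF ml[OF s(2)] bilin_left[OF p_bilin s(3)]] A])
      (simp add: s lm_pure)
qed

lemma \<Theta>_lin: "Y \<in> carrier AA \<Longrightarrow> linear_map K AA A3 (\<lambda>X. \<Theta> X Y)"
  unfolding \<Theta>_def by (rule tensor_map_linear(1)[OF A A A AA lin_id bilin_left[OF lm_bilin]])

lemma \<Theta>_pure: "Y \<in> carrier AA \<Longrightarrow> a \<in> carrier A \<Longrightarrow> b \<in> carrier A \<Longrightarrow> \<Theta> (p a b) Y = pure_tensor K A AA a (lm b Y)"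
  unfolding \<Theta>_def by (rule tensor_map_linear(2)[OF A A A AA lin_id bilin_left[OF lm_bilin]])

lemma \<Theta>_bilin: "bilinear K AA AA A3 (\<lambda>Y X. \<Theta> X Y)"
proof (rule bilin_from_span[OF AA AA A3 tensor_spans[OF A A] \<Theta>_lin])
  fix s assume "s \<in> {p v w |v w. v \<in> carrier A \<and> w \<in> carrier A}"
  then obtain a b where s: "s = p a b" "a \<in> carrier A" "b \<in> carrier A" by auto
  show "linear_map K AA A3 (\<Theta> s)"
    by (rule lin_congI[OF lin_comp[OF lm_lin[OF s(3)] bilin_right[OF p3_bilin s(2)]] AA])
      (simp add: s \<Theta>_pure)
qed

text \<open>On \<open>c \<otimes> d\<close> the map \<open>\<alpha>\<close> expands
  \<open>\<Delta> (m x c)\<close> by the infinitesimal relation. Its two product terms give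
  \<open>lm3 x\<close> and \<open>\<Theta>\<close>, its correction term gives
  \<open>x \<otimes> Y\<close>. The mirror image is \<open>\<beta>_rm\<close>, while
  \<open>\<alpha>_rm\<close> and \<open>\<beta>_lm\<close> have no correction.\<close>

lemma \<alpha>_lm:
  assumes x: "x \<in> carrier A" and Y: "Y \<in> carrier AA"
  shows "\<alpha> (lm x Y) \<oplus>\<^bsub>A3\<^esub> pure_tensor K A AA x Y = lm3 x (\<alpha> Y) \<oplus>\<^bsub>A3\<^esub> \<Theta> (\<Delta> x) Y"
proof (rule eqI[where f="\<lambda>Y. \<alpha> (lm x Y) \<oplus>\<^bsub>A3\<^esub> pure_tensor K A AA x Y" and g="\<lambda>Y. lm3 x (\<alpha> Y) \<oplus>\<^bsub>A3\<^esub> \<Theta> (\<Delta> x) Y",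
    OF A3 lin_add_fun[OF lin_comp[OF lm_lin[OF x] \<alpha>_lin] bilin_right[OF p3_bilin x] A3]
      lin_add_fun[OF lin_comp[OF \<alpha>_lin lm3_lin[OF x]] bilin_left[OF \<Theta>_bilin D_closed[OF x]] A3] _ Y])
  fix c d assume cd: "c \<in> carrier A" "d \<in> carrier A"
  have 1: "\<rho> d (lm x X) = lm3 x (\<rho> d X)" if "X \<in> carrier AA" for X
    by (rule eqI[OF A3 lin_comp[OF lm_lin[OF x] \<rho>_lin[OF cd(2)]] lin_comp[OF \<rho>_lin[OF cd(2)] lm3_lin[OF x]] _ that])
      (simp add: lm_pure lm3_pure \<rho>_pure x cd m_closed p_closed)
  have 2: "\<rho> d (rm c X) = \<Theta> X (p c d)" if "X \<in> carrier AA" for X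
    by (rule eqI[OF A3 lin_comp[OF rm_lin[OF cd(1)] \<rho>_lin[OF cd(2)]] \<Theta>_lin[OF p_closed[OF cd]] _ that])
      (simp add: rm_pure \<Theta>_pure lm_pure \<rho>_pure x cd m_closed p_closed)
  have "\<alpha> (lm x (p c d)) \<oplus>\<^bsub>A3\<^esub> pure_tensor K A AA x (p c d) = \<rho> d (\<Delta> (m x c)) \<oplus>\<^bsub>A3\<^esub> \<rho> d (p x c)"
    using x cd by (simp add: lm_pure \<alpha>_pure m_closed \<rho>_pure)
  also have "\<dots> = \<rho> d (\<Delta> (m x c) \<oplus>\<^bsub>AA\<^esub> p x c)"
    using x cd by (simp add: lin_add[OF \<rho>_lin] m_closed D_closed p_closed)
  also have "\<dots> = \<rho> d (lm x (\<Delta> c) \<oplus>\<^bsub>AA\<^esub> rm c (\<Delta> x))"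
    using inf[OF x cd(1)] by (simp add: lm_def rm_def)
  also have "\<dots> = \<rho> d (lm x (\<Delta> c)) \<oplus>\<^bsub>A3\<^esub> \<rho> d (rm c (\<Delta> x))"
    using x cd by (simp add: lin_add[OF \<rho>_lin] lin_closed[OF lm_lin] lin_closed[OF rm_lin] D_closed)
  also have "\<dots> = lm3 x (\<alpha> (p c d)) \<oplus>\<^bsub>A3\<^esub> \<Theta> (\<Delta> x) (p c d)"
    using x cd by (simp add: 1 2 D_closed \<alpha>_pure)
  finally show "\<alpha> (lm x (p c d)) \<oplus>\<^bsub>A3\<^esub> pure_tensor K A AA x (p c d) = lm3 x (\<alpha> (p c d)) \<oplus>\<^bsub>A3\<^esub> \<Theta> (\<Delta> x) (p c d)" .
qed

lemma \<alpha>_rm: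
  assumes y: "y \<in> carrier A" and X: "X \<in> carrier AA"
  shows "\<alpha> (rm y X) = rm3 y (\<alpha> X)"
proof (rule eqI[OF A3 lin_comp[OF rm_lin[OF y] \<alpha>_lin] lin_comp[OF \<alpha>_lin rm3_lin[OF y]] _ X])
  fix c d assume cd: "c \<in> carrier A" "d \<in> carrier A"
  have "\<rho> (m d y) X = rm3 y (\<rho> d X)" if "X \<in> carrier AA" for X
    by (rule eqI[OF A3 \<rho>_lin[OF m_closed[OF cd(2) y]] lin_comp[OF \<rho>_lin[OF cd(2)] rm3_lin[OF y]] _ that])
      (simp add: rm_pure rm3_pure \<rho>_pure y cd m_closed p_closed)
  then show "\<alpha> (rm y (p c d)) = rm3 y (\<alpha> (p c d))"
    using y cd by (simp add: rm_pure \<alpha>_pure m_closed D_closed)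
qed

lemma \<beta>_lm:
  assumes x: "x \<in> carrier A" and Y: "Y \<in> carrier AA"
  shows "\<beta> (lm x Y) = lm3 x (\<beta> Y)"
  by (rule eqI[OF A3 lin_comp[OF lm_lin[OF x] \<beta>_lin] lin_comp[OF \<beta>_lin lm3_lin[OF x]] _ Y])
    (simp add: x lm_pure \<beta>_pure lm3_pure m_closed D_closed)

lemma \<beta>_rm:
  assumes y: "y \<in> carrier A" and X: "X \<in> carrier AA"
  shows "\<beta> (rm y X) \<oplus>\<^bsub>A3\<^esub> \<rho> y X = \<Theta> X (\<Delta> y) \<oplus>\<^bsub>A3\<^esub> rm3 y (\<beta> X)"
proof (rule eqI[where f="\<lambda>X. \<beta> (rm y X) \<oplus>\<^bsub>A3\<^esub> \<rho> y X" and g="\<lambda>X. \<Theta> X (\<Delta> y) \<oplus>\<^bsub>A3\<^esub> rm3 y (\<beta> X)",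
    OF A3 lin_add_fun[OF lin_comp[OF rm_lin[OF y] \<beta>_lin] \<rho>_lin[OF y] A3]
      lin_add_fun[OF \<Theta>_lin[OF D_closed[OF y]] lin_comp[OF \<beta>_lin rm3_lin[OF y]] A3] _ X])
  fix c d assume cd: "c \<in> carrier A" "d \<in> carrier A"
  note la = lin_add[OF bilin_right[OF p3_bilin cd(1)]]
  show "\<beta> (rm y (p c d)) \<oplus>\<^bsub>A3\<^esub> \<rho> y (p c d) = \<Theta> (p c d) (\<Delta> y) \<oplus>\<^bsub>A3\<^esub> rm3 y (\<beta> (p c d))"
    using y cd inf[OF cd(2) y]
    by (simp add: rm_pure \<beta>_pure \<rho>_pure m_closed D_closed \<Theta>_pure rm3_pure la[symmetric] p_closed
        lin_closed[OF lm_lin] lin_closed[OF rm_lin])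
      (simp add: lm_def rm_def)
qed

text \<open>Both sides of coassociativity at \<open>m x y\<close> equal \<open>x\<close> times the
  iterated coproduct of \<open>y\<close>, plus \<open>\<Theta> (\<Delta> x) (\<Delta> y)\<close>,
  plus the iterated coproduct of \<open>x\<close> times \<open>y\<close>, minus
  \<open>\<Delta> x \<otimes> y\<close> and \<open>x \<otimes> \<Delta> y\<close>. The subtracted
  terms are added on both sides and cancelled at the end.\<close>

lemma coassoc_at_dot:
  assumes x: "x \<in> carrier A" and y: "y \<in> carrier A" and cx: "coassoc_at K A \<Delta> x" and cy: "coassoc_at K A \<Delta> y"
  shows "coassoc_at K A \<Delta> (m x y)"
proof -
  note cl = x y m_closed D_closed p_closed p3_closed lin_closed[OF \<alpha>_lin] lin_closed[OF \<beta>_lin]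
    lin_closed[OF \<rho>_lin] lin_closed[OF lm_lin] lin_closed[OF rm_lin]
    lin_closed[OF lm3_lin] lin_closed[OF rm3_lin] lin_closed[OF \<Theta>_lin]
  have i: "\<Delta> (m x y) \<oplus>\<^bsub>AA\<^esub> p x y = lm x (\<Delta> y) \<oplus>\<^bsub>AA\<^esub> rm y (\<Delta> x)"
    using inf[OF x y] by (simp add: lm_def rm_def)
  have a: "\<alpha> (\<Delta> (m x y)) \<oplus>\<^bsub>A3\<^esub> \<rho> y (\<Delta> x) = \<alpha> (lm x (\<Delta> y)) \<oplus>\<^bsub>A3\<^esub> rm3 y (\<alpha> (\<Delta> x))"
    using arg_cong[OF i, of \<alpha>] by (simp add: lin_add[OF \<alpha>_lin] cl \<alpha>_pure \<alpha>_rm)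
  have b: "\<beta> (\<Delta> (m x y)) \<oplus>\<^bsub>A3\<^esub> pure_tensor K A AA x (\<Delta> y) = lm3 x (\<beta> (\<Delta> y)) \<oplus>\<^bsub>A3\<^esub> \<beta> (rm y (\<Delta> x))"
    using arg_cong[OF i, of \<beta>] by (simp add: lin_add[OF \<beta>_lin] cl \<beta>_pure \<beta>_lm)
  have "\<alpha> (\<Delta> (m x y)) \<oplus>\<^bsub>A3\<^esub> (\<rho> y (\<Delta> x) \<oplus>\<^bsub>A3\<^esub> pure_tensor K A AA x (\<Delta> y))
     = (\<alpha> (lm x (\<Delta> y)) \<oplus>\<^bsub>A3\<^esub> pure_tensor K A AA x (\<Delta> y)) \<oplus>\<^bsub>A3\<^esub> rm3 y (\<alpha> (\<Delta> x))"
  proof -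
    have "\<alpha> (\<Delta> (m x y)) \<oplus>\<^bsub>A3\<^esub> (\<rho> y (\<Delta> x) \<oplus>\<^bsub>A3\<^esub> pure_tensor K A AA x (\<Delta> y))
      = (\<alpha> (lm x (\<Delta> y)) \<oplus>\<^bsub>A3\<^esub> rm3 y (\<alpha> (\<Delta> x))) \<oplus>\<^bsub>A3\<^esub> pure_tensor K A AA x (\<Delta> y)"
      using a by (simp add: cl A3.a_assoc[symmetric])
    then show ?thesis by (simp add: cl A3.a_ac)
  qed
  also have "\<dots> = lm3 x (\<beta> (\<Delta> y)) \<oplus>\<^bsub>A3\<^esub> (\<Theta> (\<Delta> x) (\<Delta> y) \<oplus>\<^bsub>A3\<^esub> rm3 y (\<beta> (\<Delta> x)))"
    using cx cy by (simp add: \<alpha>_lm cl coassoc_at_iff A3.a_assoc)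
  also have "\<dots> = lm3 x (\<beta> (\<Delta> y)) \<oplus>\<^bsub>A3\<^esub> (\<beta> (rm y (\<Delta> x)) \<oplus>\<^bsub>A3\<^esub> \<rho> y (\<Delta> x))"
    by (simp add: \<beta>_rm cl)
  also have "\<dots> = (\<beta> (\<Delta> (m x y)) \<oplus>\<^bsub>A3\<^esub> pure_tensor K A AA x (\<Delta> y)) \<oplus>\<^bsub>A3\<^esub> \<rho> y (\<Delta> x)"
    by (simp add: b cl A3.a_assoc)
  also have "\<dots> = \<beta> (\<Delta> (m x y)) \<oplus>\<^bsub>A3\<^esub> (\<rho> y (\<Delta> x) \<oplus>\<^bsub>A3\<^esub> pure_tensor K A AA x (\<Delta> y))"
    by (simp add: cl A3.a_ac)
  finally show ?thesis
    unfolding coassoc_at_iff by (simp add: cl)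
qed

text \<open>Under \<open>\<epsilon> \<otimes> id\<close> the correction term
  \<open>x \<otimes> y\<close> becomes \<open>\<epsilon> x \<odot> y\<close>, and so does the term
  with \<open>\<Delta> y\<close>, by the counit axiom at \<open>y\<close>. The two cancel and
  \<open>m x y\<close> remains; the other counit axiom is symmetric.\<close>

lemma counit_at_dot:
  assumes e: "linear_map K A (scalar_module K) \<epsilon>"
    and em: "\<And>x y. x \<in> carrier A \<Longrightarrow> y \<in> carrier A \<Longrightarrow> \<epsilon> (m x y) = \<epsilon> x \<otimes>\<^bsub>K\<^esub> \<epsilon> y"
    and x: "x \<in> carrier A" and y: "y \<in> carrier A" and cx: "counit_at K A \<Delta> \<epsilon> x" and cy: "counit_at K A \<Delta> \<epsilon> y"
  shows "counit_at K A \<Delta> \<epsilon> (m x y)"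
proof -
  have ec: "a \<in> carrier A \<Longrightarrow> \<epsilon> a \<in> carrier K" for a using lin_closed[OF e] by simp
  define l where "l = lift_quot K A (\<lambda>(a, b). \<epsilon> a \<odot>\<^bsub>A\<^esub> b)"
  define r where "r = lift_quot K A (\<lambda>(a, b). \<epsilon> b \<odot>\<^bsub>A\<^esub> a)"
  note c = counit_maps[OF A e, folded l_def r_def]
  have i: "\<Delta> (m x y) \<oplus>\<^bsub>AA\<^esub> p x y = lm x (\<Delta> y) \<oplus>\<^bsub>AA\<^esub> rm y (\<Delta> x)"
    using inf[OF x y] by (simp add: lm_def rm_def)
  note cl = x y m_closed D_closed p_closed lin_closed[OF lm_lin] lin_closed[OF rm_lin] ec
     lin_closed[OF c(1)] lin_closed[OF c(3)]
  have l1: "l (lm x Y) = \<epsilon> x \<odot>\<^bsub>A\<^esub> l Y" if "Y \<in> carrier AA" for Y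
    by (rule eqI[OF A lin_comp[OF lm_lin[OF x] c(1)] lin_smult_fun[OF c(1) A ec[OF x]] _ that])
      (simp add: cl lm_pure c em A.smult_assoc1)
  have l2: "l (rm y X) = m (l X) y" if "X \<in> carrier AA" for X
    by (rule eqI[OF A lin_comp[OF rm_lin[OF y] c(1)] lin_comp[OF c(1) ml[OF y]] _ that])
      (simp add: cl rm_pure c lin_smult[OF ml])
  have r1: "r (lm x Y) = m x (r Y)" if "Y \<in> carrier AA" for Y
    by (rule eqI[OF A lin_comp[OF lm_lin[OF x] c(3)] lin_comp[OF c(3) mr[OF x]] _ that])
      (simp add: cl lm_pure c lin_smult[OF mr])
  have r2: "r (rm y X) = \<epsilon> y \<odot>\<^bsub>A\<^esub> r X" if "X \<in> carrier AA" for X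
    by (rule eqI[OF A lin_comp[OF rm_lin[OF y] c(3)] lin_smult_fun[OF c(3) A ec[OF y]] _ that])
      (simp add: cl rm_pure c em A.smult_assoc1[symmetric] A.R.m_comm)
  have h: "l (\<Delta> x) = x" "l (\<Delta> y) = y" "r (\<Delta> x) = x" "r (\<Delta> y) = y"
    using cx cy by (simp_all add: counit_at_def l_def r_def)
  have "l (\<Delta> (m x y)) \<oplus>\<^bsub>A\<^esub> \<epsilon> x \<odot>\<^bsub>A\<^esub> y = m x y \<oplus>\<^bsub>A\<^esub> \<epsilon> x \<odot>\<^bsub>A\<^esub> y"
    using arg_cong[OF i, of l] by (simp add: lin_add[OF c(1)] cl c l1 l2 h A.a_comm)
  then have 1: "l (\<Delta> (m x y)) = m x y" by (simp add: cl)
  have "r (\<Delta> (m x y)) \<oplus>\<^bsub>A\<^esub> \<epsilon> y \<odot>\<^bsub>A\<^esub> x = m x y \<oplus>\<^bsub>A\<^esub> \<epsilon> y \<odot>\<^bsub>A\<^esub> x"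
    using arg_cong[OF i, of r] by (simp add: lin_add[OF c(3)] cl c r1 r2 h)
  then have "r (\<Delta> (m x y)) = m x y" by (simp add: cl)
  with 1 show ?thesis by (simp add: counit_at_def l_def r_def)
qed

end

section \<open>Coassociativity and counitality for a multiplicative coproduct\<close>

lemma tensor_assoc_mult:
  assumes alg: "assoc_algebra K A"
  defines "AA \<equiv> tensor K A A"
  assumes X: "X \<in> carrier (tensor K AA A)" and Y: "Y \<in> carrier (tensor K AA A)"
  shows "tensor_assoc K A (X \<otimes>\<^bsub>tensor K AA A\<^esub> Y) = tensor_assoc K A X \<otimes>\<^bsub>tensor K A AA\<^esub> tensor_assoc K A Y"
proof -
  note A = assoc_algebraD(1)[OF alg]
  have AA: "module K AA" unfolding AA_def by (rule tensor_module[OF A A])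
  have algA: "assoc_algebra K AA" unfolding AA_def by (rule tensor_assoc_algebra[OF alg alg])
  note bA = assoc_algebra_bilinear[OF alg] and bAA = assoc_algebra_bilinear[OF algA]
  let ?L = "tensor K AA A" and ?R = "tensor K A AA"
  note mL = tensor_module[OF AA A] and mR = tensor_module[OF A AA]
  note bl = tensor_mult_bilinear_pure(1)[OF AA A bAA bA] and bp = tensor_mult_bilinear_pure(2)[OF AA A bAA bA]
  note cl = tensor_mult_bilinear_pure(1)[OF A AA bA bAA] and cp = tensor_mult_bilinear_pure(2)[OF A AA bA bAA]
  note dp = tensor_mult_bilinear_pure(2)[OF A A bA bA, folded AA_def]
  note ta = tensor_assoc_linear(1)[OF A, folded AA_def] and tap = tensor_assoc_linear(2)[OF A, folded AA_def]
  note pcl = pure_tensor_closed[OF A A, folded AA_def]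
  let ?P = "{pure_tensor K A A v w |v w. v \<in> carrier A \<and> w \<in> carrier A}"
  let ?S = "{pure_tensor K AA A X c |X c. X \<in> ?P \<and> c \<in> carrier A}"
  \<comment> \<open>Pure tensors whose first factor is itself a pure tensor still span, which
    reduces the claim to products of elements of \<open>A\<close>.\<close>
  have sp: "spans K ?L ?S"
    unfolding spans_def
  proof (intro conjI allI impI)
    show "?S \<subseteq> carrier ?L" by (auto intro!: pure_tensor_closed[OF AA A] pcl)
    fix N assume N: "submodule N K ?L \<and> ?S \<subseteq> N"
    interpret L: module K ?L by (rule mL)
    interpret AA: module K AA by (rule AA)
    have NN: "\<zero>\<^bsub>?L\<^esub> \<in> N \<and> (\<forall>x\<in>N. \<forall>y\<in>N. x \<oplus>\<^bsub>?L\<^esub> y \<in> N) \<and> (\<forall>c\<in>carrier K. \<forall>x\<in>N. c \<odot>\<^bsub>?L\<^esub> x \<in> N)"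
      using conjunct1[OF N] unfolding submodule_iff[OF mL] by simp
    have 1: "pure_tensor K AA A X c \<in> N" if "X \<in> carrier AA" "c \<in> carrier A" for X c
    proof -
      note l = bilin_left[OF pure_tensor_bilinear[OF AA A] that(2)]
      show ?thesis
        using tensor_spans[OF A A, folded AA_def] AA that(1)
      proof (induction rule: spans_induct)
        case zero
        then show ?case using lin_zero[OF l AA mL] NN by simp
      next
        case (gen x)
        then show ?case using N that(2) by blast
      next
        case (add x y)
        then show ?case using lin_add[OF l] NN by simp
      next
        case (smult c x)
        then show ?case using lin_smult[OF l] NN by simp
      qed
    qed
    have "{pure_tensor K AA A v w |v w. v \<in> carrier AA \<and> w \<in> carrier A} \<subseteq> N" using 1 by fast
    then show "carrier ?L \<subseteq> N" using conjunct2[OF tensor_spans[OF AA A, unfolded spans_def]] N by simp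
  qed
  show ?thesis
  proof (rule bilin_eqI[where f="\<lambda>X Y. tensor_assoc K A (X \<otimes>\<^bsub>?L\<^esub> Y)" and
      g="\<lambda>X Y. tensor_assoc K A X \<otimes>\<^bsub>?R\<^esub> tensor_assoc K A Y",
      OF sp sp mL mL mR
      bilin_comp[OF bl lin_id lin_id ta] bilin_comp[OF cl ta ta lin_id] _ X Y])
    fix x y assume "x \<in> ?S" "y \<in> ?S"
    then obtain a b c a' b' c' where "x = pure_tensor K AA A (pure_tensor K A A a b) c" "y = pure_tensor K AA A (pure_tensor K A A a' b') c'"
      "a \<in> carrier A" "b \<in> carrier A" "c \<in> carrier A" "a' \<in> carrier A" "b' \<in> carrier A" "c' \<in> carrier A"
      by blast
    then show "tensor_assoc K A (x \<otimes>\<^bsub>?L\<^esub> y) = tensor_assoc K A x \<otimes>\<^bsub>?R\<^esub> tensor_assoc K A y"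
      by (simp add: bp cp dp tap pcl assoc_algebraD(5)[OF alg])
  qed
qed

text \<open>The associator, \<open>\<Delta> \<otimes> id\<close> and
  \<open>id \<otimes> \<Delta>\<close> are multiplicative, hence so are both sides of
  coassociativity.\<close>

lemma coassoc_at_mult:
  assumes alg: "assoc_algebra K A" and D: "linear_map K A (tensor K A A) \<Delta>"
    and Dm: "\<And>x y. x \<in> carrier A \<Longrightarrow> y \<in> carrier A \<Longrightarrow> \<Delta> (x \<otimes>\<^bsub>A\<^esub> y) = \<Delta> x \<otimes>\<^bsub>tensor K A A\<^esub> \<Delta> y"
    and x: "x \<in> carrier A" and y: "y \<in> carrier A" and cx: "coassoc_at K A \<Delta> x" and cy: "coassoc_at K A \<Delta> y"
  shows "coassoc_at K A \<Delta> (x \<otimes>\<^bsub>A\<^esub> y)"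
proof -
  note A = assoc_algebraD(1)[OF alg]
  note algA = tensor_assoc_algebra[OF alg alg]
  note AA = assoc_algebraD(1)[OF algA]
  note cl = lin_closed[OF D]
  note t1 = tensor_map_mult[OF alg alg algA alg D lin_id Dm refl]
  note t2 = tensor_map_mult[OF alg alg alg algA lin_id D refl Dm]
  note tc = lin_closed[OF tensor_map_linear(1)[OF A A AA A D lin_id]]
  show ?thesis using cx cy x y
    by (simp add: coassoc_at_def Dm t1 t2 cl tensor_assoc_mult[OF alg] tc)
qed

lemma counit_at_mult:
  assumes alg: "assoc_algebra K A" and D: "linear_map K A (tensor K A A) \<Delta>"
    and Dm: "\<And>x y. x \<in> carrier A \<Longrightarrow> y \<in> carrier A \<Longrightarrow> \<Delta> (x \<otimes>\<^bsub>A\<^esub> y) = \<Delta> x \<otimes>\<^bsub>tensor K A A\<^esub> \<Delta> y"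
    and e: "linear_map K A (scalar_module K) \<epsilon>"
    and em: "\<And>x y. x \<in> carrier A \<Longrightarrow> y \<in> carrier A \<Longrightarrow> \<epsilon> (x \<otimes>\<^bsub>A\<^esub> y) = \<epsilon> x \<otimes>\<^bsub>K\<^esub> \<epsilon> y"
    and x: "x \<in> carrier A" and y: "y \<in> carrier A" and cx: "counit_at K A \<Delta> \<epsilon> x" and cy: "counit_at K A \<Delta> \<epsilon> y"
  shows "counit_at K A \<Delta> \<epsilon> (x \<otimes>\<^bsub>A\<^esub> y)"
proof -
  note A = assoc_algebraD(1)[OF alg] and cl = assoc_algebraD(5)[OF alg]
  interpret A: module K A by (rule A)
  have ec: "a \<in> carrier A \<Longrightarrow> \<epsilon> a \<in> carrier K" for a using lin_closed[OF e] by simp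
  note b = assoc_algebra_bilinear[OF alg]
  note bl = tensor_mult_bilinear_pure(1)[OF A A b b] and bp = tensor_mult_bilinear_pure(2)[OF A A b b]
  note sp = tensor_spans[OF A A] and T = tensor_module[OF A A]
  note c = counit_maps[OF A e]
  note ls = lin_smult[OF bilin_left[OF b]] lin_smult[OF bilin_right[OF b]]
  \<comment> \<open>Stated for an arbitrary linear \<open>l\<close> so that it serves both
    \<open>\<epsilon> \<otimes> id\<close> and \<open>id \<otimes> \<epsilon>\<close>.\<close>
  have key: "l (X \<otimes>\<^bsub>tensor K A A\<^esub> Y) = l X \<otimes>\<^bsub>A\<^esub> l Y"
    if l: "linear_map K (tensor K A A) A l" and X: "X \<in> carrier (tensor K A A)" and Y: "Y \<in> carrier (tensor K A A)"
      and pure: "\<And>a b a' b'. a \<in> carrier A \<Longrightarrow> b \<in> carrier A \<Longrightarrow> a' \<in> carrier A \<Longrightarrow> b' \<in> carrier A \<Longrightarrow>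
        l (pure_tensor K A A (a \<otimes>\<^bsub>A\<^esub> a') (b \<otimes>\<^bsub>A\<^esub> b')) = l (pure_tensor K A A a b) \<otimes>\<^bsub>A\<^esub> l (pure_tensor K A A a' b')" for l X Y
    by (rule bilin_eqI[where f="\<lambda>X Y. l (X \<otimes>\<^bsub>tensor K A A\<^esub> Y)" and g="\<lambda>X Y. l X \<otimes>\<^bsub>A\<^esub> l Y",
       OF sp sp T T A bilin_comp[OF bl lin_id lin_id l] bilin_comp[OF b l l lin_id] _ X Y])
      (auto simp: bp pure)
  note 1 = key[OF c(1)] and 2 = key[OF c(3)]
  show ?thesis using cx cy x y
    by (simp add: counit_at_def Dm 1 2 lin_closed[OF D] c cl em ec ls A.smult_assoc1[symmetric] A.R.m_comm)
qed

lemma tensor_assoc_struct_cong: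
  assumes "carrier C = carrier A" "add C = add A" "smult C = smult A"
  shows "tensor_assoc K C = tensor_assoc K A"
proof -
  note c = tensor_struct_cong[OF assms assms] tensor_space_struct_cong(2)[OF assms assms]
  note c3 = tensor_struct_cong[OF assms c(1,3,4)] tensor_space_struct_cong(2)[OF assms c(1,3,4)]
  show ?thesis
    unfolding tensor_assoc_def Let_def c3(5) c(5)
    by (simp add: lift_quot_struct_cong[OF c3(1,3,4,2)])
qed

text \<open>The coalgebra axioms see only the vector space, so they may be phrased over any record
  \<open>A\<close> that shares it with \<open>C\<close>. This gives access to the pointwise
  predicates on \<open>T(V)\<close> and on 2-associative algebras.\<close>

lemma coalgebra_iff:
  fixes C :: "('k, 'a, 'x) bialg_scheme" and A :: "('k, 'a, 'y) module_scheme"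
  assumes "carrier C = carrier A" "add C = add A" "smult C = smult A" "zero C = zero A"
  shows "coalgebra K C \<longleftrightarrow> module K A \<and> linear_map K A (tensor K A A) (comult C) \<and>
    linear_map K A (scalar_module K) (counit C) \<and>
    (\<forall>x \<in> carrier A. coassoc_at K A (comult C) x \<and> counit_at K A (comult C) (counit C) x)"
proof -
  note s = assms(1-3)
  note c = tensor_struct_cong[OF s s]
  have m: "module K C \<longleftrightarrow> module K A"
    using module_cong[of K A C] module_cong[of K C A] assms by auto
  have l: "linear_map K C (tensor K C C) (comult C) \<longleftrightarrow> linear_map K A (tensor K A A) (comult C)"
    "linear_map K C (scalar_module K) (counit C) \<longleftrightarrow> linear_map K A (scalar_module K) (counit C)"
    by (rule lin_struct_cong; simp add: assms c)+
  have t: "tensor_map K (tensor K C C) C = (tensor_map K (tensor K A A) A :: ('a \<Rightarrow> _) \<Rightarrow> ('a \<Rightarrow> _) \<Rightarrow> _)"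
    "tensor_map K C (tensor K C C) = (tensor_map K A (tensor K A A) :: ('a \<Rightarrow> _) \<Rightarrow> ('a \<Rightarrow> _) \<Rightarrow> _)"
    by (intro ext fun_cong[OF tensor_map_struct_cong] c s)+
  show ?thesis
    unfolding coalgebra_def Let_def m l t tensor_assoc_struct_cong[OF s] coassoc_at_def counit_at_def
      lift_quot_struct_cong[OF assms] assms
    by auto
qed

section \<open>Multilinear maps and the tensor coalgebra\<close>

text \<open>One function on words collects a family of \<open>n\<close>-linear maps, one for every
  length \<open>n\<close>; no condition links different lengths.\<close>

definition "multilinear K V U g \<longleftrightarrow> (\<forall>xs \<in> lists (carrier V). g xs \<in> carrier U) \<and>
    (\<forall>xs \<in> lists (carrier V). \<forall>ys \<in> lists (carrier V). linear_map K V U (\<lambda>v. g (xs @ [v] @ ys)))"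

lemma multilinearI:
  assumes "\<And>xs. xs \<in> lists (carrier V) \<Longrightarrow> g xs \<in> carrier U"
    and "\<And>xs ys. xs \<in> lists (carrier V) \<Longrightarrow> ys \<in> lists (carrier V) \<Longrightarrow> linear_map K V U (\<lambda>v. g (xs @ [v] @ ys))"
  shows "multilinear K V U g"
  using assms by (simp add: multilinear_def)

lemma multilinear_closed: "multilinear K V U g \<Longrightarrow> xs \<in> lists (carrier V) \<Longrightarrow> g xs \<in> carrier U"
  by (simp add: multilinear_def)

lemma multilinear_linear:
  "multilinear K V U g \<Longrightarrow> xs \<in> lists (carrier V) \<Longrightarrow> ys \<in> lists (carrier V) \<Longrightarrow> linear_map K V U (\<lambda>v. g (xs @ [v] @ ys))"
  by (simp add: multilinear_def)

lemma multilinear_comp: "multilinear K V U g \<Longrightarrow> linear_map K U W f \<Longrightarrow> multilinear K V W (\<lambda>xs. f (g xs))"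
  apply (rule multilinearI)
  subgoal by (erule lin_closed) (erule (1) multilinear_closed)
  subgoal for xs ys using lin_comp[OF multilinear_linear[of K V U g xs ys], of W f] by blast
  done

lemma multilinear_append_left: "multilinear K V U g \<Longrightarrow> zs \<in> lists (carrier V) \<Longrightarrow> multilinear K V U (\<lambda>xs. g (zs @ xs))"
  apply (rule multilinearI)
  subgoal for xs using multilinear_closed[of K V U g "zs @ xs"] by simp
  subgoal for xs ys using multilinear_linear[of K V U g "zs @ xs" ys] by simp
  done

lemma multilinear_append_right: "multilinear K V U g \<Longrightarrow> zs \<in> lists (carrier V) \<Longrightarrow> multilinear K V U (\<lambda>xs. g (xs @ zs))"
  apply (rule multilinearI)
  subgoal for xs using multilinear_closed[of K V U g "xs @ zs"] by simp
  subgoal for xs ys using multilinear_linear[of K V U g xs "ys @ zs"] by simp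
  done

lemma multilinear_zero:
  assumes "multilinear K V U g" "module K V" "module K U" "xs \<in> lists (carrier V)" "ys \<in> lists (carrier V)"
  shows "g (xs @ [\<zero>\<^bsub>V\<^esub>] @ ys) = \<zero>\<^bsub>U\<^esub>"
  using lin_zero[OF multilinear_linear[OF assms(1,4,5)] assms(2,3)] .

lemma multilinear_eq_zero:
  assumes "multilinear K V U g" "module K V" "module K U" "xs \<in> lists (carrier V)" "\<zero>\<^bsub>V\<^esub> \<in> set xs"
  shows "g xs = \<zero>\<^bsub>U\<^esub>"
proof -
  obtain as bs where xs: "xs = as @ \<zero>\<^bsub>V\<^esub> # bs" using assms(5) by (meson split_list)
  then show ?thesis using multilinear_zero[OF assms(1-3), of as bs] assms(4) by simp
qed

lemma lin_finsum_fun: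
  assumes "module K U" "\<And>i. i \<in> I \<Longrightarrow> linear_map K V U (g i)"
  shows "linear_map K V U (\<lambda>v. \<Oplus>\<^bsub>U\<^esub>i\<in>I. g i v)"
proof -
  interpret U: module K U by fact
  note c = lin_closed[OF assms(2)]
  show ?thesis
  proof (cases "finite I")
    case True
    show ?thesis
    proof (rule linear_mapI)
      fix x y assume "x \<in> carrier V" "y \<in> carrier V"
      then show "(\<Oplus>\<^bsub>U\<^esub>i\<in>I. g i (x \<oplus>\<^bsub>V\<^esub> y)) = (\<Oplus>\<^bsub>U\<^esub>i\<in>I. g i x) \<oplus>\<^bsub>U\<^esub> (\<Oplus>\<^bsub>U\<^esub>i\<in>I. g i y)"
        by (subst U.finsum_addf[symmetric]) (auto intro!: c U.finsum_eqI lin_add[OF assms(2)])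
    next
      fix d x assume "d \<in> carrier K" "x \<in> carrier V"
      then show "(\<Oplus>\<^bsub>U\<^esub>i\<in>I. g i (d \<odot>\<^bsub>V\<^esub> x)) = d \<odot>\<^bsub>U\<^esub> (\<Oplus>\<^bsub>U\<^esub>i\<in>I. g i x)"
        by (subst U.finsum_smult_ldistr[OF True]) (auto intro!: c U.finsum_eqI lin_smult[OF assms(2)])
    qed (auto intro!: U.finsum_closed c)
  next
    case False
    then show ?thesis using lin_zero_fun[OF assms(1), of V] by (simp add: U.finsum_infinite)
  qed
qed

text \<open>The index set may depend on the length of the word but not on its letters, so it stays
  fixed while one letter varies.\<close>

lemma multilinear_finsum:
  assumes "module K U" "\<And>i. multilinear K V U (g i)"
  shows "multilinear K V U (\<lambda>xs. \<Oplus>\<^bsub>U\<^esub>i\<in>I (length xs). g i xs)"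
proof -
  interpret U: module K U by fact
  show ?thesis
  proof (rule multilinearI)
    fix xs assume "xs \<in> lists (carrier V)"
    then show "(\<Oplus>\<^bsub>U\<^esub>i\<in>I (length xs). g i xs) \<in> carrier U"
      by (intro U.finsum_closed) (auto intro: multilinear_closed[OF assms(2)])
  next
    fix xs ys assume *: "xs \<in> lists (carrier V)" "ys \<in> lists (carrier V)"
    have "linear_map K V U (\<lambda>v. \<Oplus>\<^bsub>U\<^esub>i\<in>I (length (xs @ [\<zero>\<^bsub>V\<^esub>] @ ys)). g i (xs @ [v] @ ys))"
      by (rule lin_finsum_fun[OF assms(1) multilinear_linear[OF assms(2) *]])
    then show "linear_map K V U (\<lambda>v. \<Oplus>\<^bsub>U\<^esub>i\<in>I (length (xs @ [v] @ ys)). g i (xs @ [v] @ ys))" by simp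
  qed
qed

lemma multilinear_take_drop:
  assumes "\<And>xs. xs \<in> lists (carrier V) \<Longrightarrow> multilinear K V U (b xs)"
    and "\<And>ys. ys \<in> lists (carrier V) \<Longrightarrow> multilinear K V U (\<lambda>xs. b xs ys)"
  shows "multilinear K V U (\<lambda>xs. b (take i xs) (drop i xs))"
proof (rule multilinearI)
  have td: "take i xs \<in> lists (carrier V)" "drop i xs \<in> lists (carrier V)" if "xs \<in> lists (carrier V)" for xs i
    using that by (auto dest: in_set_takeD in_set_dropD)
  show "b (take i xs) (drop i xs) \<in> carrier U" if "xs \<in> lists (carrier V)" for xs
    by (rule multilinear_closed[OF assms(1)[OF td(1)[OF that]] td(2)[OF that]])
  fix xs ys assume *: "xs \<in> lists (carrier V)" "ys \<in> lists (carrier V)"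
  show "linear_map K V U (\<lambda>v. b (take i (xs @ [v] @ ys)) (drop i (xs @ [v] @ ys)))"
  proof (cases "i \<le> length xs")
    case True
    then show ?thesis using multilinear_linear[OF assms(1), of "take i xs" "drop i xs" ys] td * by simp
  next
    case False
    \<comment> \<open>The varied letter has position \<open>length xs\<close>, counted from zero, so
      it belongs to the part that is taken once \<open>i\<close> is at least
      \<open>length xs + 1\<close>.\<close>
    then obtain j where "i = length xs + Suc j" using less_imp_Suc_add[of "length xs" i] by auto
    then show ?thesis using multilinear_linear[OF assms(2), of "drop j ys" xs "take j ys"] td * by simp
  qed
qed

context
  fixes K :: "('k, 'm) ring_scheme" and V :: "('k, 'a, 'x) module_scheme"
  assumes V: "module K V"
begin

private abbreviation "FW \<equiv> free_module K (lists (carrier V))"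
private abbreviation "TW \<equiv> words_module K V"

private lemma cKW: "cring K" by (rule module_cring[OF V])

private lemma relsW: "word_rels K V \<subseteq> carrier FW"
proof -
  interpret V: module K V by (rule V)
  interpret F: module K FW by (rule free_module_module[OF cKW])
  show ?thesis unfolding word_rels_def Let_def
    by (intro Un_least) (auto intro!: basis_elt_closed[OF cKW] F.minus_closed F.a_closed F.smult_closed)
qed

lemma words_module_module: "module K TW"
  unfolding words_module_def Let_def by (rule free_quot_module[OF cKW relsW])

lemma word_closed: "xs \<in> lists (carrier V) \<Longrightarrow> word K V xs \<in> carrier TW"
  unfolding words_module_def Let_def word_def by (rule free_quot_closed[OF cKW relsW])

lemma words_spans: "spans K TW (word K V ` lists (carrier V))"
  using free_quot_spans[OF cKW relsW] unfolding words_module_def word_def Let_def .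

lemma words_eqI:
  assumes "module K U" "linear_map K TW U f" "linear_map K TW U g"
    and "\<And>xs. xs \<in> lists (carrier V) \<Longrightarrow> f (word K V xs) = g (word K V xs)" and "x \<in> carrier TW"
  shows "f x = g x"
  by (rule lin_eqI[OF words_spans words_module_module assms(1-3) _ assms(5)]) (use assms(4) in auto)

lemma word_multilinear: "multilinear K V TW (word K V)"
proof (rule multilinearI[OF word_closed])
  interpret V: module K V by (rule V)
  interpret F: module K FW by (rule free_module_module[OF cKW])
  interpret T: module K TW by (rule words_module_module)
  let ?p = "\<lambda>f. submodule_span K FW (word_rels K V) +>\<^bsub>FW\<^esub> f"
  have p: "linear_map K FW TW ?p"
    unfolding words_module_def Let_def by (rule free_quot_proj[OF cKW relsW])
  have eq: "?p a = ?p b" if "a \<ominus>\<^bsub>FW\<^esub> b \<in> word_rels K V" "a \<in> carrier FW" "b \<in> carrier FW" for a b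
  proof -
    have "?p (a \<ominus>\<^bsub>FW\<^esub> b) = \<zero>\<^bsub>TW\<^esub>"
      unfolding words_module_def Let_def by (rule free_quot_rel[OF cKW relsW that(1)])
    then show ?thesis
      using lin_minus[OF p F.module_axioms T.module_axioms that(2,3)] lin_closed[OF p] that
      by (simp add: T.minus_eq_zero_iff)
  qed
  note b = basis_elt_closed[OF cKW]
  have P: "word K V = (\<lambda>xs. ?p (basis_elt K xs))" by (simp add: word_def Let_def fun_eq_iff)
  fix xs ys assume *: "xs \<in> lists (carrier V)" "ys \<in> lists (carrier V)"
  show "linear_map K V TW (\<lambda>v. word K V (xs @ [v] @ ys))"
  proof (rule linear_mapI)
    fix v assume "v \<in> carrier V" then show "word K V (xs @ [v] @ ys) \<in> carrier TW" using * by (intro word_closed) auto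
  next
    fix u v assume uv: "u \<in> carrier V" "v \<in> carrier V"
    have l: "xs @ [w] @ ys \<in> lists (carrier V)" if "w \<in> carrier V" for w using * that by auto
    have "?p (basis_elt K (xs @ [u \<oplus>\<^bsub>V\<^esub> v] @ ys)) = ?p (basis_elt K (xs @ [u] @ ys) \<oplus>\<^bsub>FW\<^esub> basis_elt K (xs @ [v] @ ys))"
    proof (rule eq, goal_cases)
      case 1
      show ?case unfolding word_rels_def Let_def by (rule UnI1, rule CollectI) (use * uv in fast)
    qed (intro b l uv F.a_closed V.a_closed)+
    then show "word K V (xs @ [u \<oplus>\<^bsub>V\<^esub> v] @ ys) = word K V (xs @ [u] @ ys) \<oplus>\<^bsub>TW\<^esub> word K V (xs @ [v] @ ys)"
      by (simp only: P lin_add[OF p b b, OF l l, OF uv])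
  next
    fix c v assume uv: "c \<in> carrier K" "v \<in> carrier V"
    have l: "xs @ [w] @ ys \<in> lists (carrier V)" if "w \<in> carrier V" for w using * that by auto
    have "?p (basis_elt K (xs @ [c \<odot>\<^bsub>V\<^esub> v] @ ys)) = ?p (c \<odot>\<^bsub>FW\<^esub> basis_elt K (xs @ [v] @ ys))"
    proof (rule eq, goal_cases)
      case 1
      show ?case unfolding word_rels_def Let_def by (rule UnI2, rule CollectI) (use * uv in fast)
    qed (intro b l uv V.smult_closed F.smult_closed)+
    then show "word K V (xs @ [c \<odot>\<^bsub>V\<^esub> v] @ ys) = c \<odot>\<^bsub>TW\<^esub> word K V (xs @ [v] @ ys)"
      by (simp only: P lin_smult[OF p uv(1) b, OF l, OF uv(2)])
  qed
qed

lemma words_lift: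
  assumes U: "module K U" and g: "multilinear K V U g"
  shows "linear_map K TW U (lift_quot K U g)"
    and "xs \<in> lists (carrier V) \<Longrightarrow> lift_quot K U g (word K V xs) = g xs"
proof -
  interpret V: module K V by (rule V)
  interpret U: module K U by (rule U)
  interpret F: module K FW by (rule free_module_module[OF cKW])
  note cl = multilinear_closed[OF g]
  have L: "linear_map K FW U (lin_ext K U g)" by (rule lin_ext_linear[OF U cl])
  note Lm = lin_minus[OF L F.module_axioms U]
  have Lb: "lin_ext K U g (basis_elt K xs) = g xs" if "xs \<in> lists (carrier V)" for xs
    by (rule lin_ext_basis_elt[OF U that cl])
  note b = basis_elt_closed[OF cKW]
  have z: "lin_ext K U g f = \<zero>\<^bsub>U\<^esub>" if f: "f \<in> word_rels K V" for f
    using f unfolding word_rels_def Let_def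
  proof (elim UnE CollectE exE conjE)
    fix xs u v ys assume *: "xs \<in> lists (carrier V)" "u \<in> carrier V" "v \<in> carrier V" "ys \<in> lists (carrier V)"
      and f: "f = basis_elt K (xs @ [u \<oplus>\<^bsub>V\<^esub> v] @ ys) \<ominus>\<^bsub>FW\<^esub> (basis_elt K (xs @ [u] @ ys) \<oplus>\<^bsub>FW\<^esub> basis_elt K (xs @ [v] @ ys))"
    have l: "xs @ [w] @ ys \<in> lists (carrier V)" if "w \<in> carrier V" for w using * that by auto
    show ?thesis unfolding f
      using lin_add[OF multilinear_linear[OF g *(1,4)] *(2,3)] l[OF *(2)] l[OF *(3)] l[OF V.a_closed[OF *(2,3)]]
      by (simp only: Lm b Lb lin_add[OF L] U.minus_eq_zero_iff cl F.a_closed U.a_closed)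
  next
    fix xs c v ys assume *: "xs \<in> lists (carrier V)" "c \<in> carrier K" "v \<in> carrier V" "ys \<in> lists (carrier V)"
      and f: "f = basis_elt K (xs @ [c \<odot>\<^bsub>V\<^esub> v] @ ys) \<ominus>\<^bsub>FW\<^esub> (c \<odot>\<^bsub>FW\<^esub> basis_elt K (xs @ [v] @ ys))"
    have l: "xs @ [w] @ ys \<in> lists (carrier V)" if "w \<in> carrier V" for w using * that by auto
    show ?thesis unfolding f
      using lin_smult[OF multilinear_linear[OF g *(1,4)] *(2,3)] l[OF *(3)] l[OF V.smult_closed[OF *(2,3)]]
      by (simp only: Lm b Lb lin_smult[OF L] U.minus_eq_zero_iff cl F.smult_closed U.smult_closed *)
  qed
  note fq = free_quot_lift[OF cKW relsW U cl z]
  show "linear_map K TW U (lift_quot K U g)"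
    using fq(1) unfolding words_module_def Let_def .
  show "xs \<in> lists (carrier V) \<Longrightarrow> lift_quot K U g (word K V xs) = g xs"
    using fq(2)[of xs] unfolding word_def Let_def .
qed

text \<open>The iterated lift extends a function of two words bilinearly; \<open>word_concat\<close>
  and \<open>star_prod\<close> are its instances.\<close>

lemma words_lift2:
  assumes U: "module K U"
    and b1: "\<And>xs. xs \<in> lists (carrier V) \<Longrightarrow> multilinear K V U (b xs)"
    and b2: "\<And>ys. ys \<in> lists (carrier V) \<Longrightarrow> multilinear K V U (\<lambda>xs. b xs ys)"
  shows "bilinear K TW TW U (\<lambda>X Y. lift_quot K U (\<lambda>xs. lift_quot K U (b xs) Y) X)"
    and "xs \<in> lists (carrier V) \<Longrightarrow> ys \<in> lists (carrier V) \<Longrightarrow>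
      lift_quot K U (\<lambda>xs. lift_quot K U (b xs) (word K V ys)) (word K V xs) = b xs ys"
proof -
  note TW = words_module_module
  have ml: "multilinear K V U (\<lambda>xs. lift_quot K U (b xs) Y)" if Y: "Y \<in> carrier TW" for Y
  proof (rule multilinearI)
    fix xs assume "xs \<in> lists (carrier V)"
    then show "lift_quot K U (b xs) Y \<in> carrier U" using lin_closed[OF words_lift(1)[OF U b1]] Y by blast
  next
    fix xs ys assume *: "xs \<in> lists (carrier V)" "ys \<in> lists (carrier V)"
    have l: "xs @ [w] @ ys \<in> lists (carrier V)" if "w \<in> carrier V" for w using * that by auto
    have "bilinear K V TW U (\<lambda>v Y. lift_quot K U (b (xs @ [v] @ ys)) Y)"
    proof (rule bilin_from_span[OF V TW U words_spans])
      show "linear_map K TW U (lift_quot K U (b (xs @ [v] @ ys)))" if "v \<in> carrier V" for v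
        by (rule words_lift(1)[OF U b1[OF l[OF that]]])
      fix s assume "s \<in> word K V ` lists (carrier V)"
      then obtain zs where s: "s = word K V zs" "zs \<in> lists (carrier V)" by auto
      show "linear_map K V U (\<lambda>v. lift_quot K U (b (xs @ [v] @ ys)) s)"
        by (rule lin_congI[OF multilinear_linear[OF b2[OF s(2)] *] V])
          (simp only: s words_lift(2)[OF U b1[OF l]])
    qed
    then show "linear_map K V U (\<lambda>v. lift_quot K U (b (xs @ [v] @ ys)) Y)"
      by (rule bilin_left[OF _ Y])
  qed
  have "bilinear K TW TW U (\<lambda>Y X. lift_quot K U (\<lambda>xs. lift_quot K U (b xs) Y) X)"
  proof (rule bilin_from_span[OF TW TW U words_spans words_lift(1)[OF U ml]])
    fix s assume "s \<in> word K V ` lists (carrier V)"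
    then obtain zs where s: "s = word K V zs" "zs \<in> lists (carrier V)" by auto
    show "linear_map K TW U (\<lambda>Y. lift_quot K U (\<lambda>xs. lift_quot K U (b xs) Y) s)"
      by (rule lin_congI[OF words_lift(1)[OF U b1[OF s(2)]] TW]) (simp only: s words_lift(2)[OF U ml])
  qed
  then show "bilinear K TW TW U (\<lambda>X Y. lift_quot K U (\<lambda>xs. lift_quot K U (b xs) Y) X)"
    by (simp add: bilinear_def)
  assume "xs \<in> lists (carrier V)" "ys \<in> lists (carrier V)"
  then show "lift_quot K U (\<lambda>xs. lift_quot K U (b xs) (word K V ys)) (word K V xs) = b xs ys"
    by (simp only: words_lift(2)[OF U ml[OF word_closed]] words_lift(2)[OF U b1])
qed

end

definition "word_concat K V X Y = lift_quot K (words_module K V) (\<lambda>xs. lift_quot K (words_module K V) (\<lambda>ys. word K V (xs @ ys)) Y) X"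

text \<open>The projection of \<open>T(V)\<close> onto its component \<open>V\<close> of degree
  one.\<close>

definition "letter K V = lift_quot K V (\<lambda>xs. if length xs = 1 then hd xs else \<zero>\<^bsub>V\<^esub>)"

text \<open>The letter projection on the left factor followed by concatenation. Composed with the
  coproduct it restores a word of positive length from its first letter and the rest.\<close>

definition "peel K V = lift_quot K (words_module K V) (\<lambda>(a, b). word_concat K V (word K V [letter K V a]) b)"

lemma with_coalgebra_simps [simp]:
  "carrier (with_coalgebra A D e) = carrier A" "mult (with_coalgebra A D e) = mult A"
  "one (with_coalgebra A D e) = one A" "zero (with_coalgebra A D e) = zero A" "add (with_coalgebra A D e) = add A"
  "smult (with_coalgebra A D e) = smult A" "comult (with_coalgebra A D e) = D" "counit (with_coalgebra A D e) = e"
  by (simp_all add: with_coalgebra_def)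

lemma tensor_coalgebra_simps:
  "carrier (tensor_coalgebra K V) = carrier (words_module K V)" "zero (tensor_coalgebra K V) = zero (words_module K V)"
  "add (tensor_coalgebra K V) = add (words_module K V)" "smult (tensor_coalgebra K V) = smult (words_module K V)"
  by (simp_all add: tensor_coalgebra_def Let_def)

section \<open>The tensor coalgebra\<close>

locale words = module K V for K :: "('k, 'm) ring_scheme" and V :: "('k, 'a, 'x) module_scheme"
begin

abbreviation "T \<equiv> words_module K V"
abbreviation "TT \<equiv> tensor K T T"
abbreviation "p \<equiv> pure_tensor K T T"
abbreviation "w \<equiv> word K V"
abbreviation "L \<equiv> lists (carrier V)"
abbreviation "\<Delta> \<equiv> comult (tensor_coalgebra K V)"
abbreviation "\<epsilon> \<equiv> counit (tensor_coalgebra K V)"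
abbreviation "cc \<equiv> word_concat K V"
abbreviation "\<pi> \<equiv> letter K V"

lemma V: "module K V" by (rule module_axioms)
lemma T: "module K T" by (rule words_module_module[OF V])
lemma TT: "module K TT" by (rule tensor_module[OF T T])
sublocale T: module K T by (rule T)
sublocale TT: module K TT by (rule TT)

lemmas w_closed = word_closed[OF V]
lemmas p_closed = pure_tensor_closed[OF T T]
lemmas p_bilin = pure_tensor_bilinear[OF T T]
lemmas w_multi = word_multilinear[OF V]
lemmas w_spans = words_spans[OF V]
lemmas w_eqI = words_eqI[OF V]
lemmas w_lift = words_lift[OF V]
lemmas w_lift2 = words_lift2[OF V]

lemma w_bilin_eqI:
  assumes "module K U" "bilinear K T T U f" "bilinear K T T U g"
    and "\<And>xs ys. xs \<in> L \<Longrightarrow> ys \<in> L \<Longrightarrow> f (w xs) (w ys) = g (w xs) (w ys)" and "x \<in> carrier T" "y \<in> carrier T"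
  shows "f x y = g x y"
  by (rule bilin_eqI[OF w_spans w_spans T T assms(1-3) _ assms(5,6)]) (use assms(4) in auto)

lemma take_L: "xs \<in> L \<Longrightarrow> take i xs \<in> L" and drop_L: "xs \<in> L \<Longrightarrow> drop i xs \<in> L"
  by (auto dest: in_set_takeD in_set_dropD)

lemma cc_bilin: "bilinear K T T T cc"
  and cc_word: "xs \<in> L \<Longrightarrow> ys \<in> L \<Longrightarrow> cc (w xs) (w ys) = w (xs @ ys)"
  using w_lift2[OF T multilinear_append_left[OF w_multi] multilinear_append_right[OF w_multi]]
  unfolding word_concat_def[abs_def] by auto

lemmas cc_closed = bilin_closed[OF cc_bilin]
lemmas cc_left = bilin_left[OF cc_bilin]
lemmas cc_right = bilin_right[OF cc_bilin]

lemma cc_assoc: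
  assumes "x \<in> carrier T" "y \<in> carrier T" "z \<in> carrier T"
  shows "cc (cc x y) z = cc x (cc y z)"
proof -
  have 1: "cc (cc (w xs) (w ys)) z = cc (w xs) (cc (w ys) z)" if "xs \<in> L" "ys \<in> L" "z \<in> carrier T" for xs ys z
    by (rule w_eqI[OF T cc_right lin_comp[OF cc_right cc_right] _ that(3)])
      (use that in \<open>simp_all add: cc_word cc_closed w_closed\<close>)
  show ?thesis
    by (rule w_bilin_eqI[where f="\<lambda>x y. cc (cc x y) z" and g="\<lambda>x y. cc x (cc y z)", OF T
        bilin_comp[OF cc_bilin lin_id lin_id cc_left[OF assms(3)]]
        bilin_comp[OF cc_bilin lin_id cc_left[OF assms(3)] lin_id] _ assms(1,2)])
      (simp add: 1 assms)
qed

lemma cc_unit: "x \<in> carrier T \<Longrightarrow> cc (w []) x = x" "x \<in> carrier T \<Longrightarrow> cc x (w []) = x"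
proof -
  show "x \<in> carrier T \<Longrightarrow> cc (w []) x = x"
    by (rule w_eqI[OF T cc_right lin_id]) (simp_all add: cc_word w_closed)
  show "x \<in> carrier T \<Longrightarrow> cc x (w []) = x"
    by (rule w_eqI[where f="\<lambda>x. cc x (w [])", OF T cc_left lin_id]) (simp_all add: cc_word w_closed)
qed

lemma \<pi>_lin: "linear_map K T V \<pi>" and \<pi>_word: "xs \<in> L \<Longrightarrow> \<pi> (w xs) = (if length xs = 1 then hd xs else \<zero>\<^bsub>V\<^esub>)"
proof -
  have "multilinear K V V (\<lambda>xs. if length xs = 1 then hd xs else \<zero>\<^bsub>V\<^esub>)"
  proof (rule multilinearI)
    fix xs assume "xs \<in> L"
    then show "(if length xs = 1 then hd xs else \<zero>\<^bsub>V\<^esub>) \<in> carrier V" by (cases xs) auto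
  next
    fix xs ys :: "'a list"
    show "linear_map K V V (\<lambda>v. if length (xs @ [v] @ ys) = 1 then hd (xs @ [v] @ ys) else \<zero>\<^bsub>V\<^esub>)"
      using lin_zero_fun[OF V, of V] lin_id[of K V] by (cases "xs = [] \<and> ys = []") auto
  qed
  note l = w_lift[OF V this, folded letter_def]
  show "linear_map K T V \<pi>" by (rule l(1))
  show "xs \<in> L \<Longrightarrow> \<pi> (w xs) = (if length xs = 1 then hd xs else \<zero>\<^bsub>V\<^esub>)" by (rule l(2))
qed

lemmas \<pi>_closed = lin_closed[OF \<pi>_lin]

lemma S: "module K (scalar_module K)"
  by (rule scalar_module_module[OF R.is_cring])

lemma \<epsilon>_lin: "linear_map K T (scalar_module K) \<epsilon>" and \<epsilon>_word: "xs \<in> L \<Longrightarrow> \<epsilon> (w xs) = (if xs = [] then \<one>\<^bsub>K\<^esub> else \<zero>\<^bsub>K\<^esub>)"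
proof -
  have "multilinear K V (scalar_module K) (\<lambda>xs. if xs = [] then \<one>\<^bsub>K\<^esub> else \<zero>\<^bsub>K\<^esub>)"
    by (rule multilinearI) (use lin_zero_fun[OF S, of V] in auto)
  note l = w_lift[OF S this]
  show "linear_map K T (scalar_module K) \<epsilon>" "xs \<in> L \<Longrightarrow> \<epsilon> (w xs) = (if xs = [] then \<one>\<^bsub>K\<^esub> else \<zero>\<^bsub>K\<^esub>)"
    using l by (simp_all add: tensor_coalgebra_def Let_def)
qed

lemma \<epsilon>_closed: "x \<in> carrier T \<Longrightarrow> \<epsilon> x \<in> carrier K"
  using lin_closed[OF \<epsilon>_lin] by simp

lemma \<Delta>_lin: "linear_map K T TT \<Delta>"
  and \<Delta>_word: "xs \<in> L \<Longrightarrow> \<Delta> (w xs) = (\<Oplus>\<^bsub>TT\<^esub>i \<in> {0..length xs}. p (w (take i xs)) (w (drop i xs)))"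
proof -
  have "multilinear K V TT (\<lambda>xs. p (w (take i xs)) (w (drop i xs)))" for i
    by (rule multilinear_take_drop[where b="\<lambda>a b. p (w a) (w b)"])
      (auto intro!: multilinear_comp[OF w_multi] bilin_left[OF p_bilin] bilin_right[OF p_bilin] w_closed)
  from multilinear_finsum[OF TT this, where I="\<lambda>n. {0..n}"]
  have "multilinear K V TT (\<lambda>xs. \<Oplus>\<^bsub>TT\<^esub>i \<in> {0..length xs}. p (w (take i xs)) (w (drop i xs)))" .
  note l = w_lift[OF TT this]
  show "linear_map K T TT \<Delta>" "xs \<in> L \<Longrightarrow> \<Delta> (w xs) = (\<Oplus>\<^bsub>TT\<^esub>i \<in> {0..length xs}. p (w (take i xs)) (w (drop i xs)))"
    using l by (simp_all add: tensor_coalgebra_def Let_def)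
qed

lemmas \<Delta>_closed = lin_closed[OF \<Delta>_lin]

lemma peel_lin: "linear_map K TT T (peel K V)"
  and peel_pure: "a \<in> carrier T \<Longrightarrow> b \<in> carrier T \<Longrightarrow> peel K V (p a b) = cc (w [\<pi> a]) b"
proof -
  have "linear_map K V T (\<lambda>v. w [v])" using multilinear_linear[OF w_multi, of "[]" "[]"] by simp
  from bilin_comp[OF cc_bilin lin_comp[OF \<pi>_lin this] lin_id lin_id]
  have b: "bilinear K T T T (\<lambda>a b. case (a, b) of (a, b) \<Rightarrow> cc (w [\<pi> a]) b)" by simp
  show "linear_map K TT T (peel K V)" "a \<in> carrier T \<Longrightarrow> b \<in> carrier T \<Longrightarrow> peel K V (p a b) = cc (w [\<pi> a]) b"
    using tensor_lift[OF T T T b] by (simp_all add: peel_def)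
qed

lemma letter_lin: "linear_map K V T (\<lambda>v. w [v])"
  using multilinear_linear[OF w_multi, of "[]" "[]"] by simp

lemma w_zero_letter: "w [\<zero>\<^bsub>V\<^esub>] = \<zero>\<^bsub>T\<^esub>"
  by (rule lin_zero[OF letter_lin V T])

lemma cc_zero: "x \<in> carrier T \<Longrightarrow> cc \<zero>\<^bsub>T\<^esub> x = \<zero>\<^bsub>T\<^esub>"
  by (rule lin_zero[OF cc_left T T])

text \<open>Iterating this recovers a tensor from the counits and letters of its iterated coproducts.\<close>

lemma peel_\<Delta>:
  assumes "x \<in> carrier T"
  shows "\<epsilon> x \<odot>\<^bsub>T\<^esub> w [] \<oplus>\<^bsub>T\<^esub> peel K V (\<Delta> x) = x"
proof (rule w_eqI[where f="\<lambda>x. \<epsilon> x \<odot>\<^bsub>T\<^esub> w [] \<oplus>\<^bsub>T\<^esub> peel K V (\<Delta> x)", OF T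
      lin_add_fun[OF lin_scale[OF T \<epsilon>_lin] lin_comp[OF \<Delta>_lin peel_lin] T] lin_id _ assms])
  show w0: "w [] \<in> carrier T" by (simp add: w_closed)
  fix xs assume xs: "xs \<in> L"
  let ?f = "\<lambda>i. cc (w [\<pi> (w (take i xs))]) (w (drop i xs))"
  have fc: "?f i \<in> carrier T" for i
    using \<pi>_closed[OF w_closed[OF take_L[OF xs, of i]]] by (intro cc_closed w_closed drop_L xs) simp
  have "peel K V (\<Delta> (w xs)) = (\<Oplus>\<^bsub>T\<^esub>i \<in> {0..length xs}. peel K V (p (w (take i xs)) (w (drop i xs))))"
    unfolding \<Delta>_word[OF xs]
    by (rule lin_finsum[OF peel_lin TT T]) (intro p_closed w_closed take_L drop_L xs)
  also have "\<dots> = (\<Oplus>\<^bsub>T\<^esub>i \<in> {0..length xs}. ?f i)"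
    by (intro T.finsum_eqI refl fc peel_pure w_closed take_L drop_L xs)
  also have "\<dots> = (if xs = [] then \<zero>\<^bsub>T\<^esub> else w xs)"
  proof -
    \<comment> \<open>The letter projection kills every prefix whose length is not one, so only the
      cut after the first letter contributes.\<close>
    have z: "?f i = \<zero>\<^bsub>T\<^esub>" if "i \<noteq> 1 \<or> xs = []" "i \<le> length xs" for i
    proof -
      have "length (take i xs) \<noteq> 1" using that by auto
      then show ?thesis
        using \<pi>_word[OF take_L[OF xs], of i] cc_zero[OF w_closed[OF drop_L[OF xs]]] w_zero_letter by simp
    qed
    show ?thesis
    proof (cases "xs = []")
      case True
      have "(\<Oplus>\<^bsub>T\<^esub>i \<in> {0..length xs}. ?f i) = \<zero>\<^bsub>T\<^esub>" using z True by (intro T.add.finprod_one_eqI) auto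
      then show ?thesis using True by simp
    next
      case False
      then obtain a as where as: "xs = a # as" by (cases xs) auto
      have "(\<Oplus>\<^bsub>T\<^esub>i \<in> {0..length xs}. ?f i) = (\<Oplus>\<^bsub>T\<^esub>i \<in> {1}. ?f i)"
      proof (rule T.finsum_mono_neutral[symmetric])
        show "{1} \<subseteq> {0..length xs}" using as by simp
        show "?f i = \<zero>\<^bsub>T\<^esub>" if "i \<in> {0..length xs} - {1}" for i using that by (intro z) auto
      qed (simp, rule fc)
      also have "\<dots> = ?f 1" using fc[of 1] by simp
      also have "\<dots> = w xs" using xs as \<pi>_word[of "[a]"] cc_word[of "[a]" as] by simp
      finally show ?thesis using as by simp
    qed
  qed
  finally show "\<epsilon> (w xs) \<odot>\<^bsub>T\<^esub> w [] \<oplus>\<^bsub>T\<^esub> peel K V (\<Delta> (w xs)) = w xs"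
    using xs w0 w_closed[OF xs] by (simp add: \<epsilon>_word)
qed

text \<open>The cuts of \<open>xs @ ys\<close> up to position \<open>length xs\<close> come from
  \<open>\<Delta> x\<close>, those from that position on come from \<open>\<Delta> y\<close>. The
  cut exactly between the words is counted twice, which accounts for the summand
  \<open>p x y\<close>.\<close>

lemma \<Delta>_cc:
  assumes x: "x \<in> carrier T" and y: "y \<in> carrier T"
  shows "\<Delta> (cc x y) \<oplus>\<^bsub>TT\<^esub> p x y = tensor_map K T T (cc x) (\<lambda>b. b) (\<Delta> y) \<oplus>\<^bsub>TT\<^esub> tensor_map K T T (\<lambda>a. a) (\<lambda>b. cc b y) (\<Delta> x)"
proof -
  note tl = tensor_map_linear[OF T T T T cc_right lin_id] and tr = tensor_map_linear[OF T T T T lin_id cc_left]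
  have lb: "bilinear K T TT TT (\<lambda>x. tensor_map K T T (cc x) (\<lambda>b. b))"
  proof (rule bilin_from_span[OF T TT TT tensor_spans[OF T T] tl(1)])
    fix s assume "s \<in> {p v w |v w. v \<in> carrier T \<and> w \<in> carrier T}"
    then obtain a b where s: "s = p a b" "a \<in> carrier T" "b \<in> carrier T" by auto
    show "linear_map K T TT (\<lambda>v. tensor_map K T T (cc v) (\<lambda>b. b) s)"
      by (rule lin_congI[OF lin_comp[OF cc_left[OF s(2)] bilin_left[OF p_bilin s(3)]] T])
        (simp add: s tl)
  qed
  have rb: "bilinear K T TT TT (\<lambda>y. tensor_map K T T (\<lambda>b. b) (\<lambda>b. cc b y))"
  proof (rule bilin_from_span[OF T TT TT tensor_spans[OF T T] tr(1)])
    fix s assume "s \<in> {p v w |v w. v \<in> carrier T \<and> w \<in> carrier T}"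
    then obtain a b where s: "s = p a b" "a \<in> carrier T" "b \<in> carrier T" by auto
    show "linear_map K T TT (\<lambda>v. tensor_map K T T (\<lambda>b. b) (\<lambda>b. cc b v) s)"
      by (rule lin_congI[OF lin_comp[OF cc_right[OF s(3)] bilin_right[OF p_bilin s(2)]] T])
        (simp add: s tr)
  qed
  have b1: "bilinear K T T TT (\<lambda>x y. \<Delta> (cc x y) \<oplus>\<^bsub>TT\<^esub> p x y)"
    using bilin_comp[OF cc_bilin lin_id lin_id \<Delta>_lin] p_bilin
    by (simp add: bilinear_def lin_add_fun TT)
  have b2: "bilinear K T T TT (\<lambda>x y. tensor_map K T T (cc x) (\<lambda>b. b) (\<Delta> y) \<oplus>\<^bsub>TT\<^esub> tensor_map K T T (\<lambda>a. a) (\<lambda>b. cc b y) (\<Delta> x))"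
    using bilin_comp[OF lb lin_id \<Delta>_lin lin_id] bilin_comp[OF rb lin_id \<Delta>_lin lin_id]
    by (simp add: bilinear_def lin_add_fun TT)
  show ?thesis
  proof (rule w_bilin_eqI[OF TT b1 b2 _ x y])
    fix xs ys assume xs: "xs \<in> L" and ys: "ys \<in> L"
    then have xys: "xs @ ys \<in> L" by simp
    let ?m = "length xs" and ?n = "length ys"
    let ?f = "\<lambda>k. p (w (take k (xs @ ys))) (w (drop k (xs @ ys)))"
    have fc: "?f k \<in> carrier TT" for k by (intro p_closed w_closed take_L drop_L xys)
    have pc: "p (w (take i zs)) (w (drop i zs)) \<in> carrier TT" if "zs \<in> L" for i zs
      by (intro p_closed w_closed take_L drop_L that)
    have l: "tensor_map K T T (cc (w xs)) (\<lambda>b. b) (\<Delta> (w ys)) = (\<Oplus>\<^bsub>TT\<^esub>k \<in> {?m..?m + ?n}. ?f k)"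
    proof -
      have "tensor_map K T T (cc (w xs)) (\<lambda>b. b) (\<Delta> (w ys)) =
        (\<Oplus>\<^bsub>TT\<^esub>j \<in> {0..?n}. tensor_map K T T (cc (w xs)) (\<lambda>b. b) (p (w (take j ys)) (w (drop j ys))))"
        unfolding \<Delta>_word[OF ys] by (rule lin_finsum[OF tl(1) TT TT pc]) (use xs ys w_closed in auto)
      also have "\<dots> = (\<Oplus>\<^bsub>TT\<^esub>k \<in> {?m..?m + ?n}. ?f k)"
      proof (rule TT.finsum_bij[where h="\<lambda>j. ?m + j", OF _ fc])
        show "bij_betw (\<lambda>j. ?m + j) {0..?n} {?m..?m + ?n}" by (simp add: bij_betw_def)
        fix j
        show "tensor_map K T T (cc (w xs)) (\<lambda>b. b) (p (w (take j ys)) (w (drop j ys))) = ?f (?m + j)"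
          by (subst tl(2)) (use xs ys take_L drop_L in \<open>simp_all add: cc_word w_closed\<close>)
      qed
      finally show ?thesis .
    qed
    have r: "tensor_map K T T (\<lambda>a. a) (\<lambda>b. cc b (w ys)) (\<Delta> (w xs)) = (\<Oplus>\<^bsub>TT\<^esub>k \<in> {0..?m}. ?f k)"
    proof -
      have "tensor_map K T T (\<lambda>a. a) (\<lambda>b. cc b (w ys)) (\<Delta> (w xs)) =
        (\<Oplus>\<^bsub>TT\<^esub>j \<in> {0..?m}. tensor_map K T T (\<lambda>a. a) (\<lambda>b. cc b (w ys)) (p (w (take j xs)) (w (drop j xs))))"
        unfolding \<Delta>_word[OF xs] by (rule lin_finsum[OF tr(1) TT TT pc]) (use xs ys w_closed in auto)
      also have "\<dots> = (\<Oplus>\<^bsub>TT\<^esub>k \<in> {0..?m}. ?f k)"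
      proof (rule TT.finsum_eqI[OF refl fc])
        fix j assume "j \<in> {0..?m}"
        then show "tensor_map K T T (\<lambda>a. a) (\<lambda>b. cc b (w ys)) (p (w (take j xs)) (w (drop j xs))) = ?f j"
          by (subst tr(2)) (use xs ys take_L drop_L in \<open>simp_all add: cc_word w_closed\<close>)
      qed
      finally show ?thesis .
    qed
    have "{0..?m + ?n} = {0..?m} \<union> {?m<..?m + ?n}" by auto
    then have 1: "\<Delta> (w (xs @ ys)) = (\<Oplus>\<^bsub>TT\<^esub>k \<in> {0..?m}. ?f k) \<oplus>\<^bsub>TT\<^esub> (\<Oplus>\<^bsub>TT\<^esub>k \<in> {?m<..?m + ?n}. ?f k)"
      unfolding \<Delta>_word[OF xys] length_append by (simp only:) (rule TT.finsum_Un_disjoint, use fc in auto)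
    have "{?m..?m + ?n} = insert ?m {?m<..?m + ?n}" by auto
    then have 2: "(\<Oplus>\<^bsub>TT\<^esub>k \<in> {?m..?m + ?n}. ?f k) = p (w xs) (w ys) \<oplus>\<^bsub>TT\<^esub> (\<Oplus>\<^bsub>TT\<^esub>k \<in> {?m<..?m + ?n}. ?f k)"
      by (simp only:) (subst TT.finsum_insert, use fc xs ys p_closed w_closed in auto)
    have c: "(\<Oplus>\<^bsub>TT\<^esub>k \<in> A. ?f k) \<in> carrier TT" for A by (intro TT.finsum_closed) (use fc in auto)
    show "\<Delta> (cc (w xs) (w ys)) \<oplus>\<^bsub>TT\<^esub> p (w xs) (w ys) = tensor_map K T T (cc (w xs)) (\<lambda>b. b) (\<Delta> (w ys)) \<oplus>\<^bsub>TT\<^esub>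
      tensor_map K T T (\<lambda>a. a) (\<lambda>b. cc b (w ys)) (\<Delta> (w xs))"
      unfolding l r cc_word[OF xs ys] 1 2
      using c[of "{0..?m}"] c[of "{?m<..?m + ?n}"] p_closed[OF w_closed[OF xs] w_closed[OF ys]]
      by (simp add: TT.a_ac)
  qed
qed

lemma infinitesimal: "infinitesimal_comult K T \<Delta> cc"
  by (intro infinitesimal_comult.intro linear_comult.intro infinitesimal_comult_axioms.intro T \<Delta>_lin cc_bilin cc_assoc \<Delta>_cc)

lemma \<epsilon>_cc:
  assumes x: "x \<in> carrier T" and y: "y \<in> carrier T"
  shows "\<epsilon> (cc x y) = \<epsilon> x \<otimes>\<^bsub>K\<^esub> \<epsilon> y"
proof (rule w_bilin_eqI[where f="\<lambda>x y. \<epsilon> (cc x y)" and g="\<lambda>x y. \<epsilon> x \<otimes>\<^bsub>K\<^esub> \<epsilon> y", OF S bilin_comp[OF cc_bilin lin_id lin_id \<epsilon>_lin] _ _ x y])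
  show "bilinear K T T (scalar_module K) (\<lambda>x y. \<epsilon> x \<otimes>\<^bsub>K\<^esub> \<epsilon> y)"
    by (intro bilinearI linear_mapI)
      (auto simp: \<epsilon>_closed lin_add[OF \<epsilon>_lin] lin_smult[OF \<epsilon>_lin] R.l_distr R.r_distr R.m_assoc R.m_lcomm)
qed (auto simp: cc_word \<epsilon>_word)

lemma \<Delta>_unit: "\<Delta> (w []) = p (w []) (w [])"
  using p_closed[OF w_closed w_closed, of "[]" "[]"] by (simp add: \<Delta>_word)

lemma \<Delta>_letter: "v \<in> carrier V \<Longrightarrow> \<Delta> (w [v]) = p (w []) (w [v]) \<oplus>\<^bsub>TT\<^esub> p (w [v]) (w [])"
proof -
  assume v: "v \<in> carrier V"
  have "{0..length [v]} = {0, 1}" by auto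
  then show ?thesis unfolding \<Delta>_word[OF Cons_in_lists_iff[THEN iffD2, OF conjI[OF v lists.Nil]]]
    using v by (simp add: p_closed w_closed)
qed

text \<open>Words are concatenation products of letters, so the axioms propagate from the empty word
  and the primitive letters by the infinitesimal relation; no triple sum of cuts has to be
  handled.\<close>

lemma coassoc_counit: "x \<in> carrier T \<Longrightarrow> coassoc_at K T \<Delta> x \<and> counit_at K T \<Delta> \<epsilon> x"
proof -
  interpret I: infinitesimal_comult K T \<Delta> cc by (rule infinitesimal)
  note c = counit_maps[OF T \<epsilon>_lin]
  have w0: "w [] \<in> carrier T" by (simp add: w_closed)
  have wl: "w [v] \<in> carrier T" if "v \<in> carrier V" for v using that by (simp add: w_closed)
  have 0: "coassoc_at K T \<Delta> (w []) \<and> counit_at K T \<Delta> \<epsilon> (w [])"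
    by (simp add: I.coassoc_at_iff \<Delta>_unit I.\<alpha>_pure I.\<beta>_pure I.\<rho>_pure w0 counit_at_def c \<epsilon>_word)
  have 1: "coassoc_at K T \<Delta> (w [v]) \<and> counit_at K T \<Delta> \<epsilon> (w [v])" if v: "v \<in> carrier V" for v
    using w0 wl[OF v] v bilin_closed[OF pure_tensor_bilinear[OF T TT]] p_closed
    by (simp add: I.coassoc_at_iff \<Delta>_letter \<Delta>_unit lin_add[OF I.\<alpha>_lin] lin_add[OF I.\<beta>_lin] I.\<alpha>_pure I.\<beta>_pure I.\<rho>_pure
        lin_add[OF I.\<rho>_lin] lin_add[OF bilin_right[OF I.p3_bilin]]
        counit_at_def c lin_add[OF c(1)] lin_add[OF c(3)] \<epsilon>_word I.A3.a_ac)
  have 2: "coassoc_at K T \<Delta> (w xs) \<and> counit_at K T \<Delta> \<epsilon> (w xs)" if "xs \<in> L" for xs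
    using that
  proof (induction xs)
    case (Cons a xs)
    then have "w (a # xs) = cc (w [a]) (w xs)" by (subst cc_word) auto
    then show ?case
      using Cons 1[of a] I.coassoc_at_dot[of "w [a]" "w xs"] I.counit_at_dot[OF \<epsilon>_lin \<epsilon>_cc, of "w [a]" "w xs"] wl
      by (simp add: w_closed)
  qed (use 0 in simp)
  assume x: "x \<in> carrier T"
  have "carrier T \<subseteq> {x \<in> carrier T. coassoc_at K T \<Delta> x}" "carrier T \<subseteq> {x \<in> carrier T. counit_at K T \<Delta> \<epsilon> x}"
    using w_spans I.coassoc_at_submodule I.counit_at_submodule[OF \<epsilon>_lin] 2 w_closed
    unfolding spans_def by (auto simp: image_subset_iff)
  then show "coassoc_at K T \<Delta> x \<and> counit_at K T \<Delta> \<epsilon> x" using x by auto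
qed

text \<open>The counit axiom forces \<open>\<epsilon> x = 0\<close>. In \<open>peel_\<Delta>\<close>
  the summand with the empty word on the left vanishes, and the other one is the letter of
  \<open>x\<close>. Thus the primitive elements of \<open>T(V)\<close> are the letters.\<close>

lemma primitive_word:
  assumes x: "x \<in> carrier T" and D: "\<Delta> x = p x (w []) \<oplus>\<^bsub>TT\<^esub> p (w []) x"
  shows "x = w [\<pi> x]"
proof -
  have w0: "w [] \<in> carrier T" by (simp add: w_closed)
  note c = counit_maps[OF T \<epsilon>_lin]
  have wl: "w [\<pi> x] \<in> carrier T" using x by (simp add: w_closed \<pi>_closed)
  have "lift_quot K T (\<lambda>(a, b). \<epsilon> a \<odot>\<^bsub>T\<^esub> b) (\<Delta> x) = x" using coassoc_counit[OF x] by (simp add: counit_at_def)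
  then have "\<epsilon> x \<odot>\<^bsub>T\<^esub> w [] \<oplus>\<^bsub>T\<^esub> x = x"
    unfolding D using x w0 p_closed by (simp add: lin_add[OF c(1)] c(2) \<epsilon>_word)
  then have "\<epsilon> x \<odot>\<^bsub>T\<^esub> w [] = \<zero>\<^bsub>T\<^esub>" using x w0 \<epsilon>_closed[OF x] by (simp add: T.add.r_cancel_one)
  moreover have "peel K V (\<Delta> x) = w [\<pi> x]"
    unfolding D using x w0 p_closed wl
    by (simp add: lin_add[OF peel_lin] peel_pure \<pi>_word w_zero_letter cc_zero cc_unit)
  ultimately show ?thesis using peel_\<Delta>[OF x] wl by simp
qed

end

section \<open>The product on the tensor coalgebra of a \<open>B\<^sub>\<infinity>\<close>-algebra\<close>

text \<open>In contrast to \<open>cuts\<close>, the number of blocks is free and empty pairs are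
  excluded, which keeps the set finite. The lists left out contribute zero because
  \<open>M [] [] = 0\<close>.\<close>

definition blocks :: "'a list \<Rightarrow> 'a list \<Rightarrow> ('a list \<times> 'a list) list set"
  where "blocks us vs = {ps. ([], []) \<notin> set ps \<and> concat (map fst ps) = us \<and> concat (map snd ps) = vs}"

lemma finite_cuts: "finite (cuts l us vs)"
proof -
  let ?A = "\<lambda>us. {xs. set xs \<subseteq> set us \<and> length xs \<le> length us}"
  have fin: "finite (?A us)" for us :: "'b list" by (rule finite_lists_length_le) simp
  have 1: "xs \<in> ?A (concat xss)" if "xs \<in> set xss" for xs and xss :: "'b list list"
    using that by (induction xss) auto
  have "cuts l us vs \<subseteq> {ps. set ps \<subseteq> ?A us \<times> ?A vs \<and> length ps = l}"
  proof
    fix ps assume ps: "ps \<in> cuts l us vs"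
    have c: "concat (map fst ps) = us" "concat (map snd ps) = vs" using ps by (simp_all add: cuts_def)
    have "set ps \<subseteq> ?A us \<times> ?A vs"
    proof
      fix x assume "x \<in> set ps"
      then have m: "fst x \<in> set (map fst ps)" "snd x \<in> set (map snd ps)" by auto
      show "x \<in> ?A us \<times> ?A vs" using 1[OF m(1), unfolded c] 1[OF m(2), unfolded c]
        by (simp add: mem_Times_iff)
    qed
    then show "ps \<in> {ps. set ps \<subseteq> ?A us \<times> ?A vs \<and> length ps = l}" using ps by (simp add: cuts_def)
  qed
  then show ?thesis by (rule finite_subset) (intro finite_lists_length_eq finite_cartesian_product fin)
qed

text \<open>Every pair takes up at least one letter. This bound makes \<open>blocks\<close>
  finite.\<close>

lemma length_blocks: "ps \<in> blocks us vs \<Longrightarrow> length ps \<le> length us + length vs"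
proof (induction ps arbitrary: us vs)
  case (Cons p ps)
  obtain a b where p: "p = (a, b)" by (cases p)
  have "length ps \<le> length (concat (map fst ps)) + length (concat (map snd ps))"
    by (rule Cons.IH) (use Cons.prems in \<open>auto simp: blocks_def\<close>)
  moreover have "us = a @ concat (map fst ps)" "vs = b @ concat (map snd ps)" "length a + length b \<ge> 1"
    using Cons.prems p by (cases a; cases b; auto simp: blocks_def)+
  ultimately show ?case by simp
qed simp

lemma blocks_cuts: "blocks us vs = {ps \<in> (\<Union>l\<in>{0..length us + length vs}. cuts l us vs). ([], []) \<notin> set ps}"
  using length_blocks[of _ us vs] by (auto simp: cuts_def blocks_def)

lemma finite_blocks: "finite (blocks us vs)"
  unfolding blocks_cuts by (simp add: finite_cuts)

lemma blocks_Nil: "blocks [] [] = {[]}"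
proof -
  have "ps = []" if "ps \<in> blocks [] []" for ps :: "('b list \<times> 'b list) list"
    using length_blocks[OF that] by simp
  then show ?thesis by (auto simp: blocks_def)
qed

lemma blocks_letters: "ps \<in> blocks us vs \<Longrightarrow> p \<in> set ps \<Longrightarrow> set (fst p) \<subseteq> set us \<and> set (snd p) \<subseteq> set vs"
  by (auto simp: blocks_def)

text \<open>The index set of the product of the coproducts of two words: one cut position in
  each.\<close>

definition cut_points :: "'a list \<Rightarrow> 'b list \<Rightarrow> (nat \<times> nat) set"
  where "cut_points us vs = {0..length us} \<times> {0..length vs}"

text \<open>The first pair of blocks is given by a cut point; \<open>(0, 0)\<close> is left out
  because a pair may not be empty on both sides.\<close>

lemma blocks_Cons:
  assumes "us \<noteq> [] \<or> vs \<noteq> []"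
  shows "blocks us vs = (\<Union>z \<in> cut_points us vs - {(0, 0)}.
    (#) (take (fst z) us, take (snd z) vs) ` blocks (drop (fst z) us) (drop (snd z) vs))" (is "_ = ?R")
proof
  show "blocks us vs \<subseteq> ?R"
  proof
    fix ps assume ps: "ps \<in> blocks us vs"
    with assms obtain a b qs where p: "ps = (a, b) # qs" by (cases ps) (auto simp: blocks_def)
    have "us = a @ concat (map fst qs)" "vs = b @ concat (map snd qs)" "a \<noteq> [] \<or> b \<noteq> []" "qs \<in> blocks (concat (map fst qs)) (concat (map snd qs))"
      using ps p by (auto simp: blocks_def)
    then have "ps \<in> (#) (take (length a) us, take (length b) vs) ` blocks (drop (length a) us) (drop (length b) vs)"
      "(length a, length b) \<in> cut_points us vs - {(0, 0)}"
      using p by (auto simp: cut_points_def)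
    then show "ps \<in> ?R" by force
  qed
  show "?R \<subseteq> blocks us vs"
    by (auto simp: blocks_def cut_points_def)
qed

context abelian_monoid begin

lemma finsum_blocks_Cons:
  assumes "us \<noteq> [] \<or> vs \<noteq> []" "\<And>ps. ps \<in> blocks us vs \<Longrightarrow> f ps \<in> carrier G"
  shows "(\<Oplus>ps\<in>blocks us vs. f ps) = (\<Oplus>z \<in> cut_points us vs - {(0, 0)}.
    \<Oplus>ps\<in>blocks (drop (fst z) us) (drop (snd z) vs). f ((take (fst z) us, take (snd z) vs) # ps))"
proof -
  let ?I = "cut_points us vs - {(0, 0)}"
  let ?B = "\<lambda>z. (#) (take (fst z) us, take (snd z) vs) ` blocks (drop (fst z) us) (drop (snd z) vs)"
  have c: "f ps \<in> carrier G" if "z \<in> ?I" "ps \<in> ?B z" for z ps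
    using that assms(2) unfolding blocks_Cons[OF assms(1)] by blast
  have fin: "finite ?I" by (simp add: cut_points_def)
  have "(\<Oplus>ps\<in>blocks us vs. f ps) = (\<Oplus>ps\<in>(\<Union>z\<in>?I. ?B z). f ps)"
    by (rule finsum_eqI[OF blocks_Cons[OF assms(1)] _ refl]) (use c in blast)
  also have "\<dots> = (\<Oplus>z\<in>?I. \<Oplus>ps\<in>?B z. f ps)"
  proof (rule add.finprod_UN_disjoint[OF fin])
    show "pairwise (\<lambda>i j. disjnt (?B i) (?B j)) ?I"
    proof (rule pairwiseI)
      fix i j assume ij: "i \<in> ?I" "j \<in> ?I" "i \<noteq> j"
      obtain i1 i2 j1 j2 where ij': "i = (i1, i2)" "j = (j1, j2)" by (cases i; cases j)
      have "(take (fst i) us, take (snd i) vs) \<noteq> (take (fst j) us, take (snd j) vs)"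
      proof
        assume "(take (fst i) us, take (snd i) vs) = (take (fst j) us, take (snd j) vs)"
        then have "length (take (fst i) us) = length (take (fst j) us)" "length (take (snd i) vs) = length (take (snd j) vs)" by simp_all
        then show False using ij unfolding ij' by (auto simp: cut_points_def min_def split: if_splits)
      qed
      then show "disjnt (?B i) (?B j)" by (auto simp: disjnt_def)
    qed
  qed (use c in \<open>auto simp: finite_blocks\<close>)
  also have "\<dots> = (\<Oplus>z \<in> ?I. \<Oplus>ps\<in>blocks (drop (fst z) us) (drop (snd z) vs). f ((take (fst z) us, take (snd z) vs) # ps))"
  proof (rule finsum_eqI[OF refl])
    fix z assume z: "z \<in> ?I"
    show "(\<Oplus>ps\<in>blocks (drop (fst z) us) (drop (snd z) vs). f ((take (fst z) us, take (snd z) vs) # ps)) \<in> carrier G"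
      by (rule finsum_closed) (use c[OF z] in auto)
    show "(\<Oplus>ps\<in>?B z. f ps) = (\<Oplus>ps\<in>blocks (drop (fst z) us) (drop (snd z) vs). f ((take (fst z) us, take (snd z) vs) # ps))"
      by (rule finsum_reindex) (use c[OF z] in \<open>auto simp: inj_on_def\<close>)
  qed
  finally show ?thesis .
qed

text \<open>The sums in the axioms of a \<open>B\<^sub>\<infinity>\<close>-algebra run over cuts
  with a prescribed number of blocks, empty pairs included. A list without empty pairs has between 1
  and \<open>length us + length vs\<close> blocks, and the lists with an empty pair vanish.\<close>

lemma finsum_cuts:
  assumes "\<And>l ps. ps \<in> cuts l us vs \<Longrightarrow> f ps \<in> carrier G" "us \<noteq> [] \<or> vs \<noteq> []"
    and "\<And>l ps. ps \<in> cuts l us vs \<Longrightarrow> ([], []) \<in> set ps \<Longrightarrow> f ps = \<zero>"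
  shows "(\<Oplus>l\<in>{1..length us + length vs}. \<Oplus>ps\<in>cuts l us vs. f ps) = (\<Oplus>ps\<in>blocks us vs. f ps)"
proof -
  let ?C = "Sigma {1..length us + length vs} (\<lambda>l. cuts l us vs)" and ?B = "(\<lambda>ps. (length ps, ps)) ` blocks us vs"
  have fC: "finite ?C" by (intro finite_SigmaI) (auto simp: finite_cuts)
  have len: "length ps \<in> {1..length us + length vs}" if "ps \<in> blocks us vs" for ps
    using length_blocks[OF that] that assms(2) by (cases ps) (auto simp: blocks_def)
  have BC: "?B \<subseteq> ?C" using len by (auto simp: blocks_def cuts_def)
  have "(\<Oplus>l\<in>{1..length us + length vs}. \<Oplus>ps\<in>cuts l us vs. f ps) = (\<Oplus>z\<in>?C. f (snd z))"
    by (rule finsum_Sigma) (use assms(1) in \<open>auto simp: finite_cuts\<close>)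
  also have "\<dots> = (\<Oplus>z\<in>?B. f (snd z))"
  proof (rule finsum_mono_neutral[OF fC BC, symmetric])
    fix z assume z: "z \<in> ?C - ?B"
    then have "snd z \<in> cuts (fst z) us vs" "([], []) \<in> set (snd z)"
      by (auto simp: cuts_def blocks_def image_iff)
    then show "f (snd z) = \<zero>" by (rule assms(3))
  qed (use BC assms(1) in auto)
  also have "\<dots> = (\<Oplus>ps\<in>blocks us vs. f ps)"
    by (subst finsum_reindex) (use assms(1) BC in \<open>auto simp: inj_on_def image_subset_iff\<close>)
  finally show ?thesis .
qed

end

lemma bilinear_finsum:
  assumes b: "bilinear K V W U b" and m: "module K V" "module K W" "module K U"
    and f: "\<And>i. i \<in> I \<Longrightarrow> f i \<in> carrier V" and g: "\<And>j. j \<in> J \<Longrightarrow> g j \<in> carrier W" and fin: "finite I" "finite J"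
  shows "b (finsum V f I) (finsum W g J) = (\<Oplus>\<^bsub>U\<^esub>z\<in>I \<times> J. b (f (fst z)) (g (snd z)))"
proof -
  interpret V: module K V by fact
  interpret W: module K W by fact
  interpret U: module K U by fact
  have gc: "finsum W g J \<in> carrier W" using g by (intro W.finsum_closed) auto
  have "b (finsum V f I) (finsum W g J) = (\<Oplus>\<^bsub>U\<^esub>i\<in>I. b (f i) (finsum W g J))"
    by (rule lin_finsum[OF bilin_left[OF b gc] m(1,3) f])
  also have "\<dots> = (\<Oplus>\<^bsub>U\<^esub>i\<in>I. \<Oplus>\<^bsub>U\<^esub>j\<in>J. b (f i) (g j))"
    by (rule U.finsum_eqI[OF refl])
      (auto intro!: U.finsum_closed bilin_closed[OF b] f g lin_finsum[OF bilin_right[OF b] m(2,3)])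
  also have "\<dots> = (\<Oplus>\<^bsub>U\<^esub>z\<in>I \<times> J. b (f (fst z)) (g (snd z)))"
    by (rule U.finsum_Sigma) (auto intro!: bilin_closed[OF b] f g fin)
  finally show ?thesis .
qed

lemma (in words) coalg_unique:
  fixes size :: "'i \<Rightarrow> nat"
  assumes F: "\<And>x. x \<in> X \<Longrightarrow> F x \<in> carrier T" and G: "\<And>x. x \<in> X \<Longrightarrow> G x \<in> carrier T"
    and lr: "\<And>x j. x \<in> X \<Longrightarrow> j \<in> J x \<Longrightarrow> l x j \<in> X \<and> r x j \<in> X"
    and DF: "\<And>x. x \<in> X \<Longrightarrow> \<Delta> (F x) = (\<Oplus>\<^bsub>TT\<^esub>j\<in>J x. p (F (l x j)) (F (r x j)))"
    and DG: "\<And>x. x \<in> X \<Longrightarrow> \<Delta> (G x) = (\<Oplus>\<^bsub>TT\<^esub>j\<in>J x. p (G (l x j)) (G (r x j)))"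
    and e: "\<And>x. x \<in> X \<Longrightarrow> \<epsilon> (F x) = \<epsilon> (G x)" and pi: "\<And>x. x \<in> X \<Longrightarrow> \<pi> (F x) = \<pi> (G x)"
    and size: "\<And>x j. x \<in> X \<Longrightarrow> j \<in> J x \<Longrightarrow> size (r x j) < size x \<or> \<pi> (F (l x j)) = \<zero>\<^bsub>V\<^esub>"
    and x: "x \<in> X"
  shows "F x = G x"
  using x
proof (induction x rule: measure_induct_rule[where f=size])
  case (less x)
  have wl: "w [v] \<in> carrier T" if "v \<in> carrier V" for v using that by (simp add: w_closed)
  have rec: "F x = \<epsilon> (F x) \<odot>\<^bsub>T\<^esub> w [] \<oplus>\<^bsub>T\<^esub> (\<Oplus>\<^bsub>T\<^esub>j\<in>J x. cc (w [\<pi> (F (l x j))]) (F (r x j)))"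
    if x: "x \<in> X" and F: "\<And>x. x \<in> X \<Longrightarrow> F x \<in> carrier T" and DF: "\<Delta> (F x) = (\<Oplus>\<^bsub>TT\<^esub>j\<in>J x. p (F (l x j)) (F (r x j)))" for F x
  proof -
    have "peel K V (\<Delta> (F x)) = (\<Oplus>\<^bsub>T\<^esub>j\<in>J x. peel K V (p (F (l x j)) (F (r x j))))"
      unfolding DF by (rule lin_finsum[OF peel_lin TT T]) (use lr[OF x] F p_closed in blast)
    also have "\<dots> = (\<Oplus>\<^bsub>T\<^esub>j\<in>J x. cc (w [\<pi> (F (l x j))]) (F (r x j)))"
      by (rule T.finsum_eqI[OF refl]) (use lr[OF x] in \<open>auto intro!: peel_pure F cc_closed wl \<pi>_closed\<close>)
    finally show ?thesis using peel_\<Delta>[OF F[OF x]] by simp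
  qed
  have "(\<Oplus>\<^bsub>T\<^esub>j\<in>J x. cc (w [\<pi> (F (l x j))]) (F (r x j))) = (\<Oplus>\<^bsub>T\<^esub>j\<in>J x. cc (w [\<pi> (G (l x j))]) (G (r x j)))"
  proof (rule T.finsum_eqI[OF refl])
    fix j assume j: "j \<in> J x"
    note lrj = lr[OF less.prems j]
    show "cc (w [\<pi> (G (l x j))]) (G (r x j)) \<in> carrier T" using lrj by (intro cc_closed wl \<pi>_closed G) auto
    have "\<pi> (F (l x j)) = \<pi> (G (l x j))" using pi lrj by simp
    moreover have "F (r x j) = G (r x j)" if "size (r x j) < size x" using less.IH[OF that] lrj by simp
    ultimately show "cc (w [\<pi> (F (l x j))]) (F (r x j)) = cc (w [\<pi> (G (l x j))]) (G (r x j))"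
      using size[OF less.prems j] lrj F G by (auto simp: w_zero_letter cc_zero)
  qed
  then show ?case
    using rec[OF less.prems F DF[OF less.prems]] rec[OF less.prems G DG[OF less.prems]] e[OF less.prems] by simp
qed

text \<open>The candidate for a coalgebra map \<open>T(V) \<otimes> T(V) \<rightarrow> T(V)\<close>
  with letter components \<open>M\<close>: both words are cut into simultaneous blocks, and
  \<open>M\<close> turns each pair of blocks into a letter. If \<open>M [x] [] = x\<close>,
  \<open>M [] [x] = x\<close> and \<open>M\<close> is zero otherwise, this is the shuffle
  product.\<close>

definition "star_word K V M us vs = (\<Oplus>\<^bsub>words_module K V\<^esub>ps\<in>blocks us vs. word K V (map (\<lambda>(a, b). M a b) ps))"

definition "star_prod K V M X Y = lift_quot K (words_module K V) (\<lambda>us. lift_quot K (words_module K V) (star_word K V M us) Y) X"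

definition "star_alg K V M = (let T = words_module K V in
    \<lparr>carrier = carrier T, mult = star_prod K V M, one = word K V [], zero = zero T, add = add T, smult = smult T,
     dot = word_concat K V\<rparr>)"

lemma star_alg_simps:
  "carrier (star_alg K V M) = carrier (words_module K V)" "mult (star_alg K V M) = star_prod K V M"
  "one (star_alg K V M) = word K V []" "zero (star_alg K V M) = zero (words_module K V)"
  "add (star_alg K V M) = add (words_module K V)" "smult (star_alg K V M) = smult (words_module K V)"
  "dot (star_alg K V M) = word_concat K V"
  by (simp_all add: star_alg_def Let_def)

definition "star_bialg K V M =
    with_coalgebra (star_alg K V M) (comult (tensor_coalgebra K V)) (counit (tensor_coalgebra K V))"

lemma star_bialg_simps:
  "carrier (star_bialg K V M) = carrier (words_module K V)" "mult (star_bialg K V M) = star_prod K V M"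
  "one (star_bialg K V M) = word K V []" "zero (star_bialg K V M) = zero (words_module K V)"
  "add (star_bialg K V M) = add (words_module K V)" "smult (star_bialg K V M) = smult (words_module K V)"
  "comult (star_bialg K V M) = comult (tensor_coalgebra K V)" "counit (star_bialg K V M) = counit (tensor_coalgebra K V)"
  by (simp_all add: star_bialg_def star_alg_simps)

text \<open>The axioms enter in layers: multilinearity here, the unit in \<open>binf_star\<close>,
  the associativity relation in \<open>binf_words\<close>. For a cofree bialgebra the last layer is
  reached only after its product has been identified with \<open>star_prod\<close>, and this
  identification rests on the first layer.\<close>

locale star_words = words K V for K :: "('k, 'm) ring_scheme" and V :: "('k, 'a, 'x) module_scheme" +
  fixes M :: "'a list \<Rightarrow> 'a list \<Rightarrow> 'a"
  assumes M1: "\<And>vs. vs \<in> lists (carrier V) \<Longrightarrow> multilinear K V V (\<lambda>us. M us vs)"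
    and M2: "\<And>us. us \<in> lists (carrier V) \<Longrightarrow> multilinear K V V (M us)"
    and M00: "M [] [] = \<zero>\<^bsub>V\<^esub>"
begin

abbreviation "S \<equiv> star_word K V M"
abbreviation "mm \<equiv> map (\<lambda>(a, b). M a b)"
abbreviation "st \<equiv> star_prod K V M"

text \<open>Exchanging the arguments of \<open>M\<close> preserves the assumptions, so statements
  about one argument of the product transfer to the other.\<close>

lemma swap: "star_words K V (\<lambda>us vs. M vs us)"
  by unfold_locales (auto intro: M1 M2 M00)

lemma M_closed: "us \<in> L \<Longrightarrow> vs \<in> L \<Longrightarrow> M us vs \<in> carrier V"
  by (rule multilinear_closed[OF M2])

lemma blocks_L:
  assumes "us \<in> L" "vs \<in> L" "ps \<in> blocks us vs"
  shows "mm ps \<in> L"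
proof -
  have "M (fst x) (snd x) \<in> carrier V" if x: "x \<in> set ps" for x
    using blocks_letters[OF assms(3) x] assms(1,2) by (intro M_closed) auto
  then show ?thesis by (auto simp: in_lists_conv_set case_prod_beta)
qed

lemma S_closed: "us \<in> L \<Longrightarrow> vs \<in> L \<Longrightarrow> S us vs \<in> carrier T"
  unfolding star_word_def by (intro T.finsum_closed Pi_I w_closed blocks_L)

lemma S_swap: "us \<in> L \<Longrightarrow> vs \<in> L \<Longrightarrow> star_word K V (\<lambda>us vs. M vs us) vs us = S us vs"
  unfolding star_word_def
proof (rule T.finsum_bij[where h="map prod.swap"])
  show "bij_betw (map prod.swap) (blocks vs us) (blocks us vs)"
    by (rule bij_betw_byWitness[where f'="map prod.swap"]) (auto simp: blocks_def comp_def)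
qed (rule w_closed[OF blocks_L], assumption+, simp add: comp_def split_def)

lemma S_Nil: "S [] [] = w []"
  by (simp add: star_word_def blocks_Nil w_closed)

lemma S_rec:
  assumes us: "us \<in> L" and vs: "vs \<in> L" and ne: "us \<noteq> [] \<or> vs \<noteq> []"
  shows "S us vs = (\<Oplus>\<^bsub>T\<^esub>z \<in> cut_points us vs - {(0, 0)}.
    cc (w [M (take (fst z) us) (take (snd z) vs)]) (S (drop (fst z) us) (drop (snd z) vs)))"
proof -
  have wc: "ps \<in> blocks us vs \<Longrightarrow> w (mm ps) \<in> carrier T" for ps by (rule w_closed[OF blocks_L[OF us vs]])
  show ?thesis
    unfolding star_word_def[of K V M us vs]
  proof (rule trans[OF T.finsum_blocks_Cons[OF ne wc] T.finsum_eqI[OF refl]], assumption)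
  fix z
  note tl = take_L[OF us, of "fst z"] take_L[OF vs, of "snd z"] and dl = drop_L[OF us, of "fst z"] drop_L[OF vs, of "snd z"]
  have ml: "[M (take (fst z) us) (take (snd z) vs)] \<in> L" using M_closed[OF tl] by simp
  show "cc (w [M (take (fst z) us) (take (snd z) vs)]) (S (drop (fst z) us) (drop (snd z) vs)) \<in> carrier T"
    by (intro cc_closed w_closed ml S_closed dl)
  have "(\<Oplus>\<^bsub>T\<^esub>ps\<in>blocks (drop (fst z) us) (drop (snd z) vs). w (mm ((take (fst z) us, take (snd z) vs) # ps)))
    = (\<Oplus>\<^bsub>T\<^esub>ps\<in>blocks (drop (fst z) us) (drop (snd z) vs). cc (w [M (take (fst z) us) (take (snd z) vs)]) (w (mm ps)))"
  proof (rule T.finsum_eqI[OF refl])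
    fix ps assume ps: "ps \<in> blocks (drop (fst z) us) (drop (snd z) vs)"
    show "cc (w [M (take (fst z) us) (take (snd z) vs)]) (w (mm ps)) \<in> carrier T"
      by (intro cc_closed w_closed ml blocks_L[OF dl ps])
    show "w (mm ((take (fst z) us, take (snd z) vs) # ps)) = cc (w [M (take (fst z) us) (take (snd z) vs)]) (w (mm ps))"
      by (subst cc_word[OF ml blocks_L[OF dl ps]]) simp
  qed
  also have "\<dots> = cc (w [M (take (fst z) us) (take (snd z) vs)]) (S (drop (fst z) us) (drop (snd z) vs))"
    unfolding star_word_def
    by (rule lin_finsum[OF cc_right[OF w_closed[OF ml]] T T w_closed[OF blocks_L[OF dl]], symmetric])
  finally show "(\<Oplus>\<^bsub>T\<^esub>ps\<in>blocks (drop (fst z) us) (drop (snd z) vs). w (mm ((take (fst z) us, take (snd z) vs) # ps)))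
    = cc (w [M (take (fst z) us) (take (snd z) vs)]) (S (drop (fst z) us) (drop (snd z) vs))" .
  qed
qed

text \<open>The set \<open>blocks us vs\<close> contains the letters themselves and changes when one
  of them varies, so the defining sum is not a sum of linear maps over a fixed index set. The
  recursion \<open>S_rec\<close> runs over cut points, which depend on lengths only; the varied
  letter lies either in the first block, where \<open>M\<close> is linear, or in the rest, where
  induction applies.\<close>

lemma S_multilinear_left:
  assumes vs: "vs \<in> L" shows "multilinear K V T (\<lambda>us. S us vs)"
proof (rule multilinearI)
  show "xs \<in> L \<Longrightarrow> S xs vs \<in> carrier T" for xs by (rule S_closed[OF _ vs])
  fix xs ys assume "xs \<in> L" "ys \<in> L"
  with vs show "linear_map K V T (\<lambda>v. S (xs @ [v] @ ys) vs)"
  proof (induction "length xs + length vs" arbitrary: xs vs rule: less_induct)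
    case less
    \<comment> \<open>The letter zero is a placeholder; only the length of the word matters
      here.\<close>
    let ?I = "cut_points (xs @ [\<zero>\<^bsub>V\<^esub>] @ ys) vs - {(0, 0)}"
    let ?f = "\<lambda>z v. cc (w [M (take (fst z) (xs @ [v] @ ys)) (take (snd z) vs)]) (S (drop (fst z) (xs @ [v] @ ys)) (drop (snd z) vs))"
    have "linear_map K V T (\<lambda>v. \<Oplus>\<^bsub>T\<^esub>z\<in>?I. ?f z v)"
    proof (rule lin_finsum_fun[OF T])
      fix z assume z: "z \<in> ?I"
      note tv = take_L[OF less.prems(1), of "snd z"] and dv = drop_L[OF less.prems(1), of "snd z"]
      show "linear_map K V T (?f z)"
      proof (cases "fst z \<le> length xs")
        case True
        have "length (drop (fst z) xs) + length (drop (snd z) vs) < length xs + length vs"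
          using z True by (cases z) (auto simp: cut_points_def)
        from less.hyps[OF this dv drop_L[OF less.prems(2)] less.prems(3)]
        have l: "linear_map K V T (\<lambda>v. S (drop (fst z) xs @ [v] @ ys) (drop (snd z) vs))" .
        have "w [M (take (fst z) xs) (take (snd z) vs)] \<in> carrier T"
          using M_closed[OF take_L[OF less.prems(2)] tv] by (simp add: w_closed)
        from lin_comp[OF l cc_right[OF this]] show ?thesis using True by simp
      next
        case False
        then obtain j where j: "fst z = length xs + Suc j" using less_imp_Suc_add[of "length xs" "fst z"] by auto
        have "linear_map K V T (\<lambda>v. cc (w [M (xs @ [v] @ take j ys) (take (snd z) vs)]) (S (drop j ys) (drop (snd z) vs)))"
          using lin_comp[OF lin_comp[OF multilinear_linear[OF M1[OF tv] less.prems(2) take_L[OF less.prems(3)]] letter_lin]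
             cc_left[OF S_closed[OF drop_L[OF less.prems(3)] dv]]] .
        then show ?thesis using j by simp
      qed
    qed
    then show ?case
    proof (rule lin_congI[OF _ V])
      fix v assume "v \<in> carrier V"
      then have "xs @ [v] @ ys \<in> L" using less.prems by auto
      from S_rec[OF this less.prems(1)] show "S (xs @ [v] @ ys) vs = (\<Oplus>\<^bsub>T\<^esub>z\<in>?I. ?f z v)"
        by (simp add: cut_points_def)
    qed
  qed
qed

lemma S_multilinear_right:
  assumes us: "us \<in> L" shows "multilinear K V T (S us)"
proof -
  have m: "multilinear K V T (\<lambda>vs. star_word K V (\<lambda>us vs. M vs us) vs us)"
    by (rule star_words.S_multilinear_left[OF swap us])
  show ?thesis
  proof (rule multilinearI)
    show "xs \<in> L \<Longrightarrow> S us xs \<in> carrier T" for xs by (rule S_closed[OF us])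
    fix xs ys assume *: "xs \<in> L" "ys \<in> L"
    show "linear_map K V T (\<lambda>v. S us (xs @ [v] @ ys))"
    proof (rule lin_congI[OF multilinear_linear[OF m *] V])
      fix v assume "v \<in> carrier V"
      then have "xs @ [v] @ ys \<in> L" using * by auto
      then show "S us (xs @ [v] @ ys) = star_word K V (\<lambda>us vs. M vs us) (xs @ [v] @ ys) us"
        by (rule S_swap[OF us, symmetric])
    qed
  qed
qed

lemma st_bilin: "bilinear K T T T st"
  and st_word: "us \<in> L \<Longrightarrow> vs \<in> L \<Longrightarrow> st (w us) (w vs) = S us vs"
  using w_lift2[OF T S_multilinear_right S_multilinear_left] unfolding star_prod_def[abs_def] by auto

lemmas st_closed = bilin_closed[OF st_bilin]
lemmas st_left = bilin_left[OF st_bilin]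
lemmas st_right = bilin_right[OF st_bilin]

text \<open>A word of length one arises only from the trivial block list, which consists of the pair
  of whole words. For two empty words this list is absent and both sides are zero by
  \<open>M00\<close>.\<close>

lemma \<pi>_S: assumes us: "us \<in> L" and vs: "vs \<in> L" shows "\<pi> (S us vs) = M us vs"
proof -
  have wc: "ps \<in> blocks us vs \<Longrightarrow> w (mm ps) \<in> carrier T" for ps by (rule w_closed[OF blocks_L[OF us vs]])
  have wv: "ps \<in> blocks us vs \<Longrightarrow> \<pi> (w (mm ps)) = (if length ps = 1 then hd (mm ps) else \<zero>\<^bsub>V\<^esub>)" for ps
    using \<pi>_word[OF blocks_L[OF us vs]] by simp
  have "\<pi> (S us vs) = (\<Oplus>\<^bsub>V\<^esub>ps\<in>blocks us vs. \<pi> (w (mm ps)))"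
    unfolding star_word_def by (rule lin_finsum[OF \<pi>_lin T V wc])
  also have "\<dots> = M us vs"
  proof (cases "us = [] \<and> vs = []")
    case True
    then show ?thesis by (simp add: blocks_Nil \<pi>_word M00)
  next
    case False
    have b: "[(us, vs)] \<in> blocks us vs" using False by (auto simp: blocks_def)
    have "(\<Oplus>\<^bsub>V\<^esub>ps\<in>blocks us vs. \<pi> (w (mm ps))) = (\<Oplus>\<^bsub>V\<^esub>ps\<in>{[(us, vs)]}. \<pi> (w (mm ps)))"
    proof (rule M.finsum_mono_neutral[symmetric, OF finite_blocks])
      show "{[(us, vs)]} \<subseteq> blocks us vs" using b by simp
      fix ps assume ps: "ps \<in> blocks us vs - {[(us, vs)]}"
      then have "length ps \<noteq> 1" by (auto simp: blocks_def length_Suc_conv)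
      then show "\<pi> (w (mm ps)) = \<zero>\<^bsub>V\<^esub>" using wv ps by simp
    next
      fix ps assume "ps \<in> {[(us, vs)]}"
      then show "\<pi> (w (mm ps)) \<in> carrier V" using b \<pi>_closed[OF wc] by blast
    qed
    also have "\<dots> = M us vs" using wv[OF b] M_closed[OF us vs] by simp
    finally show ?thesis .
  qed
  finally show ?thesis .
qed

lemma \<epsilon>_S: assumes us: "us \<in> L" and vs: "vs \<in> L" shows "\<epsilon> (S us vs) = (if us = [] \<and> vs = [] then \<one>\<^bsub>K\<^esub> else \<zero>\<^bsub>K\<^esub>)"
proof (cases "us = [] \<and> vs = []")
  case True
  then show ?thesis by (simp add: S_Nil \<epsilon>_word)
next
  case False
  interpret S: module K "scalar_module K" by (rule words.S[OF words_axioms])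
  have wc: "ps \<in> blocks us vs \<Longrightarrow> w (mm ps) \<in> carrier T" for ps by (rule w_closed[OF blocks_L[OF us vs]])
  have ne: "ps \<in> blocks us vs \<Longrightarrow> ps \<noteq> []" for ps using False by (auto simp: blocks_def)
  have "\<epsilon> (S us vs) = (\<Oplus>\<^bsub>scalar_module K\<^esub>ps\<in>blocks us vs. \<epsilon> (w (mm ps)))"
    unfolding star_word_def by (rule lin_finsum[OF \<epsilon>_lin T words.S[OF words_axioms] wc])
  also have "\<dots> = \<zero>\<^bsub>scalar_module K\<^esub>"
    by (rule S.add.finprod_one_eqI) (simp add: \<epsilon>_word[OF blocks_L[OF us vs]] ne)
  finally show ?thesis by (simp only: if_not_P[OF False] scalar_module_simps)
qed

text \<open>Cutting a word of blocks after \<open>i\<close> blocks is the same as cutting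
  \<open>us\<close> and \<open>vs\<close> at one position each and choosing block lists for the two
  halves.\<close>

lemma \<Delta>_S:
  assumes us: "us \<in> L" and vs: "vs \<in> L"
  shows "\<Delta> (S us vs) = (\<Oplus>\<^bsub>TT\<^esub>z\<in>cut_points us vs.
    p (S (take (fst z) us) (take (snd z) vs)) (S (drop (fst z) us) (drop (snd z) vs)))"
proof -
  have wc: "ps \<in> blocks us vs \<Longrightarrow> w (mm ps) \<in> carrier T" for ps by (rule w_closed[OF blocks_L[OF us vs]])
  note bl = blocks_L[OF us vs]
  note btk = w_closed[OF blocks_L[OF take_L[OF us] take_L[OF vs]]]
  note bdr = w_closed[OF blocks_L[OF drop_L[OF us] drop_L[OF vs]]]
  let ?A = "Sigma (blocks us vs) (\<lambda>ps. {0..length ps})"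
  let ?B = "Sigma (cut_points us vs) (\<lambda>z. blocks (take (fst z) us) (take (snd z) vs) \<times> blocks (drop (fst z) us) (drop (snd z) vs))"
  let ?g = "\<lambda>x. p (w (mm (take (snd x) (fst x)))) (w (mm (drop (snd x) (fst x))))"
  let ?h = "\<lambda>x. p (w (mm (fst (snd x)))) (w (mm (snd (snd x))))"
  let ?\<eta> = "\<lambda>x. (fst (snd x) @ snd (snd x), length (fst (snd x)))"
  \<comment> \<open>The inverse of \<open>?\<eta>\<close>: the cut point is recovered as the total
    lengths of the first \<open>i\<close> blocks.\<close>
  let ?\<gamma> = "\<lambda>x. ((length (concat (map fst (take (snd x) (fst x)))), length (concat (map snd (take (snd x) (fst x))))), take (snd x) (fst x), drop (snd x) (fst x))"
  have gc: "?g x \<in> carrier TT" if xA: "x \<in> ?A" for x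
  proof -
    obtain ps i where y: "x = (ps, i)" "ps \<in> blocks us vs" using xA by blast
    show ?thesis
      unfolding y(1) fst_conv snd_conv take_map[symmetric] drop_map[symmetric]
      by (intro p_closed w_closed take_L drop_L bl y(2))
  qed
  have "\<Delta> (S us vs) = (\<Oplus>\<^bsub>TT\<^esub>ps\<in>blocks us vs. \<Delta> (w (mm ps)))"
    unfolding star_word_def by (rule lin_finsum[OF \<Delta>_lin T TT wc])
  also have "\<dots> = (\<Oplus>\<^bsub>TT\<^esub>ps\<in>blocks us vs. \<Oplus>\<^bsub>TT\<^esub>i\<in>{0..length ps}. ?g (ps, i))"
    by (rule TT.finsum_eqI[OF refl])
      (use gc \<Delta>_word[OF bl] in \<open>auto intro!: TT.finsum_closed simp: take_map drop_map\<close>)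
  also have "\<dots> = (\<Oplus>\<^bsub>TT\<^esub>x\<in>?A. ?g x)"
    by (subst TT.finsum_Sigma) (use gc in \<open>auto simp: finite_blocks\<close>)
  also have "\<dots> = (\<Oplus>\<^bsub>TT\<^esub>x\<in>?B. ?h x)"
  proof (rule TT.finsum_bij[where h="?\<eta>", symmetric, OF _ gc])
    show "bij_betw ?\<eta> ?B ?A"
    proof (rule bij_betw_byWitness[where f'="?\<gamma>"])
      show "\<forall>x\<in>?B. ?\<gamma> (?\<eta> x) = x"
        by (auto simp: blocks_def cut_points_def)
      show "\<forall>x\<in>?A. ?\<eta> (?\<gamma> x) = x"
        by auto
      show "?\<eta> ` ?B \<subseteq> ?A"
        by (auto simp: blocks_def)
      show "?\<gamma> ` ?A \<subseteq> ?B"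
      proof
        fix y assume "y \<in> ?\<gamma> ` ?A"
        then obtain ps i where ps: "ps \<in> blocks us vs" "i \<le> length ps"
          and y: "y = ((length (concat (map fst (take i ps))), length (concat (map snd (take i ps)))), take i ps, drop i ps)" by auto
        have u: "us = concat (map fst (take i ps)) @ concat (map fst (drop i ps))"
          "vs = concat (map snd (take i ps)) @ concat (map snd (drop i ps))"
          using ps by (simp_all add: blocks_def concat_append[symmetric] map_append[symmetric] del: concat_append map_append)
        have n: "([], []) \<notin> set (take i ps)" "([], []) \<notin> set (drop i ps)"
          using ps by (auto simp: blocks_def dest: in_set_takeD in_set_dropD)
        let ?a = "concat (map fst (take i ps))" and ?b = "concat (map snd (take i ps))"
        have "take (length ?a) us = ?a" "drop (length ?a) us = concat (map fst (drop i ps))" "length ?a \<le> length us"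
          by (subst u(1), simp only: append_eq_conv_conj length_append append_take_drop_id take_append drop_append diff_self_eq_0 take_0 drop_0 append_Nil2 take_all_iff le_refl drop_all append_Nil le_add1)+
        moreover have "take (length ?b) vs = ?b" "drop (length ?b) vs = concat (map snd (drop i ps))" "length ?b \<le> length vs"
          by (subst u(2), simp only: append_eq_conv_conj length_append append_take_drop_id take_append drop_append diff_self_eq_0 take_0 drop_0 append_Nil2 take_all_iff le_refl drop_all append_Nil le_add1)+
        ultimately show "y \<in> ?B" unfolding y using n by (simp add: cut_points_def blocks_def)
      qed
    qed
  qed (assumption, simp)
  also have "\<dots> = (\<Oplus>\<^bsub>TT\<^esub>z\<in>cut_points us vs. \<Oplus>\<^bsub>TT\<^esub>y\<in>blocks (take (fst z) us) (take (snd z) vs) \<times> blocks (drop (fst z) us) (drop (snd z) vs).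
     p (w (mm (fst y))) (w (mm (snd y))))"
    by (subst TT.finsum_Sigma) (auto simp: finite_blocks cut_points_def intro!: p_closed intro: btk bdr)
  also have "\<dots> = (\<Oplus>\<^bsub>TT\<^esub>z\<in>cut_points us vs.
    p (S (take (fst z) us) (take (snd z) vs)) (S (drop (fst z) us) (drop (snd z) vs)))"
  proof (rule TT.finsum_eqI[OF refl])
    fix z
    show "p (S (take (fst z) us) (take (snd z) vs)) (S (drop (fst z) us) (drop (snd z) vs)) \<in> carrier TT"
      by (intro p_closed S_closed take_L drop_L us vs)
    show "(\<Oplus>\<^bsub>TT\<^esub>y\<in>blocks (take (fst z) us) (take (snd z) vs) \<times> blocks (drop (fst z) us) (drop (snd z) vs).
     p (w (mm (fst y))) (w (mm (snd y)))) = p (S (take (fst z) us) (take (snd z) vs)) (S (drop (fst z) us) (drop (snd z) vs))"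
      unfolding star_word_def
      by (rule bilinear_finsum[OF p_bilin T T TT _ _ finite_blocks finite_blocks, symmetric])
        (rule btk bdr, assumption)+
  qed
  finally show ?thesis .
qed

end

lemma assoc_algebra_struct_cong:
  fixes K :: "('k, 'm) ring_scheme" and A :: "('k, 'a, 'x) module_scheme" and B :: "('k, 'a, 'y) module_scheme"
  assumes "carrier B = carrier A" "add B = add A" "zero B = zero A" "smult B = smult A" "mult B = mult A" "one B = one A"
  shows "assoc_algebra K B \<longleftrightarrow> assoc_algebra K A"
proof -
  have 1: "assoc_algebra K Y" if X: "assoc_algebra K X" and
    c: "carrier Y = carrier X" "add Y = add X" "zero Y = zero X" "smult Y = smult X" "mult Y = mult X" "one Y = one X"
    for X :: "('k, 'a, 'z) module_scheme" and Y :: "('k, 'a, 'w) module_scheme"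
  proof -
    interpret X: ring X by (rule assoc_algebraD[OF X])
    show ?thesis
    proof (rule assoc_algebraI[OF _ _ _ spans_carrier])
      show "module K Y" by (rule module_cong[OF assoc_algebraD(1)[OF X]]) (simp_all add: c)
      show "bilinear K Y Y Y (mult Y)"
        using assoc_algebra_bilinear[OF X] by (subst bilin_struct_cong[of _ X _ X _ X]) (simp_all add: c)
    qed (simp_all add: c X.m_assoc)
  qed
  show ?thesis using 1[of A B] 1[of B A] assms by auto
qed

lemma tensor_cong:
  assumes "carrier V' = carrier V" "add V' = add V" "smult V' = smult V" "mult V' = mult V" "one V' = one V"
    and "carrier W' = carrier W" "add W' = add W" "smult W' = smult W" "mult W' = mult W" "one W' = one W"
  shows "tensor K V' W' = tensor K V W"
  unfolding tensor_def tensor_space_struct_cong[OF assms(1-3,6-8)] assms ..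

lemma dot_alg_simps [simp]:
  "carrier (dot_alg A) = carrier A" "add (dot_alg A) = add A" "zero (dot_alg A) = zero A"
  "smult (dot_alg A) = smult A" "one (dot_alg A) = one A" "mult (dot_alg A) = dot A"
  by (simp_all add: dot_alg_def)

text \<open>Since 1 is a unit for \<open>dot\<close>, multiplication by \<open>x \<otimes> 1\<close>
  from the left and by \<open>1 \<otimes> y\<close> from the right each act on one tensor factor.
  This turns the relation in the definition of a 2-associative bialgebra into the form used by
  \<open>infinitesimal_comult\<close>.\<close>

lemma infinitesimal_iff:
  assumes A: "two_as_algebra K A" and D: "linear_map K A (tensor K A A) \<Delta>" and x: "x \<in> carrier A" and y: "y \<in> carrier A"
  defines "D \<equiv> tensor K (dot_alg A) (dot_alg A)" and "p \<equiv> pure_tensor K A A" and "T \<equiv> tensor K A A"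
  shows "\<Delta> (dot A x y) = (p x \<one>\<^bsub>A\<^esub> \<otimes>\<^bsub>D\<^esub> \<Delta> y \<oplus>\<^bsub>D\<^esub> \<Delta> x \<otimes>\<^bsub>D\<^esub> p \<one>\<^bsub>A\<^esub> y) \<ominus>\<^bsub>D\<^esub> p x y \<longleftrightarrow>
    \<Delta> (dot A x y) \<oplus>\<^bsub>T\<^esub> p x y = tensor_map K A A (dot A x) (\<lambda>b. b) (\<Delta> y) \<oplus>\<^bsub>T\<^esub> tensor_map K A A (\<lambda>a. a) (\<lambda>b. dot A b y) (\<Delta> x)"
proof -
  have a1: "assoc_algebra K A" and a2: "assoc_algebra K (dot_alg A)" using A by (simp_all add: two_as_algebra_def)
  note m = assoc_algebraD(1)[OF a1] and m2 = assoc_algebraD(1)[OF a2]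
  note b2 = assoc_algebra_bilinear[OF a2]
  interpret dm: monoid "dot_alg A" by (rule assoc_algebraD[OF a2])
  have one: "\<one>\<^bsub>A\<^esub> \<in> carrier A" using dm.one_closed by simp
  have u: "dot A \<one>\<^bsub>A\<^esub> a = a" "dot A a \<one>\<^bsub>A\<^esub> = a" if "a \<in> carrier A" for a
    using dm.l_one[of a] dm.r_one[of a] that by simp_all
  have bd: "bilinear K A A A (dot A)"
    using b2 by (subst (asm) bilin_struct_cong[of _ A _ A _ A]) simp_all
  have dc: "dot A a b \<in> carrier A" if "a \<in> carrier A" "b \<in> carrier A" for a b using bilin_closed[OF bd that] .
  have c: "carrier D = carrier T" "zero D = zero T" "add D = add T" "smult D = smult T"
    unfolding D_def T_def by (rule tensor_struct_cong; simp)+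
  have pd: "pure_tensor K (dot_alg A) (dot_alg A) = p" unfolding p_def by (rule tensor_space_struct_cong) simp_all
  have T: "module K T" unfolding T_def by (rule tensor_module[OF m m])
  interpret T: module K T by (rule T)
  note D' = D[folded T_def]
  note mp = tensor_mult_bilinear_pure(2)[OF m2 m2 b2 b2, unfolded pd, folded D_def, simplified]
  have mb: "bilinear K T T T (mult D)"
    using tensor_mult_bilinear_pure(1)[OF m2 m2 b2 b2] unfolding D_def[symmetric]
    by (subst (asm) bilin_struct_cong[of _ T _ T _ T]) (simp_all add: c)
  note pc = pure_tensor_closed[OF m m, folded p_def T_def]
  note l = tensor_map_linear[OF m m m m bilin_right[OF bd x] lin_id, folded p_def T_def]
  note r = tensor_map_linear[OF m m m m lin_id bilin_left[OF bd y], folded p_def T_def]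
  note eqI = tensor_eqI[OF m m T, folded p_def T_def]
  have 1: "p x \<one>\<^bsub>A\<^esub> \<otimes>\<^bsub>D\<^esub> Y = tensor_map K A A (dot A x) (\<lambda>b. b) Y" if Y: "Y \<in> carrier T" for Y
    by (rule eqI[OF bilin_right[OF mb pc[OF x one]] l(1) _ Y]) (simp add: mp l x one u)
  have 2: "X \<otimes>\<^bsub>D\<^esub> p \<one>\<^bsub>A\<^esub> y = tensor_map K A A (\<lambda>a. a) (\<lambda>b. dot A b y) X" if X: "X \<in> carrier T" for X
    by (rule eqI[where f="\<lambda>X. X \<otimes>\<^bsub>D\<^esub> p \<one>\<^bsub>A\<^esub> y", OF bilin_left[OF mb pc[OF one y]] r(1) _ X]) (simp add: mp r y one u)
  have cl: "\<Delta> (dot A x y) \<in> carrier T" "p x y \<in> carrier T" "tensor_map K A A (dot A x) (\<lambda>b. b) (\<Delta> y) \<in> carrier T"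
    "tensor_map K A A (\<lambda>a. a) (\<lambda>b. dot A b y) (\<Delta> x) \<in> carrier T"
    by (intro lin_closed[OF D'] lin_closed[OF l(1)] lin_closed[OF r(1)] pc dc x y)+
  have e: "a = b \<ominus>\<^bsub>T\<^esub> d \<longleftrightarrow> a \<oplus>\<^bsub>T\<^esub> d = b" if "a \<in> carrier T" "b \<in> carrier T" "d \<in> carrier T" for a b d
  proof
    assume "a = b \<ominus>\<^bsub>T\<^esub> d"
    then show "a \<oplus>\<^bsub>T\<^esub> d = b" using that by (simp add: a_minus_def T.a_assoc T.l_neg)
  next
    assume "a \<oplus>\<^bsub>T\<^esub> d = b"
    then have "b \<ominus>\<^bsub>T\<^esub> d = a" using that by (auto simp: a_minus_def T.a_assoc T.r_neg)
    then show "a = b \<ominus>\<^bsub>T\<^esub> d" by simp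
  qed
  show ?thesis
    unfolding 1[OF lin_closed[OF D' y]] 2[OF lin_closed[OF D' x]] c(3) a_minus_struct_cong[OF c(1,3,2)]
    using cl by (intro e) auto
qed

locale binf_star = star_words +
  assumes M_unit: "\<And>x. x \<in> carrier V \<Longrightarrow> M [x] [] = x" "\<And>x. x \<in> carrier V \<Longrightarrow> M [] [x] = x"
    and M_unit0: "\<And>us. us \<in> lists (carrier V) \<Longrightarrow> length us \<ge> 2 \<Longrightarrow> M us [] = \<zero>\<^bsub>V\<^esub>"
      "\<And>us. us \<in> lists (carrier V) \<Longrightarrow> length us \<ge> 2 \<Longrightarrow> M [] us = \<zero>\<^bsub>V\<^esub>"

section \<open>Compatibility with the coproduct, unit and associativity\<close>

context star_words begin

abbreviation "E \<equiv> star_alg K V M"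
abbreviation "TE \<equiv> tensor K E E"

lemma TE: "carrier TE = carrier TT" "zero TE = zero TT" "add TE = add TT" "smult TE = smult TT" "pure_tensor K E E = p"
  by (rule tensor_struct_cong tensor_space_struct_cong; simp add: star_alg_simps)+

lemma E: "module K E"
  by (rule module_cong[OF T]) (simp_all add: star_alg_simps)

lemma E_bilin: "bilinear K E E E (mult E)"
  using st_bilin by (subst bilin_struct_cong[of _ T _ T _ T]) (simp_all add: star_alg_simps)

lemma TE_bilin: "bilinear K TT TT TT (mult TE)"
  using tensor_mult_bilinear_pure(1)[OF E E E_bilin E_bilin]
  by (subst (asm) bilin_struct_cong[of _ TT _ TT _ TT]) (simp_all add: TE)

lemma TE_pure: "a \<in> carrier T \<Longrightarrow> b \<in> carrier T \<Longrightarrow> c \<in> carrier T \<Longrightarrow> d \<in> carrier T \<Longrightarrow>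
    p a b \<otimes>\<^bsub>TE\<^esub> p c d = p (st a c) (st b d)"
  using tensor_mult_bilinear_pure(2)[OF E E E_bilin E_bilin, of a b c d] unfolding TE by (simp add: star_alg_simps)

text \<open>A cut point of two words is a pair of cut positions, so the terms in
  \<open>\<Delta>_S\<close> are those of the product of the two deconcatenations.\<close>

lemma \<Delta>_st:
  assumes "x \<in> carrier T" "y \<in> carrier T"
  shows "\<Delta> (st x y) = \<Delta> x \<otimes>\<^bsub>TE\<^esub> \<Delta> y"
proof (rule w_bilin_eqI[where f="\<lambda>x y. \<Delta> (st x y)" and g="\<lambda>x y. \<Delta> x \<otimes>\<^bsub>TE\<^esub> \<Delta> y", OF TT
      bilin_comp[OF st_bilin lin_id lin_id \<Delta>_lin]
      bilin_comp[OF TE_bilin \<Delta>_lin \<Delta>_lin lin_id] _ assms])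
  fix us vs assume us: "us \<in> L" and vs: "vs \<in> L"
  note cl = w_closed[OF take_L[OF us]] w_closed[OF take_L[OF vs]] w_closed[OF drop_L[OF us]] w_closed[OF drop_L[OF vs]]
  have "\<Delta> (w us) \<otimes>\<^bsub>TE\<^esub> \<Delta> (w vs) = (\<Oplus>\<^bsub>TT\<^esub>z\<in>{0..length us} \<times> {0..length vs}.
      p (w (take (fst z) us)) (w (drop (fst z) us)) \<otimes>\<^bsub>TE\<^esub> p (w (take (snd z) vs)) (w (drop (snd z) vs)))"
    unfolding \<Delta>_word[OF us] \<Delta>_word[OF vs]
    by (rule bilinear_finsum[OF TE_bilin TT TT TT]) (simp_all add: p_closed cl)
  also have "\<dots> = (\<Oplus>\<^bsub>TT\<^esub>z\<in>cut_points us vs. p (S (take (fst z) us) (take (snd z) vs)) (S (drop (fst z) us) (drop (snd z) vs)))"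
    by (rule TT.finsum_eqI)
      (simp_all only: cut_points_def TE_pure[OF cl(1,3,2,4)] st_word[OF take_L[OF us] take_L[OF vs]]
        st_word[OF drop_L[OF us] drop_L[OF vs]] p_closed[OF S_closed[OF take_L[OF us] take_L[OF vs]] S_closed[OF drop_L[OF us] drop_L[OF vs]]])
  finally show "\<Delta> (st (w us) (w vs)) = \<Delta> (w us) \<otimes>\<^bsub>TE\<^esub> \<Delta> (w vs)"
    by (simp only: st_word[OF us vs] \<Delta>_S[OF us vs])
qed

lemma \<epsilon>_st:
  assumes x: "x \<in> carrier T" and y: "y \<in> carrier T"
  shows "\<epsilon> (st x y) = \<epsilon> x \<otimes>\<^bsub>K\<^esub> \<epsilon> y"
proof (rule w_bilin_eqI[where f="\<lambda>x y. \<epsilon> (st x y)" and g="\<lambda>x y. \<epsilon> x \<otimes>\<^bsub>K\<^esub> \<epsilon> y", OF words.S[OF words_axioms]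
    bilin_comp[OF st_bilin lin_id lin_id \<epsilon>_lin] _ _ x y])
  show "bilinear K T T (scalar_module K) (\<lambda>x y. \<epsilon> x \<otimes>\<^bsub>K\<^esub> \<epsilon> y)"
    by (intro bilinearI linear_mapI)
      (auto simp: \<epsilon>_closed lin_add[OF \<epsilon>_lin] lin_smult[OF \<epsilon>_lin] R.l_distr R.r_distr R.m_assoc R.m_lcomm)
  fix us vs assume "us \<in> L" "vs \<in> L"
  then show "\<epsilon> (st (w us) (w vs)) = \<epsilon> (w us) \<otimes>\<^bsub>K\<^esub> \<epsilon> (w vs)" by (simp add: st_word \<epsilon>_S \<epsilon>_word)
qed

text \<open>One side of the associativity relation of a \<open>B\<^sub>\<infinity>\<close>-algebra,
  recognised as the letter component of a triple product; \<open>\<pi>_st_right\<close> is the other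
  side.\<close>

lemma \<pi>_st_left:
  assumes us: "us \<in> L" and vs: "vs \<in> L" and ws: "ws \<in> L"
  shows "\<pi> (st (S us vs) (w ws)) = (\<Oplus>\<^bsub>V\<^esub>ps\<in>blocks us vs. M (mm ps) ws)"
proof -
  have "\<pi> (st (S us vs) (w ws)) = (\<Oplus>\<^bsub>V\<^esub>ps\<in>blocks us vs. \<pi> (st (w (mm ps)) (w ws)))"
    unfolding star_word_def[of K V M us vs]
    by (rule lin_finsum[OF lin_comp[OF st_left[OF w_closed[OF ws]] \<pi>_lin] T V w_closed[OF blocks_L[OF us vs]]])
  also have "\<dots> = (\<Oplus>\<^bsub>V\<^esub>ps\<in>blocks us vs. M (mm ps) ws)"
    by (rule M.finsum_eqI[OF refl])
      (simp_all only: st_word[OF blocks_L[OF us vs] ws] \<pi>_S[OF blocks_L[OF us vs] ws] M_closed[OF blocks_L[OF us vs] ws])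
  finally show ?thesis .
qed

lemma \<pi>_st_right:
  assumes us: "us \<in> L" and vs: "vs \<in> L" and ws: "ws \<in> L"
  shows "\<pi> (st (w us) (S vs ws)) = (\<Oplus>\<^bsub>V\<^esub>ps\<in>blocks vs ws. M us (mm ps))"
proof -
  have "\<pi> (st (w us) (S vs ws)) = (\<Oplus>\<^bsub>V\<^esub>ps\<in>blocks vs ws. \<pi> (st (w us) (w (mm ps))))"
    unfolding star_word_def[of K V M vs ws]
    by (rule lin_finsum[OF lin_comp[OF st_right[OF w_closed[OF us]] \<pi>_lin] T V w_closed[OF blocks_L[OF vs ws]]])
  also have "\<dots> = (\<Oplus>\<^bsub>V\<^esub>ps\<in>blocks vs ws. M us (mm ps))"
    by (rule M.finsum_eqI[OF refl])
      (simp_all only: st_word[OF us blocks_L[OF vs ws]] \<pi>_S[OF us blocks_L[OF vs ws]] M_closed[OF us blocks_L[OF vs ws]])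
  finally show ?thesis .
qed

end

context binf_star begin

text \<open>A cut point of \<open>us\<close> and the empty word is a cut of \<open>us\<close>, so
  both sides obey the deconcatenation recursion; their letters agree by the unit axioms for
  \<open>M\<close>.\<close>

lemma S_unit_right: assumes "us \<in> L" shows "S us [] = w us"
proof (rule coalg_unique[where F="\<lambda>us. S us []" and G=w and X=L and J="\<lambda>us. {0..length us}" and l="\<lambda>us i. take i us"
      and r="\<lambda>us i. drop i us" and size=length, OF _ _ _ _ _ _ _ _ assms])
  fix us assume us: "us \<in> L"
  show "S us [] \<in> carrier T" by (rule S_closed[OF us lists.Nil])
  show "w us \<in> carrier T" by (rule w_closed[OF us])
  show "\<Delta> (w us) = (\<Oplus>\<^bsub>TT\<^esub>i\<in>{0..length us}. p (w (take i us)) (w (drop i us)))" by (rule \<Delta>_word[OF us])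
  show "\<Delta> (S us []) = (\<Oplus>\<^bsub>TT\<^esub>i\<in>{0..length us}. p (S (take i us) []) (S (drop i us) []))"
    unfolding \<Delta>_S[OF us lists.Nil]
  proof (rule TT.finsum_bij[where h=fst], goal_cases)
    case 1
    show ?case by (rule bij_betw_byWitness[where f'="\<lambda>i. (i, 0)"]) (auto simp: cut_points_def)
  next
    case 2
    show ?case by (rule p_closed[OF S_closed[OF take_L[OF us] lists.Nil] S_closed[OF drop_L[OF us] lists.Nil]])
  next
    case 3
    show ?case by simp
  qed
  show "\<epsilon> (S us []) = \<epsilon> (w us)" using us by (simp add: \<epsilon>_S \<epsilon>_word)
  show "\<pi> (S us []) = \<pi> (w us)"
  proof (cases us)
    case Nil then show ?thesis by (simp add: S_Nil)
  next
    case (Cons a as)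
    show ?thesis
    proof (cases as)
      case Nil then show ?thesis using Cons us by (simp add: \<pi>_S \<pi>_word M_unit)
    next
      case (Cons b bs)
      then show ?thesis using \<open>us = a # as\<close> us \<pi>_S[OF us lists.Nil] \<pi>_word[OF us] M_unit0(1)[OF us] by simp
    qed
  qed
  fix i assume i: "i \<in> {0..length us}"
  show "take i us \<in> L \<and> drop i us \<in> L" by (simp only: take_L[OF us] drop_L[OF us] simp_thms)
  \<comment> \<open>At \<open>i = 0\<close> the right part does not shrink, but then the left part
    is the empty word and has no letter.\<close>
  show "length (drop i us) < length us \<or> \<pi> (S (take i us) []) = \<zero>\<^bsub>V\<^esub>"
    using i by (cases "i = 0") (auto simp: S_Nil \<pi>_word)
qed

lemma S_unit_left: assumes us: "us \<in> L" shows "S [] us = w us"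
proof -
  interpret sw: binf_star K V "\<lambda>us vs. M vs us"
    by (intro binf_star.intro swap binf_star_axioms.intro) (simp_all add: M_unit M_unit0)
  show ?thesis using sw.S_unit_right[OF us] S_swap[OF lists.Nil us] by simp
qed

lemma st_unit: "x \<in> carrier T \<Longrightarrow> st (w []) x = x" "x \<in> carrier T \<Longrightarrow> st x (w []) = x"
proof -
  have w0: "w [] \<in> carrier T" by (simp add: w_closed)
  show "x \<in> carrier T \<Longrightarrow> st (w []) x = x"
    by (rule w_eqI[OF T st_right[OF w0] lin_id]) (simp_all add: st_word S_unit_left)
  show "x \<in> carrier T \<Longrightarrow> st x (w []) = x"
    by (rule w_eqI[where f="\<lambda>x. st x (w [])", OF T st_left[OF w0] lin_id]) (simp_all add: st_word S_unit_right)
qed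

end

locale binf_words = binf_star +
  assumes M_rel: "\<And>us vs ws. us \<in> lists (carrier V) \<Longrightarrow> vs \<in> lists (carrier V) \<Longrightarrow> ws \<in> lists (carrier V) \<Longrightarrow>
    us \<noteq> [] \<Longrightarrow> vs \<noteq> [] \<Longrightarrow> ws \<noteq> [] \<Longrightarrow>
    (\<Oplus>\<^bsub>V\<^esub>ps\<in>blocks us vs. M (map (\<lambda>(a, b). M a b) ps) ws) = (\<Oplus>\<^bsub>V\<^esub>ps\<in>blocks vs ws. M us (map (\<lambda>(a, b). M a b) ps))"
begin

text \<open>The coproducts of both triple products are indexed by simultaneous cuts of the three
  words, so \<open>coalg_unique\<close> leaves the counits and the letters to compare. The letters
  are the two sides of the \<open>B\<^sub>\<infinity>\<close> relation.\<close>

lemma st_assoc_words: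
  assumes "us \<in> L" "vs \<in> L" "ws \<in> L"
  shows "st (S us vs) (w ws) = st (w us) (S vs ws)"
proof -
  let ?F = "\<lambda>(us, vs, ws). st (S us vs) (w ws)" and ?G = "\<lambda>(us, vs, ws). st (w us) (S vs ws)"
  let ?J = "\<lambda>(us, vs, ws). cut_points us vs \<times> {0..length ws}"
  let ?l = "\<lambda>(us, vs, ws) z. (take (fst (fst z)) us, take (snd (fst z)) vs, take (snd z) ws)"
  let ?r = "\<lambda>(us, vs, ws) z. (drop (fst (fst z)) us, drop (snd (fst z)) vs, drop (snd z) ws)"
  let ?s = "\<lambda>(us, vs, ws). length us + length vs + length ws"
  have X: "\<exists>us vs ws. x = (us, vs, ws) \<and> us \<in> L \<and> vs \<in> L \<and> ws \<in> L" if "x \<in> L \<times> L \<times> L" for x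
    using that by (cases x) blast
  have "?F (us, vs, ws) = ?G (us, vs, ws)"
  proof (rule coalg_unique[where F="?F" and G="?G" and X="L \<times> L \<times> L" and J="?J" and l="?l" and r="?r" and size="?s"])
    show "(us, vs, ws) \<in> L \<times> L \<times> L" using assms by blast
  next
    fix x assume "x \<in> L \<times> L \<times> L"
    from X[OF this] obtain us vs ws where x: "x = (us, vs, ws)" and us: "us \<in> L" and vs: "vs \<in> L" and ws: "ws \<in> L" by blast
    note t = take_L[OF us] take_L[OF vs] take_L[OF ws] and d = drop_L[OF us] drop_L[OF vs] drop_L[OF ws]
    note Sc = S_closed[OF us vs] S_closed[OF vs ws] and wc = w_closed[OF us] w_closed[OF vs] w_closed[OF ws]
    note Stc = S_closed[OF t(1,2)] S_closed[OF t(2,3)] and wtc = w_closed[OF t(1)] w_closed[OF t(2)] w_closed[OF t(3)]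
    note Sdc = S_closed[OF d(1,2)] S_closed[OF d(2,3)] and wdc = w_closed[OF d(1)] w_closed[OF d(2)] w_closed[OF d(3)]
    show "?F x \<in> carrier T" "?G x \<in> carrier T" unfolding x prod.case by (intro st_closed Sc wc)+
    show "\<Delta> (?F x) = (\<Oplus>\<^bsub>TT\<^esub>z\<in>?J x. p (?F (?l x z)) (?F (?r x z)))"
    proof -
      have "\<Delta> (?F x) = (\<Oplus>\<^bsub>TT\<^esub>z\<in>cut_points us vs \<times> {0..length ws}.
         p (S (take (fst (fst z)) us) (take (snd (fst z)) vs)) (S (drop (fst (fst z)) us) (drop (snd (fst z)) vs)) \<otimes>\<^bsub>TE\<^esub>
         p (w (take (snd z) ws)) (w (drop (snd z) ws)))"
        unfolding x prod.case \<Delta>_st[OF Sc(1) wc(3)] \<Delta>_S[OF us vs] \<Delta>_word[OF ws]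
        by (rule bilinear_finsum[OF TE_bilin TT TT TT p_closed[OF Stc(1) Sdc(1)] p_closed[OF wtc(3) wdc(3)]])
          (simp_all add: cut_points_def)
      also have "\<dots> = (\<Oplus>\<^bsub>TT\<^esub>z\<in>?J x. p (?F (?l x z)) (?F (?r x z)))"
        unfolding x prod.case
        by (rule TT.finsum_eqI[OF refl]) (simp_all only: TE_pure[OF Stc(1) Sdc(1) wtc(3) wdc(3)] p_closed[OF st_closed[OF Stc(1) wtc(3)] st_closed[OF Sdc(1) wdc(3)]])
      finally show ?thesis .
    qed
    show "\<Delta> (?G x) = (\<Oplus>\<^bsub>TT\<^esub>z\<in>?J x. p (?G (?l x z)) (?G (?r x z)))"
    proof -
      have "\<Delta> (?G x) = (\<Oplus>\<^bsub>TT\<^esub>z\<in>{0..length us} \<times> cut_points vs ws.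
         p (w (take (fst z) us)) (w (drop (fst z) us)) \<otimes>\<^bsub>TE\<^esub>
         p (S (take (fst (snd z)) vs) (take (snd (snd z)) ws)) (S (drop (fst (snd z)) vs) (drop (snd (snd z)) ws)))"
        unfolding x prod.case \<Delta>_st[OF wc(1) Sc(2)] \<Delta>_S[OF vs ws] \<Delta>_word[OF us]
        by (rule bilinear_finsum[OF TE_bilin TT TT TT p_closed[OF wtc(1) wdc(1)] p_closed[OF Stc(2) Sdc(2)]])
          (simp_all add: cut_points_def)
      also have "\<dots> = (\<Oplus>\<^bsub>TT\<^esub>z\<in>?J x. p (?G (?l x z)) (?G (?r x z)))"
      \<comment> \<open>The cuts are bracketed as \<open>(i, (j, k))\<close> on this side and as
        \<open>((i, j), k)\<close> in \<open>?J\<close>.\<close>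
      proof (rule TT.finsum_bij[where h="\<lambda>z. ((fst z, fst (snd z)), snd (snd z))"])
        show "bij_betw (\<lambda>z. ((fst z, fst (snd z)), snd (snd z))) ({0..length us} \<times> cut_points vs ws) (?J x)"
          by (rule bij_betw_byWitness[where f'="\<lambda>z. (fst (fst z), (snd (fst z), snd z))"]) (auto simp: cut_points_def x)
      next
        fix z
        show "p (?G (?l x z)) (?G (?r x z)) \<in> carrier TT" unfolding x prod.case
          by (rule p_closed[OF st_closed[OF wtc(1) Stc(2)] st_closed[OF wdc(1) Sdc(2)]])
      next
        fix z
        show "p (w (take (fst z) us)) (w (drop (fst z) us)) \<otimes>\<^bsub>TE\<^esub>
         p (S (take (fst (snd z)) vs) (take (snd (snd z)) ws)) (S (drop (fst (snd z)) vs) (drop (snd (snd z)) ws)) =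
         p (?G (?l x ((fst z, fst (snd z)), snd (snd z)))) (?G (?r x ((fst z, fst (snd z)), snd (snd z))))"
          unfolding x prod.case fst_conv snd_conv by (rule TE_pure[OF wtc(1) wdc(1) Stc(2) Sdc(2)])
      qed
      finally show ?thesis .
    qed
    show "\<epsilon> (?F x) = \<epsilon> (?G x)"
      unfolding x prod.case \<epsilon>_st[OF Sc(1) wc(3)] \<epsilon>_st[OF wc(1) Sc(2)] \<epsilon>_S[OF us vs] \<epsilon>_S[OF vs ws] \<epsilon>_word[OF us] \<epsilon>_word[OF ws]
      by auto
    show "\<pi> (?F x) = \<pi> (?G x)"
    \<comment> \<open>The relation \<open>M_rel\<close> speaks of nonempty words; the remaining
      cases are the unit laws.\<close>
    proof (cases "us = [] \<or> vs = [] \<or> ws = []")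
      case True
      have "st (S us vs) (w ws) = st (w us) (S vs ws)"
      proof -
        have "st (S us vs) (w ws) = st (w us) (S vs ws)" if "us = []"
          unfolding that S_unit_left[OF vs] st_unit(1)[OF Sc(2)] by (rule st_word[OF vs ws])
        moreover have "st (S us vs) (w ws) = st (w us) (S vs ws)" if "vs = []"
          unfolding that S_unit_left[OF ws] S_unit_right[OF us] ..
        moreover have "st (S us vs) (w ws) = st (w us) (S vs ws)" if "ws = []"
          unfolding that S_unit_right[OF vs] st_unit(2)[OF Sc(1)] by (rule st_word[OF us vs, symmetric])
        ultimately show ?thesis using True by blast
      qed
      then show ?thesis unfolding x prod.case by (rule arg_cong)
    next
      case False
      then show ?thesis unfolding x prod.case \<pi>_st_left[OF us vs ws] \<pi>_st_right[OF us vs ws]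
        by (intro M_rel us vs ws) auto
    qed
    fix z assume z: "z \<in> ?J x"
    show "?l x z \<in> L \<times> L \<times> L \<and> ?r x z \<in> L \<times> L \<times> L" unfolding x prod.case by (intro conjI SigmaI t d)
    show "?s (?r x z) < ?s x \<or> \<pi> (?F (?l x z)) = \<zero>\<^bsub>V\<^esub>"
    proof (cases "z = ((0, 0), 0)")
      case True
      have w0: "w [] \<in> carrier T" by (simp add: w_closed)
      show ?thesis unfolding x True by (simp add: S_Nil st_unit(1)[OF w0] \<pi>_word)
    next
      case False
      then show ?thesis using z unfolding x by (cases z) (auto simp: cut_points_def)
    qed
  qed
  then show ?thesis by simp
qed

lemma E_assoc_algebra: "assoc_algebra K E"
proof (rule assoc_algebraI[OF E E_bilin])
  show "\<one>\<^bsub>E\<^esub> \<in> carrier E" by (simp add: star_alg_simps w_closed)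
  show "spans K E (w ` L)"
    using w_spans by (subst spans_struct_cong[OF T]) (simp_all add: star_alg_simps)
next
  fix x y z assume "x \<in> w ` L" "y \<in> w ` L" "z \<in> w ` L"
  then obtain us vs ws where "x = w us" "y = w vs" "z = w ws" and L: "us \<in> L" "vs \<in> L" "ws \<in> L" by blast
  then show "x \<otimes>\<^bsub>E\<^esub> y \<otimes>\<^bsub>E\<^esub> z = x \<otimes>\<^bsub>E\<^esub> (y \<otimes>\<^bsub>E\<^esub> z)"
    by (simp only: star_alg_simps st_word[OF L(1,2)] st_word[OF L(2,3)] st_assoc_words[OF L])
next
  fix x assume "x \<in> w ` L"
  then have "x \<in> carrier T" using w_closed by blast
  then show "\<one>\<^bsub>E\<^esub> \<otimes>\<^bsub>E\<^esub> x = x" "x \<otimes>\<^bsub>E\<^esub> \<one>\<^bsub>E\<^esub> = x" by (simp_all add: star_alg_simps st_unit)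
qed

lemma dot_E_assoc_algebra: "assoc_algebra K (dot_alg E)"
proof (rule assoc_algebraI[OF _ _ _ spans_carrier])
  show "module K (dot_alg E)" by (rule module_cong[OF E]) simp_all
  show "bilinear K (dot_alg E) (dot_alg E) (dot_alg E) (mult (dot_alg E))"
    using cc_bilin by (subst bilin_struct_cong[of _ T _ T _ T]) (simp_all add: star_alg_simps)
qed (simp_all add: star_alg_simps w_closed cc_unit cc_assoc)

lemma E_two_as_algebra: "two_as_algebra K E"
  by (simp add: two_as_algebra_def E_assoc_algebra dot_E_assoc_algebra)

lemma star_bialg_bialgebra: "bialgebra K (star_bialg K V M)"
proof -
  let ?B = "star_bialg K V M"
  have 1: "assoc_algebra K ?B"
    using E_assoc_algebra by (subst assoc_algebra_struct_cong[of _ E]) (simp_all add: star_bialg_def)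
  have 2: "coalgebra K ?B"
    by (subst coalgebra_iff[of _ T]) (simp_all add: star_bialg_def star_alg_simps T \<Delta>_lin \<epsilon>_lin coassoc_counit)
  have t: "tensor K ?B ?B = TE" by (rule tensor_cong) (simp_all add: star_bialg_def)
  have 3: "\<Delta> \<in> ring_hom ?B TE"
    by (rule ring_hom_memI)
      (simp_all add: star_bialg_def star_alg_simps TE \<Delta>_closed \<Delta>_st lin_add[OF \<Delta>_lin] \<Delta>_unit tensor_simps(5))
  have 4: "\<epsilon> \<in> ring_hom ?B K"
    using lin_add[OF \<epsilon>_lin]
    by (intro ring_hom_memI) (simp_all add: star_bialg_def star_alg_simps \<epsilon>_closed \<epsilon>_st \<epsilon>_word)
  show ?thesis using 1 2 3 4 unfolding bialgebra_def t by (simp add: star_bialg_def)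
qed

lemma tensor_map_E: "tensor_map K E E f g = tensor_map K T T f g"
  by (rule tensor_map_struct_cong) (simp_all add: star_alg_simps)

lemma star_two_as_bialgebra: "two_as_bialgebra K E \<Delta> \<epsilon>"
proof -
  have D: "linear_map K E (tensor K E E) \<Delta>"
    using \<Delta>_lin by (subst lin_struct_cong[of _ T _ TT]) (simp_all add: star_alg_simps TE)
  show ?thesis unfolding two_as_bialgebra_def Let_def
  proof (intro conjI ballI E_two_as_algebra star_bialg_bialgebra[unfolded star_bialg_def])
    fix x y assume "x \<in> carrier E" "y \<in> carrier E"
    then show "\<Delta> (dot E x y) = (pure_tensor K E E x \<one>\<^bsub>E\<^esub> \<otimes>\<^bsub>tensor K (dot_alg E) (dot_alg E)\<^esub> \<Delta> y \<oplus>\<^bsub>tensor K (dot_alg E) (dot_alg E)\<^esub>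
      \<Delta> x \<otimes>\<^bsub>tensor K (dot_alg E) (dot_alg E)\<^esub> pure_tensor K E E \<one>\<^bsub>E\<^esub> y) \<ominus>\<^bsub>tensor K (dot_alg E) (dot_alg E)\<^esub> pure_tensor K E E x y"
      by (subst infinitesimal_iff[OF E_two_as_algebra D]) (simp_all add: tensor_map_E TE star_alg_simps \<Delta>_cc)
  qed
qed

end

section \<open>Quotients of algebras with two products\<close>

text \<open>Without associativity and unit laws, so that quotients of the magma algebra of terms and
  quotients of \<open>2as(R)\<close> are covered alike.\<close>

locale two_magma =
  fixes K :: "('k, 'm) ring_scheme" and A :: "('k, 'a, 'x) two_alg_scheme"
  assumes A: "module K A" and mult_bilin: "bilinear K A A A (mult A)" and dot_bilin: "bilinear K A A A (dot A)"
    and one: "\<one>\<^bsub>A\<^esub> \<in> carrier A"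
begin

sublocale A: module K A by (rule A)

lemma two_ideal_carrier: "two_ideal K A (carrier A)"
  using bilin_closed[OF mult_bilin] bilin_closed[OF dot_bilin] by (simp add: two_ideal_def A.carrier_is_submodule)

lemma two_ideal_two_ideal_gen:
  assumes "S \<subseteq> carrier A"
  shows "two_ideal K A (two_ideal_gen K A S)"
proof -
  have *: "submodule (\<Inter> {t. two_ideal K A t \<and> S \<subseteq> t}) K A"
    unfolding submodule_iff[OF A]
  proof (intro conjI ballI)
    show "\<Inter> {t. two_ideal K A t \<and> S \<subseteq> t} \<subseteq> carrier A" using two_ideal_carrier assms by (intro Inter_lower) simp
  qed (auto simp: two_ideal_def submodule_iff[OF A])
  show ?thesis unfolding two_ideal_gen_def hull_def two_ideal_def[of K A "\<Inter> _"]
    using * by (auto simp: two_ideal_def)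
qed

lemma two_ideal_gen_incl: "S \<subseteq> two_ideal_gen K A S"
  unfolding two_ideal_gen_def by (rule hull_subset)

lemma two_ideal_gen_least: "two_ideal K A J \<Longrightarrow> S \<subseteq> J \<Longrightarrow> two_ideal_gen K A S \<subseteq> J"
  unfolding two_ideal_gen_def by (rule hull_minimal)

lemma two_ideal_kernel:
  assumes "module K B" "linear_map K A B h" "bilinear K B B B m" "bilinear K B B B d"
    and "\<And>x y. x \<in> carrier A \<Longrightarrow> y \<in> carrier A \<Longrightarrow> h (x \<otimes>\<^bsub>A\<^esub> y) = m (h x) (h y)"
    and "\<And>x y. x \<in> carrier A \<Longrightarrow> y \<in> carrier A \<Longrightarrow> h (dot A x y) = d (h x) (h y)"
  shows "two_ideal K A {x \<in> carrier A. h x = \<zero>\<^bsub>B\<^esub>}"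
  unfolding two_ideal_def
  using submodule_kernel[OF assms(2) A assms(1)] bilin_closed[OF mult_bilin] bilin_closed[OF dot_bilin]
    lin_zero[OF bilin_left[OF assms(3)] assms(1,1)] lin_zero[OF bilin_right[OF assms(3)] assms(1,1)]
    lin_zero[OF bilin_left[OF assms(4)] assms(1,1)] lin_zero[OF bilin_right[OF assms(4)] assms(1,1)]
    lin_closed[OF assms(2)] assms(5,6)
  by simp

end

locale two_quotient = two_magma +
  fixes I
  assumes I: "two_ideal K A I"
begin

abbreviation "Q \<equiv> two_quot A I"
abbreviation "pr x \<equiv> I +>\<^bsub>A\<^esub> x"

sublocale SM: submod K A I
  using I by (intro submod.intro A) (simp add: two_ideal_def)

lemma Q_simps:
  "carrier Q = carrier (quot_module A I)" "add Q = add (quot_module A I)" "zero Q = zero (quot_module A I)"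
  "smult Q = smult (quot_module A I)" "one Q = pr \<one>\<^bsub>A\<^esub>"
  by (simp_all add: two_quot_def quot_module_def)

lemma Q: "module K Q"
  by (rule module_cong[OF SM.quot_module_module]) (simp_all add: Q_simps)

lemma pr_linear: "linear_map K A Q pr"
  using SM.quot_proj_linear by (subst lin_struct_cong[of _ A _ "quot_module A I"]) (simp_all add: Q_simps)

lemma Q_carrier: "carrier Q = pr ` carrier A"
  by (simp add: Q_simps SM.quot_carrier)

lemma pr_eq_iff: "x \<in> carrier A \<Longrightarrow> y \<in> carrier A \<Longrightarrow> pr x = pr y \<longleftrightarrow> x \<ominus>\<^bsub>A\<^esub> y \<in> I"
  by (rule SM.coset_eq_iff)

text \<open>The product of cosets is a union over all pairs of representatives. Changing one factor
  at a time shows that all these pairs give the same coset.\<close>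

lemma rcoset_prod:
  assumes b: "bilinear K A A A m" and x: "x \<in> carrier A" and y: "y \<in> carrier A"
    and l: "\<And>a x. a \<in> carrier A \<Longrightarrow> x \<in> I \<Longrightarrow> m a x \<in> I" and r: "\<And>a x. a \<in> carrier A \<Longrightarrow> x \<in> I \<Longrightarrow> m x a \<in> I"
  shows "(\<Union>a\<in>pr x. \<Union>b\<in>pr y. pr (m a b)) = pr (m x y)"
proof -
  have eq: "pr (m a b) = pr (m x y)" if a: "a \<in> pr x" and b': "b \<in> pr y" for a b
  proof -
    have ac: "a \<in> carrier A" and bc: "b \<in> carrier A" using SM.mem_coset_carrier a b' x y by blast+
    have "a \<ominus>\<^bsub>A\<^esub> x \<in> I" using SM.mem_coset_eq[OF x a] pr_eq_iff[OF ac x] by simp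
    then have 1: "m (a \<ominus>\<^bsub>A\<^esub> x) b \<in> I" by (rule r[OF bc])
    have "b \<ominus>\<^bsub>A\<^esub> y \<in> I" using SM.mem_coset_eq[OF y b'] pr_eq_iff[OF bc y] by simp
    then have 2: "m x (b \<ominus>\<^bsub>A\<^esub> y) \<in> I" by (rule l[OF x])
    have "pr (m a b) = pr (m x b)"
      using 1 lin_minus[OF bilin_left[OF b bc] A A ac x]
      by (subst pr_eq_iff) (simp_all add: bilin_closed[OF b] ac bc x)
    also have "\<dots> = pr (m x y)"
      using 2 lin_minus[OF bilin_right[OF b x] A A bc y]
      by (subst pr_eq_iff) (simp_all add: bilin_closed[OF b] bc x y)
    finally show ?thesis .
  qed
  have "(\<Union>a\<in>pr x. \<Union>b\<in>pr y. pr (m a b)) = (\<Union>a\<in>pr x. \<Union>b\<in>pr y. pr (m x y))"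
    by (intro SUP_cong refl eq)
  also have "\<dots> = pr (m x y)" using SM.mem_coset[OF x] SM.mem_coset[OF y] by blast
  finally show ?thesis .
qed

lemma pr_mult: "x \<in> carrier A \<Longrightarrow> y \<in> carrier A \<Longrightarrow> pr x \<otimes>\<^bsub>Q\<^esub> pr y = pr (x \<otimes>\<^bsub>A\<^esub> y)"
  using rcoset_prod[OF mult_bilin] I by (simp add: two_quot_def quot_module_def rcoset_mult_def two_ideal_def)

lemma pr_dot: "x \<in> carrier A \<Longrightarrow> y \<in> carrier A \<Longrightarrow> dot Q (pr x) (pr y) = pr (dot A x y)"
proof -
  have "I +>\<^bsub>dot_alg A\<^esub> z = pr z" for z by (simp add: a_r_coset_def r_coset_def)
  then show "x \<in> carrier A \<Longrightarrow> y \<in> carrier A \<Longrightarrow> dot Q (pr x) (pr y) = pr (dot A x y)"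
    using rcoset_prod[OF dot_bilin] I by (simp add: two_quot_def rcoset_mult_def two_ideal_def)
qed

lemma Q_prod_bilin:
  assumes "bilinear K A A A m" "\<And>x y. x \<in> carrier A \<Longrightarrow> y \<in> carrier A \<Longrightarrow> m' (pr x) (pr y) = pr (m x y)"
  shows "bilinear K Q Q Q m'"
proof (rule bilinearI; rule linear_mapI)
  note c = bilin_closed[OF assms(1)] and p = lin_closed[OF pr_linear]
  note ad = lin_add[OF pr_linear, symmetric] and sm = lin_smult[OF pr_linear, symmetric]
  note r = lin_add[OF bilin_right[OF assms(1)]] lin_smult[OF bilin_right[OF assms(1)]]
  note l = lin_add[OF bilin_left[OF assms(1)]] lin_smult[OF bilin_left[OF assms(1)]]
  fix X Y assume X: "X \<in> carrier Q" and Y: "Y \<in> carrier Q"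
  then obtain x y where x: "x \<in> carrier A" "X = pr x" and y: "y \<in> carrier A" "Y = pr y" unfolding Q_carrier by blast
  show "m' X Y \<in> carrier Q" "m' Y X \<in> carrier Q" using x y by (simp_all add: assms(2) c p)
  { fix Z assume "Z \<in> carrier Q"
    then obtain z where z: "z \<in> carrier A" "Z = pr z" unfolding Q_carrier by blast
    show "m' X (Y \<oplus>\<^bsub>Q\<^esub> Z) = m' X Y \<oplus>\<^bsub>Q\<^esub> m' X Z" "m' (Y \<oplus>\<^bsub>Q\<^esub> Z) X = m' Y X \<oplus>\<^bsub>Q\<^esub> m' Z X"
      using x y z by (simp_all add: assms(2) ad c r l) }
next
  note c = bilin_closed[OF assms(1)] and p = lin_closed[OF pr_linear]
  note sm = lin_smult[OF pr_linear, symmetric]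
  note r = lin_smult[OF bilin_right[OF assms(1)]] and l = lin_smult[OF bilin_left[OF assms(1)]]
  fix X Y e assume X: "X \<in> carrier Q" and e: "e \<in> carrier K" and Y: "Y \<in> carrier Q"
  then obtain x y where x: "x \<in> carrier A" "X = pr x" and y: "y \<in> carrier A" "Y = pr y" unfolding Q_carrier by blast
  show "m' X (e \<odot>\<^bsub>Q\<^esub> Y) = e \<odot>\<^bsub>Q\<^esub> m' X Y" "m' (e \<odot>\<^bsub>Q\<^esub> Y) X = e \<odot>\<^bsub>Q\<^esub> m' Y X"
    using x y e by (simp_all add: assms(2) sm c r l)
qed

lemmas Q_mult_bilin = Q_prod_bilin[OF mult_bilin pr_mult]
lemmas Q_dot_bilin = Q_prod_bilin[OF dot_bilin pr_dot]

lemma Q_one: "\<one>\<^bsub>Q\<^esub> \<in> carrier Q"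
  by (simp add: Q_simps(5) lin_closed[OF pr_linear] one)

lemma Q_two_as_algebra:
  assumes m: "\<And>x y z. x \<in> carrier A \<Longrightarrow> y \<in> carrier A \<Longrightarrow> z \<in> carrier A \<Longrightarrow> (x \<otimes>\<^bsub>A\<^esub> y) \<otimes>\<^bsub>A\<^esub> z \<ominus>\<^bsub>A\<^esub> x \<otimes>\<^bsub>A\<^esub> (y \<otimes>\<^bsub>A\<^esub> z) \<in> I"
    "\<And>x. x \<in> carrier A \<Longrightarrow> \<one>\<^bsub>A\<^esub> \<otimes>\<^bsub>A\<^esub> x \<ominus>\<^bsub>A\<^esub> x \<in> I" "\<And>x. x \<in> carrier A \<Longrightarrow> x \<otimes>\<^bsub>A\<^esub> \<one>\<^bsub>A\<^esub> \<ominus>\<^bsub>A\<^esub> x \<in> I"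
    and d: "\<And>x y z. x \<in> carrier A \<Longrightarrow> y \<in> carrier A \<Longrightarrow> z \<in> carrier A \<Longrightarrow> dot A (dot A x y) z \<ominus>\<^bsub>A\<^esub> dot A x (dot A y z) \<in> I"
    "\<And>x. x \<in> carrier A \<Longrightarrow> dot A \<one>\<^bsub>A\<^esub> x \<ominus>\<^bsub>A\<^esub> x \<in> I" "\<And>x. x \<in> carrier A \<Longrightarrow> dot A x \<one>\<^bsub>A\<^esub> \<ominus>\<^bsub>A\<^esub> x \<in> I"
  shows "two_as_algebra K Q"
proof -
  note mc = bilin_closed[OF mult_bilin] and dc = bilin_closed[OF dot_bilin]
  have 1: "assoc_algebra K Q"
  proof (rule assoc_algebraI[OF Q Q_mult_bilin Q_one spans_carrier])
    fix X Y Z assume "X \<in> carrier Q" "Y \<in> carrier Q" "Z \<in> carrier Q"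
    then obtain x y z where "X = pr x" "Y = pr y" "Z = pr z" "x \<in> carrier A" "y \<in> carrier A" "z \<in> carrier A"
      unfolding Q_carrier by blast
    then show "X \<otimes>\<^bsub>Q\<^esub> Y \<otimes>\<^bsub>Q\<^esub> Z = X \<otimes>\<^bsub>Q\<^esub> (Y \<otimes>\<^bsub>Q\<^esub> Z)" using m(1) by (simp add: pr_mult mc pr_eq_iff)
  next
    fix X assume "X \<in> carrier Q"
    then obtain x where "X = pr x" "x \<in> carrier A" unfolding Q_carrier by blast
    then show "\<one>\<^bsub>Q\<^esub> \<otimes>\<^bsub>Q\<^esub> X = X" "X \<otimes>\<^bsub>Q\<^esub> \<one>\<^bsub>Q\<^esub> = X" using m(2,3) by (simp_all add: Q_simps(5) pr_mult mc pr_eq_iff one)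
  qed
  have 2: "assoc_algebra K (dot_alg Q)"
  proof (rule assoc_algebraI[OF _ _ _ spans_carrier])
    show "module K (dot_alg Q)" by (rule module_cong[OF Q]) simp_all
    show "bilinear K (dot_alg Q) (dot_alg Q) (dot_alg Q) (mult (dot_alg Q))"
      using Q_dot_bilin by (subst bilin_struct_cong[of _ Q _ Q _ Q]) simp_all
    show "\<one>\<^bsub>dot_alg Q\<^esub> \<in> carrier (dot_alg Q)" using Q_one by simp
  next
    fix X Y Z assume "X \<in> carrier (dot_alg Q)" "Y \<in> carrier (dot_alg Q)" "Z \<in> carrier (dot_alg Q)"
    then obtain x y z where "X = pr x" "Y = pr y" "Z = pr z" "x \<in> carrier A" "y \<in> carrier A" "z \<in> carrier A"
      unfolding dot_alg_simps Q_carrier by blast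
    then show "X \<otimes>\<^bsub>dot_alg Q\<^esub> Y \<otimes>\<^bsub>dot_alg Q\<^esub> Z = X \<otimes>\<^bsub>dot_alg Q\<^esub> (Y \<otimes>\<^bsub>dot_alg Q\<^esub> Z)" using d(1) by (simp add: pr_dot dc pr_eq_iff)
  next
    fix X assume "X \<in> carrier (dot_alg Q)"
    then obtain x where "X = pr x" "x \<in> carrier A" unfolding dot_alg_simps Q_carrier by blast
    then show "\<one>\<^bsub>dot_alg Q\<^esub> \<otimes>\<^bsub>dot_alg Q\<^esub> X = X" "X \<otimes>\<^bsub>dot_alg Q\<^esub> \<one>\<^bsub>dot_alg Q\<^esub> = X"
      using d(2,3) by (simp_all add: Q_simps(5) pr_dot dc pr_eq_iff one)
  qed
  show ?thesis using 1 2 by (simp add: two_as_algebra_def)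
qed

end

lemma two_as_algebraD:
  assumes "two_as_algebra K A"
  shows "assoc_algebra K A" "assoc_algebra K (dot_alg A)" "module K A" "\<one>\<^bsub>A\<^esub> \<in> carrier A"
    "bilinear K A A A (mult A)" "bilinear K A A A (dot A)"
proof -
  show 1: "assoc_algebra K A" and 2: "assoc_algebra K (dot_alg A)" using assms by (simp_all add: two_as_algebra_def)
  show "module K A" "\<one>\<^bsub>A\<^esub> \<in> carrier A" "bilinear K A A A (mult A)"
    using assoc_algebraD[OF 1] assoc_algebra_bilinear[OF 1] by simp_all
  show "bilinear K A A A (dot A)"
    using assoc_algebra_bilinear[OF 2] by (subst (asm) bilin_struct_cong[of _ A _ A _ A]) simp_all
qed

lemma two_as_algebra_dot:
  assumes "two_as_algebra K A"
  shows "x \<in> carrier A \<Longrightarrow> y \<in> carrier A \<Longrightarrow> dot A x y \<in> carrier A"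
    "x \<in> carrier A \<Longrightarrow> y \<in> carrier A \<Longrightarrow> z \<in> carrier A \<Longrightarrow> dot A (dot A x y) z = dot A x (dot A y z)"
    "x \<in> carrier A \<Longrightarrow> dot A \<one>\<^bsub>A\<^esub> x = x" "x \<in> carrier A \<Longrightarrow> dot A x \<one>\<^bsub>A\<^esub> = x"
proof -
  interpret dm: monoid "dot_alg A" by (rule assoc_algebraD[OF two_as_algebraD(2)[OF assms]])
  show "x \<in> carrier A \<Longrightarrow> y \<in> carrier A \<Longrightarrow> dot A x y \<in> carrier A"
    "x \<in> carrier A \<Longrightarrow> y \<in> carrier A \<Longrightarrow> z \<in> carrier A \<Longrightarrow> dot A (dot A x y) z = dot A x (dot A y z)"
    "x \<in> carrier A \<Longrightarrow> dot A \<one>\<^bsub>A\<^esub> x = x" "x \<in> carrier A \<Longrightarrow> dot A x \<one>\<^bsub>A\<^esub> = x"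
    using dm.m_closed[of x y] dm.m_assoc[of x y z] dm.l_one[of x] dm.r_one[of x] by simp_all
qed

lemma two_as_algebra_magma: "two_as_algebra K A \<Longrightarrow> two_magma K A"
  by (simp add: two_magma_def two_as_algebraD)

definition two_as_hom where
  "two_as_hom K A B h \<longleftrightarrow> linear_map K A B h \<and> h \<one>\<^bsub>A\<^esub> = \<one>\<^bsub>B\<^esub> \<and>
    (\<forall>x \<in> carrier A. \<forall>y \<in> carrier A. h (x \<otimes>\<^bsub>A\<^esub> y) = h x \<otimes>\<^bsub>B\<^esub> h y) \<and>
    (\<forall>x \<in> carrier A. \<forall>y \<in> carrier A. h (dot A x y) = dot B (h x) (h y))"

section \<open>The free 2-associative algebra\<close>

lemma free_two_magma_simps:
  "carrier (free_two_magma K X) = carrier (free_module K {t. set_two_term t \<subseteq> X})"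
  "add (free_two_magma K X) = add (free_module K {t. set_two_term t \<subseteq> X})"
  "zero (free_two_magma K X) = zero (free_module K {t. set_two_term t \<subseteq> X})"
  "smult (free_two_magma K X) = smult (free_module K {t. set_two_term t \<subseteq> X})"
  "one (free_two_magma K X) = basis_elt K Unit"
  "mult (free_two_magma K X) = (\<lambda>f g t. case t of Star r s \<Rightarrow> f r \<otimes>\<^bsub>K\<^esub> g s | _ \<Rightarrow> \<zero>\<^bsub>K\<^esub>)"
  "dot (free_two_magma K X) = (\<lambda>f g t. case t of Dot r s \<Rightarrow> f r \<otimes>\<^bsub>K\<^esub> g s | _ \<Rightarrow> \<zero>\<^bsub>K\<^esub>)"
  by (simp_all add: free_two_magma_def Let_def)

lemma free_two_magma_magma:
  assumes cK: "cring K"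
  shows "two_magma K (free_two_magma K X)"
proof -
  interpret K: cring K by (rule cK)
  let ?F = "free_two_magma K X" and ?Y = "{t. set_two_term t \<subseteq> X}"
  have F: "module K ?F" by (rule module_cong[OF free_module_module[OF cK]]) (simp_all add: free_two_magma_simps)
  note cl = free_module_closed[OF cK]
  have m: "(\<lambda>t. case t of Star r s \<Rightarrow> f r \<otimes>\<^bsub>K\<^esub> g s | _ \<Rightarrow> \<zero>\<^bsub>K\<^esub>) \<in> carrier (free_module K ?Y)"
    and d: "(\<lambda>t. case t of Dot r s \<Rightarrow> f r \<otimes>\<^bsub>K\<^esub> g s | _ \<Rightarrow> \<zero>\<^bsub>K\<^esub>) \<in> carrier (free_module K ?Y)"
    if f: "f \<in> carrier (free_module K ?Y)" and g: "g \<in> carrier (free_module K ?Y)" for f g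
  proof -
    let ?sup = "{x. f x \<noteq> \<zero>\<^bsub>K\<^esub>} \<times> {x. g x \<noteq> \<zero>\<^bsub>K\<^esub>}"
    have fin: "finite ?sup" using f g by (simp add: free_module_simps)
    have z: "f x \<otimes>\<^bsub>K\<^esub> g y = \<zero>\<^bsub>K\<^esub>" if "x \<notin> ?Y \<or> y \<notin> ?Y" for x y
      using that f g cl[OF f, of x] cl[OF g, of y] by (auto simp: free_module_simps)
    have z2: "f x \<noteq> \<zero>\<^bsub>K\<^esub> \<and> g y \<noteq> \<zero>\<^bsub>K\<^esub>" if "f x \<otimes>\<^bsub>K\<^esub> g y \<noteq> \<zero>\<^bsub>K\<^esub>" for x y
      using that cl[OF f, of x] cl[OF g, of y] by auto
    have s1: "{t. (case t of Star r s \<Rightarrow> f r \<otimes>\<^bsub>K\<^esub> g s | _ \<Rightarrow> \<zero>\<^bsub>K\<^esub>) \<noteq> \<zero>\<^bsub>K\<^esub>} \<subseteq> (\<lambda>(r, s). Star r s) ` ?sup"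
    proof
      fix t assume t: "t \<in> {t. (case t of Star r s \<Rightarrow> f r \<otimes>\<^bsub>K\<^esub> g s | _ \<Rightarrow> \<zero>\<^bsub>K\<^esub>) \<noteq> \<zero>\<^bsub>K\<^esub>}"
      then obtain r s where "t = Star r s" by (cases t) auto
      then show "t \<in> (\<lambda>(r, s). Star r s) ` ?sup" using t z2[of r s] by force
    qed
    have s2: "{t. (case t of Dot r s \<Rightarrow> f r \<otimes>\<^bsub>K\<^esub> g s | _ \<Rightarrow> \<zero>\<^bsub>K\<^esub>) \<noteq> \<zero>\<^bsub>K\<^esub>} \<subseteq> (\<lambda>(r, s). Dot r s) ` ?sup"
    proof
      fix t assume t: "t \<in> {t. (case t of Dot r s \<Rightarrow> f r \<otimes>\<^bsub>K\<^esub> g s | _ \<Rightarrow> \<zero>\<^bsub>K\<^esub>) \<noteq> \<zero>\<^bsub>K\<^esub>}"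
      then obtain r s where "t = Dot r s" by (cases t) auto
      then show "t \<in> (\<lambda>(r, s). Dot r s) ` ?sup" using t z2[of r s] by force
    qed
    show "(\<lambda>t. case t of Star r s \<Rightarrow> f r \<otimes>\<^bsub>K\<^esub> g s | _ \<Rightarrow> \<zero>\<^bsub>K\<^esub>) \<in> carrier (free_module K ?Y)"
      using finite_subset[OF s1 finite_imageI[OF fin]] cl[OF f] cl[OF g] z
      unfolding free_module_simps by (auto split: two_term.splits)
    show "(\<lambda>t. case t of Dot r s \<Rightarrow> f r \<otimes>\<^bsub>K\<^esub> g s | _ \<Rightarrow> \<zero>\<^bsub>K\<^esub>) \<in> carrier (free_module K ?Y)"
      using finite_subset[OF s2 finite_imageI[OF fin]] cl[OF f] cl[OF g] z
      unfolding free_module_simps by (auto split: two_term.splits)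
  qed
  have bm: "bilinear K ?F ?F ?F (mult ?F)"
    by (intro bilinearI linear_mapI)
      (auto simp: free_two_magma_simps m free_module_simps(3,4) fun_eq_iff cl K.l_distr K.r_distr K.m_assoc K.m_lcomm split: two_term.split)
  have bd: "bilinear K ?F ?F ?F (dot ?F)"
    by (intro bilinearI linear_mapI)
      (auto simp: free_two_magma_simps d free_module_simps(3,4) fun_eq_iff cl K.l_distr K.r_distr K.m_assoc K.m_lcomm split: two_term.split)
  show ?thesis
    by (intro two_magma.intro F bm bd) (simp add: free_two_magma_simps basis_elt_closed[OF cK])
qed

lemma free_two_magma_basis:
  assumes "cring K"
  shows "mult (free_two_magma K X) (basis_elt K s) (basis_elt K t) = basis_elt K (Star s t)"
    "dot (free_two_magma K X) (basis_elt K s) (basis_elt K t) = basis_elt K (Dot s t)"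
proof -
  interpret K: cring K by fact
  show "mult (free_two_magma K X) (basis_elt K s) (basis_elt K t) = basis_elt K (Star s t)"
    "dot (free_two_magma K X) (basis_elt K s) (basis_elt K t) = basis_elt K (Dot s t)"
    by (auto simp: free_two_magma_simps basis_elt_def fun_eq_iff split: two_term.split)
qed

primrec two_term_eval :: "('k, 'b, 'y) two_alg_scheme \<Rightarrow> ('a \<Rightarrow> 'b) \<Rightarrow> 'a two_term \<Rightarrow> 'b"
  where "two_term_eval B f (Var v) = f v"
  | "two_term_eval B f Unit = \<one>\<^bsub>B\<^esub>"
  | "two_term_eval B f (Star s t) = two_term_eval B f s \<otimes>\<^bsub>B\<^esub> two_term_eval B f t"
  | "two_term_eval B f (Dot s t) = dot B (two_term_eval B f s) (two_term_eval B f t)"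

definition "two_as_lift K B f X = lin_ext K B (two_term_eval B f) (SOME x. x \<in> X)"

locale free_two_as =
  fixes K :: "('k, 'm) ring_scheme" and V :: "('k, 'v, 'x) module_scheme"
  assumes V: "module K V"
begin

abbreviation "F \<equiv> free_two_magma K (carrier V)"
abbreviation "X \<equiv> {t. set_two_term t \<subseteq> carrier V}"
abbreviation "I \<equiv> two_as_ideal K V"
abbreviation "A \<equiv> two_as K V"
abbreviation "gen \<equiv> two_as_gen K V"

lemma cK: "cring K" by (rule module_cring[OF V])

sublocale V: module K V by (rule V)
sublocale F: two_magma K F by (rule free_two_magma_magma[OF cK])

lemma basis_F: "t \<in> X \<Longrightarrow> basis_elt K t \<in> carrier F"
  by (simp add: free_two_magma_simps basis_elt_closed[OF cK])

lemma F_spans: "spans K F (basis_elt K ` X)"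
  using spans_free_module[OF cK, of X]
  by (subst spans_struct_cong[OF free_module_module[OF cK]]) (simp_all add: free_two_magma_simps)

lemma rels_closed: "two_as_rels K V \<subseteq> carrier F"
proof -
  note mc = bilin_closed[OF F.mult_bilin] and dc = bilin_closed[OF F.dot_bilin]
  have v: "v \<in> carrier V \<Longrightarrow> basis_elt K (Var v) \<in> carrier F" for v by (rule basis_F) simp
  show ?thesis unfolding two_as_rels_def Let_def
    by (intro Un_least UN_least) (auto intro!: F.A.minus_closed mc dc F.one v F.A.a_closed F.A.smult_closed)
qed

lemma I_ideal: "two_ideal K F I"
  unfolding two_as_ideal_def by (rule F.two_ideal_two_ideal_gen[OF rels_closed])

lemma I_rels: "two_as_rels K V \<subseteq> I"
  unfolding two_as_ideal_def by (rule F.two_ideal_gen_incl)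

sublocale Q: two_quotient K F I
  by (intro two_quotient.intro F.two_magma_axioms two_quotient_axioms.intro I_ideal)

lemma A_eq: "A = two_quot F I"
  by (simp add: two_as_def)

lemma A_two_as_algebra: "two_as_algebra K A"
  unfolding A_eq
proof (rule Q.Q_two_as_algebra)
  show "x \<otimes>\<^bsub>F\<^esub> y \<otimes>\<^bsub>F\<^esub> z \<ominus>\<^bsub>F\<^esub> x \<otimes>\<^bsub>F\<^esub> (y \<otimes>\<^bsub>F\<^esub> z) \<in> I" if "x \<in> carrier F" "y \<in> carrier F" "z \<in> carrier F" for x y z
    by (rule subsetD[OF I_rels], unfold two_as_rels_def Let_def, rule UnI1, rule UnI1, rule UN_I[of "mult F"], simp, rule UnI1, rule UnI1)
      (use that in fast)
  show "dot F (dot F x y) z \<ominus>\<^bsub>F\<^esub> dot F x (dot F y z) \<in> I" if "x \<in> carrier F" "y \<in> carrier F" "z \<in> carrier F" for x y z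
    by (rule subsetD[OF I_rels], unfold two_as_rels_def Let_def, rule UnI1, rule UnI1, rule UN_I[of "dot F"], simp, rule UnI1, rule UnI1)
      (use that in fast)
  show "\<one>\<^bsub>F\<^esub> \<otimes>\<^bsub>F\<^esub> x \<ominus>\<^bsub>F\<^esub> x \<in> I" if "x \<in> carrier F" for x
    by (rule subsetD[OF I_rels], unfold two_as_rels_def Let_def, rule UnI1, rule UnI1, rule UN_I[of "mult F"], simp, rule UnI1, rule UnI2)
      (use that in fast)
  show "dot F \<one>\<^bsub>F\<^esub> x \<ominus>\<^bsub>F\<^esub> x \<in> I" if "x \<in> carrier F" for x
    by (rule subsetD[OF I_rels], unfold two_as_rels_def Let_def, rule UnI1, rule UnI1, rule UN_I[of "dot F"], simp, rule UnI1, rule UnI2)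
      (use that in fast)
  show "x \<otimes>\<^bsub>F\<^esub> \<one>\<^bsub>F\<^esub> \<ominus>\<^bsub>F\<^esub> x \<in> I" if "x \<in> carrier F" for x
    by (rule subsetD[OF I_rels], unfold two_as_rels_def Let_def, rule UnI1, rule UnI1, rule UN_I[of "mult F"], simp, rule UnI2)
      (use that in fast)
  show "dot F x \<one>\<^bsub>F\<^esub> \<ominus>\<^bsub>F\<^esub> x \<in> I" if "x \<in> carrier F" for x
    by (rule subsetD[OF I_rels], unfold two_as_rels_def Let_def, rule UnI1, rule UnI1, rule UN_I[of "dot F"], simp, rule UnI2)
      (use that in fast)
qed

lemmas A = two_as_algebraD(3)[OF A_two_as_algebra]
lemmas A_one = two_as_algebraD(4)[OF A_two_as_algebra]
lemmas A_mult_bilin = two_as_algebraD(5)[OF A_two_as_algebra]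
lemmas A_dot_bilin = two_as_algebraD(6)[OF A_two_as_algebra]
lemmas A_mult_closed = bilin_closed[OF A_mult_bilin]
lemmas A_dot_closed = bilin_closed[OF A_dot_bilin]

sublocale A: module K A by (rule A)

lemma gen_pr: "gen v = Q.pr (basis_elt K (Var v))"
  by (simp add: two_as_gen_def)

lemma gen_closed: "v \<in> carrier V \<Longrightarrow> gen v \<in> carrier A"
  unfolding gen_pr A_eq by (rule lin_closed[OF Q.pr_linear basis_F]) simp

lemma gen_linear: "linear_map K V A gen"
proof -
  have v: "v \<in> carrier V \<Longrightarrow> basis_elt K (Var v) \<in> carrier F" for v by (rule basis_F) simp
  show ?thesis
  proof (rule linear_mapI[OF gen_closed])
    fix x y assume xy: "x \<in> carrier V" "y \<in> carrier V"
    have "basis_elt K (Var (x \<oplus>\<^bsub>V\<^esub> y)) \<ominus>\<^bsub>F\<^esub> (basis_elt K (Var x) \<oplus>\<^bsub>F\<^esub> basis_elt K (Var y)) \<in> I"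
      by (rule subsetD[OF I_rels], unfold two_as_rels_def Let_def, rule UnI1, rule UnI2) (use xy in fast)
    then have "Q.pr (basis_elt K (Var (x \<oplus>\<^bsub>V\<^esub> y))) = Q.pr (basis_elt K (Var x) \<oplus>\<^bsub>F\<^esub> basis_elt K (Var y))"
      using xy v by (subst Q.pr_eq_iff) simp_all
    then show "gen (x \<oplus>\<^bsub>V\<^esub> y) = gen x \<oplus>\<^bsub>A\<^esub> gen y"
      using xy v lin_add[OF Q.pr_linear] unfolding gen_pr A_eq by simp
  next
    fix c x assume xy: "c \<in> carrier K" "x \<in> carrier V"
    have "basis_elt K (Var (c \<odot>\<^bsub>V\<^esub> x)) \<ominus>\<^bsub>F\<^esub> (c \<odot>\<^bsub>F\<^esub> basis_elt K (Var x)) \<in> I"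
      by (rule subsetD[OF I_rels], unfold two_as_rels_def Let_def, rule UnI2) (use xy in fast)
    then have "Q.pr (basis_elt K (Var (c \<odot>\<^bsub>V\<^esub> x))) = Q.pr (c \<odot>\<^bsub>F\<^esub> basis_elt K (Var x))"
      using xy v by (subst Q.pr_eq_iff) simp_all
    then show "gen (c \<odot>\<^bsub>V\<^esub> x) = c \<odot>\<^bsub>A\<^esub> gen x"
      using xy v lin_smult[OF Q.pr_linear] unfolding gen_pr A_eq by simp
  qed
qed

text \<open>The classes of terms span, and terms are built from 1, generators and the two products.
  The property has to cut out a submodule in order to pass from terms to their linear
  combinations.\<close>

lemma A_induct [consumes 1, case_names submodule one gen mult dot]:
  assumes x: "x \<in> carrier A"
    and sub: "submodule {x \<in> carrier A. P x} K A" and one: "P \<one>\<^bsub>A\<^esub>" and gen: "\<And>v. v \<in> carrier V \<Longrightarrow> P (gen v)"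
    and mult: "\<And>x y. x \<in> carrier A \<Longrightarrow> y \<in> carrier A \<Longrightarrow> P x \<Longrightarrow> P y \<Longrightarrow> P (x \<otimes>\<^bsub>A\<^esub> y)"
    and dot: "\<And>x y. x \<in> carrier A \<Longrightarrow> y \<in> carrier A \<Longrightarrow> P x \<Longrightarrow> P y \<Longrightarrow> P (dot A x y)"
  shows "P x"
proof -
  have t: "P (Q.pr (basis_elt K t))" if "t \<in> X" for t
    using that
  proof (induction t)
    case (Var v)
    then show ?case using gen[of v] by (simp add: gen_pr)
  next
    case Unit
    then show ?case using one by (simp add: A_eq Q.Q_simps(5) free_two_magma_simps(5))
  next
    case (Star s t)
    then have st: "s \<in> X" "t \<in> X" by auto
    note b = basis_F[OF st(1)] basis_F[OF st(2)]
    show ?case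
      using mult[unfolded A_eq, OF lin_closed[OF Q.pr_linear b(1)] lin_closed[OF Q.pr_linear b(2)]] Star.IH st
      by (simp add: Q.pr_mult[OF b] free_two_magma_basis[OF cK])
  next
    case (Dot s t)
    then have st: "s \<in> X" "t \<in> X" by auto
    note b = basis_F[OF st(1)] basis_F[OF st(2)]
    show ?case
      using dot[unfolded A_eq, OF lin_closed[OF Q.pr_linear b(1)] lin_closed[OF Q.pr_linear b(2)]] Dot.IH st
      by (simp add: Q.pr_dot[OF b] free_two_magma_basis[OF cK])
  qed
  have "spans K A (Q.pr ` basis_elt K ` X)"
    unfolding A_eq by (rule spans_image[OF F_spans F.A Q.Q Q.pr_linear Q.Q_carrier[symmetric]])
  moreover have "Q.pr ` basis_elt K ` X \<subseteq> {x \<in> carrier A. P x}"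
    using t lin_closed[OF Q.pr_linear basis_F] unfolding A_eq by blast
  ultimately have "carrier A \<subseteq> {x \<in> carrier A. P x}" using sub unfolding spans_def by simp
  then show ?thesis using x by (simp add: subset_iff)
qed

text \<open>The kernel of the evaluation of terms in \<open>B\<close> is an ideal for both products
  and contains the defining relations, hence it contains \<open>I\<close>.\<close>

lemma two_as_lift:
  assumes B: "two_as_algebra K B" and f: "linear_map K V B f"
  shows "two_as_hom K A B (two_as_lift K B f)"
    and "v \<in> carrier V \<Longrightarrow> two_as_lift K B f (gen v) = f v"
proof -
  note Bm = two_as_algebraD(3)[OF B] and B1 = two_as_algebraD(4)[OF B] and Bb = two_as_algebraD(5,6)[OF B]
  interpret B: module K B by (rule Bm)
  interpret mB: monoid B by (rule assoc_algebraD[OF two_as_algebraD(1)[OF B]])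
  note dB = two_as_algebra_dot[OF B]
  let ?e = "two_term_eval B f" and ?h = "lin_ext K B (two_term_eval B f)"
  have ec: "?e t \<in> carrier B" if "t \<in> X" for t
    using that by (induction t) (auto simp: B1 lin_closed[OF f] bilin_closed[OF Bb(1)] bilin_closed[OF Bb(2)])
  have h: "linear_map K F B ?h"
    using lin_ext_linear[OF Bm, of X ?e] ec
    by (subst lin_struct_cong[of _ "free_module K X" _ B]) (simp_all add: free_two_magma_simps)
  have hb: "?h (basis_elt K t) = ?e t" if "t \<in> X" for t
    by (rule lin_ext_basis_elt[OF Bm that ec])
  have hm: "?h (x \<otimes>\<^bsub>F\<^esub> y) = ?h x \<otimes>\<^bsub>B\<^esub> ?h y" if "x \<in> carrier F" "y \<in> carrier F" for x y
  proof (rule bilin_eqI[where f="\<lambda>x y. ?h (x \<otimes>\<^bsub>F\<^esub> y)" and g="\<lambda>x y. ?h x \<otimes>\<^bsub>B\<^esub> ?h y", OF F_spans F_spans F.A F.A Bm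
      bilin_comp[OF F.mult_bilin lin_id lin_id h] bilin_comp[OF Bb(1) h h lin_id] _ that])
    fix x y assume "x \<in> basis_elt K ` X" "y \<in> basis_elt K ` X"
    then obtain s t where "x = basis_elt K s" "y = basis_elt K t" "s \<in> X" "t \<in> X" by blast
    then show "?h (x \<otimes>\<^bsub>F\<^esub> y) = ?h x \<otimes>\<^bsub>B\<^esub> ?h y" using hb[of "Star s t"] by (simp add: free_two_magma_basis[OF cK] hb)
  qed
  have hd: "?h (dot F x y) = dot B (?h x) (?h y)" if "x \<in> carrier F" "y \<in> carrier F" for x y
  proof (rule bilin_eqI[where f="\<lambda>x y. ?h (dot F x y)" and g="\<lambda>x y. dot B (?h x) (?h y)", OF F_spans F_spans F.A F.A Bm
      bilin_comp[OF F.dot_bilin lin_id lin_id h] bilin_comp[OF Bb(2) h h lin_id] _ that])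
    fix x y assume "x \<in> basis_elt K ` X" "y \<in> basis_elt K ` X"
    then obtain s t where "x = basis_elt K s" "y = basis_elt K t" "s \<in> X" "t \<in> X" by blast
    then show "?h (dot F x y) = dot B (?h x) (?h y)" using hb[of "Dot s t"] by (simp add: free_two_magma_basis[OF cK] hb)
  qed
  have h1: "?h \<one>\<^bsub>F\<^esub> = \<one>\<^bsub>B\<^esub>" using hb[of Unit] by (simp add: free_two_magma_simps(5))
  note hc = lin_closed[OF h]
  note mc = bilin_closed[OF F.mult_bilin] and dc = bilin_closed[OF F.dot_bilin]
  note hs = lin_minus[OF h F.A Bm]
  have v: "v \<in> carrier V \<Longrightarrow> basis_elt K (Var v) \<in> carrier F" for v by (rule basis_F) simp
  have hv: "v \<in> carrier V \<Longrightarrow> ?h (basis_elt K (Var v)) = f v" for v using hb[of "Var v"] by simp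
  have z: "?h x = \<zero>\<^bsub>B\<^esub>" if x: "x \<in> two_as_rels K V" for x
  proof -
    \<comment> \<open>Both products obey the same axioms, so their relations are checked once, for a
      product \<open>\<mu>\<close> of the magma and the matching product \<open>\<mu>'\<close> of
      \<open>B\<close>.\<close>
    have 1: "?h x = \<zero>\<^bsub>B\<^esub>" if \<mu>: "\<mu> = mult F \<and> \<mu>' = mult B \<or> \<mu> = dot F \<and> \<mu>' = dot B" and
      x: "x \<in> {\<mu> (\<mu> x y) z \<ominus>\<^bsub>F\<^esub> \<mu> x (\<mu> y z) |x y z. x \<in> carrier F \<and> y \<in> carrier F \<and> z \<in> carrier F} \<union>
        {\<mu> \<one>\<^bsub>F\<^esub> x \<ominus>\<^bsub>F\<^esub> x |x. x \<in> carrier F} \<union> {\<mu> x \<one>\<^bsub>F\<^esub> \<ominus>\<^bsub>F\<^esub> x |x. x \<in> carrier F}" for \<mu> \<mu>'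
    proof -
      have c: "\<mu> a b \<in> carrier F" "?h (\<mu> a b) = \<mu>' (?h a) (?h b)" if "a \<in> carrier F" "b \<in> carrier F" for a b
        using \<mu> hm hd mc dc that by auto
      have u: "\<mu>' \<one>\<^bsub>B\<^esub> a = a" "\<mu>' a \<one>\<^bsub>B\<^esub> = a" if "a \<in> carrier B" for a using \<mu> dB that by auto
      have a': "\<mu>' a b \<in> carrier B" if "a \<in> carrier B" "b \<in> carrier B" for a b using \<mu> dB that by auto
      have a: "\<mu>' (\<mu>' a b) e = \<mu>' a (\<mu>' b e)" if "a \<in> carrier B" "b \<in> carrier B" "e \<in> carrier B" for a b e
        using \<mu> dB mB.m_assoc that by auto
      show ?thesis using x
        by (elim UnE CollectE exE conjE) (simp_all add: hs c u a a' F.one h1 hc B.minus_eq_zero_iff)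
    qed
    from x show ?thesis unfolding two_as_rels_def Let_def
    proof (elim UnE UN_E)
      fix \<mu> assume \<mu>: "\<mu> \<in> {mult F, dot F}"
      then obtain \<mu>' where "\<mu> = mult F \<and> \<mu>' = mult B \<or> \<mu> = dot F \<and> \<mu>' = dot B" by blast
      note 2 = 1[OF this]
      show "x \<in> {\<mu> (\<mu> x y) z \<ominus>\<^bsub>F\<^esub> \<mu> x (\<mu> y z) |x y z. x \<in> carrier F \<and> y \<in> carrier F \<and> z \<in> carrier F} \<Longrightarrow> ?thesis"
        "x \<in> {\<mu> \<one>\<^bsub>F\<^esub> x \<ominus>\<^bsub>F\<^esub> x |x. x \<in> carrier F} \<Longrightarrow> ?thesis" "x \<in> {\<mu> x \<one>\<^bsub>F\<^esub> \<ominus>\<^bsub>F\<^esub> x |x. x \<in> carrier F} \<Longrightarrow> ?thesis"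
        by (rule 2, rule UnI1, rule UnI1, assumption) (rule 2, rule UnI1, rule UnI2, assumption, rule 2, rule UnI2, assumption)
    next
      assume "x \<in> {basis_elt K (Var (u \<oplus>\<^bsub>V\<^esub> v)) \<ominus>\<^bsub>F\<^esub> (basis_elt K (Var u) \<oplus>\<^bsub>F\<^esub> basis_elt K (Var v)) |u v. u \<in> carrier V \<and> v \<in> carrier V}"
      then show ?thesis
        by (elim CollectE exE conjE) (simp add: hs v hv lin_add[OF h] lin_add[OF f] lin_closed[OF f] B.minus_eq_zero_iff)
    next
      assume "x \<in> {basis_elt K (Var (c \<odot>\<^bsub>V\<^esub> v)) \<ominus>\<^bsub>F\<^esub> c \<odot>\<^bsub>F\<^esub> basis_elt K (Var v) |c v. c \<in> carrier K \<and> v \<in> carrier V}"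
      then show ?thesis
        by (elim CollectE exE conjE) (simp add: hs v hv lin_smult[OF h] lin_smult[OF f] lin_closed[OF f] B.minus_eq_zero_iff)
    qed
  qed
  have "I \<subseteq> {x \<in> carrier F. ?h x = \<zero>\<^bsub>B\<^esub>}"
    unfolding two_as_ideal_def
    by (rule F.two_ideal_gen_least[OF F.two_ideal_kernel[OF Bm h Bb hm hd]]) (use z rels_closed in auto)
  then have zI: "\<And>x. x \<in> I \<Longrightarrow> ?h x = \<zero>\<^bsub>B\<^esub>" by auto
  note ql = Q.SM.quot_lift[OF Bm h]
  have L: "linear_map K A B (two_as_lift K B f)"
    unfolding two_as_lift_def[abs_def] A_eq using ql(1)[OF zI]
    by (subst lin_struct_cong[of _ "quot_module F I" _ B]) (simp_all add: Q.Q_simps)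
  have P: "two_as_lift K B f (Q.pr x) = ?h x" if "x \<in> carrier F" for x
    unfolding two_as_lift_def by (rule ql(2)[OF zI that])
  show "two_as_hom K A B (two_as_lift K B f)"
    unfolding two_as_hom_def
  proof (intro conjI ballI L)
    show "two_as_lift K B f \<one>\<^bsub>A\<^esub> = \<one>\<^bsub>B\<^esub>" by (simp add: A_eq Q.Q_simps(5) P F.one h1)
    fix x y assume "x \<in> carrier A" "y \<in> carrier A"
    then obtain a b where "x = Q.pr a" "y = Q.pr b" "a \<in> carrier F" "b \<in> carrier F" unfolding A_eq Q.Q_carrier by blast
    then show "two_as_lift K B f (x \<otimes>\<^bsub>A\<^esub> y) = two_as_lift K B f x \<otimes>\<^bsub>B\<^esub> two_as_lift K B f y"
      "two_as_lift K B f (dot A x y) = dot B (two_as_lift K B f x) (two_as_lift K B f y)"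
      by (simp_all add: A_eq Q.pr_mult Q.pr_dot P hm hd mc dc)
  qed
  show "v \<in> carrier V \<Longrightarrow> two_as_lift K B f (gen v) = f v"
    by (simp add: gen_pr P v hv)
qed

end

section \<open>The coproduct of the free 2-associative algebra\<close>

lemma minus_eq_iff:
  assumes "module K V" "a \<in> carrier V" "b \<in> carrier V" "d \<in> carrier V"
  shows "a = b \<ominus>\<^bsub>V\<^esub> d \<longleftrightarrow> a \<oplus>\<^bsub>V\<^esub> d = b"
proof -
  interpret V: module K V by fact
  show ?thesis
  proof
    assume "a = b \<ominus>\<^bsub>V\<^esub> d"
    then show "a \<oplus>\<^bsub>V\<^esub> d = b" using assms by (simp add: a_minus_def V.a_assoc V.l_neg)
  next
    assume "a \<oplus>\<^bsub>V\<^esub> d = b"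
    then have "b \<ominus>\<^bsub>V\<^esub> d = a" using assms by (auto simp: a_minus_def V.a_assoc V.r_neg)
    then show "a = b \<ominus>\<^bsub>V\<^esub> d" by simp
  qed
qed

lemma Prim_iff:
  assumes H: "module K H" and D: "comult H x \<in> carrier (tensor K H H)" and one: "\<one>\<^bsub>H\<^esub> \<in> carrier H" and x: "x \<in> carrier H"
  shows "x \<in> Prim K H \<longleftrightarrow> comult H x = pure_tensor K H H x \<one>\<^bsub>H\<^esub> \<oplus>\<^bsub>tensor K H H\<^esub> pure_tensor K H H \<one>\<^bsub>H\<^esub> x"
proof -
  let ?T = "tensor K H H"
  have T: "module K ?T" by (rule tensor_module[OF H H])
  interpret T: module K ?T by (rule T)
  note c = pure_tensor_closed[OF H H x one] pure_tensor_closed[OF H H one x]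
  have "x \<in> Prim K H \<longleftrightarrow> comult H x \<ominus>\<^bsub>?T\<^esub> pure_tensor K H H x \<one>\<^bsub>H\<^esub> = pure_tensor K H H \<one>\<^bsub>H\<^esub> x"
    using x c D by (simp add: Prim_def T.minus_eq_zero_iff)
  also have "\<dots> \<longleftrightarrow> pure_tensor K H H \<one>\<^bsub>H\<^esub> x \<oplus>\<^bsub>?T\<^esub> pure_tensor K H H x \<one>\<^bsub>H\<^esub> = comult H x"
    using minus_eq_iff[OF T c(2) D c(1)] by auto
  also have "\<dots> \<longleftrightarrow> comult H x = pure_tensor K H H x \<one>\<^bsub>H\<^esub> \<oplus>\<^bsub>?T\<^esub> pure_tensor K H H \<one>\<^bsub>H\<^esub> x"
    using c by (auto simp: T.a_comm)
  finally show ?thesis .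
qed

lemma Prim_with_coalgebra_iff:
  assumes H: "module K H" and D: "D x \<in> carrier (tensor K H H)" and one: "\<one>\<^bsub>H\<^esub> \<in> carrier H" and x: "x \<in> carrier H"
  shows "x \<in> Prim K (with_coalgebra H D e) \<longleftrightarrow>
    D x = pure_tensor K H H x \<one>\<^bsub>H\<^esub> \<oplus>\<^bsub>tensor K H H\<^esub> pure_tensor K H H \<one>\<^bsub>H\<^esub> x"
proof -
  let ?C = "with_coalgebra H D e"
  have C: "module K ?C" by (rule module_cong[OF H]) simp_all
  have t: "tensor K ?C ?C = tensor K H H" by (rule tensor_cong) simp_all
  have p: "pure_tensor K ?C ?C = pure_tensor K H H" by (rule tensor_space_struct_cong) simp_all
  show ?thesis using Prim_iff[OF C, of x] D one x unfolding t p by simp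
qed

lemma two_as_bialgebraI:
  fixes A :: "('k, 'a, 'x) two_alg_scheme"
  assumes tA: "two_as_algebra K A"
    and D: "linear_map K A (tensor K A A) \<Delta>" and e: "linear_map K A (scalar_module K) \<epsilon>"
    and co: "\<And>x. x \<in> carrier A \<Longrightarrow> coassoc_at K A \<Delta> x" and cu: "\<And>x. x \<in> carrier A \<Longrightarrow> counit_at K A \<Delta> \<epsilon> x"
    and D1: "\<Delta> \<one>\<^bsub>A\<^esub> = pure_tensor K A A \<one>\<^bsub>A\<^esub> \<one>\<^bsub>A\<^esub>"
    and Dm: "\<And>x y. x \<in> carrier A \<Longrightarrow> y \<in> carrier A \<Longrightarrow> \<Delta> (x \<otimes>\<^bsub>A\<^esub> y) = \<Delta> x \<otimes>\<^bsub>tensor K A A\<^esub> \<Delta> y"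
    and e1: "\<epsilon> \<one>\<^bsub>A\<^esub> = \<one>\<^bsub>K\<^esub>" and em: "\<And>x y. x \<in> carrier A \<Longrightarrow> y \<in> carrier A \<Longrightarrow> \<epsilon> (x \<otimes>\<^bsub>A\<^esub> y) = \<epsilon> x \<otimes>\<^bsub>K\<^esub> \<epsilon> y"
    and inf: "\<And>x y. x \<in> carrier A \<Longrightarrow> y \<in> carrier A \<Longrightarrow> \<Delta> (dot A x y) \<oplus>\<^bsub>tensor K A A\<^esub> pure_tensor K A A x y =
      tensor_map K A A (dot A x) (\<lambda>b. b) (\<Delta> y) \<oplus>\<^bsub>tensor K A A\<^esub> tensor_map K A A (\<lambda>a. a) (\<lambda>b. dot A b y) (\<Delta> x)"
  shows "two_as_bialgebra K A \<Delta> \<epsilon>"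
  unfolding two_as_bialgebra_def Let_def
proof (intro conjI ballI tA)
  let ?B = "with_coalgebra A \<Delta> \<epsilon>"
  have t: "tensor K ?B ?B = tensor K A A" by (rule tensor_cong) simp_all
  have 1: "assoc_algebra K ?B"
    using two_as_algebraD(1)[OF tA] by (subst assoc_algebra_struct_cong[of _ A]) simp_all
  have 2: "coalgebra K ?B"
    by (subst coalgebra_iff[of _ A]) (simp_all add: two_as_algebraD(3)[OF tA] D e co cu)
  have 3: "\<Delta> \<in> ring_hom ?B (tensor K A A)"
    by (rule ring_hom_memI) (simp_all add: lin_closed[OF D] Dm lin_add[OF D] D1 tensor_simps(5))
  have 4: "\<epsilon> \<in> ring_hom ?B K"
    using lin_add[OF e] lin_closed[OF e] by (intro ring_hom_memI) (simp_all add: em e1)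
  show "bialgebra K ?B" using 1 2 3 4 unfolding bialgebra_def t by simp
  fix x y assume xy: "x \<in> carrier A" "y \<in> carrier A"
  show "\<Delta> (dot A x y) = (pure_tensor K A A x \<one>\<^bsub>A\<^esub> \<otimes>\<^bsub>tensor K (dot_alg A) (dot_alg A)\<^esub> \<Delta> y \<oplus>\<^bsub>tensor K (dot_alg A) (dot_alg A)\<^esub>
      \<Delta> x \<otimes>\<^bsub>tensor K (dot_alg A) (dot_alg A)\<^esub> pure_tensor K A A \<one>\<^bsub>A\<^esub> y) \<ominus>\<^bsub>tensor K (dot_alg A) (dot_alg A)\<^esub> pure_tensor K A A x y"
    by (subst infinitesimal_iff[OF tA D xy]) (rule inf[OF xy])
qed

lemma two_as_bialgebraD:
  fixes A :: "('k, 'a, 'x) two_alg_scheme"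
  assumes tb: "two_as_bialgebra K A \<Delta> \<epsilon>"
  shows "two_as_algebra K A"
    and "linear_map K A (tensor K A A) \<Delta>" and "linear_map K A (scalar_module K) \<epsilon>"
    and "\<And>x. x \<in> carrier A \<Longrightarrow> coassoc_at K A \<Delta> x" and "\<And>x. x \<in> carrier A \<Longrightarrow> counit_at K A \<Delta> \<epsilon> x"
    and "\<Delta> \<one>\<^bsub>A\<^esub> = pure_tensor K A A \<one>\<^bsub>A\<^esub> \<one>\<^bsub>A\<^esub>"
    and "\<And>x y. x \<in> carrier A \<Longrightarrow> y \<in> carrier A \<Longrightarrow> \<Delta> (x \<otimes>\<^bsub>A\<^esub> y) = \<Delta> x \<otimes>\<^bsub>tensor K A A\<^esub> \<Delta> y"
    and "\<epsilon> \<one>\<^bsub>A\<^esub> = \<one>\<^bsub>K\<^esub>" and "\<And>x y. x \<in> carrier A \<Longrightarrow> y \<in> carrier A \<Longrightarrow> \<epsilon> (x \<otimes>\<^bsub>A\<^esub> y) = \<epsilon> x \<otimes>\<^bsub>K\<^esub> \<epsilon> y"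
    and "infinitesimal_comult K A \<Delta> (dot A)"
proof -
  let ?B = "with_coalgebra A \<Delta> \<epsilon>"
  show tA: "two_as_algebra K A" using tb by (simp add: two_as_bialgebra_def)
  have b: "bialgebra K ?B" using tb by (simp add: two_as_bialgebra_def)
  have t: "tensor K ?B ?B = tensor K A A" by (rule tensor_cong) simp_all
  have c: "coalgebra K ?B" using b by (simp add: bialgebra_def)
  note c' = c[unfolded coalgebra_iff[of ?B A, simplified]]
  show D: "linear_map K A (tensor K A A) \<Delta>" and "linear_map K A (scalar_module K) \<epsilon>"
    and "\<And>x. x \<in> carrier A \<Longrightarrow> coassoc_at K A \<Delta> x" and "\<And>x. x \<in> carrier A \<Longrightarrow> counit_at K A \<Delta> \<epsilon> x"
    using c' by simp_all
  have h: "\<Delta> \<in> ring_hom ?B (tensor K A A)" "\<epsilon> \<in> ring_hom ?B K" using b unfolding bialgebra_def t by simp_all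
  show "\<Delta> \<one>\<^bsub>A\<^esub> = pure_tensor K A A \<one>\<^bsub>A\<^esub> \<one>\<^bsub>A\<^esub>" using ring_hom_one[OF h(1)] by (simp add: tensor_simps(5))
  show "\<epsilon> \<one>\<^bsub>A\<^esub> = \<one>\<^bsub>K\<^esub>" using ring_hom_one[OF h(2)] by simp
  show "\<And>x y. x \<in> carrier A \<Longrightarrow> y \<in> carrier A \<Longrightarrow> \<Delta> (x \<otimes>\<^bsub>A\<^esub> y) = \<Delta> x \<otimes>\<^bsub>tensor K A A\<^esub> \<Delta> y"
    using ring_hom_mult[OF h(1)] by simp
  show "\<And>x y. x \<in> carrier A \<Longrightarrow> y \<in> carrier A \<Longrightarrow> \<epsilon> (x \<otimes>\<^bsub>A\<^esub> y) = \<epsilon> x \<otimes>\<^bsub>K\<^esub> \<epsilon> y"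
    using ring_hom_mult[OF h(2)] by simp
  show "infinitesimal_comult K A \<Delta> (dot A)"
  proof (intro infinitesimal_comult.intro linear_comult.intro infinitesimal_comult_axioms.intro two_as_algebraD[OF tA] D two_as_algebra_dot(2)[OF tA])
    fix x y assume xy: "x \<in> carrier A" "y \<in> carrier A"
    have "\<Delta> (dot A x y) = (pure_tensor K A A x \<one>\<^bsub>A\<^esub> \<otimes>\<^bsub>tensor K (dot_alg A) (dot_alg A)\<^esub> \<Delta> y \<oplus>\<^bsub>tensor K (dot_alg A) (dot_alg A)\<^esub>
      \<Delta> x \<otimes>\<^bsub>tensor K (dot_alg A) (dot_alg A)\<^esub> pure_tensor K A A \<one>\<^bsub>A\<^esub> y) \<ominus>\<^bsub>tensor K (dot_alg A) (dot_alg A)\<^esub> pure_tensor K A A x y"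
      using tb xy unfolding two_as_bialgebra_def Let_def by blast
    then show "\<Delta> (dot A x y) \<oplus>\<^bsub>tensor K A A\<^esub> pure_tensor K A A x y =
      tensor_map K A A (dot A x) (\<lambda>b. b) (\<Delta> y) \<oplus>\<^bsub>tensor K A A\<^esub> tensor_map K A A (\<lambda>a. a) (\<lambda>b. dot A b y) (\<Delta> x)"
      by (subst (asm) infinitesimal_iff[OF tA D xy])
  qed
qed

section \<open>Further consequences of the infinitesimal relation\<close>

context infinitesimal_comult begin

lemma rm_bilin: "bilinear K A AA AA rm"
proof (rule bilin_from_span[OF A AA AA tensor_spans[OF A A] rm_lin])
  fix s assume "s \<in> {p v w |v w. v \<in> carrier A \<and> w \<in> carrier A}"
  then obtain a b where s: "s = p a b" "a \<in> carrier A" "b \<in> carrier A" by auto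
  show "linear_map K A AA (\<lambda>v. rm v s)"
    by (rule lin_congI[OF lin_comp[OF mr[OF s(3)] bilin_right[OF p_bilin s(2)]] A])
      (simp add: s rm_pure)
qed

lemma lm_lm: "x \<in> carrier A \<Longrightarrow> y \<in> carrier A \<Longrightarrow> X \<in> carrier AA \<Longrightarrow> lm x (lm y X) = lm (m x y) X"
  by (rule eqI[OF AA lin_comp[OF lm_lin lm_lin] lm_lin[OF m_closed]]) (simp_all add: lm_pure m_closed m_assoc)

lemma rm_rm: "x \<in> carrier A \<Longrightarrow> y \<in> carrier A \<Longrightarrow> X \<in> carrier AA \<Longrightarrow> rm y (rm x X) = rm (m x y) X"
  by (rule eqI[OF AA lin_comp[OF rm_lin rm_lin] rm_lin[OF m_closed]]) (simp_all add: rm_pure m_closed m_assoc)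

lemma lm_rm: "x \<in> carrier A \<Longrightarrow> y \<in> carrier A \<Longrightarrow> X \<in> carrier AA \<Longrightarrow> rm y (lm x X) = lm x (rm y X)"
  by (rule eqI[OF AA lin_comp[OF lm_lin rm_lin] lin_comp[OF rm_lin lm_lin]]) (simp_all add: rm_pure lm_pure m_closed)

text \<open>A 2-associative bialgebra demands a multiplicative counit for \<open>*\<close>; for the
  other product it follows. Applying \<open>\<epsilon> \<otimes> id\<close> to the infinitesimal
  relation leaves \<open>\<epsilon> x \<odot> y\<close> equal to
  \<open>\<epsilon> \<otimes> id\<close> of \<open>lm x (\<Delta> y)\<close>. Applying
  \<open>\<epsilon>\<close> once more gives \<open>\<epsilon> (m x y)\<close> on the right, by the
  other counit axiom at \<open>y\<close>.\<close>

lemma counit_dot: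
  assumes e: "linear_map K A (scalar_module K) \<epsilon>" and cu: "\<And>x. x \<in> carrier A \<Longrightarrow> counit_at K A \<Delta> \<epsilon> x"
    and x: "x \<in> carrier A" and y: "y \<in> carrier A"
  shows "\<epsilon> (m x y) = \<epsilon> x \<otimes>\<^bsub>K\<^esub> \<epsilon> y"
proof -
  have ec: "a \<in> carrier A \<Longrightarrow> \<epsilon> a \<in> carrier K" for a using lin_closed[OF e] by simp
  have es: "c \<in> carrier K \<Longrightarrow> a \<in> carrier A \<Longrightarrow> \<epsilon> (c \<odot>\<^bsub>A\<^esub> a) = c \<otimes>\<^bsub>K\<^esub> \<epsilon> a" for a c using lin_smult[OF e] by simp
  define l where "l = lift_quot K A (\<lambda>(a, b). \<epsilon> a \<odot>\<^bsub>A\<^esub> b)"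
  define r where "r = lift_quot K A (\<lambda>(a, b). \<epsilon> b \<odot>\<^bsub>A\<^esub> a)"
  note c = counit_maps[OF A e, folded l_def r_def]
  have S: "module K (scalar_module K)" by (rule scalar_module_module[OF A.R.is_cring])
  note cl = x y m_closed D_closed p_closed lin_closed[OF lm_lin] lin_closed[OF rm_lin] ec
     lin_closed[OF c(1)] lin_closed[OF c(3)]
  have l2: "l (rm y X) = m (l X) y" if "X \<in> carrier AA" for X
    by (rule eqI[OF A lin_comp[OF rm_lin[OF y] c(1)] lin_comp[OF c(1) ml[OF y]] _ that])
      (simp add: cl rm_pure c lin_smult[OF ml])
  have lr: "\<epsilon> (l (lm x Y)) = \<epsilon> (m x (r Y))" if "Y \<in> carrier AA" for Y
    by (rule eqI[OF S lin_comp[OF lin_comp[OF lm_lin[OF x] c(1)] e] lin_comp[OF lin_comp[OF c(3) mr[OF x]] e] _ that])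
      (simp add: cl lm_pure c lin_smult[OF mr] es A.R.m_comm)
  have h: "l (\<Delta> x) = x" "r (\<Delta> y) = y" "l (\<Delta> (m x y)) = m x y"
    using cu cl by (simp_all add: counit_at_def l_def r_def)
  have i: "\<Delta> (m x y) \<oplus>\<^bsub>AA\<^esub> p x y = lm x (\<Delta> y) \<oplus>\<^bsub>AA\<^esub> rm y (\<Delta> x)"
    using inf[OF x y] by (simp add: lm_def rm_def)
  have "m x y \<oplus>\<^bsub>A\<^esub> \<epsilon> x \<odot>\<^bsub>A\<^esub> y = m x y \<oplus>\<^bsub>A\<^esub> l (lm x (\<Delta> y))"
    using arg_cong[OF i, of l] by (simp add: lin_add[OF c(1)] cl c l2 h A.a_comm)
  then have "\<epsilon> x \<odot>\<^bsub>A\<^esub> y = l (lm x (\<Delta> y))" by (simp add: cl)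
  then have "\<epsilon> (\<epsilon> x \<odot>\<^bsub>A\<^esub> y) = \<epsilon> (m x y)" using lr[of "\<Delta> y"] by (simp add: h cl)
  then show ?thesis using es ec x y by simp
qed

end

text \<open>
  A linear map \<open>\<Delta> : A \<rightarrow> A \<otimes> A\<close> satisfies the unital infinitesimal relation iff \<open>x \<mapsto> (x, \<Delta> x)\<close> is multiplicative
  for the product \<open>dot\<close> of the following algebra on \<open>A \<times> (A \<otimes> A)\<close>.
\<close>

definition "infinitesimal_alg K A = (let AA = tensor K A A in
    \<lparr>carrier = carrier A \<times> carrier AA,
     mult = (\<lambda>x y. (fst x \<otimes>\<^bsub>A\<^esub> fst y, snd x \<otimes>\<^bsub>AA\<^esub> snd y)),
     one = (\<one>\<^bsub>A\<^esub>, \<one>\<^bsub>AA\<^esub>), zero = (\<zero>\<^bsub>A\<^esub>, \<zero>\<^bsub>AA\<^esub>),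
     add = (\<lambda>x y. (fst x \<oplus>\<^bsub>A\<^esub> fst y, snd x \<oplus>\<^bsub>AA\<^esub> snd y)),
     smult = (\<lambda>c x. (c \<odot>\<^bsub>A\<^esub> fst x, c \<odot>\<^bsub>AA\<^esub> snd x)),
     dot = (\<lambda>x y. (dot A (fst x) (fst y),
       tensor_map K A A (dot A (fst x)) (\<lambda>b. b) (snd y) \<oplus>\<^bsub>AA\<^esub> tensor_map K A A (\<lambda>a. a) (\<lambda>b. dot A b (fst y)) (snd x)
         \<ominus>\<^bsub>AA\<^esub> pure_tensor K A A (fst x) (fst y)))\<rparr>)"

text \<open>The map \<open>x \<mapsto> x \<otimes> 1\<close> satisfies the relation for a trivial
  reason. It makes the operators \<open>lm\<close> and \<open>rm\<close> of the locale available
  before a coproduct has been constructed.\<close>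

lemma infinitesimal_trivial:
  assumes tA: "two_as_algebra K A"
  shows "infinitesimal_comult K A (\<lambda>x. pure_tensor K A A x \<one>\<^bsub>A\<^esub>) (dot A)"
proof -
  note A = two_as_algebraD(3)[OF tA] and one = two_as_algebraD(4)[OF tA] and b = two_as_algebraD(6)[OF tA]
  note l = tensor_map_linear(2)[OF A A A A bilin_right[OF b] lin_id]
  note r = tensor_map_linear(2)[OF A A A A lin_id bilin_left[OF b]]
  show ?thesis
  proof (intro infinitesimal_comult.intro linear_comult.intro infinitesimal_comult_axioms.intro A b two_as_algebra_dot(2)[OF tA]
      bilin_left[OF pure_tensor_bilinear[OF A A] one])
    fix x y assume xy: "x \<in> carrier A" "y \<in> carrier A"
    show "pure_tensor K A A (dot A x y) \<one>\<^bsub>A\<^esub> \<oplus>\<^bsub>tensor K A A\<^esub> pure_tensor K A A x y =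
      tensor_map K A A (dot A x) (\<lambda>b. b) (pure_tensor K A A y \<one>\<^bsub>A\<^esub>) \<oplus>\<^bsub>tensor K A A\<^esub>
      tensor_map K A A (\<lambda>a. a) (\<lambda>b. dot A b y) (pure_tensor K A A x \<one>\<^bsub>A\<^esub>)"
      by (simp only: l[OF xy one] r[OF xy(2,1) one] two_as_algebra_dot(3)[OF tA xy(2)])
  qed
qed

lemma infinitesimal_alg_two_as_algebra:
  fixes A :: "('k, 'a, 'x) two_alg_scheme"
  assumes tA: "two_as_algebra K A"
  shows "two_as_algebra K (infinitesimal_alg K A)"
    and "linear_map K (infinitesimal_alg K A) A fst" and "linear_map K (infinitesimal_alg K A) (tensor K A A) snd"
    and "linear_map K V A f \<Longrightarrow> linear_map K V (tensor K A A) g \<Longrightarrow> linear_map K V (infinitesimal_alg K A) (\<lambda>v. (f v, g v))"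
proof -
  let ?B = "infinitesimal_alg K A" and ?T = "tensor K A A"
  interpret I: infinitesimal_comult K A "\<lambda>x. pure_tensor K A A x \<one>\<^bsub>A\<^esub>" "dot A" by (rule infinitesimal_trivial[OF tA])
  note A = two_as_algebraD(3)[OF tA] and one = two_as_algebraD(4)[OF tA] and mb = two_as_algebraD(5)[OF tA]
  note aA = two_as_algebraD(1)[OF tA]
  note aT = tensor_assoc_algebra[OF aA aA]
  note Tb = assoc_algebra_bilinear[OF aT] and T1 = assoc_algebraD(4)[OF aT]
  interpret mA: monoid A by (rule assoc_algebraD[OF aA])
  interpret mT: monoid ?T by (rule assoc_algebraD[OF aT])
  note d = two_as_algebra_dot[OF tA]
  have s: "carrier ?B = carrier A \<times> carrier ?T" "add ?B = (\<lambda>x y. (fst x \<oplus>\<^bsub>A\<^esub> fst y, snd x \<oplus>\<^bsub>?T\<^esub> snd y))"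
    "smult ?B = (\<lambda>c x. (c \<odot>\<^bsub>A\<^esub> fst x, c \<odot>\<^bsub>?T\<^esub> snd x))" "zero ?B = (\<zero>\<^bsub>A\<^esub>, \<zero>\<^bsub>?T\<^esub>)" "one ?B = (\<one>\<^bsub>A\<^esub>, \<one>\<^bsub>?T\<^esub>)"
    "mult ?B = (\<lambda>x y. (fst x \<otimes>\<^bsub>A\<^esub> fst y, snd x \<otimes>\<^bsub>?T\<^esub> snd y))"
    "dot ?B = (\<lambda>x y. (dot A (fst x) (fst y), I.lm (fst x) (snd y) \<oplus>\<^bsub>?T\<^esub> I.rm (fst y) (snd x) \<ominus>\<^bsub>?T\<^esub> pure_tensor K A A (fst x) (fst y)))"
    by (simp_all add: infinitesimal_alg_def Let_def I.lm_def I.rm_def)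
  have B: "module K ?B"
  proof (rule moduleI[OF I.A.R.is_cring])
    show "abelian_group ?B"
    proof (rule abelian_groupI)
      fix x assume "x \<in> carrier ?B"
      then show "\<exists>y\<in>carrier ?B. y \<oplus>\<^bsub>?B\<^esub> x = \<zero>\<^bsub>?B\<^esub>"
        by (intro bexI[of _ "(\<ominus>\<^bsub>A\<^esub> fst x, \<ominus>\<^bsub>?T\<^esub> snd x)"]) (auto simp: s I.A.l_neg I.AA.l_neg)
    qed (auto simp: s I.A.a_ac I.AA.a_ac)
  qed (auto simp: s I.A.smult_l_distr I.AA.smult_l_distr I.A.smult_r_distr I.AA.smult_r_distr I.A.smult_assoc1 I.AA.smult_assoc1)
  show f: "linear_map K ?B A fst" and sn: "linear_map K ?B ?T snd"
    by (rule linear_mapI; auto simp: s)+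
  have pr: "linear_map K V ?B (\<lambda>v. (f v, g v))" if "linear_map K V A f" "linear_map K V ?T g"
    for V :: "('k, 'v, 'z) module_scheme" and f g
    using that by (auto simp: linear_map_def s Pi_iff)
  then show "linear_map K V A f \<Longrightarrow> linear_map K V ?T g \<Longrightarrow> linear_map K V ?B (\<lambda>v. (f v, g v))" .
  have m: "bilinear K ?B ?B ?B (mult ?B)" unfolding s(6)
  proof (intro bilinearI pr)
    fix x assume x: "x \<in> carrier ?B"
    then have x': "fst x \<in> carrier A" "snd x \<in> carrier ?T" by (auto simp: s)
    show "linear_map K ?B A (\<lambda>y. fst x \<otimes>\<^bsub>A\<^esub> fst y)" "linear_map K ?B A (\<lambda>y. fst y \<otimes>\<^bsub>A\<^esub> fst x)"
      by (rule lin_comp[OF f bilin_right[OF mb x'(1)]], rule lin_comp[OF f bilin_left[OF mb x'(1)]])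
    show "linear_map K ?B ?T (\<lambda>y. snd x \<otimes>\<^bsub>?T\<^esub> snd y)" "linear_map K ?B ?T (\<lambda>y. snd y \<otimes>\<^bsub>?T\<^esub> snd x)"
      by (rule lin_comp[OF sn bilin_right[OF Tb x'(2)]], rule lin_comp[OF sn bilin_left[OF Tb x'(2)]])
  qed
  have dt: "bilinear K ?B ?B ?B (dot ?B)" unfolding s(7)
  proof (intro bilinearI pr)
    fix x assume x: "x \<in> carrier ?B"
    then have x': "fst x \<in> carrier A" "snd x \<in> carrier ?T" by (auto simp: s)
    show "linear_map K ?B A (\<lambda>y. dot A (fst x) (fst y))" "linear_map K ?B A (\<lambda>y. dot A (fst y) (fst x))"
      by (rule lin_comp[OF f I.mr[OF x'(1)]], rule lin_comp[OF f I.ml[OF x'(1)]])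
    show "linear_map K ?B ?T (\<lambda>y. I.lm (fst x) (snd y) \<oplus>\<^bsub>?T\<^esub> I.rm (fst y) (snd x) \<ominus>\<^bsub>?T\<^esub> pure_tensor K A A (fst x) (fst y))"
      by (intro lin_minus_fun lin_add_fun I.AA
          lin_comp[OF sn I.lm_lin[OF x'(1)]] lin_comp[OF f bilin_left[OF I.rm_bilin x'(2)]]
          lin_comp[OF f bilin_right[OF I.p_bilin x'(1)]])
    show "linear_map K ?B ?T (\<lambda>y. I.lm (fst y) (snd x) \<oplus>\<^bsub>?T\<^esub> I.rm (fst x) (snd y) \<ominus>\<^bsub>?T\<^esub> pure_tensor K A A (fst y) (fst x))"
      by (intro lin_minus_fun lin_add_fun I.AA
          lin_comp[OF sn I.rm_lin[OF x'(1)]] lin_comp[OF f bilin_left[OF I.lm_bilin x'(2)]]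
          lin_comp[OF f bilin_left[OF I.p_bilin x'(1)]])
  qed
  have b1: "\<one>\<^bsub>?B\<^esub> \<in> carrier ?B" by (simp add: s one T1)
  have a1: "assoc_algebra K ?B"
  proof (rule assoc_algebraI[OF B m b1 spans_carrier])
    fix x y z assume "x \<in> carrier ?B" "y \<in> carrier ?B" "z \<in> carrier ?B"
    then show "x \<otimes>\<^bsub>?B\<^esub> y \<otimes>\<^bsub>?B\<^esub> z = x \<otimes>\<^bsub>?B\<^esub> (y \<otimes>\<^bsub>?B\<^esub> z)" by (auto simp: s mA.m_assoc mT.m_assoc)
  next
    fix x assume "x \<in> carrier ?B"
    then show "\<one>\<^bsub>?B\<^esub> \<otimes>\<^bsub>?B\<^esub> x = x" "x \<otimes>\<^bsub>?B\<^esub> \<one>\<^bsub>?B\<^esub> = x" by (auto simp: s)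
  qed
  have T1': "\<one>\<^bsub>?T\<^esub> = pure_tensor K A A \<one>\<^bsub>A\<^esub> \<one>\<^bsub>A\<^esub>" by (rule tensor_simps)
  have lm1: "I.lm \<one>\<^bsub>A\<^esub> X = X" and rm1: "I.rm \<one>\<^bsub>A\<^esub> X = X" if X: "X \<in> carrier ?T" for X
    by (rule I.eqI[OF I.AA I.lm_lin[OF one] lin_id _ X]; simp add: I.lm_pure one d(3))
      (rule I.eqI[OF I.AA I.rm_lin[OF one] lin_id _ X]; simp add: I.rm_pure one d(4))
  note lmc = lin_closed[OF I.lm_lin] and rmc = lin_closed[OF I.rm_lin]
  \<comment> \<open>Writing \<open>dot\<close> as juxtaposition, both bracketings of
    \<open>(a, P)\<close>, \<open>(b, Q)\<close> and \<open>(e, R)\<close> have the second component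
    \<open>abR + aQe + Pbe - a \<otimes> be - ab \<otimes> e\<close>.\<close>
  have as: "dot ?B (dot ?B x y) z = dot ?B x (dot ?B y z)" if "x \<in> carrier ?B" "y \<in> carrier ?B" "z \<in> carrier ?B" for x y z
  proof -
    obtain a P b Q e R where x: "x = (a, P)" "y = (b, Q)" "z = (e, R)" by (cases x; cases y; cases z)
    have c: "a \<in> carrier A" "b \<in> carrier A" "e \<in> carrier A" and C: "P \<in> carrier ?T" "Q \<in> carrier ?T" "R \<in> carrier ?T"
      using that by (simp_all add: s x)
    note mi = lin_minus[OF I.rm_lin I.AA I.AA] lin_minus[OF I.lm_lin I.AA I.AA]
    note ad = lin_add[OF I.rm_lin] lin_add[OF I.lm_lin]
    note cc = c C lmc rmc d(1) I.p_closed
    show ?thesis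
      unfolding x s(7)
      by (simp add: cc mi ad I.lm_lm I.rm_rm I.lm_rm I.lm_pure I.rm_pure d(2))
        (simp add: cc a_minus_def I.AA.a_ac)
  qed
  have a2: "assoc_algebra K (dot_alg ?B)"
  proof (rule assoc_algebraI[OF _ _ _ spans_carrier])
    show "module K (dot_alg ?B)" by (rule module_cong[OF B]) simp_all
    show "bilinear K (dot_alg ?B) (dot_alg ?B) (dot_alg ?B) (mult (dot_alg ?B))"
      using dt by (subst bilin_struct_cong[of _ ?B _ ?B _ ?B]) simp_all
    fix x assume "x \<in> carrier (dot_alg ?B)"
    then obtain a P where x: "x = (a, P)" "a \<in> carrier A" "P \<in> carrier ?T" by (auto simp: s)
    have z: "X \<oplus>\<^bsub>?T\<^esub> Y \<ominus>\<^bsub>?T\<^esub> Y = X" "Y \<oplus>\<^bsub>?T\<^esub> X \<ominus>\<^bsub>?T\<^esub> Y = X" if "X \<in> carrier ?T" "Y \<in> carrier ?T" for X Y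
      using that minus_eq_iff[OF I.AA, of X "X \<oplus>\<^bsub>?T\<^esub> Y" Y] minus_eq_iff[OF I.AA, of X "Y \<oplus>\<^bsub>?T\<^esub> X" Y] by (simp_all add: I.AA.a_comm)
    show "\<one>\<^bsub>dot_alg ?B\<^esub> \<otimes>\<^bsub>dot_alg ?B\<^esub> x = x" "x \<otimes>\<^bsub>dot_alg ?B\<^esub> \<one>\<^bsub>dot_alg ?B\<^esub> = x"
      unfolding dot_alg_simps x(1) s(5,7) T1' using x(2,3)
      by (simp_all add: d lm1 rm1 I.lm_pure I.rm_pure one z I.p_closed)
  qed (use b1 as in simp_all)
  show "two_as_algebra K ?B" using a1 a2 by (simp add: two_as_algebra_def)
qed

lemma lin_eq_submodule:
  assumes "module K V" "module K W" "linear_map K V W f" "linear_map K V W g"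
  shows "submodule {x \<in> carrier V. f x = g x} K V"
proof -
  interpret V: module K V by fact
  show ?thesis
    by (rule submoduleI'[OF assms(1)])
      (auto simp: lin_zero[OF assms(3,1,2)] lin_zero[OF assms(4,1,2)] lin_add[OF assms(3)] lin_add[OF assms(4)]
        lin_smult[OF assms(3)] lin_smult[OF assms(4)])
qed

context free_two_as begin

abbreviation "AA \<equiv> tensor K A A"
abbreviation "p \<equiv> pure_tensor K A A"

text \<open>Both coproducts obey the same rules for 1, primitive elements and the two products, so
  compatibility with \<open>h\<close> spreads from the generators. With \<open>h\<close> the
  identity this gives uniqueness of the coproduct of \<open>2as(V)\<close>; with \<open>h\<close>
  the map to \<open>T(R)\<close> it computes the coproduct of \<open>U2(R)\<close>.\<close>

lemma hom_comult:
  assumes a: "two_as_bialgebra K A \<Delta> \<epsilon>" and ag: "\<And>v. v \<in> carrier V \<Longrightarrow> gen v \<in> Prim K (with_coalgebra A \<Delta> \<epsilon>)"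
    and c: "two_as_bialgebra K C \<Delta>' \<epsilon>'" and h: "two_as_hom K A C h"
    and cg: "\<And>v. v \<in> carrier V \<Longrightarrow> h (gen v) \<in> Prim K (with_coalgebra C \<Delta>' \<epsilon>')"
    and x: "x \<in> carrier A"
  shows "\<Delta>' (h x) = tensor_map K C C h h (\<Delta> x)" "\<epsilon>' (h x) = \<epsilon> x"
proof -
  note a = two_as_bialgebraD[OF a] and c = two_as_bialgebraD[OF c]
  note C = two_as_algebraD(3)[OF c(1)] and C1 = two_as_algebraD(4)[OF c(1)]
  interpret C: module K C by (rule C)
  have S: "module K (scalar_module K)" by (rule scalar_module_module[OF cK])
  interpret IA: infinitesimal_comult K A \<Delta> "dot A" by (rule a(10))
  interpret IC: infinitesimal_comult K C \<Delta>' "dot C" by (rule c(10))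
  have hl: "linear_map K A C h" and h1: "h \<one>\<^bsub>A\<^esub> = \<one>\<^bsub>C\<^esub>"
    and hm: "\<And>x y. x \<in> carrier A \<Longrightarrow> y \<in> carrier A \<Longrightarrow> h (x \<otimes>\<^bsub>A\<^esub> y) = h x \<otimes>\<^bsub>C\<^esub> h y"
    and hd: "\<And>x y. x \<in> carrier A \<Longrightarrow> y \<in> carrier A \<Longrightarrow> h (dot A x y) = dot C (h x) (h y)"
    using h by (simp_all add: two_as_hom_def)
  note hc = lin_closed[OF hl]
  let ?t = "tensor_map K C C h h"
  note t = tensor_map_linear[OF A A C C hl hl]
  note tc = lin_closed[OF t(1)]
  \<comment> \<open>The counit vanishes on a primitive \<open>g\<close>: its axiom reads
    \<open>\<epsilon>0 g \<odot> 1 + g = g\<close>, and applying \<open>\<epsilon>0\<close> to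
    \<open>\<epsilon>0 g \<odot> 1 = 0\<close> gives the claim.\<close>
  have prim: "\<Delta>0 g = pure_tensor K H H g \<one>\<^bsub>H\<^esub> \<oplus>\<^bsub>tensor K H H\<^esub> pure_tensor K H H \<one>\<^bsub>H\<^esub> g \<and> \<epsilon>0 g = \<zero>\<^bsub>K\<^esub>"
    if "two_as_bialgebra K H \<Delta>0 \<epsilon>0" "g \<in> Prim K (with_coalgebra H \<Delta>0 \<epsilon>0)" "g \<in> carrier H"
    for H :: "('k, 'h, 'z) two_alg_scheme" and \<Delta>0 \<epsilon>0 g
  proof -
    note d = two_as_bialgebraD[OF that(1)]
    note H = two_as_algebraD(3)[OF d(1)] and H1 = two_as_algebraD(4)[OF d(1)]
    interpret H: module K H by (rule H)
    interpret HT: module K "tensor K H H" by (rule tensor_module[OF H H])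
    have 1: "\<Delta>0 g = pure_tensor K H H g \<one>\<^bsub>H\<^esub> \<oplus>\<^bsub>tensor K H H\<^esub> pure_tensor K H H \<one>\<^bsub>H\<^esub> g"
      using that(2) Prim_with_coalgebra_iff[where D="\<Delta>0" and x=g, OF H lin_closed[OF d(2) that(3)] H1 that(3)] by simp
    note c = counit_maps[OF H d(3)]
    have ec: "\<epsilon>0 g \<in> carrier K" using lin_closed[OF d(3) that(3)] by simp
    have "lift_quot K H (\<lambda>(a, b). \<epsilon>0 a \<odot>\<^bsub>H\<^esub> b) (\<Delta>0 g) = g" using d(5)[OF that(3)] by (simp add: counit_at_def)
    then have "\<epsilon>0 g \<odot>\<^bsub>H\<^esub> \<one>\<^bsub>H\<^esub> \<oplus>\<^bsub>H\<^esub> g = g"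
      unfolding 1 using that(3) H1 pure_tensor_closed[OF H H] by (simp add: lin_add[OF c(1)] c(2) d(8))
    then have "\<epsilon>0 g \<odot>\<^bsub>H\<^esub> \<one>\<^bsub>H\<^esub> = \<zero>\<^bsub>H\<^esub>" using that(3) H1 ec by (simp add: H.add.r_cancel_one)
    then have "\<epsilon>0 (\<epsilon>0 g \<odot>\<^bsub>H\<^esub> \<one>\<^bsub>H\<^esub>) = \<zero>\<^bsub>K\<^esub>" using lin_zero[OF d(3) H S] by simp
    then have "\<epsilon>0 g = \<zero>\<^bsub>K\<^esub>" using lin_smult[OF d(3) ec H1] ec d(8) by simp
    with 1 show ?thesis by simp
  qed
  have "\<Delta>' (h x) = ?t (\<Delta> x) \<and> \<epsilon>' (h x) = \<epsilon> x"
    using x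
  proof (induction x rule: A_induct)
    case submodule
    have "{x \<in> carrier A. \<Delta>' (h x) = ?t (\<Delta> x) \<and> \<epsilon>' (h x) = \<epsilon> x} =
      {x \<in> carrier A. \<Delta>' (h x) = ?t (\<Delta> x)} \<inter> {x \<in> carrier A. \<epsilon>' (h x) = \<epsilon> x}" by auto
    moreover have "submodule {x \<in> carrier A. \<Delta>' (h x) = ?t (\<Delta> x)} K A"
      by (rule lin_eq_submodule[OF A IC.AA lin_comp[OF hl c(2)] lin_comp[OF a(2) t(1)]])
    moreover have "submodule {x \<in> carrier A. \<epsilon>' (h x) = \<epsilon> x} K A"
      by (rule lin_eq_submodule[OF A S lin_comp[OF hl c(3)] a(3)])
    ultimately show ?case by (auto simp: submodule_iff[OF A])
  next
    case one
    show ?case using A_one C1 by (simp add: h1 a(6,8) c(6,8) t(2))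
  next
    case (gen v)
    note g = gen_closed[OF gen]
    note pa = prim[OF assms(1) ag[OF gen] g] and pc = prim[OF assms(3) cg[OF gen] hc[OF g]]
    show ?case using pa pc g A_one by (simp add: lin_add[OF t(1)] t(2) IA.p_closed h1)
  next
    case (mult x y)
    have "tensor_map K C C h h (\<Delta> x \<otimes>\<^bsub>AA\<^esub> \<Delta> y) = ?t (\<Delta> x) \<otimes>\<^bsub>tensor K C C\<^esub> ?t (\<Delta> y)"
      by (rule tensor_map_mult[OF two_as_algebraD(1)[OF a(1)] two_as_algebraD(1)[OF a(1)] two_as_algebraD(1)[OF c(1)] two_as_algebraD(1)[OF c(1)]
          hl hl hm hm IA.D_closed[OF mult(1)] IA.D_closed[OF mult(2)]])
    then show ?case using mult by (simp add: hm a(7,9) c(7,9) hc)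
  next
    case (dot x y)
    note xy = dot(1,2)
    have l: "?t (IA.lm x Y) = IC.lm (h x) (?t Y)" if "Y \<in> carrier AA" for Y
      by (rule IA.eqI[OF IC.AA lin_comp[OF IA.lm_lin[OF xy(1)] t(1)] lin_comp[OF t(1) IC.lm_lin[OF hc[OF xy(1)]]] _ that])
        (simp add: xy IA.lm_pure IC.lm_pure t(2) hc hd A_dot_closed)
    have r: "?t (IA.rm y Y) = IC.rm (h y) (?t Y)" if "Y \<in> carrier AA" for Y
      by (rule IA.eqI[OF IC.AA lin_comp[OF IA.rm_lin[OF xy(2)] t(1)] lin_comp[OF t(1) IC.rm_lin[OF hc[OF xy(2)]]] _ that])
        (simp add: xy IA.rm_pure IC.rm_pure t(2) hc hd A_dot_closed)
    have ia: "\<Delta> (dot A x y) \<oplus>\<^bsub>AA\<^esub> p x y = IA.lm x (\<Delta> y) \<oplus>\<^bsub>AA\<^esub> IA.rm y (\<Delta> x)"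
      using IA.inf[OF xy] by (simp add: IA.lm_def IA.rm_def)
    have ic: "\<Delta>' (dot C (h x) (h y)) \<oplus>\<^bsub>tensor K C C\<^esub> pure_tensor K C C (h x) (h y) = IC.lm (h x) (\<Delta>' (h y)) \<oplus>\<^bsub>tensor K C C\<^esub> IC.rm (h y) (\<Delta>' (h x))"
      using IC.inf[OF hc[OF xy(1)] hc[OF xy(2)]] by (simp add: IC.lm_def IC.rm_def)
    note cl = xy hc A_dot_closed IA.D_closed IC.D_closed IA.p_closed IC.p_closed tc lin_closed[OF IA.lm_lin] lin_closed[OF IA.rm_lin]
    have "?t (\<Delta> (dot A x y)) \<oplus>\<^bsub>tensor K C C\<^esub> pure_tensor K C C (h x) (h y) = IC.lm (h x) (?t (\<Delta> y)) \<oplus>\<^bsub>tensor K C C\<^esub> IC.rm (h y) (?t (\<Delta> x))"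
      using arg_cong[OF ia, of ?t] by (simp add: lin_add[OF t(1)] cl t(2) l r)
    also have "\<dots> = \<Delta>' (h (dot A x y)) \<oplus>\<^bsub>tensor K C C\<^esub> pure_tensor K C C (h x) (h y)"
      using ic dot(3,4) by (simp add: hd xy)
    finally have "\<Delta>' (h (dot A x y)) = ?t (\<Delta> (dot A x y))" by (simp add: cl)
    then show ?case
      using IA.counit_dot[OF a(3,5) xy] IC.counit_dot[OF c(3,5) hc[OF xy(1)] hc[OF xy(2)]] dot(3,4) by (simp add: hd xy)
  qed
  then show "\<Delta>' (h x) = ?t (\<Delta> x)" "\<epsilon>' (h x) = \<epsilon> x" by simp_all
qed

end

context linear_comult begin

lemma grouplike_coassoc_counit:
  assumes u: "u \<in> carrier A" and Du: "\<Delta> u = p u u"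
    and e: "linear_map K A (scalar_module K) \<epsilon>" and eu: "\<epsilon> u = \<one>\<^bsub>K\<^esub>"
  shows "coassoc_at K A \<Delta> u" "counit_at K A \<Delta> \<epsilon> u"
  by (simp_all add: coassoc_at_iff Du \<alpha>_pure \<beta>_pure \<rho>_pure u counit_at_def counit_maps[OF A e] eu)

text \<open>Both iterated coproducts of \<open>v\<close> are the sum of the three tensors with one
  factor \<open>v\<close> and two factors \<open>u\<close>. Together with the group-like case this
  starts the induction over generators.\<close>

lemma primitive_coassoc_counit:
  assumes u: "u \<in> carrier A" and Du: "\<Delta> u = p u u" and v: "v \<in> carrier A" and Dv: "\<Delta> v = p v u \<oplus>\<^bsub>AA\<^esub> p u v"
    and e: "linear_map K A (scalar_module K) \<epsilon>" and eu: "\<epsilon> u = \<one>\<^bsub>K\<^esub>" and ev: "\<epsilon> v = \<zero>\<^bsub>K\<^esub>"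
  shows "coassoc_at K A \<Delta> v" "counit_at K A \<Delta> \<epsilon> v"
proof -
  note c = counit_maps[OF A e]
  note pc = p_closed p3_closed u v
  show "counit_at K A \<Delta> \<epsilon> v"
    using u v by (simp add: counit_at_def Dv lin_add[OF c(1)] lin_add[OF c(3)] c pc eu ev)
  have a: "\<alpha> (\<Delta> v) = (pure_tensor K A AA v (p u u) \<oplus>\<^bsub>A3\<^esub> pure_tensor K A AA u (p v u)) \<oplus>\<^bsub>A3\<^esub> pure_tensor K A AA u (p u v)"
    by (simp add: Dv lin_add[OF \<alpha>_lin] \<alpha>_pure pc lin_add[OF \<rho>_lin] \<rho>_pure Du)
  have b: "\<beta> (\<Delta> v) = pure_tensor K A AA v (p u u) \<oplus>\<^bsub>A3\<^esub> (pure_tensor K A AA u (p v u) \<oplus>\<^bsub>A3\<^esub> pure_tensor K A AA u (p u v))"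
    by (simp add: Dv lin_add[OF \<beta>_lin] \<beta>_pure pc lin_add[OF bilin_right[OF p3_bilin]] Du)
  show "coassoc_at K A \<Delta> v" unfolding coassoc_at_iff a b by (simp add: pc A3.a_assoc)
qed

end

text \<open>The target of the counit: the ground ring with its multiplication in the role of both
  products.\<close>

definition scalar_two_alg :: "('k, 'm) ring_scheme \<Rightarrow> ('k, 'k) two_alg"
  where "scalar_two_alg K = \<lparr>carrier = carrier K, mult = mult K, one = one K, zero = zero K, add = add K, smult = mult K, dot = mult K\<rparr>"

lemma scalar_two_alg_two_as:
  assumes "cring K" shows "two_as_algebra K (scalar_two_alg K)"
proof -
  interpret cring K by fact
  let ?S = "scalar_module K"
  have S: "module K ?S" by (rule scalar_module_module[OF assms])
  have 1: "assoc_algebra K ?S"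
    by (rule assoc_algebraI[OF S _ _ spans_carrier])
      (auto intro!: bilinearI linear_mapI simp: l_distr r_distr m_ac)
  have "assoc_algebra K (scalar_two_alg K)" "assoc_algebra K (dot_alg (scalar_two_alg K))"
    using 1 by (subst assoc_algebra_struct_cong[of _ ?S]; simp add: scalar_two_alg_def)+
  then show ?thesis by (simp add: two_as_algebra_def)
qed

section \<open>Existence and uniqueness of the coproduct\<close>

context free_two_as begin

lemma two_as_hom_eqI:
  assumes "two_as_hom K A B f" "two_as_hom K A B g" "two_as_algebra K B" "\<And>v. v \<in> carrier V \<Longrightarrow> f (gen v) = g (gen v)" "x \<in> carrier A"
  shows "f x = g x"
  using assms(5)
proof (induction x rule: A_induct)
  case submodule
  show ?case
    by (rule lin_eq_submodule[OF A two_as_algebraD(3)[OF assms(3)]]) (use assms(1,2) in \<open>simp_all add: two_as_hom_def\<close>)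
qed (use assms(1,2,4) in \<open>simp_all add: two_as_hom_def\<close>)

text \<open>The values \<open>(v, v \<otimes> 1 + 1 \<otimes> v)\<close> on generators extend by
  freeness to a 2-associative morphism \<open>h\<close> into the algebra on pairs, and
  \<open>\<Delta>\<close> is its second component. The counit is the morphism to the ground ring
  that is zero on generators. Coassociativity and counitality hold on 1 and on generators and pass
  to both products.\<close>

lemma coproduct_exists:
  "\<exists>\<Delta> \<epsilon>. \<Delta> \<in> extensional (carrier A) \<and> \<epsilon> \<in> extensional (carrier A) \<and> two_as_bialgebra K A \<Delta> \<epsilon> \<and>
    (\<forall>v \<in> carrier V. gen v \<in> Prim K (with_coalgebra A \<Delta> \<epsilon>))"
proof -
  note tA = A_two_as_algebra
  let ?B = "infinitesimal_alg K A"
  note tB = infinitesimal_alg_two_as_algebra[OF tA]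
  note AAm = tensor_module[OF A A]
  interpret AAm: module K AA by (rule AAm)
  note pb = pure_tensor_bilinear[OF A A] and pc = pure_tensor_closed[OF A A]
  define f where "f v = (gen v, p (gen v) \<one>\<^bsub>A\<^esub> \<oplus>\<^bsub>AA\<^esub> p \<one>\<^bsub>A\<^esub> (gen v))" for v
  have f: "linear_map K V ?B f"
    unfolding f_def[abs_def]
    by (intro tB(4) gen_linear lin_add_fun AAm lin_comp[OF gen_linear bilin_left[OF pb A_one]]
        lin_comp[OF gen_linear bilin_right[OF pb A_one]])
  define h where "h = two_as_lift K ?B f"
  have h: "two_as_hom K A ?B h" and hg: "v \<in> carrier V \<Longrightarrow> h (gen v) = f v" for v
    unfolding h_def using two_as_lift[OF tB(1) f] by simp_all
  have hl: "linear_map K A ?B h" using h by (simp add: two_as_hom_def)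
  \<comment> \<open>In the algebra on pairs, \<open>dot\<close> involves the first components of its
    arguments. Its formula becomes the infinitesimal relation for \<open>\<Delta>\<close> once these
    are known to be \<open>x\<close> and \<open>y\<close> themselves.\<close>
  have fst_h: "fst (h x) = x" if "x \<in> carrier A" for x
  proof (rule two_as_hom_eqI[OF _ _ tA _ that])
    show "two_as_hom K A A (\<lambda>x. fst (h x))"
      using h lin_comp[OF hl tB(2)] by (simp add: two_as_hom_def infinitesimal_alg_def Let_def)
    show "two_as_hom K A A (\<lambda>x. x)" by (simp add: two_as_hom_def lin_id)
  qed (simp add: hg f_def)
  define \<Delta> where "\<Delta> = restrict (\<lambda>x. snd (h x)) (carrier A)"
  have D: "linear_map K A AA \<Delta>"
    by (rule lin_congI[OF lin_comp[OF hl tB(3)] A]) (simp add: \<Delta>_def)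
  have D1: "\<Delta> \<one>\<^bsub>A\<^esub> = p \<one>\<^bsub>A\<^esub> \<one>\<^bsub>A\<^esub>"
    using h A_one by (simp add: \<Delta>_def two_as_hom_def infinitesimal_alg_def Let_def tensor_simps(5))
  have Dg: "\<Delta> (gen v) = p (gen v) \<one>\<^bsub>A\<^esub> \<oplus>\<^bsub>AA\<^esub> p \<one>\<^bsub>A\<^esub> (gen v)" if "v \<in> carrier V" for v
    using that by (simp add: \<Delta>_def gen_closed hg f_def)
  have Dm: "\<Delta> (x \<otimes>\<^bsub>A\<^esub> y) = \<Delta> x \<otimes>\<^bsub>AA\<^esub> \<Delta> y" if "x \<in> carrier A" "y \<in> carrier A" for x y
    using h that by (simp add: \<Delta>_def two_as_hom_def infinitesimal_alg_def Let_def A_mult_closed)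
  have inf: "\<Delta> (dot A x y) \<oplus>\<^bsub>AA\<^esub> p x y = tensor_map K A A (dot A x) (\<lambda>b. b) (\<Delta> y) \<oplus>\<^bsub>AA\<^esub> tensor_map K A A (\<lambda>a. a) (\<lambda>b. dot A b y) (\<Delta> x)"
    if xy: "x \<in> carrier A" "y \<in> carrier A" for x y
  proof -
    have "\<Delta> (dot A x y) = tensor_map K A A (dot A x) (\<lambda>b. b) (\<Delta> y) \<oplus>\<^bsub>AA\<^esub> tensor_map K A A (\<lambda>a. a) (\<lambda>b. dot A b y) (\<Delta> x) \<ominus>\<^bsub>AA\<^esub> p x y"
      using h xy by (simp add: \<Delta>_def two_as_hom_def infinitesimal_alg_def Let_def A_dot_closed fst_h)
    moreover have "tensor_map K A A (dot A x) (\<lambda>b. b) (\<Delta> y) \<in> carrier AA" "tensor_map K A A (\<lambda>a. a) (\<lambda>b. dot A b y) (\<Delta> x) \<in> carrier AA"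
      by (rule lin_closed[OF tensor_map_linear(1)[OF A A A A bilin_right[OF A_dot_bilin xy(1)] lin_id] lin_closed[OF D xy(2)]],
          rule lin_closed[OF tensor_map_linear(1)[OF A A A A lin_id bilin_left[OF A_dot_bilin xy(2)]] lin_closed[OF D xy(1)]])
    ultimately show ?thesis
      using minus_eq_iff[OF AAm lin_closed[OF D A_dot_closed[OF xy]] _ pc[OF xy]] by simp
  qed
  let ?S = "scalar_two_alg K"
  have tS: "two_as_algebra K ?S" by (rule scalar_two_alg_two_as[OF cK])
  note zl = two_as_lift[OF tS lin_zero_fun[OF two_as_algebraD(3)[OF tS]]]
  define \<epsilon>0 where "\<epsilon>0 = two_as_lift K ?S (\<lambda>v :: 'v. \<zero>\<^bsub>?S\<^esub>)"
  have z: "two_as_hom K A ?S \<epsilon>0" "v \<in> carrier V \<Longrightarrow> \<epsilon>0 (gen v) = \<zero>\<^bsub>K\<^esub>" for v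
    using zl unfolding \<epsilon>0_def by (simp_all add: scalar_two_alg_def)
  define \<epsilon> where "\<epsilon> = restrict \<epsilon>0 (carrier A)"
  have "linear_map K A (scalar_module K) \<epsilon>0"
    using z(1) by (subst lin_struct_cong[of _ A _ ?S]) (simp_all add: two_as_hom_def scalar_two_alg_def)
  then have e: "linear_map K A (scalar_module K) \<epsilon>"
    by (rule lin_congI[OF _ A]) (simp add: \<epsilon>_def)
  have e1: "\<epsilon> \<one>\<^bsub>A\<^esub> = \<one>\<^bsub>K\<^esub>" and em: "\<And>x y. x \<in> carrier A \<Longrightarrow> y \<in> carrier A \<Longrightarrow> \<epsilon> (x \<otimes>\<^bsub>A\<^esub> y) = \<epsilon> x \<otimes>\<^bsub>K\<^esub> \<epsilon> y"
    and ed: "\<And>x y. x \<in> carrier A \<Longrightarrow> y \<in> carrier A \<Longrightarrow> \<epsilon> (dot A x y) = \<epsilon> x \<otimes>\<^bsub>K\<^esub> \<epsilon> y"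
    and eg: "\<And>v. v \<in> carrier V \<Longrightarrow> \<epsilon> (gen v) = \<zero>\<^bsub>K\<^esub>"
    using z A_one by (simp_all add: \<epsilon>_def two_as_hom_def scalar_two_alg_def A_mult_closed A_dot_closed gen_closed)
  interpret J: infinitesimal_comult K A \<Delta> "dot A"
    by (intro infinitesimal_comult.intro linear_comult.intro infinitesimal_comult_axioms.intro A D A_dot_bilin two_as_algebra_dot(2)[OF tA] inf)
  note gl = J.grouplike_coassoc_counit[OF A_one D1 e e1]
  note pr = J.primitive_coassoc_counit[OF A_one D1 gen_closed Dg e e1 eg]
  have co: "coassoc_at K A \<Delta> x" if "x \<in> carrier A" for x
    using that
  proof (induction x rule: A_induct)
    case submodule show ?case by (rule J.coassoc_at_submodule)
  next
    case (mult x y) show ?case by (rule coassoc_at_mult[OF two_as_algebraD(1)[OF tA] D]) (use mult Dm in auto)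
  next
    case (dot x y) then show ?case by (rule J.coassoc_at_dot)
  qed (use gl pr in simp_all)
  have cu: "counit_at K A \<Delta> \<epsilon> x" if "x \<in> carrier A" for x
    using that
  proof (induction x rule: A_induct)
    case submodule show ?case by (rule J.counit_at_submodule[OF e])
  next
    case (mult x y) show ?case by (rule counit_at_mult[OF two_as_algebraD(1)[OF tA] D _ e]) (use mult Dm em in auto)
  next
    case (dot x y) show ?case by (rule J.counit_at_dot[OF e]) (use dot ed in auto)
  qed (use gl pr in simp_all)
  have bi: "two_as_bialgebra K A \<Delta> \<epsilon>"
    by (rule two_as_bialgebraI[OF tA D e]) (use co cu D1 Dm e1 em inf in auto)
  have pri: "gen v \<in> Prim K (with_coalgebra A \<Delta> \<epsilon>)" if "v \<in> carrier V" for v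
    using Prim_with_coalgebra_iff[where D="\<Delta>" and x="gen v", OF A lin_closed[OF D gen_closed[OF that]] A_one gen_closed[OF that]] Dg[OF that] by simp
  show ?thesis
    using bi pri by (intro exI[of _ \<Delta>] exI[of _ \<epsilon>]) (simp add: \<Delta>_def \<epsilon>_def)
qed

abbreviation "cop \<equiv> fst (two_as_coalg K V)"
abbreviation "cou \<equiv> snd (two_as_coalg K V)"

text \<open>Uniqueness is \<open>hom_comult\<close> for the identity map; the condition of being
  extensional turns agreement on the carrier into equality, so the definite description
  denotes.\<close>

lemma two_as_coalg:
  shows "two_as_bialgebra K A cop cou" and "v \<in> carrier V \<Longrightarrow> gen v \<in> Prim K (with_coalgebra A cop cou)"
proof -
  let ?P = "\<lambda>q. let A = two_as K V; \<Delta> = fst q; \<epsilon> = snd q in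
      \<Delta> \<in> extensional (carrier A) \<and> \<epsilon> \<in> extensional (carrier A) \<and> two_as_bialgebra K A \<Delta> \<epsilon> \<and>
      (\<forall>v \<in> carrier V. two_as_gen K V v \<in> Prim K (with_coalgebra A \<Delta> \<epsilon>))"
  have "\<exists>!q. ?P q"
  proof (rule ex_ex1I)
    show "\<exists>q. ?P q" using coproduct_exists by (auto simp: Let_def)
    fix q r assume q: "?P q" and r: "?P r"
    have id: "two_as_hom K A A (\<lambda>x. x)" by (simp add: two_as_hom_def lin_id)
    have qb: "two_as_bialgebra K A (fst q) (snd q)" and qg: "\<And>v. v \<in> carrier V \<Longrightarrow> gen v \<in> Prim K (with_coalgebra A (fst q) (snd q))"
      and rb: "two_as_bialgebra K A (fst r) (snd r)" and rg: "\<And>v. v \<in> carrier V \<Longrightarrow> gen v \<in> Prim K (with_coalgebra A (fst r) (snd r))"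
      using q r by (simp_all add: Let_def)
    note hc = hom_comult[OF qb _ rb id]
    have "fst r x = fst q x \<and> snd r x = snd q x" if "x \<in> carrier A" for x
      using hc(1)[OF qg rg that] hc(2)[OF qg rg that] tensor_map_eq_id[OF A A _ _ lin_closed[OF two_as_bialgebraD(2)[OF qb] that]] by simp
    moreover have "fst q \<in> extensional (carrier A)" "snd q \<in> extensional (carrier A)" "fst r \<in> extensional (carrier A)" "snd r \<in> extensional (carrier A)"
      using q r by (simp_all add: Let_def)
    ultimately have "fst q = fst r" "snd q = snd r" by (auto intro: extensionalityI)
    then show "q = r" by (rule prod_eqI)
  qed
  from theI'[OF this] have "?P (two_as_coalg K V)" unfolding two_as_coalg_def .
  then show "two_as_bialgebra K A cop cou" "v \<in> carrier V \<Longrightarrow> gen v \<in> Prim K (with_coalgebra A cop cou)"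
    by (simp_all add: Let_def)
qed

end

section \<open>Block sums in 2-associative algebras\<close>

lemma blocks_unique:
  assumes "map (\<lambda>(a, b). (length a, length b)) ps = map (\<lambda>(a, b). (length a, length b)) qs"
    and "concat (map fst ps) = concat (map fst qs)" "concat (map snd ps) = concat (map snd qs)"
  shows "ps = qs"
  using assms
proof (induction ps arbitrary: qs)
  case (Cons p ps)
  then obtain q qs' where qs: "qs = q # qs'" by (cases qs) auto
  with Cons show ?case by (cases p; cases q) auto
qed simp

lemma blocks_map_ex:
  assumes "concat (map fst qs) = map g us" "concat (map snd qs) = map g vs"
  shows "\<exists>ps. map (map_prod (map g) (map g)) ps = qs \<and> concat (map fst ps) = us \<and> concat (map snd ps) = vs"
  using assms
proof (induction qs arbitrary: us vs)
  case (Cons q qs)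
  obtain a b where q: "q = (a, b)" by (cases q)
  obtain u1 u2 where u: "us = u1 @ u2" "a = map g u1" "concat (map fst qs) = map g u2"
    using Cons.prems(1) q by (auto simp: append_eq_map_conv)
  obtain v1 v2 where v: "vs = v1 @ v2" "b = map g v1" "concat (map snd qs) = map g v2"
    using Cons.prems(2) q by (auto simp: append_eq_map_conv)
  obtain ps where ps: "map (map_prod (map g) (map g)) ps = qs" "concat (map fst ps) = u2" "concat (map snd ps) = v2"
    using Cons.IH[OF u(3) v(3)] by blast
  show ?case by (rule exI[of _ "(u1, v1) # ps"]) (simp add: ps q u v)
qed simp

text \<open>The map \<open>g\<close> may identify letters, so injectivity cannot be read off letter
  by letter. It holds because two block lists with the same image have blocks of the same lengths
  and cut the same words.\<close>

lemma blocks_map: "bij_betw (map (map_prod (map g) (map g))) (blocks us vs) (blocks (map g us) (map g vs))"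
  unfolding bij_betw_def
proof
  show "inj_on (map (map_prod (map g) (map g))) (blocks us vs)"
  proof (rule inj_onI)
    fix ps qs assume ps: "ps \<in> blocks us vs" "qs \<in> blocks us vs" and eq: "map (map_prod (map g) (map g)) ps = map (map_prod (map g) (map g)) qs"
    have "map (\<lambda>(a, b). (length a, length b)) (map (map_prod (map g) (map g)) xs) = map (\<lambda>(a, b). (length a, length b)) xs" for xs
      by (simp add: comp_def split_def)
    from this[of ps] this[of qs] show "ps = qs"
      using ps by (intro blocks_unique) (simp_all add: eq blocks_def)
  qed
  have cm: "concat (map fst (map (map_prod (map g) (map g)) ps)) = map g (concat (map fst ps))"
    "concat (map snd (map (map_prod (map g) (map g)) ps)) = map g (concat (map snd ps))" for ps
    by (simp_all add: map_concat comp_def)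
  have n: "([], []) \<in> set (map (map_prod (map g) (map g)) ps) \<longleftrightarrow> ([], []) \<in> set ps" for ps
    by force
  show "map (map_prod (map g) (map g)) ` blocks us vs = blocks (map g us) (map g vs)"
  proof
    show "map (map_prod (map g) (map g)) ` blocks us vs \<subseteq> blocks (map g us) (map g vs)"
      using cm n unfolding blocks_def by auto
    show "blocks (map g us) (map g vs) \<subseteq> map (map_prod (map g) (map g)) ` blocks us vs"
    proof
      fix qs assume qs: "qs \<in> blocks (map g us) (map g vs)"
      then obtain ps where ps: "map (map_prod (map g) (map g)) ps = qs" "concat (map fst ps) = us" "concat (map snd ps) = vs"
        using blocks_map_ex[of qs g us vs] by (auto simp: blocks_def)
      then have "ps \<in> blocks us vs" using qs n[of ps] by (simp add: blocks_def)
      then show "qs \<in> map (map_prod (map g) (map g)) ` blocks us vs" using ps(1) by blast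
    qed
  qed
qed

text \<open>This isolates the trivial list with a single pair of blocks: its term in a sum over
  \<open>blocks\<close> is the operation that the recursion for \<open>binf_of\<close> defines, and
  the remaining lists form the index set of that recursion.\<close>

lemma blocks_proper:
  assumes "us \<noteq> [] \<or> vs \<noteq> []"
  shows "{ps \<in> (\<Union>k \<in> {2..}. cuts k us vs). ([], []) \<notin> set ps} = blocks us vs - {[(us, vs)]}" and "[(us, vs)] \<in> blocks us vs"
proof -
  have "length ps \<ge> 2" if "ps \<in> blocks us vs" "ps \<noteq> [(us, vs)]" for ps
    using that assms by (cases ps; cases "tl ps") (auto simp: blocks_def)
  then have "ps \<in> blocks us vs \<and> 2 \<le> length ps \<longleftrightarrow> ps \<in> blocks us vs - {[(us, vs)]}" for ps
    by (cases "ps = [(us, vs)]") auto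
  moreover have "ps \<in> {ps \<in> (\<Union>k \<in> {2..}. cuts k us vs). ([], []) \<notin> set ps} \<longleftrightarrow> ps \<in> blocks us vs \<and> 2 \<le> length ps" for ps
    by (auto simp: blocks_def cuts_def)
  ultimately show "{ps \<in> (\<Union>k \<in> {2..}. cuts k us vs). ([], []) \<notin> set ps} = blocks us vs - {[(us, vs)]}"
    by blast
  show "[(us, vs)] \<in> blocks us vs" using assms by (auto simp: blocks_def)
qed

text \<open>A nontrivial list has a further pair of blocks, which takes up at least one letter.
  Strong inductions along the recursion for \<open>binf_of\<close> rest on this.\<close>

lemma blocks_shorter:
  assumes "ps \<in> blocks us vs" "ps \<noteq> [(us, vs)]" "x \<in> set ps"
  shows "length (fst x) + length (snd x) < length us + length vs"
proof -
  obtain xs ys where ps: "ps = xs @ x # ys" using assms(3) by (meson split_list)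
  have "xs @ ys \<noteq> []"
  proof
    assume "xs @ ys = []"
    then have "ps = [x]" using ps by simp
    then show False using assms(1,2) by (cases x) (auto simp: blocks_def)
  qed
  then obtain r where r: "r \<in> set (xs @ ys)" by (meson last_in_set)
  have len: "length us = length (concat (map fst ps))" "length vs = length (concat (map snd ps))"
    using assms(1) by (simp_all add: blocks_def)
  have "r \<noteq> ([], [])" using assms(1) r ps by (auto simp: blocks_def)
  then have "0 < length (fst r) + length (snd r)" by (cases r) auto
  also have "\<dots> \<le> (\<Sum>s\<leftarrow>xs @ ys. length (fst s) + length (snd s))"
    using r by (intro member_le_sum_list) auto
  also have "\<dots> = length (concat (map fst (xs @ ys))) + length (concat (map snd (xs @ ys)))"
    by (simp add: sum_list_addf length_concat comp_def)
  finally show ?thesis unfolding len ps by simp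
qed

locale two_as_alg =
  fixes K :: "('k, 'm) ring_scheme" and B :: "('k, 'b, 'y) two_alg_scheme"
  assumes tB: "two_as_algebra K B"
begin

lemmas B = two_as_algebraD(3)[OF tB]
lemmas B_one = two_as_algebraD(4)[OF tB]
lemmas B_mult_bilin = two_as_algebraD(5)[OF tB]
lemmas B_dot_bilin = two_as_algebraD(6)[OF tB]
lemmas B_mult_closed = bilin_closed[OF B_mult_bilin]
lemmas B_dot = two_as_algebra_dot[OF tB]

sublocale B: module K B by (rule B)

lemma dot_prod_closed: "us \<in> lists (carrier B) \<Longrightarrow> dot_prod B us \<in> carrier B"
  by (induction us) (auto simp: dot_prod_def B_one B_dot)

lemma dot_prod_Cons: "dot_prod B (u # us) = dot B u (dot_prod B us)"
  by (simp add: dot_prod_def)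

lemma dot_prod_Nil: "dot_prod B [] = \<one>\<^bsub>B\<^esub>"
  by (simp add: dot_prod_def)

lemma dot_prod_append:
  "us \<in> lists (carrier B) \<Longrightarrow> vs \<in> lists (carrier B) \<Longrightarrow> dot_prod B (us @ vs) = dot B (dot_prod B us) (dot_prod B vs)"
proof (induction us)
  case Nil
  then show ?case using dot_prod_closed[OF Nil(2)] by (simp add: dot_prod_Nil B_dot)
next
  case (Cons u us)
  have us: "u \<in> carrier B" "us \<in> lists (carrier B)" using Cons.prems by auto
  show ?case using Cons.IH[OF us(2) Cons.prems(2)] us dot_prod_closed[OF us(2)] dot_prod_closed[OF Cons.prems(2)]
    by (simp only: append_Cons dot_prod_Cons B_dot)
qed

lemma dot_prod_multilinear:
  assumes "linear_map K V B f" and V: "module K V"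
  shows "multilinear K V B (\<lambda>xs. dot_prod B (map f xs))"
proof (rule multilinearI)
  note fc = lin_closed[OF assms(1)]
  have ml: "map f xs \<in> lists (carrier B)" if "xs \<in> lists (carrier V)" for xs using that fc by auto
  show "dot_prod B (map f xs) \<in> carrier B" if "xs \<in> lists (carrier V)" for xs by (rule dot_prod_closed[OF ml[OF that]])
  fix xs ys assume *: "xs \<in> lists (carrier V)" "ys \<in> lists (carrier V)"
  note dx = dot_prod_closed[OF ml[OF *(1)]] and dy = dot_prod_closed[OF ml[OF *(2)]]
  have "linear_map K V B (\<lambda>v. dot B (dot_prod B (map f xs)) (dot B (f v) (dot_prod B (map f ys))))"
    by (rule lin_comp[OF lin_comp[OF assms(1) bilin_left[OF B_dot_bilin dy]] bilin_right[OF B_dot_bilin dx]])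
  moreover have "dot_prod B (map f (xs @ [v] @ ys)) = dot B (dot_prod B (map f xs)) (dot B (f v) (dot_prod B (map f ys)))" if "v \<in> carrier V" for v
  proof -
    have "map f (v # ys) \<in> lists (carrier B)" using ml[OF *(2)] fc[OF that] by simp
    from dot_prod_append[OF ml[OF *(1)] this] show ?thesis by (simp add: dot_prod_Cons)
  qed
  ultimately show "linear_map K V B (\<lambda>v. dot_prod B (map f (xs @ [v] @ ys)))"
    by (rule lin_congI[OF _ V])
qed

lemma binf_of_closed: "us \<in> lists (carrier B) \<Longrightarrow> vs \<in> lists (carrier B) \<Longrightarrow> binf_of B us vs \<in> carrier B"
proof (induction "length us + length vs" arbitrary: us vs rule: less_induct)
  case less
  show ?case
  proof (cases "us = [] \<or> vs = []")
    case True
    then show ?thesis using less.prems by (auto simp: binf_of.simps length_Suc_conv)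
  next
    case False
    have d: "dot_prod B (map (\<lambda>(p, q). binf_of B p q) ps) \<in> carrier B" if ps: "ps \<in> blocks us vs - {[(us, vs)]}" for ps
    proof (rule dot_prod_closed)
      have "binf_of B (fst x) (snd x) \<in> carrier B" if x: "x \<in> set ps" for x
      proof (rule less.hyps)
        note l = blocks_letters[OF _ x, of us vs]
        show "fst x \<in> lists (carrier B)" "snd x \<in> lists (carrier B)" using l ps less.prems by auto
        show "length (fst x) + length (snd x) < length us + length vs"
          by (rule blocks_shorter[OF _ _ x]) (use ps in auto)
      qed
      then show "map (\<lambda>(p, q). binf_of B p q) ps \<in> lists (carrier B)" by (auto simp: split_def)
    qed
    have "binf_of B us vs = (dot_prod B us \<otimes>\<^bsub>B\<^esub> dot_prod B vs) \<ominus>\<^bsub>B\<^esub>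
       (\<Oplus>\<^bsub>B\<^esub>ps \<in> blocks us vs - {[(us, vs)]}. dot_prod B (map (\<lambda>(p, q). binf_of B p q) ps))"
      by (subst binf_of.simps, subst blocks_proper(1)) (use False in simp_all)
    then show ?thesis
      using d by (simp add: B_mult_closed dot_prod_closed less.prems B.finsum_closed Pi_def)
  qed
qed

end

context two_as_alg begin

lemma blocks_lists:
  assumes "us \<in> lists C" "vs \<in> lists C" "ps \<in> blocks us vs" "x \<in> set ps"
  shows "fst x \<in> lists C" "snd x \<in> lists C"
  using blocks_letters[OF assms(3,4)] assms(1,2) by auto

lemma binf_dot_closed:
  assumes "us \<in> lists (carrier B)" "vs \<in> lists (carrier B)" "ps \<in> blocks us vs"
  shows "dot_prod B (map (\<lambda>(p, q). binf_of B p q) ps) \<in> carrier B"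
proof (rule dot_prod_closed)
  have "binf_of B (fst x) (snd x) \<in> carrier B" if "x \<in> set ps" for x
    by (rule binf_of_closed[OF blocks_lists[OF assms that]])
  then show "map (\<lambda>(p, q). binf_of B p q) ps \<in> lists (carrier B)" by (auto simp: split_def)
qed

lemma finsum_blocks_single:
  assumes "us \<noteq> [] \<or> vs \<noteq> []" "\<And>ps. ps \<in> blocks us vs \<Longrightarrow> f ps \<in> carrier B"
  shows "(\<Oplus>\<^bsub>B\<^esub>ps\<in>blocks us vs. f ps) = f [(us, vs)] \<oplus>\<^bsub>B\<^esub> (\<Oplus>\<^bsub>B\<^esub>ps\<in>blocks us vs - {[(us, vs)]}. f ps)"
proof -
  have "blocks us vs = insert [(us, vs)] (blocks us vs - {[(us, vs)]})" using blocks_proper(2)[OF assms(1)] by blast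
  then have "(\<Oplus>\<^bsub>B\<^esub>ps\<in>blocks us vs. f ps) = (\<Oplus>\<^bsub>B\<^esub>ps\<in>insert [(us, vs)] (blocks us vs - {[(us, vs)]}). f ps)" by simp
  also have "\<dots> = f [(us, vs)] \<oplus>\<^bsub>B\<^esub> (\<Oplus>\<^bsub>B\<^esub>ps\<in>blocks us vs - {[(us, vs)]}. f ps)"
    by (rule B.finsum_insert) (use finite_blocks assms(2) blocks_proper(2)[OF assms(1)] in auto)
  finally show ?thesis .
qed

text \<open>The recursion for \<open>binf_of\<close> with its sum moved to the other side. In this
  form it has the shape of \<open>star_word\<close>, with \<open>binf_of\<close> in the place of
  \<open>M\<close> and \<open>dot\<close> in the place of concatenation.\<close>

lemma mult_eq_binf_sum:
  assumes us: "us \<in> lists (carrier B)" and vs: "vs \<in> lists (carrier B)" and ne: "us \<noteq> []" "vs \<noteq> []"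
  shows "dot_prod B us \<otimes>\<^bsub>B\<^esub> dot_prod B vs = (\<Oplus>\<^bsub>B\<^esub>ps\<in>blocks us vs. dot_prod B (map (\<lambda>(p, q). binf_of B p q) ps))"
proof -
  let ?s = "\<Oplus>\<^bsub>B\<^esub>ps \<in> blocks us vs - {[(us, vs)]}. dot_prod B (map (\<lambda>(p, q). binf_of B p q) ps)"
  note d = binf_dot_closed[OF us vs]
  have s: "?s \<in> carrier B" by (rule B.finsum_closed) (use d in auto)
  have "binf_of B us vs = (dot_prod B us \<otimes>\<^bsub>B\<^esub> dot_prod B vs) \<ominus>\<^bsub>B\<^esub> ?s"
    by (subst binf_of.simps, subst blocks_proper(1)) (use ne in simp_all)
  then have "binf_of B us vs \<oplus>\<^bsub>B\<^esub> ?s = dot_prod B us \<otimes>\<^bsub>B\<^esub> dot_prod B vs"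
    using minus_eq_iff[OF B binf_of_closed[OF us vs] B_mult_closed[OF dot_prod_closed[OF us] dot_prod_closed[OF vs]] s] by simp
  moreover have "dot_prod B (map (\<lambda>(p, q). binf_of B p q) [(us, vs)]) = binf_of B us vs"
    using binf_of_closed[OF us vs] by (simp add: dot_prod_Cons dot_prod_Nil B_dot)
  ultimately show ?thesis
    using finsum_blocks_single[where f="\<lambda>ps. dot_prod B (map (\<lambda>(p, q). binf_of B p q) ps)", OF disjI1[OF ne(1)] d] by simp
qed

text \<open>Indexing by blocks of the original words permits a termwise comparison with
  \<open>star_word\<close>, whose blocks are words over \<open>R\<close> and not over their
  images.\<close>

lemma mult_eq_binf_sum_map:
  assumes us: "map g us \<in> lists (carrier B)" and vs: "map g vs \<in> lists (carrier B)" and ne: "us \<noteq> []" "vs \<noteq> []"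
  shows "dot_prod B (map g us) \<otimes>\<^bsub>B\<^esub> dot_prod B (map g vs) =
    (\<Oplus>\<^bsub>B\<^esub>ps\<in>blocks us vs. dot_prod B (map (\<lambda>(p, q). binf_of B (map g p) (map g q)) ps))"
proof -
  have "(\<Oplus>\<^bsub>B\<^esub>ps\<in>blocks us vs. dot_prod B (map (\<lambda>(p, q). binf_of B (map g p) (map g q)) ps)) =
    (\<Oplus>\<^bsub>B\<^esub>ps\<in>blocks (map g us) (map g vs). dot_prod B (map (\<lambda>(p, q). binf_of B p q) ps))"
    by (rule B.finsum_bij[OF blocks_map binf_dot_closed[OF us vs]]) (assumption, simp add: comp_def split_def map_prod_def)
  then show ?thesis using mult_eq_binf_sum[OF us vs] ne by simp
qed

end

lemma two_as_hom_dot_prod: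
  assumes h: "two_as_hom K A B h" and A: "two_as_algebra K A" and us: "us \<in> lists (carrier A)"
  shows "h (dot_prod A us) = dot_prod B (map h us)"
proof -
  interpret A: two_as_alg K A by (rule two_as_alg.intro[OF A])
  show ?thesis using us
  proof (induction us)
    case Nil
    then show ?case using h by (simp add: dot_prod_def two_as_hom_def)
  next
    case (Cons u us)
    then have "u \<in> carrier A" "us \<in> lists (carrier A)" by auto
    then show ?case using h Cons.IH A.dot_prod_closed by (simp add: dot_prod_def two_as_hom_def)
  qed
qed

text \<open>The axioms sum over \<open>cuts\<close> and the locale over \<open>blocks\<close>. The
  difference vanishes by \<open>finsum_cuts\<close>: an empty pair produces the letter zero, on
  which a multilinear map is zero.\<close>

lemma star_words_if_binf_algebra:
  assumes R: "binf_algebra K R"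
  shows "binf_words K R (ops R)"
proof -
  note R1 = R[unfolded binf_algebra_def Let_def, THEN conjunct2]
  note R2 = R1[THEN conjunct2]
  note R3 = R2[THEN conjunct2]
  note R4 = R3[THEN conjunct2]
  note R5 = R4[THEN conjunct2]
  note R6 = R5[THEN conjunct2]
  have m: "module K R" using R[unfolded binf_algebra_def Let_def] by (rule conjunct1)
  interpret R: module K R by (rule m)
  note c = R1[THEN conjunct1, rule_format] and l = R2[THEN conjunct1, rule_format] and r = R3[THEN conjunct1, rule_format]
    and M00 = R4[THEN conjunct1] and u1 = R5[THEN conjunct1, rule_format] and u2 = R6[THEN conjunct1, rule_format]
    and rel = R6[THEN conjunct2, rule_format]
  have ll: "xs @ [v] @ ys \<in> lists (carrier R)" if "xs \<in> lists (carrier R)" "ys \<in> lists (carrier R)" "v \<in> carrier R" for xs ys v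
    using that by auto
  \<comment> \<open>The linearity axioms quantify jointly over two vectors and a scalar. For
    additivity the spare scalar is 1, for homogeneity the spare vector is zero.\<close>
  have one: "\<one>\<^bsub>K\<^esub> \<in> carrier K" by simp
  have M1: "multilinear K R R (\<lambda>us. ops R us vs)" if vs: "vs \<in> lists (carrier R)" for vs
  proof (rule multilinearI)
    fix xs ys assume xy: "xs \<in> lists (carrier R)" "ys \<in> lists (carrier R)"
    show "linear_map K R R (\<lambda>v. ops R (xs @ [v] @ ys) vs)"
    proof (rule linear_mapI)
      fix x y assume "x \<in> carrier R" "y \<in> carrier R"
      then show "ops R (xs @ [x \<oplus>\<^bsub>R\<^esub> y] @ ys) vs = ops R (xs @ [x] @ ys) vs \<oplus>\<^bsub>R\<^esub> ops R (xs @ [y] @ ys) vs"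
        by (rule l[OF xy vs _ _ one, THEN conjunct1])
    next
      fix d x assume "d \<in> carrier K" "x \<in> carrier R"
      then show "ops R (xs @ [d \<odot>\<^bsub>R\<^esub> x] @ ys) vs = d \<odot>\<^bsub>R\<^esub> ops R (xs @ [x] @ ys) vs" by - (rule l[OF xy vs _ R.zero_closed, THEN conjunct2])
    qed (rule c[OF ll[OF xy] vs])
  qed (rule c[OF _ vs])
  have M2: "multilinear K R R (ops R us)" if us: "us \<in> lists (carrier R)" for us
  proof (rule multilinearI)
    fix xs ys assume xy: "xs \<in> lists (carrier R)" "ys \<in> lists (carrier R)"
    show "linear_map K R R (\<lambda>v. ops R us (xs @ [v] @ ys))"
    proof (rule linear_mapI)
      fix x y assume "x \<in> carrier R" "y \<in> carrier R"
      then show "ops R us (xs @ [x \<oplus>\<^bsub>R\<^esub> y] @ ys) = ops R us (xs @ [x] @ ys) \<oplus>\<^bsub>R\<^esub> ops R us (xs @ [y] @ ys)"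
        by (rule r[OF us xy _ _ one, THEN conjunct1])
    next
      fix d x assume "d \<in> carrier K" "x \<in> carrier R"
      then show "ops R us (xs @ [d \<odot>\<^bsub>R\<^esub> x] @ ys) = d \<odot>\<^bsub>R\<^esub> ops R us (xs @ [x] @ ys)" by - (rule r[OF us xy _ R.zero_closed, THEN conjunct2])
    qed (rule c[OF us ll[OF xy]])
  qed (rule c[OF us])
  have cl: "map (\<lambda>(a, b). ops R a b) ps \<in> lists (carrier R)" if "us \<in> lists (carrier R)" "vs \<in> lists (carrier R)" "ps \<in> cuts l us vs" for us vs ps l
  proof -
    have "ops R (fst x) (snd x) \<in> carrier R" if x: "x \<in> set ps" for x
      using \<open>us \<in> _\<close> \<open>vs \<in> _\<close> \<open>ps \<in> _\<close> x by (intro c) (auto simp: cuts_def)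
    then show ?thesis by (auto simp: split_def)
  qed
  have z: "\<zero>\<^bsub>R\<^esub> \<in> set (map (\<lambda>(a, b). ops R a b) ps)" if "([], []) \<in> set ps" for ps
    using that M00 by force
  show ?thesis
  proof (intro binf_words.intro binf_star.intro star_words.intro words.intro m star_words_axioms.intro M1 M2 M00
      binf_star_axioms.intro binf_words_axioms.intro)
    show "ops R [x] [] = x" "ops R [] [x] = x" if "x \<in> carrier R" for x using u1 that by blast+
    show "ops R us [] = \<zero>\<^bsub>R\<^esub>" "ops R [] us = \<zero>\<^bsub>R\<^esub>" if "us \<in> lists (carrier R)" "2 \<le> length us" for us using u2 that by blast+
    fix us vs ws assume us: "us \<in> lists (carrier R)" and vs: "vs \<in> lists (carrier R)" and ws: "ws \<in> lists (carrier R)"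
      and ne: "us \<noteq> []" "vs \<noteq> []" "ws \<noteq> []"
    have "(\<Oplus>\<^bsub>R\<^esub>l \<in> {1..length us + length vs}. \<Oplus>\<^bsub>R\<^esub>ps \<in> cuts l us vs. ops R (map (\<lambda>(a, b). ops R a b) ps) ws) =
      (\<Oplus>\<^bsub>R\<^esub>ps\<in>blocks us vs. ops R (map (\<lambda>(a, b). ops R a b) ps) ws)"
      by (rule R.finsum_cuts) (use ne c[OF cl[OF us vs] ws] multilinear_eq_zero[OF M1[OF ws] m m cl[OF us vs] z] in auto)
    moreover have "(\<Oplus>\<^bsub>R\<^esub>l \<in> {1..length vs + length ws}. \<Oplus>\<^bsub>R\<^esub>ps \<in> cuts l vs ws. ops R us (map (\<lambda>(a, b). ops R a b) ps)) =
      (\<Oplus>\<^bsub>R\<^esub>ps\<in>blocks vs ws. ops R us (map (\<lambda>(a, b). ops R a b) ps))"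
      by (rule R.finsum_cuts) (use ne c[OF us cl[OF vs ws]] multilinear_eq_zero[OF M2[OF us] m m cl[OF vs ws] z] in auto)
    ultimately show "(\<Oplus>\<^bsub>R\<^esub>ps\<in>blocks us vs. ops R (map (\<lambda>(a, b). ops R a b) ps) ws) = (\<Oplus>\<^bsub>R\<^esub>ps\<in>blocks vs ws. ops R us (map (\<lambda>(a, b). ops R a b) ps))"
      using rel us vs ws ne by simp
  qed
qed

section \<open>The universal enveloping algebra as a tensor coalgebra\<close>

text \<open>The prefixes \<open>W\<close>, \<open>P\<close> and \<open>U\<close> stand for
  \<open>T(R)\<close>, \<open>2as(R)\<close> and \<open>U2(R)\<close>; \<open>PE\<close>,
  \<open>PA\<close> and \<open>PU\<close> provide the calculus of 2-associative algebras in the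
  three.\<close>

locale binf_alg =
  fixes K :: "('k, 'm) ring_scheme" and R :: "('k, 'u, 'x) binf_alg_scheme"
  assumes R: "binf_algebra K R"
begin

sublocale W: binf_words K R "ops R" by (rule star_words_if_binf_algebra[OF R])
sublocale P: free_two_as K R by (rule free_two_as.intro[OF W.V])
sublocale PA: two_as_alg K P.A by (rule two_as_alg.intro[OF P.A_two_as_algebra])
sublocale PE: two_as_alg K W.E by (rule two_as_alg.intro[OF W.E_two_as_algebra])

abbreviation "pt \<equiv> two_as_lift K W.E (\<lambda>v. W.w [v])"
abbreviation "J \<equiv> U2_ideal K R"

lemma letter_E: "linear_map K R W.E (\<lambda>v. W.w [v])"
  using W.letter_lin by (subst lin_struct_cong[of _ R _ W.T]) (simp_all add: star_alg_simps)

lemma pt_hom: "two_as_hom K P.A W.E pt" and pt_gen: "v \<in> carrier R \<Longrightarrow> pt (P.gen v) = W.w [v]"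
  using P.two_as_lift[OF W.E_two_as_algebra letter_E] by simp_all

lemma pt_lin: "linear_map K P.A W.E pt"
  using pt_hom by (simp add: two_as_hom_def)

lemma gens: "us \<in> lists (carrier R) \<Longrightarrow> map P.gen us \<in> lists (carrier P.A)"
  using P.gen_closed by auto

lemma dot_prod_letters: "us \<in> lists (carrier R) \<Longrightarrow> dot_prod W.E (map (\<lambda>v. W.w [v]) us) = W.w us"
proof (induction us)
  case Nil
  then show ?case by (simp add: dot_prod_def star_alg_simps)
next
  case (Cons u us)
  then have "u \<in> carrier R" "us \<in> lists (carrier R)" by auto
  then show ?case using Cons.IH W.cc_word[of "[u]" us] by (simp add: dot_prod_def star_alg_simps)
qed

lemma pt_dot_prod:
  assumes us: "us \<in> lists (carrier R)"
  shows "pt (dot_prod P.A (map P.gen us)) = W.w us"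
proof -
  have eq: "map pt (map P.gen us) = map (\<lambda>v. W.w [v]) us" using us by (auto simp: pt_gen)
  show ?thesis
    unfolding two_as_hom_dot_prod[OF pt_hom P.A_two_as_algebra gens[OF us]] eq by (rule dot_prod_letters[OF us])
qed

text \<open>The product of two words is a sum over \<open>blocks\<close> both in
  \<open>2as(R)\<close> and in \<open>T(R)\<close>. By induction the terms of all nontrivial block
  lists correspond under \<open>pt\<close>; cancelling them leaves the terms of the trivial list,
  which are the two sides of the claim.\<close>

lemma pt_binf:
  assumes "us \<in> lists (carrier R)" "vs \<in> lists (carrier R)"
  shows "pt (binf_of P.A (map P.gen us) (map P.gen vs)) = W.w [ops R us vs]"
  using assms
proof (induction "length us + length vs" arbitrary: us vs rule: less_induct)
  case less
  note us = less.prems(1) and vs = less.prems(2)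
  have 0: "pt \<zero>\<^bsub>P.A\<^esub> = W.w [\<zero>\<^bsub>R\<^esub>]"
    using lin_zero[OF pt_lin P.A W.E] by (simp add: W.w_zero_letter star_alg_simps)
  consider "us = []" | "vs = []" | "us \<noteq> []" "vs \<noteq> []" by blast
  then show ?case
  proof cases
    case 1
    show ?thesis
    proof (cases "length vs = 1")
      case True
      then obtain v where "vs = [v]" by (auto simp: length_Suc_conv)
      then show ?thesis using 1 vs by (simp add: binf_of.simps pt_gen W.M_unit)
    next
      case False
      then have "vs = [] \<or> length vs \<ge> 2" by (cases vs; cases "tl vs") auto
      then have "ops R [] vs = \<zero>\<^bsub>R\<^esub>" using W.M00 W.M_unit0(2)[OF vs] by blast
      then show ?thesis using 1 False 0 by (simp add: binf_of.simps)
    qed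
  next
    case 2
    show ?thesis
    proof (cases "length us = 1")
      case True
      then obtain v where "us = [v]" by (auto simp: length_Suc_conv)
      then show ?thesis using 2 us by (simp add: binf_of.simps pt_gen W.M_unit)
    next
      case False
      then have "us = [] \<or> length us \<ge> 2" by (cases us; cases "tl us") auto
      then have "ops R us [] = \<zero>\<^bsub>R\<^esub>" using W.M00 W.M_unit0(1)[OF us] by blast
      then show ?thesis using 2 False 0 by (simp add: binf_of.simps)
    qed
  next
    case 3
    let ?N = "\<lambda>(p, q). binf_of P.A (map P.gen p) (map P.gen q)"
    let ?d = "\<lambda>ps. dot_prod P.A (map ?N ps)" and ?M = "map (\<lambda>(a, b). ops R a b)"
    have Nc: "map ?N ps \<in> lists (carrier P.A)" if ps: "ps \<in> blocks us vs" for ps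
    proof -
      have "?N x \<in> carrier P.A" if "x \<in> set ps" for x
        using PA.binf_of_closed[OF gens gens] PA.blocks_lists[OF us vs ps that] by (cases x) simp
      then show ?thesis by auto
    qed
    have dc: "?d ps \<in> carrier P.A" if "ps \<in> blocks us vs" for ps by (rule PA.dot_prod_closed[OF Nc[OF that]])
    have rest: "pt (?d ps) = W.w (?M ps)" if ps: "ps \<in> blocks us vs - {[(us, vs)]}" for ps
    proof -
      have psb: "ps \<in> blocks us vs" using ps by simp
      have "pt (?N x) = W.w [ops R (fst x) (snd x)]" if x: "x \<in> set ps" for x
        using less.hyps[of "fst x" "snd x"] blocks_shorter[OF psb _ x] ps PA.blocks_lists[OF us vs psb x] by (cases x) simp
      then have eq: "map pt (map ?N ps) = map (\<lambda>v. W.w [v]) (?M ps)" by (auto simp: split_def)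
      show ?thesis
        unfolding two_as_hom_dot_prod[OF pt_hom P.A_two_as_algebra Nc[OF psb]] eq by (rule dot_prod_letters[OF W.blocks_L[OF us vs psb]])
    qed
    have ne: "us \<noteq> [] \<or> vs \<noteq> []" using 3 by simp
    let ?r = "\<Oplus>\<^bsub>P.A\<^esub>ps\<in>blocks us vs - {[(us, vs)]}. ?d ps" and ?q = "\<Oplus>\<^bsub>W.E\<^esub>ps\<in>blocks us vs - {[(us, vs)]}. W.w (?M ps)"
    have wc: "ps \<in> blocks us vs \<Longrightarrow> W.w (?M ps) \<in> carrier W.E" for ps
      using W.w_closed[OF W.blocks_L[OF us vs]] by (simp add: star_alg_simps)
    have N1: "?d [(us, vs)] = binf_of P.A (map P.gen us) (map P.gen vs)"
      using PA.binf_of_closed[OF gens[OF us] gens[OF vs]] by (simp add: PA.dot_prod_Cons PA.dot_prod_Nil PA.B_dot)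
    note bc = PA.binf_of_closed[OF gens[OF us] gens[OF vs]]
    have rc: "?r \<in> carrier P.A" by (rule P.A.finsum_closed) (use dc in auto)
    have qc: "?q \<in> carrier W.E" by (rule PE.B.finsum_closed) (use wc in auto)
    have "W.S us vs = (\<Oplus>\<^bsub>W.E\<^esub>ps\<in>blocks us vs. W.w (?M ps))"
      by (simp add: star_word_def finsum_struct_cong[of W.E W.T] star_alg_simps)
    also have "\<dots> = W.w [ops R us vs] \<oplus>\<^bsub>W.E\<^esub> ?q"
      using PE.finsum_blocks_single[where f="\<lambda>ps. W.w (?M ps)", OF ne wc] by simp
    finally have S: "W.S us vs = W.w [ops R us vs] \<oplus>\<^bsub>W.E\<^esub> ?q" .
    have dp: "dot_prod P.A (map P.gen us) \<otimes>\<^bsub>P.A\<^esub> dot_prod P.A (map P.gen vs) = binf_of P.A (map P.gen us) (map P.gen vs) \<oplus>\<^bsub>P.A\<^esub> ?r"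
    proof -
      have "(\<Oplus>\<^bsub>P.A\<^esub>ps\<in>blocks us vs. ?d ps) = ?d [(us, vs)] \<oplus>\<^bsub>P.A\<^esub> ?r"
        by (rule PA.finsum_blocks_single[where f="?d", OF ne dc])
      then show ?thesis unfolding PA.mult_eq_binf_sum_map[OF gens[OF us] gens[OF vs] 3] N1 .
    qed
    have "W.S us vs = pt (dot_prod P.A (map P.gen us) \<otimes>\<^bsub>P.A\<^esub> dot_prod P.A (map P.gen vs))"
      using pt_hom PA.dot_prod_closed[OF gens[OF us]] PA.dot_prod_closed[OF gens[OF vs]] W.st_word[OF us vs]
      by (simp add: two_as_hom_def pt_dot_prod[OF us] pt_dot_prod[OF vs] star_alg_simps)
    also have "\<dots> = pt (binf_of P.A (map P.gen us) (map P.gen vs)) \<oplus>\<^bsub>W.E\<^esub> pt ?r"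
      unfolding dp by (rule lin_add[OF pt_lin bc rc])
    also have "pt ?r = ?q"
    proof -
      have "pt ?r = (\<Oplus>\<^bsub>W.E\<^esub>ps\<in>blocks us vs - {[(us, vs)]}. pt (?d ps))"
        by (rule lin_finsum[OF pt_lin P.A W.E]) (rule dc, erule DiffD1)
      also have "\<dots> = ?q"
        by (rule PE.B.finsum_eqI[OF refl]) (rule wc, erule DiffD1, rule rest)
      finally show ?thesis .
    qed
    finally have "W.w [ops R us vs] \<oplus>\<^bsub>W.E\<^esub> ?q = pt (binf_of P.A (map P.gen us) (map P.gen vs)) \<oplus>\<^bsub>W.E\<^esub> ?q" using S by simp
    moreover have "W.w [ops R us vs] \<in> carrier W.E" using W.M_closed[OF us vs] by (simp add: star_alg_simps W.w_closed)
    ultimately show ?thesis using qc lin_closed[OF pt_lin bc] by simp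
  qed
qed

abbreviation "rels \<equiv> {P.gen (ops R rs ss) \<ominus>\<^bsub>P.A\<^esub> binf_of P.A (map P.gen rs) (map P.gen ss) |rs ss.
       rs \<in> lists (carrier R) \<and> ss \<in> lists (carrier R)}"

lemma rels_A: "rels \<subseteq> carrier P.A"
proof
  fix x assume "x \<in> rels"
  then obtain rs ss where "rs \<in> lists (carrier R)" "ss \<in> lists (carrier R)"
    "x = P.gen (ops R rs ss) \<ominus>\<^bsub>P.A\<^esub> binf_of P.A (map P.gen rs) (map P.gen ss)" by blast
  then show "x \<in> carrier P.A" using P.gen_closed[OF W.M_closed] PA.binf_of_closed[OF gens gens] by simp
qed

sublocale MA: two_magma K P.A by (rule two_as_algebra_magma[OF P.A_two_as_algebra])

lemma J_eq: "J = two_ideal_gen K P.A rels"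
  by (simp add: U2_ideal_def)

sublocale U: two_quotient K P.A J
  by (intro two_quotient.intro MA.two_magma_axioms two_quotient_axioms.intro) (simp only: J_eq MA.two_ideal_two_ideal_gen[OF rels_A])

lemma U2_alg_eq: "U2_alg K R = U.Q"
  by (simp add: U2_alg_def)

lemma U_two_as_algebra: "two_as_algebra K U.Q"
proof -
  interpret m: monoid P.A by (rule assoc_algebraD[OF two_as_algebraD(1)[OF P.A_two_as_algebra]])
  have z: "x \<ominus>\<^bsub>P.A\<^esub> x \<in> J" if "x \<in> carrier P.A" for x
    using that U.pr_eq_iff[OF that that] by simp
  show ?thesis
    by (rule U.Q_two_as_algebra) (simp_all add: m.m_assoc PA.B_dot z)
qed

sublocale PU: two_as_alg K U.Q by (rule two_as_alg.intro[OF U_two_as_algebra])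

lemma pr_hom: "two_as_hom K P.A U.Q U.pr"
  by (simp add: two_as_hom_def U.pr_linear U.Q_simps(5) U.pr_mult U.pr_dot)

lemma pt_J: "x \<in> J \<Longrightarrow> pt x = \<zero>\<^bsub>W.E\<^esub>"
proof -
  have h: "\<And>x y. x \<in> carrier P.A \<Longrightarrow> y \<in> carrier P.A \<Longrightarrow> pt (x \<otimes>\<^bsub>P.A\<^esub> y) = pt x \<otimes>\<^bsub>W.E\<^esub> pt y"
    "\<And>x y. x \<in> carrier P.A \<Longrightarrow> y \<in> carrier P.A \<Longrightarrow> pt (dot P.A x y) = dot W.E (pt x) (pt y)"
    using pt_hom by (simp_all add: two_as_hom_def)
  have "J \<subseteq> {x \<in> carrier P.A. pt x = \<zero>\<^bsub>W.E\<^esub>}"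
    unfolding J_eq
  proof (rule MA.two_ideal_gen_least[OF MA.two_ideal_kernel[OF W.E pt_lin PE.B_mult_bilin PE.B_dot_bilin h]])
    show "rels \<subseteq> {x \<in> carrier P.A. pt x = \<zero>\<^bsub>W.E\<^esub>}"
    proof
      fix x assume x: "x \<in> rels"
      then obtain rs ss where rs: "rs \<in> lists (carrier R)" "ss \<in> lists (carrier R)"
        and xe: "x = P.gen (ops R rs ss) \<ominus>\<^bsub>P.A\<^esub> binf_of P.A (map P.gen rs) (map P.gen ss)" by blast
      note g = P.gen_closed[OF W.M_closed[OF rs]] and b = PA.binf_of_closed[OF gens[OF rs(1)] gens[OF rs(2)]]
      have "W.w [ops R rs ss] \<in> carrier W.E" using W.M_closed[OF rs] by (simp add: star_alg_simps W.w_closed)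
      then have "pt x = \<zero>\<^bsub>W.E\<^esub>"
        unfolding xe lin_minus[OF pt_lin P.A W.E g b] pt_gen[OF W.M_closed[OF rs]] pt_binf[OF rs] by (simp add: PE.B.minus_eq_zero_iff)
      then show "x \<in> {x \<in> carrier P.A. pt x = \<zero>\<^bsub>W.E\<^esub>}" using x rels_A by blast
    qed
  qed
  then show "x \<in> J \<Longrightarrow> pt x = \<zero>\<^bsub>W.E\<^esub>" by blast
qed

abbreviation "gU v \<equiv> U.pr (P.gen v)"
definition "\<sigma> = lift_quot K U.Q (\<lambda>us. dot_prod U.Q (map gU us))"

lemma gU_lin: "linear_map K R U.Q gU"
  by (rule lin_comp[OF P.gen_linear U.pr_linear])

lemma gUs: "us \<in> lists (carrier R) \<Longrightarrow> map gU us \<in> lists (carrier U.Q)"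
  using lin_closed[OF gU_lin] by auto

lemma \<sigma>_lin: "linear_map K W.T U.Q \<sigma>" and \<sigma>_word: "us \<in> lists (carrier R) \<Longrightarrow> \<sigma> (W.w us) = dot_prod U.Q (map gU us)"
  unfolding \<sigma>_def using W.w_lift[OF U.Q PU.dot_prod_multilinear[OF gU_lin W.V]] by simp_all

lemma pr_dot_prod: "us \<in> lists (carrier P.A) \<Longrightarrow> U.pr (dot_prod P.A us) = dot_prod U.Q (map U.pr us)"
  by (rule two_as_hom_dot_prod[OF pr_hom P.A_two_as_algebra])

lemma \<sigma>_word': "us \<in> lists (carrier R) \<Longrightarrow> \<sigma> (W.w us) = U.pr (dot_prod P.A (map P.gen us))"
  using pr_dot_prod[OF gens] by (simp add: \<sigma>_word comp_def)

lemma gU_binf: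
  assumes rs: "rs \<in> lists (carrier R)" "ss \<in> lists (carrier R)"
  shows "gU (ops R rs ss) = U.pr (binf_of P.A (map P.gen rs) (map P.gen ss))"
proof -
  have "P.gen (ops R rs ss) \<ominus>\<^bsub>P.A\<^esub> binf_of P.A (map P.gen rs) (map P.gen ss) \<in> J"
    unfolding J_eq by (rule subsetD[OF MA.two_ideal_gen_incl]) (use rs in blast)
  then show ?thesis
    using U.pr_eq_iff[OF P.gen_closed[OF W.M_closed[OF rs]] PA.binf_of_closed[OF gens[OF rs(1)] gens[OF rs(2)]]] by simp
qed

text \<open>Modulo \<open>J\<close> each letter \<open>ops R p q\<close> in the block formula of
  \<open>T(R)\<close> is the class of the corresponding \<open>binf_of\<close>, so the sum becomes
  the block formula of \<open>2as(R)\<close>. The operations stay in \<open>2as(R)\<close> and are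
  projected at the end, so \<open>binf_of\<close> is never evaluated in the quotient.\<close>

lemma \<sigma>_star_words:
  assumes us: "us \<in> lists (carrier R)" and vs: "vs \<in> lists (carrier R)"
  shows "\<sigma> (W.S us vs) = \<sigma> (W.w us) \<otimes>\<^bsub>U.Q\<^esub> \<sigma> (W.w vs)"
proof -
  interpret m: monoid U.Q by (rule assoc_algebraD[OF two_as_algebraD(1)[OF U_two_as_algebra]])
  have sc: "\<sigma> (W.w us) \<in> carrier U.Q" "\<sigma> (W.w vs) \<in> carrier U.Q"
    using lin_closed[OF \<sigma>_lin W.w_closed] us vs by blast+
  have s1: "\<sigma> (W.w []) = \<one>\<^bsub>U.Q\<^esub>" by (simp add: \<sigma>_word PU.dot_prod_Nil)
  consider "us = []" | "vs = []" | "us \<noteq> []" "vs \<noteq> []" by blast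
  then show ?thesis
  proof cases
    case 1 then show ?thesis using W.S_unit_left[OF vs] sc by (simp add: s1)
  next
    case 2 then show ?thesis using W.S_unit_right[OF us] sc by (simp add: s1)
  next
    case 3
    let ?N = "\<lambda>(p, q). binf_of P.A (map P.gen p) (map P.gen q)"
    have Nc: "map ?N ps \<in> lists (carrier P.A)" if ps: "ps \<in> blocks us vs" for ps
    proof -
      have "?N x \<in> carrier P.A" if "x \<in> set ps" for x
        using PA.binf_of_closed[OF gens gens] PA.blocks_lists[OF us vs ps that] by (cases x) simp
      then show ?thesis by auto
    qed
    have "\<sigma> (W.S us vs) = (\<Oplus>\<^bsub>U.Q\<^esub>ps\<in>blocks us vs. \<sigma> (W.w (map (\<lambda>(a, b). ops R a b) ps)))"
      unfolding star_word_def by (rule lin_finsum[OF \<sigma>_lin W.T U.Q W.w_closed[OF W.blocks_L[OF us vs]]])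
    also have "\<dots> = (\<Oplus>\<^bsub>U.Q\<^esub>ps\<in>blocks us vs. U.pr (dot_prod P.A (map ?N ps)))"
    proof (rule PU.B.finsum_eqI[OF refl])
      fix ps assume ps: "ps \<in> blocks us vs"
      show "U.pr (dot_prod P.A (map ?N ps)) \<in> carrier U.Q" by (rule lin_closed[OF U.pr_linear PA.dot_prod_closed[OF Nc[OF ps]]])
      have "gU (ops R (fst x) (snd x)) = U.pr (?N x)" if "x \<in> set ps" for x
        using gU_binf[OF PA.blocks_lists[OF us vs ps that]] by (cases x) simp
      then have eq: "map gU (map (\<lambda>(a, b). ops R a b) ps) = map U.pr (map ?N ps)" by (auto simp: split_def)
      show "\<sigma> (W.w (map (\<lambda>(a, b). ops R a b) ps)) = U.pr (dot_prod P.A (map ?N ps))"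
        unfolding \<sigma>_word[OF W.blocks_L[OF us vs ps]] pr_dot_prod[OF Nc[OF ps]] eq ..
    qed
    also have "\<dots> = U.pr (\<Oplus>\<^bsub>P.A\<^esub>ps\<in>blocks us vs. dot_prod P.A (map ?N ps))"
      by (rule lin_finsum[OF U.pr_linear P.A U.Q PA.dot_prod_closed[OF Nc], symmetric])
    also have "\<dots> = U.pr (dot_prod P.A (map P.gen us) \<otimes>\<^bsub>P.A\<^esub> dot_prod P.A (map P.gen vs))"
      unfolding PA.mult_eq_binf_sum_map[OF gens[OF us] gens[OF vs] 3] ..
    also have "\<dots> = \<sigma> (W.w us) \<otimes>\<^bsub>U.Q\<^esub> \<sigma> (W.w vs)"
      using PA.dot_prod_closed[OF gens[OF us]] PA.dot_prod_closed[OF gens[OF vs]]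
      by (simp add: U.pr_mult \<sigma>_word'[OF us] \<sigma>_word'[OF vs])
    finally show ?thesis .
  qed
qed

lemma \<sigma>_hom: "two_as_hom K W.E U.Q \<sigma>"
  unfolding two_as_hom_def
proof (intro conjI ballI)
  show "linear_map K W.E U.Q \<sigma>"
    using \<sigma>_lin by (subst lin_struct_cong[of _ W.T _ U.Q]) (simp_all add: star_alg_simps)
  show "\<sigma> \<one>\<^bsub>W.E\<^esub> = \<one>\<^bsub>U.Q\<^esub>" by (simp add: star_alg_simps \<sigma>_word PU.dot_prod_Nil)
  fix x y assume "x \<in> carrier W.E" "y \<in> carrier W.E"
  then have xy: "x \<in> carrier W.T" "y \<in> carrier W.T" by (simp_all add: star_alg_simps)
  show "\<sigma> (x \<otimes>\<^bsub>W.E\<^esub> y) = \<sigma> x \<otimes>\<^bsub>U.Q\<^esub> \<sigma> y" unfolding star_alg_simps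
    by (rule W.w_bilin_eqI[where f="\<lambda>x y. \<sigma> (W.st x y)" and g="\<lambda>x y. \<sigma> x \<otimes>\<^bsub>U.Q\<^esub> \<sigma> y", OF U.Q
        bilin_comp[OF W.st_bilin lin_id lin_id \<sigma>_lin] bilin_comp[OF PU.B_mult_bilin \<sigma>_lin \<sigma>_lin lin_id] _ xy])
      (simp only: W.st_word \<sigma>_star_words)
  show "\<sigma> (dot W.E x y) = dot U.Q (\<sigma> x) (\<sigma> y)" unfolding star_alg_simps
  proof (rule W.w_bilin_eqI[where f="\<lambda>x y. \<sigma> (W.cc x y)" and g="\<lambda>x y. dot U.Q (\<sigma> x) (\<sigma> y)", OF U.Q
        bilin_comp[OF W.cc_bilin lin_id lin_id \<sigma>_lin] bilin_comp[OF PU.B_dot_bilin \<sigma>_lin \<sigma>_lin lin_id] _ xy])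
    fix us vs assume L: "us \<in> lists (carrier R)" "vs \<in> lists (carrier R)"
    then have "us @ vs \<in> lists (carrier R)" by simp
    then show "\<sigma> (W.cc (W.w us) (W.w vs)) = dot U.Q (\<sigma> (W.w us)) (\<sigma> (W.w vs))"
      using PU.dot_prod_append[OF gUs gUs] L by (simp only: W.cc_word \<sigma>_word map_append)
  qed
qed

text \<open>Both sides are morphisms out of the free 2-associative algebra and agree on
  generators.\<close>

lemma \<sigma>_pt: "x \<in> carrier P.A \<Longrightarrow> \<sigma> (pt x) = U.pr x"
proof (rule P.two_as_hom_eqI[OF _ pr_hom U_two_as_algebra])
  show "two_as_hom K P.A U.Q (\<lambda>x. \<sigma> (pt x))"
    using pt_hom \<sigma>_hom lin_closed[OF pt_lin] lin_comp[of K P.A W.E pt U.Q \<sigma>]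
    by (simp add: two_as_hom_def)
  show "\<sigma> (pt (P.gen v)) = gU v" if "v \<in> carrier R" for v
    using that lin_closed[OF gU_lin that] by (simp add: pt_gen \<sigma>_word PU.dot_prod_Cons PU.dot_prod_Nil PU.B_dot)
qed

lemma pt_surj: "t \<in> carrier W.T \<Longrightarrow> \<exists>x \<in> carrier P.A. pt x = t"
proof -
  interpret A: module K P.A by (rule P.A)
  have ptT: "linear_map K P.A W.T pt"
    using pt_lin by (subst (asm) lin_struct_cong[of _ P.A _ W.T]) (simp_all add: star_alg_simps)
  assume t: "t \<in> carrier W.T"
  show ?thesis using W.w_spans W.T t
  proof (induction rule: spans_induct)
    case zero
    show ?case using lin_zero[OF ptT P.A W.T] by blast
  next
    case (gen x)
    then obtain us where us: "us \<in> lists (carrier R)" "x = W.w us" by blast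
    show ?case unfolding us(2)
      by (rule bexI[of _ "dot_prod P.A (map P.gen us)"]) (rule pt_dot_prod[OF us(1)], rule PA.dot_prod_closed[OF gens[OF us(1)]])
  next
    case (add x y)
    then obtain a b where "a \<in> carrier P.A" "pt a = x" "b \<in> carrier P.A" "pt b = y" by blast
    then show ?case using lin_add[OF ptT, of a b] by (intro bexI[of _ "a \<oplus>\<^bsub>P.A\<^esub> b"]) simp_all
  next
    case (smult c x)
    then obtain a where "a \<in> carrier P.A" "pt a = x" by blast
    then show ?case using lin_smult[OF ptT smult(1), of a] smult(1) by (intro bexI[of _ "c \<odot>\<^bsub>P.A\<^esub> a"]) simp_all
  qed
qed

lemma pt_eq: "x \<in> carrier P.A \<Longrightarrow> y \<in> carrier P.A \<Longrightarrow> U.pr x = U.pr y \<Longrightarrow> pt x = pt y"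
proof -
  assume x: "x \<in> carrier P.A" and y: "y \<in> carrier P.A" and "U.pr x = U.pr y"
  then have "pt (x \<ominus>\<^bsub>P.A\<^esub> y) = \<zero>\<^bsub>W.E\<^esub>" using U.pr_eq_iff[OF x y] pt_J by blast
  then show "pt x = pt y"
    using lin_minus[OF pt_lin P.A W.E x y] lin_closed[OF pt_lin] x y by (simp add: PE.B.minus_eq_zero_iff)
qed

text \<open>Every tensor is a value of \<open>pt\<close>, and \<open>\<sigma> (pt x)\<close> is the
  class of \<open>x\<close>. Surjectivity is immediate; injectivity holds because \<open>pt\<close>
  takes equal values on elements of the same class.\<close>

lemma \<sigma>_bij: "bij_betw \<sigma> (carrier W.T) (carrier U.Q)"
  unfolding bij_betw_def
proof
  show "inj_on \<sigma> (carrier W.T)"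
  proof (rule inj_onI)
    fix s t assume "s \<in> carrier W.T" "t \<in> carrier W.T" and e: "\<sigma> s = \<sigma> t"
    then obtain x y where "x \<in> carrier P.A" "pt x = s" "y \<in> carrier P.A" "pt y = t" using pt_surj by blast
    then show "s = t" using pt_eq[of x y] e \<sigma>_pt by auto
  qed
  have ptT: "x \<in> carrier P.A \<Longrightarrow> pt x \<in> carrier W.T" for x using lin_closed[OF pt_lin] by (simp add: star_alg_simps)
  show "\<sigma> ` carrier W.T = carrier U.Q"
  proof
    show "\<sigma> ` carrier W.T \<subseteq> carrier U.Q" using lin_closed[OF \<sigma>_lin] by blast
    show "carrier U.Q \<subseteq> \<sigma> ` carrier W.T"
    proof
      fix X assume "X \<in> carrier U.Q"
      then obtain x where x: "x \<in> carrier P.A" "X = U.pr x" unfolding U.Q_carrier by blast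
      then show "X \<in> \<sigma> ` carrier W.T" using \<sigma>_pt[OF x(1)] ptT[OF x(1)] by (intro image_eqI[of _ _ "pt x"]) simp_all
    qed
  qed
qed

lemma U2_simps:
  "carrier (U2 K R) = carrier U.Q" "mult (U2 K R) = mult U.Q" "one (U2 K R) = one U.Q" "zero (U2 K R) = zero U.Q"
  "add (U2 K R) = add U.Q" "smult (U2 K R) = smult U.Q"
  "comult (U2 K R) = (\<lambda>X. tensor_map K U.Q U.Q U.pr U.pr (P.cop (SOME x. x \<in> X)))"
  "counit (U2 K R) = (\<lambda>X. P.cou (SOME x. x \<in> X))"
  by (simp_all add: U2_def Let_def U2_alg_eq)

lemma letter_Prim: "v \<in> carrier R \<Longrightarrow> W.w [v] \<in> Prim K (with_coalgebra W.E W.\<Delta> W.\<epsilon>)"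
proof -
  assume v: "v \<in> carrier R"
  have w: "W.w [v] \<in> carrier W.T" "W.w [] \<in> carrier W.T" using v by (simp_all add: W.w_closed)
  show ?thesis
    using Prim_with_coalgebra_iff[OF W.E, of W.\<Delta> "W.w [v]"] w v W.\<Delta>_closed[OF w(1)] W.p_closed[OF w] W.p_closed[OF w(2,1)]
    by (simp add: star_alg_simps W.TE W.\<Delta>_letter W.TT.a_comm)
qed

text \<open>The coproduct of \<open>U2 K R\<close> at \<open>\<sigma> t\<close> is computed from a
  chosen representative \<open>?x\<close> in \<open>2as(R)\<close>. Injectivity of
  \<open>\<sigma>\<close> gives \<open>pt ?x = t\<close> for this choice, and \<open>pt\<close>
  respects coproducts by \<open>hom_comult\<close>; this replaces a proof that \<open>J\<close> is a
  coideal.\<close>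

lemma \<sigma>_coalgebra_map: "coalgebra_map K (star_bialg K R (ops R)) (U2 K R) \<sigma>"
  unfolding coalgebra_map_def
proof (intro conjI ballI)
  show "linear_map K (star_bialg K R (ops R)) (U2 K R) \<sigma>"
    using \<sigma>_lin by (subst lin_struct_cong[of _ W.T _ U.Q]) (simp_all add: star_bialg_simps U2_simps)
  fix t assume "t \<in> carrier (star_bialg K R (ops R))"
  then have t: "t \<in> carrier W.T" by (simp add: star_bialg_simps)
  let ?x = "SOME x. x \<in> \<sigma> t"
  have sc: "\<sigma> t \<in> carrier (quot_module P.A J)" using lin_closed[OF \<sigma>_lin t] by (simp add: U.Q_simps)
  note x = U.SM.some_coset_rep[OF sc]
  have ptT: "pt ?x \<in> carrier W.T" using lin_closed[OF pt_lin x(1)] by (simp add: star_alg_simps)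
  have px: "pt ?x = t"
    using \<sigma>_pt[OF x(1)] x(2) \<sigma>_bij ptT t by (simp add: bij_betw_def inj_on_def)
  have pg: "\<And>v. v \<in> carrier R \<Longrightarrow> pt (P.gen v) \<in> Prim K (with_coalgebra W.E W.\<Delta> W.\<epsilon>)"
    by (simp add: pt_gen letter_Prim)
  note hc = P.hom_comult[OF P.two_as_coalg(1) _ W.star_two_as_bialgebra pt_hom _ x(1)]
  have D: "W.\<Delta> t = tensor_map K W.E W.E pt pt (P.cop ?x)" and e: "W.\<epsilon> t = P.cou ?x"
    using hc(1)[OF P.two_as_coalg(2) pg] hc(2)[OF P.two_as_coalg(2) pg] px by simp_all
  note \<sigma>E = \<sigma>_hom[unfolded two_as_hom_def, THEN conjunct1]
  note cx = lin_closed[OF two_as_bialgebraD(2)[OF P.two_as_coalg(1)] x(1)]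
  have "tensor_map K U.Q U.Q \<sigma> \<sigma> (W.\<Delta> t) = tensor_map K U.Q U.Q (\<lambda>x. \<sigma> (pt x)) (\<lambda>x. \<sigma> (pt x)) (P.cop ?x)"
    unfolding D by (rule tensor_map_comp[OF P.A P.A W.E W.E U.Q U.Q pt_lin pt_lin \<sigma>E \<sigma>E cx])
  also have "\<dots> = tensor_map K U.Q U.Q U.pr U.pr (P.cop ?x)"
    by (rule tensor_map_cong[OF P.A P.A U.Q U.Q lin_comp[OF pt_lin \<sigma>E] lin_comp[OF pt_lin \<sigma>E] \<sigma>_pt \<sigma>_pt cx])
  finally have "comult (U2 K R) (\<sigma> t) = tensor_map K U.Q U.Q \<sigma> \<sigma> (W.\<Delta> t)" by (simp add: U2_simps)
  moreover have "tensor_map K (U2 K R) (U2 K R) \<sigma> \<sigma> = tensor_map K U.Q U.Q \<sigma> \<sigma>"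
    by (rule tensor_map_struct_cong) (simp_all add: U2_simps)
  ultimately show "comult (U2 K R) (\<sigma> t) = tensor_map K (U2 K R) (U2 K R) \<sigma> \<sigma> (comult (star_bialg K R (ops R)) t)"
    by (simp add: star_bialg_simps)
  show "counit (U2 K R) (\<sigma> t) = counit (star_bialg K R (ops R)) t" by (simp add: U2_simps star_bialg_simps e)
qed

lemma \<sigma>_ring_hom: "\<sigma> \<in> ring_hom (star_bialg K R (ops R)) (U2 K R)"
  using \<sigma>_hom lin_closed[OF \<sigma>_lin] lin_add[OF \<sigma>_lin]
  by (intro ring_hom_memI) (simp_all add: star_bialg_simps U2_simps two_as_hom_def star_alg_simps)

end

section \<open>Isomorphisms of bialgebras\<close>

text \<open>Ring homomorphisms need not respect the record field \<open>zero\<close> of a structure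
  that is not yet known to be a group. The last condition supplies this, so that the axioms of
  \<open>G\<close> can be derived from those of \<open>H\<close>.\<close>

definition "bialg_iso K H G f \<longleftrightarrow>
    bij_betw f (carrier H) (carrier G) \<and> f \<in> ring_hom H G \<and> coalgebra_map K H G f \<and> f \<zero>\<^bsub>H\<^esub> = \<zero>\<^bsub>G\<^esub>"

lemma tensor_assoc_natural:
  assumes H: "module K H" and G: "module K G" and f: "linear_map K H G f" and X: "X \<in> carrier (tensor K (tensor K H H) H)"
  shows "tensor_assoc K G (tensor_map K (tensor K G G) G (tensor_map K G G f f) f X) =
    tensor_map K G (tensor K G G) f (tensor_map K G G f f) (tensor_assoc K H X)"
proof -
  note HH = tensor_module[OF H H] and GG = tensor_module[OF G G]
  note ff = tensor_map_linear[OF H H G G f f]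
  note l = tensor_map_linear[OF HH H GG G ff(1) f] and r = tensor_map_linear[OF H HH G GG f ff(1)]
  note aH = tensor_assoc_linear[OF H] and aG = tensor_assoc_linear[OF G]
  note fc = lin_closed[OF f]
  let ?U = "tensor K G (tensor K G G)"
  let ?L = "\<lambda>X. tensor_assoc K G (tensor_map K (tensor K G G) G (tensor_map K G G f f) f X)"
  let ?R = "\<lambda>X. tensor_map K G (tensor K G G) f (tensor_map K G G f f) (tensor_assoc K H X)"
  note U = tensor_module[OF G GG]
  have Ll: "linear_map K (tensor K (tensor K H H) H) ?U ?L" by (rule lin_comp[OF l(1) aG(1)])
  have Rl: "linear_map K (tensor K (tensor K H H) H) ?U ?R" by (rule lin_comp[OF aH(1) r(1)])
  show ?thesis
  proof (rule tensor_eqI[where f="?L" and g="?R", OF HH H U Ll Rl _ X])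
    fix Y c assume Y: "Y \<in> carrier (tensor K H H)" and c: "c \<in> carrier H"
    note pl = bilin_left[OF pure_tensor_bilinear[OF HH H] c]
    show "?L (pure_tensor K (tensor K H H) H Y c) = ?R (pure_tensor K (tensor K H H) H Y c)"
    proof (rule tensor_eqI[where f="\<lambda>Y. ?L (pure_tensor K (tensor K H H) H Y c)" and g="\<lambda>Y. ?R (pure_tensor K (tensor K H H) H Y c)",
        OF H H U lin_comp[OF pl Ll] lin_comp[OF pl Rl] _ Y])
      fix a b assume ab: "a \<in> carrier H" "b \<in> carrier H"
      then show "?L (pure_tensor K (tensor K H H) H (pure_tensor K H H a b) c) = ?R (pure_tensor K (tensor K H H) H (pure_tensor K H H a b) c)"
        using c by (simp add: l(2) r(2) ff(2) aH(2) aG(2) fc pure_tensor_closed[OF H H])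
    qed
  qed
qed

text \<open>Every element of \<open>G\<close> is some \<open>f x\<close>, and each axiom at
  \<open>f x\<close> is the image of the axiom at \<open>x\<close>; naturality of the associator
  moves \<open>f\<close> past it.\<close>

lemma coalgebra_iso_coalgebra:
  assumes C: "coalgebra K H" and f: "coalgebra_map K H G f" and s: "f ` carrier H = carrier G" and z: "f \<zero>\<^bsub>H\<^esub> = \<zero>\<^bsub>G\<^esub>"
  shows "coalgebra K G"
proof -
  have H: "module K H" and D: "linear_map K H (tensor K H H) (comult H)" and E: "linear_map K H (scalar_module K) (counit H)"
    and ca: "\<And>x. x \<in> carrier H \<Longrightarrow> coassoc_at K H (comult H) x \<and> counit_at K H (comult H) (counit H) x"
    using C unfolding coalgebra_iff[OF refl refl refl refl] by blast+
  have fl: "linear_map K H G f" and fD: "\<And>x. x \<in> carrier H \<Longrightarrow> comult G (f x) = tensor_map K G G f f (comult H x)"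
    and fE: "\<And>x. x \<in> carrier H \<Longrightarrow> counit G (f x) = counit H x"
    using f unfolding coalgebra_map_def by blast+
  have G: "module K G" by (rule module_surj[OF H fl s z])
  note HH = tensor_module[OF H H] and GG = tensor_module[OF G G]
  note ff = tensor_map_linear[OF H H G G fl fl]
  have DG: "linear_map K G (tensor K G G) (comult G)"
    by (rule lin_from_surj[OF H fl s lin_comp[OF D ff(1)] fD])
  have EG: "linear_map K G (scalar_module K) (counit G)"
    by (rule lin_from_surj[OF H fl s E fE])
  have "coassoc_at K G (comult G) y \<and> counit_at K G (comult G) (counit G) y" if yG: "y \<in> carrier G" for y
  proof -
    obtain x where y: "y = f x" and x: "x \<in> carrier H" by (rule imageE[OF yG[folded s]])
    note Dx = lin_closed[OF D x]
    let ?ff = "tensor_map K G G f f"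
    have "coassoc_at K G (comult G) y"
    proof -
      have 1: "tensor_map K (tensor K G G) G (comult G) (\<lambda>y. y) (?ff (comult H x)) =
        tensor_map K (tensor K G G) G ?ff f (tensor_map K (tensor K H H) H (comult H) (\<lambda>y. y) (comult H x))"
        unfolding tensor_map_comp[OF H H G G GG G fl fl DG lin_id Dx] tensor_map_comp[OF H H HH H GG G D lin_id ff(1) fl Dx]
        by (rule tensor_map_cong[OF H H GG G lin_comp[OF fl DG] fl fD refl Dx])
      have 2: "tensor_map K G (tensor K G G) (\<lambda>y. y) (comult G) (?ff (comult H x)) =
        tensor_map K G (tensor K G G) f ?ff (tensor_map K H (tensor K H H) (\<lambda>y. y) (comult H) (comult H x))"
        unfolding tensor_map_comp[OF H H G G G GG fl fl lin_id DG Dx] tensor_map_comp[OF H H H HH G GG lin_id D fl ff(1) Dx]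
        by (rule tensor_map_cong[OF H H G GG fl lin_comp[OF fl DG] refl fD Dx])
      have 3: "tensor_map K (tensor K H H) H (comult H) (\<lambda>y. y) (comult H x) \<in> carrier (tensor K (tensor K H H) H)"
        by (rule lin_closed[OF tensor_map_linear(1)[OF H H HH H D lin_id] Dx])
      show ?thesis
        using ca[OF x] unfolding coassoc_at_def y fD[OF x] 1 2 tensor_assoc_natural[OF H G fl 3] by simp
    qed
    moreover have "counit_at K G (comult G) (counit G) y"
    proof -
      note cH = counit_maps[OF H E] and cG = counit_maps[OF G EG]
      have EH: "counit H a \<in> carrier K" if "a \<in> carrier H" for a using lin_closed[OF E that] by simp
      have l: "lift_quot K G (\<lambda>(a, b). counit G a \<odot>\<^bsub>G\<^esub> b) (?ff (comult H x)) = f (lift_quot K H (\<lambda>(a, b). counit H a \<odot>\<^bsub>H\<^esub> b) (comult H x))"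
        by (rule tensor_eqI[where f="\<lambda>X. lift_quot K G (\<lambda>(a, b). counit G a \<odot>\<^bsub>G\<^esub> b) (?ff X)", OF H H G lin_comp[OF ff(1) cG(1)] lin_comp[OF cH(1) fl] _ Dx])
          (simp add: ff(2) cG(2) cH(2) lin_closed[OF fl] lin_smult[OF fl EH] fE)
      have r: "lift_quot K G (\<lambda>(a, b). counit G b \<odot>\<^bsub>G\<^esub> a) (?ff (comult H x)) = f (lift_quot K H (\<lambda>(a, b). counit H b \<odot>\<^bsub>H\<^esub> a) (comult H x))"
        by (rule tensor_eqI[where f="\<lambda>X. lift_quot K G (\<lambda>(a, b). counit G b \<odot>\<^bsub>G\<^esub> a) (?ff X)", OF H H G lin_comp[OF ff(1) cG(3)] lin_comp[OF cH(3) fl] _ Dx])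
          (simp add: ff(2) cG(4) cH(4) lin_closed[OF fl] lin_smult[OF fl EH] fE)
      show ?thesis using ca[OF x] unfolding counit_at_def y fD[OF x] l r by simp
    qed
    ultimately show ?thesis by blast
  qed
  then show ?thesis unfolding coalgebra_iff[OF refl refl refl refl] using G DG EG by blast
qed

lemma bialgebraD:
  assumes "bialgebra K H"
  shows "assoc_algebra K H" "coalgebra K H" "module K H" "linear_map K H (tensor K H H) (comult H)"
    "linear_map K H (scalar_module K) (counit H)"
    "\<And>x y. x \<in> carrier H \<Longrightarrow> y \<in> carrier H \<Longrightarrow> comult H (x \<otimes>\<^bsub>H\<^esub> y) = comult H x \<otimes>\<^bsub>tensor K H H\<^esub> comult H y"
    "\<And>x y. x \<in> carrier H \<Longrightarrow> y \<in> carrier H \<Longrightarrow> counit H (x \<otimes>\<^bsub>H\<^esub> y) = counit H x \<otimes>\<^bsub>K\<^esub> counit H y"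
    "comult H \<one>\<^bsub>H\<^esub> = pure_tensor K H H \<one>\<^bsub>H\<^esub> \<one>\<^bsub>H\<^esub>" "counit H \<one>\<^bsub>H\<^esub> = \<one>\<^bsub>K\<^esub>"
  using assms assoc_algebraD(1)[of K H]
  by (simp_all add: bialgebra_def coalgebra_def Let_def ring_hom_def tensor_simps(5))

lemma bialg_isoD:
  assumes "bialg_iso K H G f"
  shows "bij_betw f (carrier H) (carrier G)" "f \<in> ring_hom H G" "coalgebra_map K H G f" "f \<zero>\<^bsub>H\<^esub> = \<zero>\<^bsub>G\<^esub>"
    "linear_map K H G f" "f \<one>\<^bsub>H\<^esub> = \<one>\<^bsub>G\<^esub>" "f ` carrier H = carrier G"
    "\<And>x. x \<in> carrier H \<Longrightarrow> comult G (f x) = tensor_map K G G f f (comult H x)"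
    "\<And>x. x \<in> carrier H \<Longrightarrow> counit G (f x) = counit H x"
    "\<And>x y. x \<in> carrier H \<Longrightarrow> y \<in> carrier H \<Longrightarrow> f (x \<otimes>\<^bsub>H\<^esub> y) = f x \<otimes>\<^bsub>G\<^esub> f y"
  using assms by (simp_all add: bialg_iso_def coalgebra_map_def ring_hom_def bij_betw_def)

text \<open>This is also how \<open>U2 K R\<close> is shown to be a bialgebra: its axioms are
  carried over from \<open>T(R)\<close> instead of being checked in the quotient.\<close>

lemma bialg_iso_bialgebra:
  assumes H: "bialgebra K H" and f: "bialg_iso K H G f"
  shows "bialgebra K G"
proof -
  note h = bialgebraD[OF H] and fi = bialg_isoD[OF f]
  note s = fi(7) and fm = fi(10)
  have G: "module K G" by (rule module_surj[OF h(3) fi(5) s fi(4)])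
  have r: "\<exists>x. x \<in> carrier H \<and> y = f x" if "y \<in> carrier G" for y using that unfolding s[symmetric] by blast
  have c: "f x \<in> carrier G" if "x \<in> carrier H" for x using imageI[OF that, of f] unfolding s .
  note hc = assoc_algebraD(4,5)[OF h(1)] and hb = assoc_algebra_bilinear[OF h(1)]
  interpret m: monoid H by (rule assoc_algebraD[OF h(1)])
  have A: "assoc_algebra K G"
  proof (rule assoc_algebraI[OF G _ _ spans_carrier])
    show "bilinear K G G G (mult G)"
    proof (rule bilinearI)
      fix y assume "y \<in> carrier G"
      then obtain v where v: "v \<in> carrier H" "y = f v" using r by blast
      show "linear_map K G G ((\<otimes>\<^bsub>G\<^esub>) y)"
        by (rule lin_from_surj[OF h(3) fi(5) s lin_comp[OF bilin_right[OF hb v(1)] fi(5)]]) (simp add: v fm)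
      show "linear_map K G G (\<lambda>x. x \<otimes>\<^bsub>G\<^esub> y)"
        by (rule lin_from_surj[OF h(3) fi(5) s lin_comp[OF bilin_left[OF hb v(1)] fi(5)]]) (simp add: v fm)
    qed
    show "\<one>\<^bsub>G\<^esub> \<in> carrier G" using c[OF hc(1)] by (simp add: fi(6))
  next
    fix x y t assume xyt: "x \<in> carrier G" "y \<in> carrier G" "t \<in> carrier G"
    from r[OF xyt(1)] r[OF xyt(2)] r[OF xyt(3)] obtain u v w where "u \<in> carrier H" "x = f u" "v \<in> carrier H" "y = f v" "w \<in> carrier H" "t = f w" by blast
    then show "x \<otimes>\<^bsub>G\<^esub> y \<otimes>\<^bsub>G\<^esub> t = x \<otimes>\<^bsub>G\<^esub> (y \<otimes>\<^bsub>G\<^esub> t)" by (simp add: fm[symmetric] m.m_assoc)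
  next
    fix x assume "x \<in> carrier G"
    then obtain u where "u \<in> carrier H" "x = f u" using r by blast
    then show "\<one>\<^bsub>G\<^esub> \<otimes>\<^bsub>G\<^esub> x = x" "x \<otimes>\<^bsub>G\<^esub> \<one>\<^bsub>G\<^esub> = x" by (simp_all add: fi(6)[symmetric] fm[symmetric])
  qed
  have C: "coalgebra K G" by (rule coalgebra_iso_coalgebra[OF h(2) fi(3) s fi(4)])
  have D: "linear_map K G (tensor K G G) (comult G)" and E: "linear_map K G (scalar_module K) (counit G)"
    using C by (simp_all add: coalgebra_def Let_def)
  have DR: "comult G \<in> ring_hom G (tensor K G G)"
  proof (rule ring_hom_memI)
    fix x y assume xy: "x \<in> carrier G" "y \<in> carrier G"
    from r[OF xy(1)] r[OF xy(2)] obtain u v where uv: "u \<in> carrier H" "x = f u" "v \<in> carrier H" "y = f v" by blast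
    note Du = lin_closed[OF h(4) uv(1)] and Dv = lin_closed[OF h(4) uv(3)]
    have "comult G (x \<otimes>\<^bsub>G\<^esub> y) = tensor_map K G G f f (comult H (u \<otimes>\<^bsub>H\<^esub> v))"
      unfolding uv(2,4) fm[OF uv(1,3), symmetric] by (rule fi(8)[OF hc(2)[OF uv(1,3)]])
    also have "\<dots> = comult G x \<otimes>\<^bsub>tensor K G G\<^esub> comult G y"
      unfolding h(6)[OF uv(1,3)] uv(2,4) fi(8)[OF uv(1)] fi(8)[OF uv(3)]
      by (rule tensor_map_mult[OF h(1) h(1) A A fi(5) fi(5) fm fm Du Dv])
    finally show "comult G (x \<otimes>\<^bsub>G\<^esub> y) = comult G x \<otimes>\<^bsub>tensor K G G\<^esub> comult G y" .
  next
    show "comult G \<one>\<^bsub>G\<^esub> = \<one>\<^bsub>tensor K G G\<^esub>"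
      using fi(8)[OF hc(1)] tensor_map_linear(2)[OF h(3,3) G G fi(5,5) hc(1,1)] by (simp add: fi(6) h(8) tensor_simps(5))
  qed (simp_all add: lin_closed[OF D] lin_add[OF D])
  have ER: "counit G \<in> ring_hom G K"
  proof (rule ring_hom_memI)
    fix x y assume xy: "x \<in> carrier G" "y \<in> carrier G"
    from r[OF xy(1)] r[OF xy(2)] obtain u v where uv: "u \<in> carrier H" "x = f u" "v \<in> carrier H" "y = f v" by blast
    then show "counit G (x \<otimes>\<^bsub>G\<^esub> y) = counit G x \<otimes>\<^bsub>K\<^esub> counit G y"
      by (simp add: fm[symmetric] fi(9) h(7) hc(2))
  next
    show "counit G \<one>\<^bsub>G\<^esub> = \<one>\<^bsub>K\<^esub>" using fi(9)[OF hc(1)] by (simp add: fi(6) h(9))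
  qed (use lin_closed[OF E] lin_add[OF E] in simp_all)
  show ?thesis unfolding bialgebra_def using A C DR ER by blast
qed

lemma coalgebra_map_comp:
  assumes "coalgebra K H" "module K G" "module K L" "coalgebra_map K H G f" "coalgebra_map K G L g"
  shows "coalgebra_map K H L (\<lambda>x. g (f x))"
proof -
  have H: "module K H" and D: "linear_map K H (tensor K H H) (comult H)"
    using assms(1) by (simp_all add: coalgebra_def Let_def)
  have f: "linear_map K H G f" and g: "linear_map K G L g" using assms(4,5) by (simp_all add: coalgebra_map_def)
  show ?thesis
    using assms(4,5) lin_comp[OF f g] lin_closed[OF f]
      tensor_map_comp[OF H H assms(2,2,3,3) f f g g lin_closed[OF D]]
    by (simp add: coalgebra_map_def)
qed

lemma coalgebra_map_cong:
  assumes "coalgebra K H" "module K G" "coalgebra_map K H G f" "\<And>x. x \<in> carrier H \<Longrightarrow> g x = f x"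
  shows "coalgebra_map K H G g"
proof -
  have H: "module K H" and D: "linear_map K H (tensor K H H) (comult H)"
    using assms(1) by (simp_all add: coalgebra_def Let_def)
  have f: "linear_map K H G f" using assms(3) by (simp add: coalgebra_map_def)
  show ?thesis
    using assms(3) lin_congI[OF f H assms(4)]
      tensor_map_cong[OF H H assms(2,2) f f assms(4)[symmetric] assms(4)[symmetric] lin_closed[OF D]]
    by (simp add: coalgebra_map_def assms(4))
qed

lemma coalgebra_map_inv:
  assumes H: "coalgebra K H" and G: "module K G" and f: "coalgebra_map K H G f" and b: "bij_betw f (carrier H) (carrier G)"
  defines "g \<equiv> inv_into (carrier H) f"
  shows "coalgebra_map K G H g"
proof -
  have Hm: "module K H" and D: "linear_map K H (tensor K H H) (comult H)"
    using H by (simp_all add: coalgebra_def Let_def)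
  have fl: "linear_map K H G f" using f by (simp add: coalgebra_map_def)
  have s: "f ` carrier H = carrier G" using b by (simp add: bij_betw_def)
  have gf: "g (f x) = x" if "x \<in> carrier H" for x unfolding g_def by (rule bij_betw_inv_into_left[OF b that])
  have gl: "linear_map K G H g" by (rule lin_from_surj[OF Hm fl s lin_id gf])
  show ?thesis
    unfolding coalgebra_map_def
  proof (intro conjI ballI gl)
    fix y assume "y \<in> carrier G"
    then obtain x where y: "y = f x" and x: "x \<in> carrier H" unfolding s[symmetric] by (rule imageE)
    note Dx = lin_closed[OF D x]
    show "counit H (g y) = counit G y" using f x by (simp add: y gf coalgebra_map_def)
    have "tensor_map K H H g g (tensor_map K G G f f (comult H x)) = tensor_map K H H (\<lambda>x. g (f x)) (\<lambda>x. g (f x)) (comult H x)"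
      by (rule tensor_map_comp[OF Hm Hm G G Hm Hm fl fl gl gl Dx])
    also have "\<dots> = comult H x" by (rule tensor_map_eq_id[OF Hm Hm gf gf Dx])
    finally show "comult H (g y) = tensor_map K H H g g (comult G y)"
      using f x by (simp add: y gf coalgebra_map_def)
  qed
qed

lemma bialg_iso_inv:
  assumes H: "bialgebra K H" and f: "bialg_iso K H G f"
  shows "bialg_iso K G H (inv_into (carrier H) f)"
proof -
  note h = bialgebraD[OF H] and fi = bialg_isoD[OF f] and g = bialgebraD[OF bialg_iso_bialgebra[OF H f]]
  note gf = bij_betw_inv_into_left[OF fi(1)]
  have r: "\<exists>x. x \<in> carrier H \<and> y = f x" if "y \<in> carrier G" for y using that unfolding fi(7)[symmetric] by blast
  have z: "\<zero>\<^bsub>H\<^esub> \<in> carrier H" by (rule abelian_groupE[OF module_abelian_group[OF h(3)]])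
  have cm: "coalgebra_map K G H (inv_into (carrier H) f)" by (rule coalgebra_map_inv[OF h(2) g(3) fi(3,1)])
  have gl: "linear_map K G H (inv_into (carrier H) f)" using cm by (simp add: coalgebra_map_def)
  show ?thesis unfolding bialg_iso_def
  proof (intro conjI cm bij_betw_inv_into[OF fi(1)] ring_hom_memI)
    fix x y assume xy: "x \<in> carrier G" "y \<in> carrier G"
    from r[OF xy(1)] r[OF xy(2)] obtain u v where "u \<in> carrier H" "x = f u" "v \<in> carrier H" "y = f v" by blast
    then show "inv_into (carrier H) f (x \<otimes>\<^bsub>G\<^esub> y) = inv_into (carrier H) f x \<otimes>\<^bsub>H\<^esub> inv_into (carrier H) f y"
      by (simp add: fi(10)[symmetric] gf assoc_algebraD(5)[OF h(1)])
  qed (simp_all add: lin_closed[OF gl] lin_add[OF gl] gf[OF z, unfolded fi(4)] gf[OF assoc_algebraD(4)[OF h(1)], unfolded fi(6)])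
qed

lemma bialg_iso_comp:
  assumes H: "bialgebra K H" and f: "bialg_iso K H G f" and g: "bialg_iso K G L g"
  shows "bialg_iso K H L (\<lambda>x. g (f x))"
proof -
  note G = bialg_iso_bialgebra[OF H f]
  note h = bialgebraD[OF H] and g' = bialgebraD[OF G] and l = bialgebraD[OF bialg_iso_bialgebra[OF G g]]
  note fi = bialg_isoD[OF f] and gi = bialg_isoD[OF g]
  have "coalgebra_map K H L (\<lambda>x. g (f x))" by (rule coalgebra_map_comp[OF h(2) g'(3) l(3) fi(3) gi(3)])
  moreover have "bij_betw (\<lambda>x. g (f x)) (carrier H) (carrier L)"
    using bij_betw_trans[OF fi(1) gi(1)] by (simp add: comp_def)
  moreover have "(\<lambda>x. g (f x)) \<in> ring_hom H L" using ring_hom_trans[OF fi(2) gi(2)] by (simp add: comp_def)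
  ultimately show ?thesis using fi(4) gi(4) by (simp add: bialg_iso_def)
qed

section \<open>Cofree bialgebras\<close>

text \<open>Zorn gives a submodule \<open>N\<close> that is maximal among those avoiding
  \<open>v\<close>. Then \<open>V\<close> is the direct sum of \<open>N\<close> and the line through
  \<open>v\<close>, and \<open>h\<close> reads off the coefficient of \<open>v\<close>.\<close>

lemma functional_exists:
  assumes K: "field K" and V: "module K V" and v: "v \<in> carrier V" "v \<noteq> \<zero>\<^bsub>V\<^esub>"
  shows "\<exists>h. linear_map K V (scalar_module K) h \<and> h v = \<one>\<^bsub>K\<^esub>"
proof -
  interpret K: field K by (rule K)
  interpret V: module K V by (rule V)
  let ?A = "{N. submodule N K V \<and> v \<notin> N}"
  have "{\<zero>\<^bsub>V\<^esub>} \<in> ?A" using v by (simp add: submodule_iff[OF V])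
  then have "?A \<noteq> {}" by blast
  then obtain N where N: "N \<in> ?A" and max: "\<And>X. X \<in> ?A \<Longrightarrow> N \<subseteq> X \<Longrightarrow> X = N"
  proof (rule subset_Zorn_nonempty[THEN bexE], goal_cases)
    case (1 \<C>)
    then have c: "\<And>X. X \<in> \<C> \<Longrightarrow> submodule X K V \<and> v \<notin> X" and t: "\<And>X Y. X \<in> \<C> \<Longrightarrow> Y \<in> \<C> \<Longrightarrow> X \<subseteq> Y \<or> Y \<subseteq> X"
      unfolding subset_chain_def by blast+
    note c' = c[THEN conjunct1, unfolded submodule_iff[OF V]]
    have "x \<oplus>\<^bsub>V\<^esub> y \<in> \<Union>\<C>" if xy: "x \<in> \<Union>\<C>" "y \<in> \<Union>\<C>" for x y
    proof -
      obtain X Y where XY: "X \<in> \<C>" "x \<in> X" "Y \<in> \<C>" "y \<in> Y" using xy by blast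
      then obtain Z where "Z \<in> \<C>" "x \<in> Z" "y \<in> Z" using t[OF XY(1,3)] by blast
      then show ?thesis using c'[of Z] by blast
    qed
    moreover have "\<Union>\<C> \<subseteq> carrier V" using c' by blast
    moreover have "\<zero>\<^bsub>V\<^esub> \<in> \<Union>\<C>" using c' 1(2) by blast
    moreover have "\<And>k x. k \<in> carrier K \<Longrightarrow> x \<in> \<Union>\<C> \<Longrightarrow> k \<odot>\<^bsub>V\<^esub> x \<in> \<Union>\<C>" using c' by blast
    ultimately have "submodule (\<Union>\<C>) K V" by (simp add: submodule_iff[OF V])
    then show ?case using c by blast
  next
    case (2 M)
    then show ?case by blast
  qed
  have Ns: "N \<subseteq> carrier V" "\<zero>\<^bsub>V\<^esub> \<in> N" and Na: "\<And>x y. x \<in> N \<Longrightarrow> y \<in> N \<Longrightarrow> x \<oplus>\<^bsub>V\<^esub> y \<in> N"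
    and Nm: "\<And>k x. k \<in> carrier K \<Longrightarrow> x \<in> N \<Longrightarrow> k \<odot>\<^bsub>V\<^esub> x \<in> N" and vN: "v \<notin> N"
    using N by (auto simp: submodule_iff[OF V])
  have Nc: "x \<in> carrier V" if "x \<in> N" for x using Ns that by blast
  have Nn: "\<ominus>\<^bsub>V\<^esub> x \<in> N" if "x \<in> N" for x
    using Nm[of "\<ominus>\<^bsub>K\<^esub> \<one>\<^bsub>K\<^esub>" x] that by (simp add: module_neg_eq_smult[OF V] Nc)
  \<comment> \<open>For \<open>x\<close> outside \<open>N\<close>, maximality puts \<open>v\<close>
    into the sum of \<open>N\<close> and the line through \<open>x\<close>. The coefficient of
    \<open>x\<close> is nonzero because \<open>v\<close> is not in \<open>N\<close>, so it can be
    inverted and the equation solved for \<open>x\<close>.\<close>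
  have ex: "\<exists>a n. a \<in> carrier K \<and> n \<in> N \<and> x = n \<oplus>\<^bsub>V\<^esub> a \<odot>\<^bsub>V\<^esub> v" if x: "x \<in> carrier V" for x
  proof (cases "x \<in> N")
    case True
    then show ?thesis using v x by (intro exI[of _ "\<zero>\<^bsub>K\<^esub>"] exI[of _ x]) simp
  next
    case False
    let ?N = "{n \<oplus>\<^bsub>V\<^esub> a \<odot>\<^bsub>V\<^esub> x |n a. n \<in> N \<and> a \<in> carrier K}"
    have NN: "n \<in> ?N" if "n \<in> N" for n using that x Nc by (intro CollectI exI[of _ n] exI[of _ "\<zero>\<^bsub>K\<^esub>"]) simp
    have "x \<in> ?N" using x Ns by (intro CollectI exI[of _ "\<zero>\<^bsub>V\<^esub>"] exI[of _ "\<one>\<^bsub>K\<^esub>"]) simp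
    then have ne: "?N \<noteq> N" using False by blast
    have "submodule ?N K V"
    proof (rule submoduleI'[OF V])
      show "?N \<subseteq> carrier V" using Nc x by auto
      show "\<zero>\<^bsub>V\<^esub> \<in> ?N" by (rule NN[OF Ns(2)])
      fix s t assume "s \<in> ?N" "t \<in> ?N"
      then obtain n a m b where s: "s = n \<oplus>\<^bsub>V\<^esub> a \<odot>\<^bsub>V\<^esub> x" "n \<in> N" "a \<in> carrier K"
        and t: "t = m \<oplus>\<^bsub>V\<^esub> b \<odot>\<^bsub>V\<^esub> x" "m \<in> N" "b \<in> carrier K" by blast
      have "s \<oplus>\<^bsub>V\<^esub> t = (n \<oplus>\<^bsub>V\<^esub> m) \<oplus>\<^bsub>V\<^esub> (a \<oplus>\<^bsub>K\<^esub> b) \<odot>\<^bsub>V\<^esub> x"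
        using s t x Nc by (simp add: V.smult_l_distr V.M.a_ac)
      then show "s \<oplus>\<^bsub>V\<^esub> t \<in> ?N" using s t Na K.a_closed by blast
    next
      fix k s assume k: "k \<in> carrier K" and "s \<in> ?N"
      then obtain n a where s: "s = n \<oplus>\<^bsub>V\<^esub> a \<odot>\<^bsub>V\<^esub> x" "n \<in> N" "a \<in> carrier K" by blast
      have "k \<odot>\<^bsub>V\<^esub> s = k \<odot>\<^bsub>V\<^esub> n \<oplus>\<^bsub>V\<^esub> (k \<otimes>\<^bsub>K\<^esub> a) \<odot>\<^bsub>V\<^esub> x"
        using s k x Nc by (simp add: V.smult_r_distr V.smult_assoc1)
      then show "k \<odot>\<^bsub>V\<^esub> s \<in> ?N" using s k Nm K.m_closed by blast
    qed
    then have "v \<in> ?N" using max[of ?N] NN ne by blast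
    then obtain n a where n: "v = n \<oplus>\<^bsub>V\<^esub> a \<odot>\<^bsub>V\<^esub> x" "n \<in> N" "a \<in> carrier K" by blast
    have "a \<noteq> \<zero>\<^bsub>K\<^esub>" using n vN x Nc[OF n(2)] by auto
    then have a: "inv\<^bsub>K\<^esub> a \<in> carrier K" "inv\<^bsub>K\<^esub> a \<otimes>\<^bsub>K\<^esub> a = \<one>\<^bsub>K\<^esub>" using n(3) K.field_Units by auto
    have "inv\<^bsub>K\<^esub> a \<odot>\<^bsub>V\<^esub> v = inv\<^bsub>K\<^esub> a \<odot>\<^bsub>V\<^esub> n \<oplus>\<^bsub>V\<^esub> (inv\<^bsub>K\<^esub> a \<otimes>\<^bsub>K\<^esub> a) \<odot>\<^bsub>V\<^esub> x"
      using n x Nc a(1) by (simp add: V.smult_r_distr V.smult_assoc1)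
    then have "x = \<ominus>\<^bsub>V\<^esub> (inv\<^bsub>K\<^esub> a \<odot>\<^bsub>V\<^esub> n) \<oplus>\<^bsub>V\<^esub> inv\<^bsub>K\<^esub> a \<odot>\<^bsub>V\<^esub> v"
      using a x Nc[OF n(2)] by (simp add: V.M.r_neg1)
    then show ?thesis using a(1) Nn[OF Nm[OF a(1) n(2)]] by blast
  qed
  define h where "h x = (SOME a. a \<in> carrier K \<and> (\<exists>n\<in>N. x = n \<oplus>\<^bsub>V\<^esub> a \<odot>\<^bsub>V\<^esub> v))" for x
  have h: "h x \<in> carrier K \<and> (\<exists>n\<in>N. x = n \<oplus>\<^bsub>V\<^esub> h x \<odot>\<^bsub>V\<^esub> v)" if "x \<in> carrier V" for x
    unfolding h_def by (rule someI_ex) (use ex[OF that] in blast)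
  have hc: "h x \<in> carrier K" if "x \<in> carrier V" for x using h[OF that] by blast
  \<comment> \<open>Two different coefficients would put a nonzero multiple of \<open>v\<close>,
    hence \<open>v\<close> itself, into \<open>N\<close>.\<close>
  have u: "h (n \<oplus>\<^bsub>V\<^esub> a \<odot>\<^bsub>V\<^esub> v) = a" if n: "n \<in> N" and a: "a \<in> carrier K" for n a
  proof (rule ccontr)
    let ?x = "n \<oplus>\<^bsub>V\<^esub> a \<odot>\<^bsub>V\<^esub> v"
    assume ne: "h ?x \<noteq> a"
    have xc: "?x \<in> carrier V" using Nc[OF n] a v by simp
    obtain m where m: "m \<in> N" "?x = m \<oplus>\<^bsub>V\<^esub> h ?x \<odot>\<^bsub>V\<^esub> v" using h[OF xc] by blast
    define b where "b = h ?x"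
    define d where "d = a \<ominus>\<^bsub>K\<^esub> b"
    have b: "b \<in> carrier K" unfolding b_def by (rule hc[OF xc])
    have dc: "d \<in> carrier K" using a b by (simp add: d_def)
    have d0: "d \<noteq> \<zero>\<^bsub>K\<^esub>" using ne a b by (simp add: d_def b_def[symmetric] K.minus_eq_zero_iff)
    have "a = d \<oplus>\<^bsub>K\<^esub> b" using a b by (simp add: d_def K.minus_eq K.a_assoc K.l_neg)
    then have "a \<odot>\<^bsub>V\<^esub> v = d \<odot>\<^bsub>V\<^esub> v \<oplus>\<^bsub>V\<^esub> b \<odot>\<^bsub>V\<^esub> v" using dc b v by (simp add: V.smult_l_distr)
    then have "n \<oplus>\<^bsub>V\<^esub> (d \<odot>\<^bsub>V\<^esub> v \<oplus>\<^bsub>V\<^esub> b \<odot>\<^bsub>V\<^esub> v) = m \<oplus>\<^bsub>V\<^esub> b \<odot>\<^bsub>V\<^esub> v"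
      using m(2)[folded b_def] by simp
    then have "n \<oplus>\<^bsub>V\<^esub> d \<odot>\<^bsub>V\<^esub> v = m" using Nc[OF n] Nc[OF m(1)] dc b v by (simp add: V.M.a_assoc[symmetric])
    then have "d \<odot>\<^bsub>V\<^esub> v = \<ominus>\<^bsub>V\<^esub> n \<oplus>\<^bsub>V\<^esub> m" using Nc[OF n] dc v by (auto simp: V.M.r_neg1)
    then have dN: "d \<odot>\<^bsub>V\<^esub> v \<in> N" using Na Nn n m by simp
    have i: "inv\<^bsub>K\<^esub> d \<in> carrier K" "inv\<^bsub>K\<^esub> d \<otimes>\<^bsub>K\<^esub> d = \<one>\<^bsub>K\<^esub>" using d0 dc K.field_Units by auto
    have "inv\<^bsub>K\<^esub> d \<odot>\<^bsub>V\<^esub> (d \<odot>\<^bsub>V\<^esub> v) \<in> N" by (rule Nm[OF i(1) dN])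
    then show False using vN i dc v by (simp add: V.smult_assoc1[symmetric])
  qed
  have "linear_map K V (scalar_module K) h"
  proof (rule linear_mapI)
    fix x y assume x: "x \<in> carrier V" and y: "y \<in> carrier V"
    obtain n m where n: "n \<in> N" "x = n \<oplus>\<^bsub>V\<^esub> h x \<odot>\<^bsub>V\<^esub> v" and m: "m \<in> N" "y = m \<oplus>\<^bsub>V\<^esub> h y \<odot>\<^bsub>V\<^esub> v" using h[OF x] h[OF y] by blast
    have "(n \<oplus>\<^bsub>V\<^esub> h x \<odot>\<^bsub>V\<^esub> v) \<oplus>\<^bsub>V\<^esub> (m \<oplus>\<^bsub>V\<^esub> h y \<odot>\<^bsub>V\<^esub> v) = (n \<oplus>\<^bsub>V\<^esub> m) \<oplus>\<^bsub>V\<^esub> (h x \<oplus>\<^bsub>K\<^esub> h y) \<odot>\<^bsub>V\<^esub> v"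
      using Nc[OF n(1)] Nc[OF m(1)] hc[OF x] hc[OF y] v by (simp add: V.smult_l_distr V.M.a_ac)
    then have "x \<oplus>\<^bsub>V\<^esub> y = (n \<oplus>\<^bsub>V\<^esub> m) \<oplus>\<^bsub>V\<^esub> (h x \<oplus>\<^bsub>K\<^esub> h y) \<odot>\<^bsub>V\<^esub> v" unfolding n(2)[symmetric] m(2)[symmetric] .
    then show "h (x \<oplus>\<^bsub>V\<^esub> y) = h x \<oplus>\<^bsub>scalar_module K\<^esub> h y" using u[OF Na[OF n(1) m(1)] K.a_closed[OF hc[OF x] hc[OF y]]] by simp
  next
    fix k x assume k: "k \<in> carrier K" and x: "x \<in> carrier V"
    obtain n where n: "n \<in> N" "x = n \<oplus>\<^bsub>V\<^esub> h x \<odot>\<^bsub>V\<^esub> v" using h[OF x] by blast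
    have "k \<odot>\<^bsub>V\<^esub> (n \<oplus>\<^bsub>V\<^esub> h x \<odot>\<^bsub>V\<^esub> v) = k \<odot>\<^bsub>V\<^esub> n \<oplus>\<^bsub>V\<^esub> (k \<otimes>\<^bsub>K\<^esub> h x) \<odot>\<^bsub>V\<^esub> v"
      using Nc[OF n(1)] hc[OF x] k v by (simp add: V.smult_r_distr V.smult_assoc1)
    then have "k \<odot>\<^bsub>V\<^esub> x = k \<odot>\<^bsub>V\<^esub> n \<oplus>\<^bsub>V\<^esub> (k \<otimes>\<^bsub>K\<^esub> h x) \<odot>\<^bsub>V\<^esub> v" unfolding n(2)[symmetric] .
    then show "h (k \<odot>\<^bsub>V\<^esub> x) = k \<odot>\<^bsub>scalar_module K\<^esub> h x" using u[OF Nm[OF k n(1)] K.m_closed[OF k hc[OF x]]] by simp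
  qed (simp add: hc)
  moreover have "h v = \<one>\<^bsub>K\<^esub>" using u[OF Ns(2) K.one_closed] v by simp
  ultimately show ?thesis by blast
qed

section \<open>Group-like elements of the tensor coalgebra\<close>

context words begin

text \<open>The \<open>n\<close>-th tensor power of the functional \<open>h\<close>, extended by
  zero to all words of other lengths; it probes the component of degree \<open>n\<close>.\<close>

lemma eval_multilinear:
  assumes h: "linear_map K V (scalar_module K) h"
  shows "multilinear K V (scalar_module K) (\<lambda>xs. if length xs = n then foldr (\<lambda>v a. h v \<otimes>\<^bsub>K\<^esub> a) xs \<one>\<^bsub>K\<^esub> else \<zero>\<^bsub>K\<^esub>)"
proof -
  let ?f = "\<lambda>xs a. foldr (\<lambda>v a. h v \<otimes>\<^bsub>K\<^esub> a) xs a"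
  have hc: "v \<in> carrier V \<Longrightarrow> h v \<in> carrier K" for v using lin_closed[OF h] by simp
  have c: "?f xs a \<in> carrier K" if "xs \<in> L" "a \<in> carrier K" for xs a
    using that by (induction xs) (simp_all add: hc)
  have l: "linear_map K V (scalar_module K) (\<lambda>v. ?f xs (h v \<otimes>\<^bsub>K\<^esub> a))" if "xs \<in> L" "a \<in> carrier K" for xs a
    using that
  proof (induction xs)
    case Nil
    then show ?case
      by (intro linear_mapI) (simp_all add: hc lin_add[OF h] lin_smult[OF h] R.l_distr R.m_assoc)
  next
    case (Cons x xs)
    then show ?case using lin_smult_fun[OF Cons.IH S, of "h x"] by (simp add: hc)
  qed
  show ?thesis
  proof (rule multilinearI)
    fix xs ys assume *: "xs \<in> L" "ys \<in> L"
    show "linear_map K V (scalar_module K) (\<lambda>v. if length (xs @ [v] @ ys) = n then ?f (xs @ [v] @ ys) \<one>\<^bsub>K\<^esub> else \<zero>\<^bsub>K\<^esub>)"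
      using l[OF *(1) c[OF *(2) R.one_closed]] lin_zero_fun[OF S, of V]
      by (cases "Suc (length xs + length ys) = n") simp_all
  qed (simp add: c)
qed

text \<open>
  For a group-like \<open>g\<close> with \<open>g = 1 + v g\<close>, the components \<open>v \<otimes> \<dots> \<otimes> v\<close> of \<open>g\<close> vanish in high degrees; a functional
  with value \<open>1\<close> at \<open>v\<close> would detect all of them.
\<close>

lemma grouplike_unique:
  assumes K: "field K" and g: "g \<in> carrier T" and D: "\<Delta> g = p g g" and e: "\<epsilon> g = \<one>\<^bsub>K\<^esub>"
  shows "g = w []"
proof -
  interpret K: field K by (rule K)
  have w0: "w [] \<in> carrier T" by (simp add: w_closed)
  note vc = \<pi>_closed[OF g]
  have wv: "w [\<pi> g] \<in> carrier T" by (simp add: w_closed vc)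
  have eq: "g = w [] \<oplus>\<^bsub>T\<^esub> cc (w [\<pi> g]) g" using peel_\<Delta>[OF g] g w0 by (simp add: D e peel_pure)
  have "\<pi> g = \<zero>\<^bsub>V\<^esub>"
  proof (rule ccontr)
    assume "\<pi> g \<noteq> \<zero>\<^bsub>V\<^esub>"
    from functional_exists[OF K V vc this] obtain h where h: "linear_map K V (scalar_module K) h" and hv: "h (\<pi> g) = \<one>\<^bsub>K\<^esub>" by blast
    define m where "m n xs = (if length xs = n then foldr (\<lambda>v a. h v \<otimes>\<^bsub>K\<^esub> a) xs \<one>\<^bsub>K\<^esub> else \<zero>\<^bsub>K\<^esub>)" for n and xs :: "'a list"
    define \<Lambda> where "\<Lambda> n = lift_quot K (scalar_module K) (m n)" for n
    have mm: "multilinear K V (scalar_module K) (m n)" for n unfolding m_def by (rule eval_multilinear[OF h])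
    have \<Lambda>l: "linear_map K T (scalar_module K) (\<Lambda> n)" and \<Lambda>w: "xs \<in> L \<Longrightarrow> \<Lambda> n (w xs) = m n xs" for n xs
      using w_lift[OF S mm] unfolding \<Lambda>_def by blast+
    have r0: "\<Lambda> 0 (cc (w [\<pi> g]) x) = \<zero>\<^bsub>K\<^esub>" if "x \<in> carrier T" for x
      using w_eqI[OF S lin_comp[OF cc_right[OF wv] \<Lambda>l] lin_zero_fun[OF S] _ that, of 0]
      by (simp add: cc_word vc \<Lambda>w m_def)
    have rS: "\<Lambda> (Suc n) (cc (w [\<pi> g]) x) = \<Lambda> n x" if "x \<in> carrier T" for n x
    proof (rule w_eqI[OF S lin_comp[OF cc_right[OF wv] \<Lambda>l] \<Lambda>l _ that])
      fix xs assume xs: "xs \<in> L"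
      have "m n xs \<in> carrier K" using multilinear_closed[OF mm xs] by simp
      then show "\<Lambda> (Suc n) (cc (w [\<pi> g]) (w xs)) = \<Lambda> n (w xs)" using xs vc hv by (simp add: cc_word \<Lambda>w m_def split: if_splits)
    qed
    have \<Lambda>g: "\<Lambda> n g = \<Lambda> n (w []) \<oplus>\<^bsub>K\<^esub> \<Lambda> n (cc (w [\<pi> g]) g)" for n
      using lin_add[OF \<Lambda>l w0 cc_closed[OF wv g], of n] unfolding eq[symmetric] by simp
    have "\<Lambda> n g = \<one>\<^bsub>K\<^esub>" for n
    proof (induction n)
      case 0
      show ?case unfolding \<Lambda>g[of 0] r0[OF g] by (simp add: \<Lambda>w m_def)
    next
      case (Suc n)
      show ?case unfolding \<Lambda>g[of "Suc n"] rS[OF g] Suc by (simp add: \<Lambda>w m_def)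
    qed
    \<comment> \<open>Elements of \<open>T(V)\<close> have bounded degree, so almost all of these
      values vanish, against the value 1 found for every \<open>n\<close>.\<close>
    moreover have "\<exists>N. \<forall>n\<ge>N. \<Lambda> n g = \<zero>\<^bsub>K\<^esub>"
      using w_spans T g
    proof (induction rule: spans_induct)
      case zero
      show ?case using lin_zero[OF \<Lambda>l T S] by simp
    next
      case (gen x)
      then obtain xs where "xs \<in> L" "x = w xs" by blast
      then show ?case by (intro exI[of _ "Suc (length xs)"]) (auto simp: \<Lambda>w m_def)
    next
      case (add x y)
      then obtain M N where "\<forall>n\<ge>M. \<Lambda> n x = \<zero>\<^bsub>K\<^esub>" "\<forall>n\<ge>N. \<Lambda> n y = \<zero>\<^bsub>K\<^esub>" by blast
      then show ?case using add(1,2) by (intro exI[of _ "max M N"]) (simp add: lin_add[OF \<Lambda>l])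
    next
      case (smult c x)
      then obtain M where "\<forall>n\<ge>M. \<Lambda> n x = \<zero>\<^bsub>K\<^esub>" by blast
      then show ?case using smult(1,2) by (intro exI[of _ M]) (simp add: lin_smult[OF \<Lambda>l])
    qed
    ultimately show False using K.one_not_zero by auto
  qed
  then show ?thesis using eq g w0 by (simp add: w_zero_letter cc_zero)
qed

end

text \<open>The coalgebra structure of \<open>B\<close> is that of \<open>T(V)\<close> on the nose,
  while product and unit are arbitrary. A general cofree bialgebra is brought into this form by
  transporting its product along the coalgebra isomorphism.\<close>

locale cofree_words = words K V for K :: "('k, 'm) ring_scheme" and V :: "('k, 'a, 'x) module_scheme" +
  fixes B :: "('k, ('a list \<Rightarrow> 'k) set) bialg"
  assumes K: "field K" and B: "bialgebra K B"
    and B_simps: "carrier B = carrier T" "zero B = zero T" "add B = add T" "smult B = smult T" "comult B = \<Delta>" "counit B = \<epsilon>"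
begin

abbreviation "BB \<equiv> tensor K B B"
definition "M us vs = \<pi> (w us \<otimes>\<^bsub>B\<^esub> w vs)"

lemma BB: "carrier BB = carrier TT" "zero BB = zero TT" "add BB = add TT" "smult BB = smult TT" "pure_tensor K B B = p"
  by (rule tensor_struct_cong tensor_space_struct_cong; simp add: B_simps)+

lemmas B' = bialgebraD[OF B, unfolded BB B_simps]

sublocale B: monoid B by (rule assoc_algebraD[OF B'(1)])

text \<open>The unit of a bialgebra is group-like and has counit 1, so
  \<open>grouplike_unique\<close> applies.\<close>

lemma B_one: "\<one>\<^bsub>B\<^esub> = w []"
  using grouplike_unique[OF K _ B'(8,9)] assoc_algebraD(4)[OF B'(1)] by (simp add: B_simps)

lemma B_bilin: "bilinear K T T T (mult B)"
  using assoc_algebra_bilinear[OF B'(1)] by (subst (asm) bilin_struct_cong[of _ T _ T _ T]) (simp_all add: B_simps)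

lemma w_B: "us \<in> L \<Longrightarrow> w us \<in> carrier B"
  by (simp add: B_simps w_closed)

lemma BB_bilin: "bilinear K TT TT TT (mult BB)"
  using tensor_mult_bilinear_pure(1)[OF bialgebraD(3,3)[OF B] assoc_algebra_bilinear[OF B'(1)] assoc_algebra_bilinear[OF B'(1)]]
  by (subst (asm) bilin_struct_cong[of _ TT _ TT _ TT]) (simp_all add: BB)

lemma BB_pure: "a \<in> carrier T \<Longrightarrow> b \<in> carrier T \<Longrightarrow> c \<in> carrier T \<Longrightarrow> d \<in> carrier T \<Longrightarrow>
    p a b \<otimes>\<^bsub>BB\<^esub> p c d = p (a \<otimes>\<^bsub>B\<^esub> c) (b \<otimes>\<^bsub>B\<^esub> d)"
  using tensor_mult_bilinear_pure(2)[OF bialgebraD(3,3)[OF B] assoc_algebra_bilinear[OF B'(1)] assoc_algebra_bilinear[OF B'(1)], of a b c d]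
  unfolding BB by (simp add: B_simps)

sublocale binf_star K V M
proof
  show "multilinear K V V (\<lambda>us. M us vs)" if "vs \<in> L" for vs
    unfolding M_def by (intro multilinear_comp[OF w_multi] lin_comp[OF bilin_left[OF B_bilin] \<pi>_lin] w_closed that)
  show "multilinear K V V (M us)" if "us \<in> L" for us
    unfolding M_def by (intro multilinear_comp[OF w_multi] lin_comp[OF bilin_right[OF B_bilin] \<pi>_lin] w_closed that)
  have u: "M us [] = \<pi> (w us)" "M [] us = \<pi> (w us)" if "us \<in> L" for us
    using B.l_one[OF w_B[OF that]] B.r_one[OF w_B[OF that]] by (simp_all add: M_def B_one)
  show "M [] [] = \<zero>\<^bsub>V\<^esub>" using u(1)[of "[]"] by (simp add: \<pi>_word)
  show "M [x] [] = x" "M [] [x] = x" if "x \<in> carrier V" for x using u[of "[x]"] that by (simp_all add: \<pi>_word)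
  show "M us [] = \<zero>\<^bsub>V\<^esub>" "M [] us = \<zero>\<^bsub>V\<^esub>" if us: "us \<in> L" and l: "2 \<le> length us" for us
    unfolding u[OF us] \<pi>_word[OF us] using l by simp_all
qed

text \<open>The coproduct of \<open>B\<close> is multiplicative, so the product in \<open>B\<close>
  obeys the same recursion over cut points as the block formula. The letters agree because
  \<open>M\<close> is defined as the letter component of the product in \<open>B\<close>.\<close>

lemma S_eq_mult:
  assumes us: "us \<in> L" and vs: "vs \<in> L" shows "S us vs = w us \<otimes>\<^bsub>B\<^esub> w vs"
proof -
  let ?F = "\<lambda>(us, vs). S us vs" and ?G = "\<lambda>(us, vs). w us \<otimes>\<^bsub>B\<^esub> w vs" and ?J = "\<lambda>(us, vs). cut_points us vs"
  let ?l = "\<lambda>(us, vs) z. (take (fst z) us, take (snd z) vs)" and ?r = "\<lambda>(us, vs) z. (drop (fst z) us, drop (snd z) vs)"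
  let ?s = "\<lambda>(us, vs). length us + length vs"
  have "?F (us, vs) = ?G (us, vs)"
  proof (rule coalg_unique[where F="?F" and G="?G" and X="L \<times> L" and J="?J" and l="?l" and r="?r" and size="?s"])
    show "(us, vs) \<in> L \<times> L" using us vs by blast
  next
    fix x assume "x \<in> L \<times> L"
    then obtain us vs where x: "x = (us, vs)" and us: "us \<in> L" and vs: "vs \<in> L" by blast
    note cl = w_closed[OF take_L[OF us]] w_closed[OF take_L[OF vs]] w_closed[OF drop_L[OF us]] w_closed[OF drop_L[OF vs]]
    note wc = w_closed[OF us] w_closed[OF vs]
    note Bc = bilin_closed[OF B_bilin]
    show "?F x \<in> carrier T" unfolding x prod.case by (rule S_closed[OF us vs])
    show "?G x \<in> carrier T" unfolding x prod.case by (rule Bc[OF wc])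
    show "\<Delta> (?F x) = (\<Oplus>\<^bsub>TT\<^esub>j\<in>?J x. p (?F (?l x j)) (?F (?r x j)))"
      unfolding x prod.case by (rule \<Delta>_S[OF us vs])
    show "\<Delta> (?G x) = (\<Oplus>\<^bsub>TT\<^esub>j\<in>?J x. p (?G (?l x j)) (?G (?r x j)))"
    proof -
      have "\<Delta> (w us \<otimes>\<^bsub>B\<^esub> w vs) = (\<Oplus>\<^bsub>TT\<^esub>z\<in>{0..length us} \<times> {0..length vs}.
        p (w (take (fst z) us)) (w (drop (fst z) us)) \<otimes>\<^bsub>BB\<^esub> p (w (take (snd z) vs)) (w (drop (snd z) vs)))"
        unfolding B'(6)[OF wc] \<Delta>_word[OF us] \<Delta>_word[OF vs]
        by (rule bilinear_finsum[OF BB_bilin TT TT TT]) (simp_all add: p_closed cl)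
      also have "\<dots> = (\<Oplus>\<^bsub>TT\<^esub>z\<in>cut_points us vs. p (w (take (fst z) us) \<otimes>\<^bsub>B\<^esub> w (take (snd z) vs)) (w (drop (fst z) us) \<otimes>\<^bsub>B\<^esub> w (drop (snd z) vs)))"
        by (rule TT.finsum_eqI) (simp_all only: cut_points_def BB_pure[OF cl(1,3,2,4)] p_closed[OF Bc[OF cl(1,2)] Bc[OF cl(3,4)]])
      finally show ?thesis unfolding x prod.case .
    qed
    show "\<epsilon> (?F x) = \<epsilon> (?G x)"
      unfolding x prod.case \<epsilon>_S[OF us vs] B'(7)[OF wc] \<epsilon>_word[OF us] \<epsilon>_word[OF vs] by simp
    show "\<pi> (?F x) = \<pi> (?G x)"
      unfolding x prod.case \<pi>_S[OF us vs] M_def ..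
    fix j assume j: "j \<in> ?J x"
    show "?l x j \<in> L \<times> L \<and> ?r x j \<in> L \<times> L"
      unfolding x prod.case by (intro conjI SigmaI take_L drop_L us vs)
    show "?s (?r x j) < ?s x \<or> \<pi> (?F (?l x j)) = \<zero>\<^bsub>V\<^esub>"
    proof (cases "j = (0, 0)")
      case True
      show ?thesis unfolding x True by (simp add: S_Nil \<pi>_word)
    next
      case False
      then show ?thesis using j unfolding x by (cases j) (auto simp: cut_points_def)
    qed
  qed
  then show ?thesis by simp
qed

lemma st_eq_mult: "x \<in> carrier T \<Longrightarrow> y \<in> carrier T \<Longrightarrow> st x y = x \<otimes>\<^bsub>B\<^esub> y"
  by (rule w_bilin_eqI[OF T st_bilin B_bilin]) (simp_all only: st_word S_eq_mult)

text \<open>The remaining axiom is the image under \<open>\<pi>\<close> of associativity in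
  \<open>B\<close>, since the product of \<open>B\<close> is now known to be the block
  product.\<close>

sublocale binf_words K V M
proof
  fix us vs ws assume L: "us \<in> L" "vs \<in> L" "ws \<in> L"
  have "st (S us vs) (w ws) = st (w us) (S vs ws)"
    unfolding S_eq_mult[OF L(1,2)] S_eq_mult[OF L(2,3)]
      st_eq_mult[OF bilin_closed[OF B_bilin w_closed[OF L(1)] w_closed[OF L(2)]] w_closed[OF L(3)]]
      st_eq_mult[OF w_closed[OF L(1)] bilin_closed[OF B_bilin w_closed[OF L(2)] w_closed[OF L(3)]]] by (rule B.m_assoc[OF w_B[OF L(1)] w_B[OF L(2)] w_B[OF L(3)]])
  then show "(\<Oplus>\<^bsub>V\<^esub>ps\<in>blocks us vs. M (mm ps) ws) = (\<Oplus>\<^bsub>V\<^esub>ps\<in>blocks vs ws. M us (mm ps))"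
    by (simp only: \<pi>_st_left[OF L, symmetric] \<pi>_st_right[OF L, symmetric])
qed

end

text \<open>The converse of \<open>star_words_if_binf_algebra\<close>: the relations over
  \<open>blocks\<close> are rewritten as sums over \<open>cuts\<close>.\<close>

lemma (in binf_words) binf_algebraI:
  assumes eq: "carrier R = carrier V" "add R = add V" "zero R = zero V" "smult R = smult V" "ops R = M"
  shows "binf_algebra K R"
proof -
  have m: "module K R" by (rule module_cong[OF V eq(1-4)])
  have cl: "mm ps \<in> L" if "us \<in> L" "vs \<in> L" "ps \<in> cuts l us vs" for us vs ps l
  proof -
    have "M (fst x) (snd x) \<in> carrier V" if x: "x \<in> set ps" for x
      using \<open>us \<in> _\<close> \<open>vs \<in> _\<close> \<open>ps \<in> _\<close> x by (intro M_closed) (auto simp: cuts_def)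
    then show ?thesis by (auto simp: split_def)
  qed
  have z: "\<zero>\<^bsub>V\<^esub> \<in> set (mm ps)" if "([], []) \<in> set ps" for ps using that M00 by force
  have rel: "(\<Oplus>\<^bsub>V\<^esub>l \<in> {1..length us + length vs}. \<Oplus>\<^bsub>V\<^esub>ps \<in> cuts l us vs. M (mm ps) ws) =
        (\<Oplus>\<^bsub>V\<^esub>m \<in> {1..length vs + length ws}. \<Oplus>\<^bsub>V\<^esub>ps \<in> cuts m vs ws. M us (mm ps))"
    if L: "us \<in> L" "vs \<in> L" "ws \<in> L" and ne: "us \<noteq> [] \<and> vs \<noteq> [] \<and> ws \<noteq> []" for us vs ws
  proof -
    have "(\<Oplus>\<^bsub>V\<^esub>l \<in> {1..length us + length vs}. \<Oplus>\<^bsub>V\<^esub>ps \<in> cuts l us vs. M (mm ps) ws) = (\<Oplus>\<^bsub>V\<^esub>ps\<in>blocks us vs. M (mm ps) ws)"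
      by (rule M.finsum_cuts) (use ne M_closed[OF cl[OF L(1,2)] L(3)] multilinear_eq_zero[OF M1[OF L(3)] V V cl[OF L(1,2)] z] in auto)
    also have "\<dots> = (\<Oplus>\<^bsub>V\<^esub>ps\<in>blocks vs ws. M us (mm ps))" by (rule M_rel[OF L]) (use ne in auto)
    also have "\<dots> = (\<Oplus>\<^bsub>V\<^esub>m \<in> {1..length vs + length ws}. \<Oplus>\<^bsub>V\<^esub>ps \<in> cuts m vs ws. M us (mm ps))"
      by (rule M.finsum_cuts[symmetric]) (use ne M_closed[OF L(1) cl[OF L(2,3)]] multilinear_eq_zero[OF M2[OF L(1)] V V cl[OF L(2,3)] z] in auto)
    finally show ?thesis .
  qed
  show ?thesis
    unfolding binf_algebra_def Let_def finsum_struct_cong[OF eq(1-3)] eq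
  proof (intro conjI ballI impI m)
    fix us vs xs x y c assume *: "us \<in> L" "xs \<in> L" "vs \<in> L" "x \<in> carrier V" "y \<in> carrier V" "c \<in> carrier K"
    note l = multilinear_linear[OF M1[OF *(3)] *(1,2)]
    show "M (us @ [x \<oplus>\<^bsub>V\<^esub> y] @ xs) vs = M (us @ [x] @ xs) vs \<oplus>\<^bsub>V\<^esub> M (us @ [y] @ xs) vs"
      by (rule lin_add[OF l *(4,5)])
    show "M (us @ [c \<odot>\<^bsub>V\<^esub> x] @ xs) vs = c \<odot>\<^bsub>V\<^esub> M (us @ [x] @ xs) vs" by (rule lin_smult[OF l *(6,4)])
  next
    fix us vs xs x y c assume *: "us \<in> L" "vs \<in> L" "xs \<in> L" "x \<in> carrier V" "y \<in> carrier V" "c \<in> carrier K"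
    note r = multilinear_linear[OF M2[OF *(1)] *(2,3)]
    show "M us (vs @ [x \<oplus>\<^bsub>V\<^esub> y] @ xs) = M us (vs @ [x] @ xs) \<oplus>\<^bsub>V\<^esub> M us (vs @ [y] @ xs)" by (rule lin_add[OF r *(4,5)])
    show "M us (vs @ [c \<odot>\<^bsub>V\<^esub> x] @ xs) = c \<odot>\<^bsub>V\<^esub> M us (vs @ [x] @ xs)" by (rule lin_smult[OF r *(6,4)])
  qed (rule M_closed M00 M_unit M_unit0 rel; assumption)+
qed

lemma words_struct_cong:
  assumes "carrier R = carrier V" "add R = add V" "smult R = smult V"
  shows "words_module K R = words_module K V" "word K R = word K V"
  using assms by (simp_all add: words_module_def word_def word_rels_def fun_eq_iff)

lemma star_bialg_struct_cong:
  assumes "carrier R = carrier V" "add R = add V" "smult R = smult V"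
  shows "star_bialg K R M = star_bialg K V M"
proof -
  note w = words_struct_cong[OF assms]
  have "star_word K R M = star_word K V M" by (simp add: fun_eq_iff star_word_def w)
  moreover have "word_concat K R = word_concat K V" by (simp add: fun_eq_iff word_concat_def w)
  ultimately show ?thesis by (simp add: star_bialg_def star_alg_def star_prod_def[abs_def] tensor_coalgebra_def w)
qed

text \<open>The records themselves need not be equal, since their products are only known to agree
  on the carrier; the identity map takes care of this.\<close>

lemma (in cofree_words) bialg_iso_star: "bialg_iso K B (star_bialg K V M) (\<lambda>x. x)"
proof -
  let ?S = "star_bialg K V M"
  have m: "tensor_map K ?S ?S (\<lambda>x. x) (\<lambda>x. x) X = X" if "X \<in> carrier TT" for X
    using that tensor_map_eq_id[OF T T refl refl, of X]
    by (subst tensor_map_struct_cong[of _ T _ T]) (simp_all add: star_bialg_simps)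
  show ?thesis
    unfolding bialg_iso_def coalgebra_map_def
    by (intro conjI ring_hom_memI linear_mapI ballI)
      (simp_all add: star_bialg_simps B_simps B_one st_eq_mult m \<Delta>_closed bij_betw_def)
qed

lemma submodule_Prim:
  assumes H: "module K H" and D: "linear_map K H (tensor K H H) (comult H)" and one: "\<one>\<^bsub>H\<^esub> \<in> carrier H"
  shows "submodule (Prim K H) K H"
  unfolding Prim_def
  by (rule submodule_kernel[OF _ H tensor_module[OF H H]])
    (intro lin_minus_fun D tensor_module H bilin_left[OF pure_tensor_bilinear[OF H H] one]
      bilin_right[OF pure_tensor_bilinear[OF H H] one])

lemma Prim_module:
  assumes "bialgebra K H" shows "module K (H\<lparr>carrier := Prim K H\<rparr>)"
  using bialgebraD[OF assms] by (intro submodule.submodule_is_module submodule_Prim assoc_algebraD)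

text \<open>The carrier of \<open>R\<close> is \<open>Prim K H\<close>, so \<open>R\<close> lives
  over the same type as \<open>H\<close> and can be used as an argument of \<open>U2\<close> over
  the given universe.\<close>

lemma cofree_bialgebra_iso_star:
  fixes H :: "('k, 'a, 'x) bialg_scheme"
  assumes K: "field K" and cf: "cofree_bialgebra K H"
  shows "\<exists>(R :: ('k, 'a) binf_alg) f. binf_algebra K R \<and> bialg_iso K H (star_bialg K R (ops R)) f"
proof -
  have H: "bialgebra K H" using cf by (simp add: cofree_bialgebra_def)
  note h = bialgebraD[OF H]
  let ?P = "H\<lparr>carrier := Prim K H\<rparr>"
  let ?C = "tensor_coalgebra K ?P"
  obtain \<phi> where f: "coalgebra_map K H ?C \<phi>" and b: "bij_betw \<phi> (carrier H) (carrier ?C)"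
    using cf by (auto simp: cofree_bialgebra_def coalgebra_iso_def)
  interpret P: words K ?P by (rule words.intro[OF Prim_module[OF H]])
  define g where "g = inv_into (carrier H) \<phi>"
  have gf: "g (\<phi> x) = x" if "x \<in> carrier H" for x unfolding g_def by (rule bij_betw_inv_into_left[OF b that])
  \<comment> \<open>The product of \<open>H\<close> is moved along \<open>\<phi>\<close>, whereas
    coproduct and counit are taken from the tensor coalgebra, as \<open>cofree_words\<close>
    demands; \<open>\<phi>\<close> is then an isomorphism of bialgebras by construction.\<close>
  define B where "B = with_coalgebra \<lparr>carrier = carrier P.T, mult = (\<lambda>x y. \<phi> (g x \<otimes>\<^bsub>H\<^esub> g y)), one = \<phi> \<one>\<^bsub>H\<^esub>,
    zero = zero P.T, add = add P.T, smult = smult P.T\<rparr> P.\<Delta> P.\<epsilon>"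
  have Bs: "carrier B = carrier P.T" "mult B = (\<lambda>x y. \<phi> (g x \<otimes>\<^bsub>H\<^esub> g y))" "one B = \<phi> \<one>\<^bsub>H\<^esub>" "zero B = zero P.T"
    "add B = add P.T" "smult B = smult P.T" "comult B = P.\<Delta>" "counit B = P.\<epsilon>" by (simp_all add: B_def)
  have C: "module K ?C" by (rule module_cong[OF P.T]) (simp_all add: tensor_coalgebra_simps)
  have fl: "linear_map K H ?C \<phi>" using f by (simp add: coalgebra_map_def)
  have fB: "linear_map K H B \<phi>"
    using fl by (subst lin_struct_cong[of _ H _ ?C]) (simp_all add: Bs tensor_coalgebra_simps)
  have tm: "tensor_map K B B \<phi> \<phi> = tensor_map K ?C ?C \<phi> \<phi>"
    by (rule tensor_map_struct_cong) (simp_all add: Bs tensor_coalgebra_simps)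
  have iso: "bialg_iso K H B \<phi>"
    unfolding bialg_iso_def
  proof (intro conjI ring_hom_memI)
    show "bij_betw \<phi> (carrier H) (carrier B)" using b by (simp add: Bs tensor_coalgebra_simps)
    show "coalgebra_map K H B \<phi>" using f fB by (simp add: coalgebra_map_def tm Bs)
    show "\<phi> \<zero>\<^bsub>H\<^esub> = \<zero>\<^bsub>B\<^esub>" using lin_zero[OF fl h(3) C] by (simp add: Bs tensor_coalgebra_simps)
  qed (simp_all add: lin_closed[OF fB] lin_add[OF fB], simp_all add: Bs gf)
  interpret B: cofree_words K ?P B
    by (intro cofree_words.intro P.words_axioms cofree_words_axioms.intro K bialg_iso_bialgebra[OF H iso]) (simp_all add: Bs)
  define R where "R = \<lparr>carrier = Prim K H, mult = mult H, one = one H, zero = zero H, add = add H, smult = smult H, ops = B.M\<rparr>"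
  have "binf_algebra K R" by (rule B.binf_algebraI) (simp_all add: R_def)
  moreover have "star_bialg K R (ops R) = star_bialg K ?P B.M"
    by (subst star_bialg_struct_cong[of R ?P]) (simp_all add: R_def)
  ultimately have "binf_algebra K R \<and> bialg_iso K H (star_bialg K R (ops R)) \<phi>"
    using bialg_iso_comp[OF H iso B.bialg_iso_star] by simp
  then show ?thesis by blast
qed

section \<open>Transport to the universe\<close>

lemma bialg_iso_Prim:
  assumes H: "bialgebra K H" and f: "bialg_iso K H G f" and x: "x \<in> Prim K H"
  shows "f x \<in> Prim K G"
proof -
  note h = bialgebraD[OF H] and g = bialgebraD[OF bialg_iso_bialgebra[OF H f]] and fi = bialg_isoD[OF f]
  note o = assoc_algebraD(4)[OF h(1)] and oG = assoc_algebraD(4)[OF g(1)]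
  have xc: "x \<in> carrier H" using x by (simp add: Prim_def)
  note fx = lin_closed[OF fi(5) xc] and ff = tensor_map_linear[OF h(3,3) g(3,3) fi(5,5)]
  have "comult H x = pure_tensor K H H x \<one>\<^bsub>H\<^esub> \<oplus>\<^bsub>tensor K H H\<^esub> pure_tensor K H H \<one>\<^bsub>H\<^esub> x"
    using Prim_iff[OF h(3) lin_closed[OF h(4) xc] o xc] x by simp
  then have "comult G (f x) = pure_tensor K G G (f x) \<one>\<^bsub>G\<^esub> \<oplus>\<^bsub>tensor K G G\<^esub> pure_tensor K G G \<one>\<^bsub>G\<^esub> (f x)"
    using fi(8)[OF xc] pure_tensor_closed[OF h(3,3)] o xc by (simp add: lin_add[OF ff(1)] ff(2) fi(6))
  then show ?thesis using Prim_iff[OF g(3) lin_closed[OF g(4) fx] oG fx] by simp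
qed

text \<open>This is needed for \<open>T(R)\<close>, whose elements are cosets of functions on words
  and have to be replaced by elements of \<open>'u\<close>. All operations of the copy are
  conjugated by \<open>g\<close>.\<close>

lemma bialg_transport:
  fixes H :: "('k, 'a, 'x) bialg_scheme" and g :: "'a \<Rightarrow> 'u"
  assumes H: "bialgebra K H" and g: "inj_on g (carrier H)"
  shows "\<exists>B :: ('k, 'u) bialg. bialg_iso K H B g"
proof -
  note h = bialgebraD[OF H]
  interpret H: module K H by (rule h(3))
  let ?i = "inv_into (carrier H) g"
  define A :: "('k, 'u) module" where "A = \<lparr>carrier = g ` carrier H, mult = (\<lambda>x y. g (?i x \<otimes>\<^bsub>H\<^esub> ?i y)), one = g \<one>\<^bsub>H\<^esub>,
    zero = g \<zero>\<^bsub>H\<^esub>, add = (\<lambda>x y. g (?i x \<oplus>\<^bsub>H\<^esub> ?i y)), smult = (\<lambda>c x. g (c \<odot>\<^bsub>H\<^esub> ?i x))\<rparr>"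
  define B where "B = with_coalgebra A (\<lambda>x. tensor_map K A A g g (comult H (?i x))) (\<lambda>x. counit H (?i x))"
  have ig: "?i (g x) = x" if "x \<in> carrier H" for x using g that by simp
  have tm: "tensor_map K B B g g = tensor_map K A A g g" by (rule tensor_map_struct_cong) (simp_all add: B_def)
  have "bialg_iso K H B g"
    unfolding bialg_iso_def coalgebra_map_def tm
    by (intro conjI ring_hom_memI linear_mapI ballI) (simp_all add: B_def A_def ig bij_betw_def g)
  then show ?thesis by blast
qed

lemma tensor_coalgebra_map:
  assumes V: "module K V" and W: "module K W" and f: "linear_map K V W f"
  defines "F \<equiv> lift_quot K (words_module K W) (\<lambda>xs. word K W (map f xs))"
  shows "coalgebra_map K (tensor_coalgebra K V) (tensor_coalgebra K W) F"
    and "xs \<in> lists (carrier V) \<Longrightarrow> F (word K V xs) = word K W (map f xs)"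
    and "linear_map K (words_module K V) (words_module K W) F"
proof -
  interpret V: words K V by (rule words.intro[OF V])
  interpret W: words K W by (rule words.intro[OF W])
  have fL: "xs \<in> V.L \<Longrightarrow> map f xs \<in> W.L" for xs using lin_closed[OF f] by auto
  have "multilinear K V W.T (\<lambda>xs. W.w (map f xs))"
  proof (rule multilinearI)
    fix xs ys assume *: "xs \<in> V.L" "ys \<in> V.L"
    show "linear_map K V W.T (\<lambda>v. W.w (map f (xs @ [v] @ ys)))"
      using lin_comp[OF f multilinear_linear[OF W.w_multi fL[OF *(1)] fL[OF *(2)]]] by simp
  qed (rule W.w_closed[OF fL])
  note l = V.w_lift[OF W.T this, folded F_def]
  show Fl: "linear_map K (words_module K V) (words_module K W) F" by (rule l(1))
  show Fw: "F (V.w xs) = W.w (map f xs)" if "xs \<in> V.L" for xs by (rule l(2)[OF that])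
  let ?FF = "tensor_map K W.T W.T F F"
  note FF = tensor_map_linear[OF V.T V.T W.T W.T Fl Fl]
  show "coalgebra_map K (tensor_coalgebra K V) (tensor_coalgebra K W) F"
    unfolding coalgebra_map_def tensor_coalgebra_simps
  proof (intro conjI ballI)
    show "linear_map K (tensor_coalgebra K V) (tensor_coalgebra K W) F"
      using Fl by (subst lin_struct_cong[of _ V.T _ W.T]) (simp_all add: tensor_coalgebra_simps)
    fix x assume x: "x \<in> carrier V.T"
    have tm: "tensor_map K (tensor_coalgebra K W) (tensor_coalgebra K W) F F = ?FF"
      by (rule tensor_map_struct_cong) (simp_all add: tensor_coalgebra_simps)
    show "W.\<Delta> (F x) = tensor_map K (tensor_coalgebra K W) (tensor_coalgebra K W) F F (V.\<Delta> x)"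
      unfolding tm
    proof (rule V.w_eqI[OF W.TT lin_comp[OF Fl W.\<Delta>_lin] lin_comp[OF V.\<Delta>_lin FF(1)] _ x])
      fix xs assume xs: "xs \<in> V.L"
      note td = V.take_L[OF xs] V.drop_L[OF xs]
      have "?FF (V.\<Delta> (V.w xs)) = (\<Oplus>\<^bsub>W.TT\<^esub>i\<in>{0..length xs}. ?FF (V.p (V.w (take i xs)) (V.w (drop i xs))))"
        unfolding V.\<Delta>_word[OF xs] by (rule lin_finsum[OF FF(1) V.TT W.TT V.p_closed[OF V.w_closed[OF td(1)] V.w_closed[OF td(2)]]])
      also have "\<dots> = (\<Oplus>\<^bsub>W.TT\<^esub>i\<in>{0..length (map f xs)}. W.p (W.w (take i (map f xs))) (W.w (drop i (map f xs))))"
        by (rule W.TT.finsum_eqI)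
          (simp_all only: length_map take_map drop_map FF(2)[OF V.w_closed[OF td(1)] V.w_closed[OF td(2)]] Fw[OF td(1)] Fw[OF td(2)]
            W.p_closed[OF W.w_closed[OF fL[OF td(1)]] W.w_closed[OF fL[OF td(2)]]])
      also have "\<dots> = W.\<Delta> (F (V.w xs))" unfolding Fw[OF xs] by (rule W.\<Delta>_word[OF fL[OF xs], symmetric])
      finally show "W.\<Delta> (F (V.w xs)) = ?FF (V.\<Delta> (V.w xs))" by simp
    qed
    show "W.\<epsilon> (F x) = V.\<epsilon> x"
      by (rule V.w_eqI[OF V.S lin_comp[OF Fl W.\<epsilon>_lin] V.\<epsilon>_lin _ x])
        (simp only: Fw W.\<epsilon>_word[OF fL] V.\<epsilon>_word map_is_Nil_conv)
  qed
qed

lemma tensor_coalgebra_iso: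
  assumes V: "module K V" and W: "module K W" and f: "linear_map K V W f" and b: "bij_betw f (carrier V) (carrier W)"
  shows "\<exists>F. coalgebra_iso K (tensor_coalgebra K V) (tensor_coalgebra K W) F"
proof -
  let ?g = "inv_into (carrier V) f"
  have gf: "?g (f x) = x" if "x \<in> carrier V" for x by (rule bij_betw_inv_into_left[OF b that])
  have fg: "f (?g x) = x" if "x \<in> carrier W" for x by (rule bij_betw_inv_into_right[OF b that])
  have g: "linear_map K W V ?g"
    by (rule lin_from_surj[OF V f _ lin_id gf]) (use b in \<open>simp add: bij_betw_def\<close>)
  let ?F = "lift_quot K (words_module K W) (\<lambda>xs. word K W (map f xs))"
  let ?G = "lift_quot K (words_module K V) (\<lambda>xs. word K V (map ?g xs))"
  note F = tensor_coalgebra_map[OF V W f] and G = tensor_coalgebra_map[OF W V g]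
  have fL: "xs \<in> lists (carrier V) \<Longrightarrow> map f xs \<in> lists (carrier W)" for xs using lin_closed[OF f] by auto
  have gL: "xs \<in> lists (carrier W) \<Longrightarrow> map ?g xs \<in> lists (carrier V)" for xs using lin_closed[OF g] by auto
  have GF: "?G (?F x) = x" if "x \<in> carrier (words_module K V)" for x
  proof (rule words_eqI[OF V words_module_module[OF V] lin_comp[OF F(3) G(3)] lin_id _ that])
    fix xs assume xs: "xs \<in> lists (carrier V)"
    then have "map ?g (map f xs) = xs" by (auto simp: gf intro!: map_idI)
    then show "?G (?F (word K V xs)) = word K V xs" by (simp only: F(2)[OF xs] G(2)[OF fL[OF xs]])
  qed
  have FG: "?F (?G x) = x" if "x \<in> carrier (words_module K W)" for x
  proof (rule words_eqI[OF W words_module_module[OF W] lin_comp[OF G(3) F(3)] lin_id _ that])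
    fix xs assume xs: "xs \<in> lists (carrier W)"
    then have "map f (map ?g xs) = xs" by (auto simp: fg intro!: map_idI)
    then show "?F (?G (word K W xs)) = word K W xs" by (simp only: G(2)[OF xs] F(2)[OF gL[OF xs]])
  qed
  have "bij_betw ?F (carrier (words_module K V)) (carrier (words_module K W))"
    by (rule bij_betw_byWitness[where f'="?G"])
      (use GF FG lin_closed[OF F(3)] lin_closed[OF G(3)] in blast)+
  then show ?thesis using F(1) unfolding coalgebra_iso_def tensor_coalgebra_simps by blast
qed

text \<open>Cofreeness of \<open>B\<close> refers to the primitive elements of \<open>B\<close>,
  whereas \<open>f\<close> starts at \<open>T(V)\<close>. The gap is closed by
  \<open>v \<mapsto> f (w [v])\<close>, a linear isomorphism from \<open>V\<close> onto
  \<open>Prim K B\<close>, because the primitive elements of \<open>T(V)\<close> are the letters and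
  \<open>f\<close> preserves primitivity in both directions.\<close>

lemma (in binf_words) cofree_bialgebra_iso:
  assumes f: "bialg_iso K (star_bialg K V M) B f"
  shows "cofree_bialgebra K B"
proof -
  let ?S = "star_bialg K V M" and ?P = "B\<lparr>carrier := Prim K B\<rparr>"
  note S = star_bialg_bialgebra
  note B = bialg_iso_bialgebra[OF S f] and fi = bialg_isoD[OF f]
  note P = Prim_module[OF B]
  have tS: "carrier (tensor K ?S ?S) = carrier TT" "add (tensor K ?S ?S) = add TT" "pure_tensor K ?S ?S = p"
    by (rule tensor_struct_cong tensor_space_struct_cong; simp add: star_bialg_simps)+
  have w0: "w [] \<in> carrier T" by (simp add: w_closed)
  have PrimS: "x \<in> Prim K ?S \<longleftrightarrow> \<Delta> x = p x (w []) \<oplus>\<^bsub>TT\<^esub> p (w []) x" if x: "x \<in> carrier T" for x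
    using Prim_iff[OF bialgebraD(3)[OF S], of x] x \<Delta>_closed[OF x] w0 unfolding tS by (simp add: star_bialg_simps)
  have wv: "w [v] \<in> carrier T" if "v \<in> carrier V" for v using that by (simp add: w_closed)
  have wP: "w [v] \<in> Prim K ?S" if v: "v \<in> carrier V" for v
    unfolding PrimS[OF wv[OF v]] \<Delta>_letter[OF v] by (rule TT.a_comm) (intro p_closed wv v w0)+
  have ST: "carrier ?S = carrier T" by (simp add: star_bialg_simps)
  have fl: "linear_map K T B f" using fi(5) by (subst (asm) lin_struct_cong[of _ T _ B]) (simp_all add: star_bialg_simps)
  have l: "linear_map K V ?P (\<lambda>v. f (w [v]))"
    using bialg_iso_Prim[OF S f wP] lin_comp[OF letter_lin fl]
    by (auto simp: linear_map_def)
  have "bij_betw (\<lambda>v. f (w [v])) (carrier V) (carrier ?P)"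
    unfolding bij_betw_def
  proof
    show "inj_on (\<lambda>v. f (w [v])) (carrier V)"
    proof (rule inj_onI)
      fix u v assume u: "u \<in> carrier V" and v: "v \<in> carrier V" and "f (w [u]) = f (w [v])"
      then have "w [u] = w [v]" using inj_onD[OF bij_betw_imp_inj_on[OF fi(1)]] wv by (simp add: ST)
      then have "\<pi> (w [u]) = \<pi> (w [v])" by simp
      then show "u = v" using u v by (simp add: \<pi>_word)
    qed
    have "y \<in> (\<lambda>v. f (w [v])) ` carrier V" if y: "y \<in> Prim K B" for y
    proof -
      let ?x = "inv_into (carrier ?S) f y"
      have yB: "y \<in> carrier B" using y by (simp add: Prim_def)
      have xP: "?x \<in> Prim K ?S" by (rule bialg_iso_Prim[OF B bialg_iso_inv[OF S f] y])
      then have xT: "?x \<in> carrier T" by (simp add: Prim_def ST)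
      have "f ?x = y" by (rule bij_betw_inv_into_right[OF fi(1) yB])
      moreover have "?x = w [\<pi> ?x]" by (rule primitive_word[OF xT]) (use PrimS[OF xT] xP in simp)
      ultimately show ?thesis using \<pi>_closed[OF xT] by (intro image_eqI[of _ _ "\<pi> ?x"]) simp_all
    qed
    moreover have "(\<lambda>v. f (w [v])) ` carrier V \<subseteq> Prim K B" using bialg_iso_Prim[OF S f wP] by blast
    ultimately show "(\<lambda>v. f (w [v])) ` carrier V = carrier ?P" by auto
  qed
  from tensor_coalgebra_iso[OF V P l this] obtain F
    where F: "coalgebra_map K (tensor_coalgebra K V) (tensor_coalgebra K ?P) F"
      and Fb: "bij_betw F (carrier T) (carrier (tensor_coalgebra K ?P))"
    by (auto simp: coalgebra_iso_def tensor_coalgebra_simps)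
  have F': "coalgebra_map K ?S (tensor_coalgebra K ?P) F"
    using F lin_struct_cong[of ?S "tensor_coalgebra K V" "tensor_coalgebra K ?P" "tensor_coalgebra K ?P" K F]
    by (simp add: coalgebra_map_def star_bialg_simps tensor_coalgebra_simps)
  note fiv = bialg_isoD[OF bialg_iso_inv[OF S f]]
  have C: "module K (tensor_coalgebra K ?P)"
    by (rule module_cong[OF words_module_module[OF P]]) (simp_all add: tensor_coalgebra_simps)
  have "coalgebra_map K B (tensor_coalgebra K ?P) (\<lambda>x. F (inv_into (carrier ?S) f x))"
    by (rule coalgebra_map_comp[OF bialgebraD(2)[OF B] bialgebraD(3)[OF S] C fiv(3) F'])
  moreover have "bij_betw (\<lambda>x. F (inv_into (carrier ?S) f x)) (carrier B) (carrier (tensor_coalgebra K ?P))"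
    using bij_betw_trans[OF fiv(1)[unfolded ST] Fb] by (simp add: comp_def ST)
  ultimately show ?thesis unfolding cofree_bialgebra_def coalgebra_iso_def using B by blast
qed

text \<open>An infinite set is equipotent with its square, which provides \<open>pair\<close>; lists
  are coded as nested pairs.\<close>

lemma inj_list_code:
  includes cardinal_syntax
  assumes "infinite (UNIV :: 'u set)"
  shows "\<exists>(pair :: 'u \<times> 'u \<Rightarrow> 'u) (code :: 'u list \<Rightarrow> 'u). inj pair \<and> inj code"
proof -
  have "|UNIV \<times> UNIV :: ('u \<times> 'u) set| \<le>o |UNIV :: 'u set|"
    using card_of_Times_same_infinite[OF assms] ordIso_iff_ordLeq by blast
  then obtain pair :: "'u \<times> 'u \<Rightarrow> 'u" where p: "inj pair" unfolding card_of_ordLeq[symmetric] by auto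
  \<comment> \<open>Two distinct tags, which tell the code of the empty list from that of a nonempty
    one.\<close>
  obtain a b :: 'u where ab: "a \<noteq> b"
    by (rule ccontr) (metis assms finite.emptyI finite.insertI finite_subset insertCI subsetI)
  define code where "code = rec_list (pair (a, a)) (\<lambda>x xs c. pair (b, pair (x, c)))"
  have c: "code [] = pair (a, a)" "code (x # xs) = pair (b, pair (x, code xs))" for x xs by (simp_all add: code_def)
  have "xs = ys" if "code xs = code ys" for xs ys
    using that
  proof (induction xs arbitrary: ys)
    case Nil then show ?case using ab by (cases ys) (auto simp: c inj_eq[OF p])
  next
    case (Cons x xs) then show ?case using ab by (cases ys) (auto simp: c inj_eq[OF p])
  qed
  then have "inj code" by (rule injI)
  with p show ?thesis by blast
qed

text \<open>A coset is coded by a chosen representative, and this finitely supported function by the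
  list of its values: pairs of a word and a coefficient, both of which embed into
  \<open>'u\<close>.\<close>

lemma words_module_inj:
  fixes K :: "('k, 'm) ring_scheme" and V :: "('k, 'u, 'x) module_scheme"
  assumes inf: "infinite (UNIV :: 'u set)" and e: "inj_on (e :: 'k \<Rightarrow> 'u) (carrier K)"
  shows "\<exists>g :: _ \<Rightarrow> 'u. inj_on g (carrier (words_module K V))"
proof -
  obtain pair :: "'u \<times> 'u \<Rightarrow> 'u" and code :: "'u list \<Rightarrow> 'u" where p: "inj pair" and c: "inj code"
    using inj_list_code[OF inf] by blast
  let ?F = "free_module K (lists (carrier V))"
  let ?N = "submodule_span K ?F (word_rels K V)"
  let ?G = "\<lambda>f. (\<lambda>xs. (xs, f xs)) ` {xs. f xs \<noteq> \<zero>\<^bsub>K\<^esub>}"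
  \<comment> \<open>A chosen enumeration of the graph of \<open>f\<close> over its support. The
    graph determines \<open>f\<close>, which is zero elsewhere.\<close>
  define ls where "ls f = (SOME l. set l = ?G f)" for f :: "'u list \<Rightarrow> 'k"
  have ls: "set (ls f) = ?G f" if "f \<in> carrier ?F" for f
  proof -
    have "finite (?G f)" using that by (intro finite_imageI) (simp add: free_module_def)
    then have "\<exists>l. set l = ?G f" by (rule finite_list)
    then show ?thesis unfolding ls_def by (rule someI_ex)
  qed
  define m where "m z = pair (code (fst z), e (snd z))" for z :: "'u list \<times> 'k"
  have mi: "inj_on m (UNIV \<times> carrier K)"
    unfolding m_def by (rule inj_onI) (auto simp: inj_eq[OF p] inj_eq[OF c] inj_on_eq_iff[OF e])
  have sub: "?G f \<subseteq> UNIV \<times> carrier K" if "f \<in> carrier ?F" for f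
    using that by (auto simp: free_module_def)
  have hi: "inj_on (\<lambda>f. code (map m (ls f))) (carrier ?F)"
  proof (rule inj_onI)
    fix f g assume f: "f \<in> carrier ?F" and g: "g \<in> carrier ?F" and "code (map m (ls f)) = code (map m (ls g))"
    then have "map m (ls f) = map m (ls g)" by (simp add: inj_eq[OF c])
    then have "ls f = ls g"
      by (rule map_inj_on) (rule inj_on_subset[OF mi], use ls[OF f] ls[OF g] sub[OF f] sub[OF g] in blast)
    then have G: "?G f = ?G g" using ls[OF f] ls[OF g] by simp
    show "f = g"
    proof
      fix xs
      show "f xs = g xs"
      proof (rule ccontr)
        assume ne: "f xs \<noteq> g xs"
        have "(xs, f xs) \<in> ?G f \<or> (xs, g xs) \<in> ?G g" using ne by auto
        then have "(xs, f xs) \<in> ?G g \<or> (xs, g xs) \<in> ?G f" using G by simp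
        then show False using ne by auto
      qed
    qed
  qed
  have T: "carrier (words_module K V) = (\<lambda>f. ?N +>\<^bsub>?F\<^esub> f) ` carrier ?F"
    by (auto simp: words_module_def Let_def quot_module_def A_RCOSETS_def')
  have "inj_on (\<lambda>X. code (map m (ls (inv_into (carrier ?F) (\<lambda>f. ?N +>\<^bsub>?F\<^esub> f) X)))) (carrier (words_module K V))"
    unfolding T
    by (rule comp_inj_on[OF inj_on_inv_into[OF subset_refl] inj_on_subset[OF hi], unfolded comp_def])
      (auto intro: inv_into_into)
  then show ?thesis by blast
qed

section \<open>The equivalence\<close>

lemma bialgebra_hom_restrict:
  assumes A: "bialgebra K A" and B: "bialgebra K B" and f: "f \<in> ring_hom A B" "coalgebra_map K A B f"
  shows "(\<lambda>x\<in>carrier A. f x) \<in> bialgebra_hom K A B"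
proof -
  note a = assoc_algebraD(2,4,5)[OF bialgebraD(1)[OF A]]
  interpret A: ring A by (rule a(1))
  have "coalgebra_map K A B (\<lambda>x\<in>carrier A. f x)"
    by (rule coalgebra_map_cong[OF bialgebraD(2)[OF A] bialgebraD(3)[OF B] f(2)]) simp
  then show ?thesis using f(1) by (auto simp: bialgebra_hom_def ring_hom_def)
qed

lemma bialgebra_hom_comp:
  assumes A: "bialgebra K A" and B: "bialgebra K B" and C: "bialgebra K C"
    and f: "f \<in> ring_hom A B" "coalgebra_map K A B f" and g: "g \<in> ring_hom B C" "coalgebra_map K B C g"
  shows "(\<lambda>x. g (f x)) \<in> ring_hom A C" "coalgebra_map K A C (\<lambda>x. g (f x))"
  using ring_hom_trans[OF f(1) g(1)] coalgebra_map_comp[OF bialgebraD(2)[OF A] bialgebraD(3)[OF B] bialgebraD(3)[OF C] f(2) g(2)]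
  by (simp_all add: comp_def)

lemma bialgebra_homD:
  assumes "f \<in> bialgebra_hom K A B"
  shows "f \<in> ring_hom A B" "coalgebra_map K A B f" "f \<in> extensional (carrier A)" "\<And>x. x \<in> carrier A \<Longrightarrow> f x \<in> carrier B"
    "f \<in> carrier A \<rightarrow> carrier B"
  using assms by (auto simp: bialgebra_hom_def ring_hom_def)

lemma bialgebra_category_simps:
  "Ob (bialgebra_category K Hs) = Hs" "Hom (bialgebra_category K Hs) = bialgebra_hom K"
  "Id (bialgebra_category K Hs) A = (\<lambda>x\<in>carrier A. x)" "Comp (bialgebra_category K Hs) A B C g f = compose (carrier A) g f"
  by (simp_all add: bialgebra_category_def)

lemma bialgebra_hom_Id: "bialgebra K A \<Longrightarrow> (\<lambda>x\<in>carrier A. x) \<in> bialgebra_hom K A A"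
proof -
  assume A: "bialgebra K A"
  note a = bialgebraD[OF A]
  show "(\<lambda>x\<in>carrier A. x) \<in> bialgebra_hom K A A"
  proof (rule bialgebra_hom_restrict[OF A A])
    show "(\<lambda>x. x) \<in> ring_hom A A" by (simp add: ring_hom_def)
    show "coalgebra_map K A A (\<lambda>x. x)"
      using lin_id tensor_map_eq_id[OF a(3,3) refl refl lin_closed[OF a(4)]]
      by (simp add: coalgebra_map_def)
  qed
qed

lemma bialgebra_hom_compose:
  assumes "bialgebra K A" "bialgebra K B" "bialgebra K C" "f \<in> bialgebra_hom K A B" "g \<in> bialgebra_hom K B C"
  shows "compose (carrier A) g f \<in> bialgebra_hom K A C"
  unfolding compose_def
  by (rule bialgebra_hom_restrict[OF assms(1,3) bialgebra_hom_comp[OF assms(1-3) bialgebra_homD(1,2)[OF assms(4)] bialgebra_homD(1,2)[OF assms(5)]]])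

lemma category_bialgebra_category:
  assumes "\<And>A. A \<in> Hs \<Longrightarrow> bialgebra K A"
  shows "category (bialgebra_category K Hs)"
  unfolding category_def bialgebra_category_simps
proof (intro conjI ballI)
  fix A B f assume "f \<in> bialgebra_hom K A B"
  note f = bialgebra_homD[OF this]
  show "compose (carrier A) f (\<lambda>x\<in>carrier A. x) = f" by (rule compose_Id[OF f(5,3)])
  show "compose (carrier A) (\<lambda>x\<in>carrier B. x) f = f" by (rule Id_compose[OF f(5,3)])
next
  fix A B C D f g h assume "f \<in> bialgebra_hom K A B"
  note f = bialgebra_homD(5)[OF this]
  show "compose (carrier A) h (compose (carrier A) g f) = compose (carrier A) (compose (carrier B) h g) f"
    by (rule compose_assoc[OF f])
qed (rule bialgebra_hom_Id bialgebra_hom_compose; use assms in blast)+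

text \<open>Any choice of partners \<open>F A\<close> with isomorphisms \<open>\<alpha> A\<close>
  extends to a functor: in conjugated morphisms the inner isomorphisms cancel, so identities and
  composites are preserved.\<close>

lemma cat_functor_conjugation:
  assumes A: "\<And>A. A \<in> \<A> \<Longrightarrow> bialgebra K A" and B: "\<And>B. B \<in> \<B> \<Longrightarrow> bialgebra K B"
    and F: "\<And>A. A \<in> \<A> \<Longrightarrow> F A \<in> \<B>" and \<alpha>: "\<And>A. A \<in> \<A> \<Longrightarrow> bialg_iso K A (F A) (\<alpha> A)"
  defines "\<Phi> \<equiv> \<lambda>A C f. \<lambda>x\<in>carrier (F A). \<alpha> C (f (inv_into (carrier A) (\<alpha> A) x))"
  shows "cat_functor (bialgebra_category K \<A>) (bialgebra_category K \<B>) F \<Phi>"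
  unfolding cat_functor_def bialgebra_category_simps
proof (intro conjI ballI F; assumption?)
  fix X Y f assume X: "X \<in> \<A>" and Y: "Y \<in> \<A>" and f: "f \<in> bialgebra_hom K X Y"
  note m = A[OF X] A[OF Y] B[OF F[OF X]] B[OF F[OF Y]]
  note h = bialgebra_hom_comp[OF m(3,1,2) bialg_isoD(2,3)[OF bialg_iso_inv[OF m(1) \<alpha>[OF X]]] bialgebra_homD(1,2)[OF f]]
  show "\<Phi> X Y f \<in> bialgebra_hom K (F X) (F Y)"
    unfolding \<Phi>_def by (rule bialgebra_hom_restrict[OF m(3,4) bialgebra_hom_comp[OF m(3,2,4) h bialg_isoD(2,3)[OF \<alpha>[OF Y]]]])
  note i = bialg_isoD(1)[OF bialg_iso_inv[OF m(1) \<alpha>[OF X]], THEN bij_betwE, THEN bspec]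
  fix Z g
  show "\<Phi> X Z (compose (carrier X) g f) = compose (carrier (F X)) (\<Phi> Y Z g) (\<Phi> X Y f)"
    using bij_betwE[OF bialg_isoD(1)[OF \<alpha>[OF Y]]]
    by (intro ext) (simp add: \<Phi>_def compose_def restrict_def i bialgebra_homD(4)[OF f] bij_betw_inv_into_left[OF bialg_isoD(1)[OF \<alpha>[OF Y]]])
next
  fix X assume X: "X \<in> \<A>"
  show "\<Phi> X X (\<lambda>x\<in>carrier X. x) = (\<lambda>x\<in>carrier (F X). x)"
    using bij_betwE[OF bialg_isoD(1)[OF bialg_iso_inv[OF A[OF X] \<alpha>[OF X]]]]
    by (intro ext) (simp add: \<Phi>_def restrict_def bij_betw_inv_into_right[OF bialg_isoD(1)[OF \<alpha>[OF X]]])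
qed

text \<open>The action \<open>\<Theta>\<close> on morphisms enters through its naturality square on
  elements. The natural isomorphism and its inverse are both provided because an equivalence asks
  for one from the identity in the first category and for one to the identity in the second.\<close>

lemma natural_iso_conjugation:
  assumes A: "\<And>A. A \<in> \<A> \<Longrightarrow> bialgebra K A"
    and F: "\<And>A. A \<in> \<A> \<Longrightarrow> F A \<in> \<A>" and \<beta>: "\<And>A. A \<in> \<A> \<Longrightarrow> bialg_iso K A (F A) (\<beta> A)"
    and \<Theta>: "\<And>A C f x. A \<in> \<A> \<Longrightarrow> C \<in> \<A> \<Longrightarrow> f \<in> bialgebra_hom K A C \<Longrightarrow> x \<in> carrier A \<Longrightarrow> \<Theta> A C f (\<beta> A x) = \<beta> C (f x)"
  defines "\<eta> \<equiv> \<lambda>A. \<lambda>x\<in>carrier A. \<beta> A x" and "\<theta> \<equiv> \<lambda>A. \<lambda>x\<in>carrier (F A). inv_into (carrier A) (\<beta> A) x"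
  shows "natural_iso (bialgebra_category K \<A>) (bialgebra_category K \<A>) (\<lambda>A. A) (\<lambda>A C f. f) F \<Theta> \<eta>"
    and "natural_iso (bialgebra_category K \<A>) (bialgebra_category K \<A>) F \<Theta> (\<lambda>A. A) (\<lambda>A C f. f) \<theta>"
proof -
  have hom: "\<eta> X \<in> bialgebra_hom K X (F X)" "\<theta> X \<in> bialgebra_hom K (F X) X"
    and c: "x \<in> carrier X \<Longrightarrow> \<beta> X x \<in> carrier (F X)" "y \<in> carrier (F X) \<Longrightarrow> inv_into (carrier X) (\<beta> X) y \<in> carrier X"
    and inv: "x \<in> carrier X \<Longrightarrow> inv_into (carrier X) (\<beta> X) (\<beta> X x) = x"
      "y \<in> carrier (F X) \<Longrightarrow> \<beta> X (inv_into (carrier X) (\<beta> X) y) = y"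
    if X: "X \<in> \<A>" for X x y
  proof -
    note i = bialg_isoD(1-3)[OF \<beta>[OF X]] and i' = bialg_isoD(1-3)[OF bialg_iso_inv[OF A[OF X] \<beta>[OF X]]]
    show "\<eta> X \<in> bialgebra_hom K X (F X)" "\<theta> X \<in> bialgebra_hom K (F X) X"
      unfolding \<eta>_def \<theta>_def by (rule bialgebra_hom_restrict A X F i(2,3) i'(2,3))+
    show "x \<in> carrier X \<Longrightarrow> \<beta> X x \<in> carrier (F X)" by (rule ring_hom_closed[OF i(2)])
    show "y \<in> carrier (F X) \<Longrightarrow> inv_into (carrier X) (\<beta> X) y \<in> carrier X" by (rule ring_hom_closed[OF i'(2)])
    show "x \<in> carrier X \<Longrightarrow> inv_into (carrier X) (\<beta> X) (\<beta> X x) = x" by (rule bij_betw_inv_into_left[OF i(1)])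
    show "y \<in> carrier (F X) \<Longrightarrow> \<beta> X (inv_into (carrier X) (\<beta> X) y) = y" by (rule bij_betw_inv_into_right[OF i(1)])
  qed
  have 1: "compose (carrier X) (\<theta> X) (\<eta> X) = (\<lambda>x\<in>carrier X. x)" "compose (carrier (F X)) (\<eta> X) (\<theta> X) = (\<lambda>x\<in>carrier (F X). x)"
    if "X \<in> \<A>" for X
    by (rule ext, simp add: \<eta>_def \<theta>_def compose_def restrict_def c[OF that] inv[OF that])+
  show "natural_iso (bialgebra_category K \<A>) (bialgebra_category K \<A>) (\<lambda>A. A) (\<lambda>A C f. f) F \<Theta> \<eta>"
    unfolding natural_iso_def cat_iso_def bialgebra_category_simps
  proof (intro conjI ballI)
    fix X Y f assume X: "X \<in> \<A>" and Y: "Y \<in> \<A>" and f: "f \<in> bialgebra_hom K X Y"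
    show "compose (carrier X) (\<eta> Y) f = compose (carrier X) (\<Theta> X Y f) (\<eta> X)"
      by (rule ext) (simp add: \<eta>_def compose_def restrict_def \<Theta>[OF X Y f] bialgebra_homD(4)[OF f])
  qed (use hom 1 in blast)+
  show "natural_iso (bialgebra_category K \<A>) (bialgebra_category K \<A>) F \<Theta> (\<lambda>A. A) (\<lambda>A C f. f) \<theta>"
    unfolding natural_iso_def cat_iso_def bialgebra_category_simps
  proof (intro conjI ballI)
    fix X Y f assume X: "X \<in> \<A>" and Y: "Y \<in> \<A>" and f: "f \<in> bialgebra_hom K X Y"
    have "\<Theta> X Y f y = \<beta> Y (f (inv_into (carrier X) (\<beta> X) y))" if "y \<in> carrier (F X)" for y
      using \<Theta>[OF X Y f c(2)[OF X that]] inv(2)[OF X that] by simp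
    then show "compose (carrier (F X)) (\<theta> Y) (\<Theta> X Y f) = compose (carrier (F X)) f (\<theta> X)"
      by (intro ext) (simp add: \<theta>_def compose_def restrict_def c[OF X] c[OF Y] inv[OF Y] bialgebra_homD(4)[OF f])
  qed (use hom 1 in blast)+
qed

text \<open>Full subcategories of bialgebras with the same isomorphism classes are equivalent, even
  over different types. The functors arise from a simultaneous choice of isomorphic partners, and
  naturality of the composites is built into the conjugation.\<close>

lemma equivalent_bialgebra_categories:
  fixes \<A> :: "('k, 'a) bialg set" and \<B> :: "('k, 'b) bialg set"
  assumes A: "\<And>A. A \<in> \<A> \<Longrightarrow> bialgebra K A" and B: "\<And>B. B \<in> \<B> \<Longrightarrow> bialgebra K B"
    and AB: "\<And>A. A \<in> \<A> \<Longrightarrow> \<exists>B f. B \<in> \<B> \<and> bialg_iso K A B f"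
    and BA: "\<And>B. B \<in> \<B> \<Longrightarrow> \<exists>A f. A \<in> \<A> \<and> bialg_iso K B A f"
  shows "equivalent_categories (bialgebra_category K \<A>) (bialgebra_category K \<B>)"
proof -
  obtain F \<alpha> where F: "\<And>A. A \<in> \<A> \<Longrightarrow> F A \<in> \<B>" and \<alpha>: "\<And>A. A \<in> \<A> \<Longrightarrow> bialg_iso K A (F A) (\<alpha> A)" using AB by metis
  obtain G \<gamma> where G: "\<And>B. B \<in> \<B> \<Longrightarrow> G B \<in> \<A>" and \<gamma>: "\<And>B. B \<in> \<B> \<Longrightarrow> bialg_iso K B (G B) (\<gamma> B)" using BA by metis
  define \<Phi> where "\<Phi> = (\<lambda>A C f. \<lambda>x\<in>carrier (F A). \<alpha> C (f (inv_into (carrier A) (\<alpha> A) x)))"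
  define \<Gamma> where "\<Gamma> = (\<lambda>A C f. \<lambda>x\<in>carrier (G A). \<gamma> C (f (inv_into (carrier A) (\<gamma> A) x)))"
  have c: "x \<in> carrier X \<Longrightarrow> \<alpha> X x \<in> carrier (F X)" "x \<in> carrier X \<Longrightarrow> \<Phi> X Y f (\<alpha> X x) = \<alpha> Y (f x)" if "X \<in> \<A>" for X Y f x
    using bij_betwE[OF bialg_isoD(1)[OF \<alpha>[OF that]]] bij_betw_inv_into_left[OF bialg_isoD(1)[OF \<alpha>[OF that]]] by (simp_all add: \<Phi>_def)
  have d: "x \<in> carrier X \<Longrightarrow> \<gamma> X x \<in> carrier (G X)" "x \<in> carrier X \<Longrightarrow> \<Gamma> X Y f (\<gamma> X x) = \<gamma> Y (f x)" if "X \<in> \<B>" for X Y f x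
    using bij_betwE[OF bialg_isoD(1)[OF \<gamma>[OF that]]] bij_betw_inv_into_left[OF bialg_isoD(1)[OF \<gamma>[OF that]]] by (simp_all add: \<Gamma>_def)
  have 3: "natural_iso (bialgebra_category K \<A>) (bialgebra_category K \<A>) (\<lambda>A. A) (\<lambda>A B f. f) (\<lambda>A. G (F A))
      (\<lambda>A B f. \<Gamma> (F A) (F B) (\<Phi> A B f)) (\<lambda>A. \<lambda>x\<in>carrier A. \<gamma> (F A) (\<alpha> A x))"
    by (rule natural_iso_conjugation(1)) (simp_all add: A F G bialg_iso_comp[OF A \<alpha> \<gamma>[OF F]] c d)
  have 4: "natural_iso (bialgebra_category K \<B>) (bialgebra_category K \<B>) (\<lambda>X. F (G X)) (\<lambda>X Y g. \<Phi> (G X) (G Y) (\<Gamma> X Y g))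
      (\<lambda>X. X) (\<lambda>X Y g. g) (\<lambda>X. \<lambda>x\<in>carrier (F (G X)). inv_into (carrier X) (\<lambda>x. \<alpha> (G X) (\<gamma> X x)) x)"
    by (rule natural_iso_conjugation(2)) (simp_all add: B F G bialg_iso_comp[OF B \<gamma> \<alpha>[OF G]] c d)
  show ?thesis
    unfolding equivalent_categories_def
    using category_bialgebra_category[OF A] category_bialgebra_category[OF B]
      cat_functor_conjugation[of \<A> K \<B> F \<alpha>, OF A B F \<alpha>, folded \<Phi>_def] cat_functor_conjugation[of \<B> K \<A> G \<gamma>, OF B A G \<gamma>, folded \<Gamma>_def] 3 4
    by blast
qed

lemma (in binf_alg) \<sigma>_bialg_iso: "bialg_iso K (star_bialg K R (ops R)) (U2 K R) \<sigma>"
  unfolding bialg_iso_def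
  using \<sigma>_bij \<sigma>_ring_hom \<sigma>_coalgebra_map lin_zero[OF \<sigma>_lin W.T U.Q] by (simp add: star_bialg_simps U2_simps)

text \<open>The size conditions on \<open>'u\<close> serve the passage from \<open>U2(R)\<close> to
  a cofree bialgebra over \<open>'u\<close>: for the carrier of \<open>T(R)\<close> to embed,
  \<open>'u\<close> has to code finite combinations of words over itself with coefficients from
  \<open>K\<close>.\<close>

theorem corollary4p3:
  fixes K :: "('k, 'm) ring_scheme"
  assumes "field K"
    and "infinite (UNIV :: 'u set)"
    and "\<exists>f :: 'k \<Rightarrow> 'u. inj_on f (carrier K)"
  shows "equivalent_categories (cofree_category K :: (('k, 'u) bialg, 'u \<Rightarrow> 'u) cat)
           (U2_category K TYPE('u))"
  unfolding cofree_category_def U2_category_def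
proof (rule equivalent_bialgebra_categories)
  fix H :: "('k, 'u) bialg" assume "H \<in> {H. cofree_bialgebra K H}"
  then have cf: "cofree_bialgebra K H" by simp
  then show H: "bialgebra K H" by (simp add: cofree_bialgebra_def)
  obtain R :: "('k, 'u) binf_alg" and f where R: "binf_algebra K R" and f: "bialg_iso K H (star_bialg K R (ops R)) f"
    using cofree_bialgebra_iso_star[OF assms(1) cf] by blast
  from bialg_iso_comp[OF H f binf_alg.\<sigma>_bialg_iso[OF binf_alg.intro[OF R]]] R
  show "\<exists>B f. B \<in> {U2 K R |R :: ('k, 'u) binf_alg. binf_algebra K R} \<and> bialg_iso K H B f" by blast
next
  fix B assume "B \<in> {U2 K R |R :: ('k, 'u) binf_alg. binf_algebra K R}"
  then obtain R :: "('k, 'u) binf_alg" where R: "binf_algebra K R" and B: "B = U2 K R" by blast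
  interpret R: binf_alg K R by (rule binf_alg.intro[OF R])
  note S = R.W.star_bialg_bialgebra and s = R.\<sigma>_bialg_iso
  show U: "bialgebra K B" unfolding B by (rule bialg_iso_bialgebra[OF S s])
  obtain e :: "'k \<Rightarrow> 'u" where e: "inj_on e (carrier K)" using assms(3) by blast
  obtain g :: "_ \<Rightarrow> 'u" where g: "inj_on g (carrier (star_bialg K R (ops R)))"
    using words_module_inj[OF assms(2) e, of R] unfolding star_bialg_simps by blast
  obtain H :: "('k, 'u) bialg" where H: "bialg_iso K (star_bialg K R (ops R)) H g" using bialg_transport[OF S g] by blast
  have "bialg_iso K B H (\<lambda>x. g (inv_into (carrier (star_bialg K R (ops R))) R.\<sigma> x))"
    by (rule bialg_iso_comp[OF U bialg_iso_inv[OF S s, folded B] H])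
  then show "\<exists>A f. A \<in> {H :: ('k, 'u) bialg. cofree_bialgebra K H} \<and> bialg_iso K B A f"
    using R.W.cofree_bialgebra_iso[OF H] by blast
qed

end
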